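(* Let $P_0$ be a $4$-polytope with $n_0$ vertices which has an $X$-type graph $G(P_0)$ whose unique sink is a simple vertex of $P_0$ (i.e. a vertex with exactly four neighbours). Then for every $d \geq 4$ and every $n \geq n_0+d-4$, $P_0$ can be extended to a $d$-polytope $P$ with $n$ vertices having an $X$-type graph; in particular, such a $d$-polytope with $n$ vertices and an $X$-type graph exists.
   Context: A polytopal digraph $G(P)$ of a polytope $P$ is an orientation of the edges of the skeleton (vertex–edge graph) of $P$. For a face $H$ of $P$, $G(P,H)$ denotes the subdigraph induced by the vertices of $H$. $G(P)$ is acyclic if it has no directed cycle. It is a unique sink orientation (USO) if for every non-empty face $H$ of $P$, $G(P,H)$ has a unique source and a unique sink. It has the Holt–Klee property if it is a USO and for every $k$-dimensional face $H$ ($k\ge 0$) there are $k$ vertex-disjoint (apart from endpoints) directed paths in $G(P,H)$ from the unique source to the unique sink of $H$. A topological sort of $G(P)$ is an ordering of the vertices such that $u$ precedes $w$ whenever $(u,w)$ is a directed edge. A combinatorial polar $P^*$ of $P$ is a polytope whose face lattice is that of $P$ turned upside down; vertex $v$ of $P$ corresponds to a facet $F(v)$ of $P^*$. A shelling of a polytope $Q$ is a linear ordering $F_1,\dots,F_s$ of its facets such that either the facets are points, or (i) $F_1$ has a linear ordering of its own facets that is a shelling of $F_1$, and (ii) for $1<j\le s$, $F_j\cap\bigcup_{i<j}F_i$ is non-empty and equals $G_1\cup\cdots\cup G_r$ for some shelling $G_1,\dots,G_r,\dots,G_t$ of $F_j$ with $1\le r\le t$. $G(P)$ has the shelling property if there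 is a topological sort $v_1,\dots,v_n$ of $G(P)$ such that $F(v_1),\dots,F(v_n)$ is a shelling of $P^*$. $G(P)$ is an $X$-type graph if it is an acyclic USO satisfying the Holt–Klee property but not the shelling property. *)

theory Defs
  imports "HOL-Analysis.Analysis"
begin

section \<open>Skeletons and polytopal digraphs\<close>

definition vertices :: "'a::euclidean_space set \<Rightarrow> 'a set" where
  "vertices P = {v. v extreme_point_of P}"

definition adjacent :: "'a::euclidean_space set \<Rightarrow> 'a \<Rightarrow> 'a \<Rightarrow> bool" where
  "adjacent P u w \<longleftrightarrow> closed_segment u w edge_of P"

definition simple_vertex :: "'a::euclidean_space set \<Rightarrow> 'a \<Rightarrow> bool" where
  "simple_vertex P v \<longleftrightarrow> v \<in> vertices P \<and> int (card {w. adjacent P v w}) = aff_dim P"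

text \<open>An arc relation \<open>E\<close> that contains exactly one of the two directions of every edge.\<close>

definition polytopal_digraph :: "'a::euclidean_space set \<Rightarrow> ('a \<times> 'a) set \<Rightarrow> bool" where
  "polytopal_digraph P E \<longleftrightarrow>
     (\<forall>u w. (u, w) \<in> E \<longrightarrow> adjacent P u w) \<and>
     (\<forall>u w. adjacent P u w \<longrightarrow> ((u, w) \<in> E) \<noteq> ((w, u) \<in> E))"

text \<open>The arcs of the subdigraph induced by the vertices of a face \<open>H\<close>. The vertices of a face
  are exactly the vertices of the polytope lying in it, so they can be computed from \<open>H\<close> alone.\<close>

definition face_arcs :: "('a::euclidean_space \<times> 'a) set \<Rightarrow> 'a set \<Rightarrow> ('a \<times> 'a) set" where
  "face_arcs E H = E \<inter> vertices H \<times> vertices H"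

definition is_source :: "('a::euclidean_space \<times> 'a) set \<Rightarrow> 'a set \<Rightarrow> 'a \<Rightarrow> bool" where
  "is_source E H v \<longleftrightarrow> v \<in> vertices H \<and> (\<forall>u. (u, v) \<notin> face_arcs E H)"

definition is_sink :: "('a::euclidean_space \<times> 'a) set \<Rightarrow> 'a set \<Rightarrow> 'a \<Rightarrow> bool" where
  "is_sink E H v \<longleftrightarrow> v \<in> vertices H \<and> (\<forall>w. (v, w) \<notin> face_arcs E H)"

definition unique_sink_orientation :: "'a::euclidean_space set \<Rightarrow> ('a \<times> 'a) set \<Rightarrow> bool" where
  "unique_sink_orientation P E \<longleftrightarrow>
     (\<forall>H. H face_of P \<and> H \<noteq> {} \<longrightarrow> (\<exists>!v. is_source E H v) \<and> (\<exists>!v. is_sink E H v))"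

definition directed_path :: "('a \<times> 'a) set \<Rightarrow> 'a \<Rightarrow> 'a \<Rightarrow> 'a list \<Rightarrow> bool" where
  "directed_path A s t p \<longleftrightarrow>
     p \<noteq> [] \<and> hd p = s \<and> last p = t \<and> distinct p \<and> successively (\<lambda>u w. (u, w) \<in> A) p"

text \<open>The paths form a set, so they are pairwise distinct; in particular an arc from the source
  to the sink counts as one path only.\<close>

definition holt_klee :: "'a::euclidean_space set \<Rightarrow> ('a \<times> 'a) set \<Rightarrow> bool" where
  "holt_klee P E \<longleftrightarrow>
     unique_sink_orientation P E \<and>
     (\<forall>H s t. H face_of P \<and> H \<noteq> {} \<and> is_source E H s \<and> is_sink E H t \<longrightarrow>
        (\<exists>\<P>. finite \<P> \<and> int (card \<P>) = aff_dim H \<and>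
             (\<forall>p\<in>\<P>. directed_path (face_arcs E H) s t p) \<and>
             (\<forall>p\<in>\<P>. \<forall>q\<in>\<P>. p \<noteq> q \<longrightarrow> set p \<inter> set q \<subseteq> {s, t})))"

definition topological_sort :: "'a::euclidean_space set \<Rightarrow> ('a \<times> 'a) set \<Rightarrow> 'a list \<Rightarrow> bool" where
  "topological_sort P E vs \<longleftrightarrow>
     distinct vs \<and> set vs = vertices P \<and>
     (\<forall>i j. i < length vs \<and> j < length vs \<and> (vs ! i, vs ! j) \<in> E \<longrightarrow> i < j)"


section \<open>Shellings and the shelling property\<close>

inductive shelling :: "'a::euclidean_space set \<Rightarrow> 'a set list \<Rightarrow> bool" where
  points:
    "\<lbrakk>distinct Fs; set Fs = {F. F facet_of Q}; \<forall>F\<in>set Fs. \<exists>x. F = {x}\<rbrakk> \<Longrightarrow> shelling Q Fs"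
| step:
    "\<lbrakk>distinct Fs; set Fs = {F. F facet_of Q}; Fs \<noteq> [];
      shelling (hd Fs) Hs;
      \<forall>j. 0 < j \<and> j < length Fs \<longrightarrow>
         Fs ! j \<inter> (\<Union>i<j. Fs ! i) \<noteq> {} \<and>
         (\<exists>Gs r. shelling (Fs ! j) Gs \<and> 1 \<le> r \<and> r \<le> length Gs \<and>
                 Fs ! j \<inter> (\<Union>i<j. Fs ! i) = \<Union> (set (take r Gs)))\<rbrakk>
     \<Longrightarrow> shelling Q Fs"

text \<open>\<open>\<phi>\<close> is an anti-isomorphism between the face lattices, which include the empty face and the
  polytope itself.\<close>

definition combinatorial_polar ::
    "'a::euclidean_space set \<Rightarrow> 'b::euclidean_space set \<Rightarrow> ('a set \<Rightarrow> 'b set) \<Rightarrow> bool" where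
  "combinatorial_polar P Q \<phi> \<longleftrightarrow>
     polytope Q \<and>
     bij_betw \<phi> {F. F face_of P} {G. G face_of Q} \<and>
     (\<forall>F F'. F face_of P \<and> F' face_of P \<longrightarrow> (F \<subseteq> F' \<longleftrightarrow> \<phi> F' \<subseteq> \<phi> F))"

text \<open>A polar of \<open>P\<close> of the same dimension exists in the ambient space of \<open>P\<close>, and whether an
  ordering of its facets is a shelling depends only on its face lattice. Hence quantifying over
  all polars in that space is the same as fixing one.\<close>

definition shelling_property :: "'a::euclidean_space set \<Rightarrow> ('a \<times> 'a) set \<Rightarrow> bool" where
  "shelling_property P E \<longleftrightarrow>
     (\<exists>(Q :: 'a set) \<phi> vs. combinatorial_polar P Q \<phi> \<and> topological_sort P E vs \<and>
        shelling Q (map (\<lambda>v. \<phi> {v}) vs))"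

definition X_type :: "'a::euclidean_space set \<Rightarrow> ('a \<times> 'a) set \<Rightarrow> bool" where
  "X_type P E \<longleftrightarrow>
     polytopal_digraph P E \<and> acyclic E \<and> unique_sink_orientation P E \<and> holt_klee P E \<and>
     \<not> shelling_property P E"


section \<open>Extending a polytope\<close>

definition pyramid_over :: "'a::euclidean_space set \<Rightarrow> 'a set \<Rightarrow> bool" where
  "pyramid_over P P' \<longleftrightarrow> (\<exists>a. a \<notin> affine hull P \<and> P' = convex hull (insert a P))"

text \<open>A halfspace cuts off exactly one vertex, which is simple. The bounding hyperplane may pass
  through other vertices; the condition on the number of vertices says that only two of the
  edges at the removed vertex are cut properly.\<close>

definition truncation_of :: "'a::euclidean_space set \<Rightarrow> 'a set \<Rightarrow> bool" where
  "truncation_of P P' \<longleftrightarrow>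
     (\<exists>v a b. simple_vertex P v \<and> {w \<in> vertices P. a \<bullet> w > b} = {v} \<and>
        P' = P \<inter> {x. a \<bullet> x \<le> b} \<and> card (vertices P') = card (vertices P) + 1)"

text \<open>\<open>P\<close> arises from an affine copy of \<open>P\<^sub>0\<close> by pyramids, which raise the dimension by one, and
  truncations, which keep it; every such step adds exactly one vertex.\<close>

inductive extension_of :: "'b::euclidean_space set \<Rightarrow> 'a::euclidean_space set \<Rightarrow> bool"
  for P\<^sub>0 where
  copy: "\<lbrakk>linear f; inj_on f (affine hull P\<^sub>0)\<rbrakk> \<Longrightarrow> extension_of P\<^sub>0 ((\<lambda>x. c + f x) ` P\<^sub>0)"
| pyramid: "\<lbrakk>extension_of P\<^sub>0 P; pyramid_over P P'\<rbrakk> \<Longrightarrow> extension_of P\<^sub>0 P'"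
| truncation: "\<lbrakk>extension_of P\<^sub>0 P; truncation_of P P'\<rbrakk> \<Longrightarrow> extension_of P\<^sub>0 P'"

end

theory Submission
  imports Defs
begin

text \<open>Shellings of a polar are translated into the face lattice of the polytope itself, where
  the polar of a face is visible as the set of faces above it. A copy of \<open>P\<^sub>0\<close> is truncated at
  its simple sink until only one vertex per missing dimension is left to be added, and pyramids
  with a source as apex do the rest.

  The truncation of a 4-polytope at its simple sink \<open>v\<close> cuts two of the four edges at \<open>v\<close> properly
  and passes through the other two neighbours \<open>w3\<close>, \<open>w4\<close>; the new facet is a tetrahedron with
  acyclically oriented skeleton, and the new sink is simple again. Directed paths into \<open>v\<close> are
  rerouted to the sink of the new face. If the new digraph had the shelling property, deleting the
  two new vertices and appending \<open>v\<close> would give a shelling of the old polar: nothing changes at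
  vertices off the hyperplane, and at \<open>w3\<close>, \<open>w4\<close> an initial segment of a shelling of the dual
  3-polytope has to be completed. That is always possible, because every partial shelling of a
  3-polytope extends (\<open>pshell_extend\<close>). Shellings of single facets of the polar exist by the theorem
  of Bruggesser and Mani.\<close>

text \<open>A hyperplane in general position would replace a simple vertex by four new ones. Passing
  through two of its neighbours it produces only two, so that the number of vertices grows by
  exactly one. The price is paid at \<open>w3\<close> and \<open>w4\<close>, which survive with a
  changed set of faces: the edge to \<open>v\<close> gives way to edges to the two new points, and
  [\<open>w3\<close>, \<open>w4\<close>] may become a new edge. The faces through any other old
  vertex keep their order structure. The cut is made at the sink because \<open>v\<close> can then
  be listed last, where any complete shelling of its dual facet will do. At \<open>w3\<close> and
  \<open>w4\<close> only an initial piece of a shelling is inherited. Completing it is the crux: if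
  the remaining cells of a polyhedral 2-sphere are listed in an st-ordering, no cell before the last
  can raise the Euler characteristic, and the equal values at both ends force each of them to be
  attached along an arc. That the filled part and its complement behave like disks is obtained from
  mod 2 cycles. This argument is tied to dimension 4, so all truncations precede the
  pyramids.\<close>

definition chained :: "('a \<Rightarrow> 'a \<Rightarrow> bool) \<Rightarrow> 'a list \<Rightarrow> bool" where
  "chained R xs \<longleftrightarrow> (\<forall>k<length xs. 0 < k --> (\<exists>i<k. R (xs ! i) (xs ! k)))"

lemma chained_Nil [simp]: "chained R []"
  by (simp add: chained_def)

lemma chained_single [simp]: "chained R [x]"
  by (simp add: chained_def)

lemma chained_snoc:
  "chained R (xs @ [x]) \<longleftrightarrow> chained R xs \<and> (xs = [] \<or> (\<exists>u\<in>set xs. R u x))"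
proof
  assume L: "chained R (xs @ [x])"
  have "chained R xs"
    unfolding chained_def
  proof (intro allI impI)
    fix k assume "k < length xs" "0 < k"
    moreover have "k < length (xs @ [x]) --> 0 < k --> (\<exists>i<k. R ((xs @ [x]) ! i) ((xs @ [x]) ! k))"
      using L unfolding chained_def by blast
    ultimately obtain i where "i < k" "R ((xs @ [x]) ! i) ((xs @ [x]) ! k)"
      by force
    then show "\<exists>i<k. R (xs ! i) (xs ! k)"
      using \<open>k < length xs\<close> by (intro exI[of _ i]) (simp add: nth_append)
  qed
  moreover have "xs = [] \<or> (\<exists>u\<in>set xs. R u x)"
  proof (cases "xs = []")
    case False
    moreover have "length xs < length (xs @ [x]) --> 0 < length xs -->
        (\<exists>i<length xs. R ((xs @ [x]) ! i) ((xs @ [x]) ! length xs))"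
      using L unfolding chained_def by blast
    ultimately obtain i where "i < length xs" "R ((xs @ [x]) ! i) ((xs @ [x]) ! length xs)"
      by auto
    then have "R (xs ! i) x" by (simp add: nth_append)
    then show ?thesis using \<open>i < length xs\<close> nth_mem by blast
  qed simp
  ultimately show "chained R xs \<and> (xs = [] \<or> (\<exists>u\<in>set xs. R u x))" by blast
next
  assume R: "chained R xs \<and> (xs = [] \<or> (\<exists>u\<in>set xs. R u x))"
  show "chained R (xs @ [x])"
    unfolding chained_def
  proof (intro allI impI)
    fix k assume k: "k < length (xs @ [x])" "0 < k"
    show "\<exists>i<k. R ((xs @ [x]) ! i) ((xs @ [x]) ! k)"
    proof (cases "k < length xs")
      case True
      then obtain i where "i < k" "R (xs ! i) (xs ! k)" using R k unfolding chained_def by auto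
      then show ?thesis using True by (intro exI[of _ i]) (simp add: nth_append)
    next
      case False
      then have "k = length xs" using k by simp
      then obtain u where "u \<in> set xs" "R u x" using R k by auto
      then obtain i where "i < length xs" "xs ! i = u" by (metis in_set_conv_nth)
      then show ?thesis using \<open>k = length xs\<close> \<open>R u x\<close> by (intro exI[of _ i]) (simp add: nth_append)
    qed
  qed
qed

text \<open>The form in which a connected enumeration is used: its graph has a single component.
  \<open>R\<close> need not be symmetric, hence closure in both directions.\<close>

lemma chained_closed:
  assumes "chained R xs" "A \<subseteq> set xs" "A ~= {}"
    and closed: "\<And>u w. u \<in> A ==> w \<in> set xs ==> R u w \<or> R w u ==> w \<in> A"
  shows "A = set xs"
  using assms
proof (induction xs arbitrary: A rule: rev_induct)
  case (snoc x xs)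
  have c: "chained R xs" "xs = [] \<or> (\<exists>u\<in>set xs. R u x)"
    using snoc.prems(1) by (auto simp: chained_snoc)
  show ?case
  proof (cases "A \<inter> set xs = {}")
    case True
    then have "x \<in> A" using snoc.prems by auto
    have "xs = []"
    proof (rule ccontr)
      assume "xs ~= []"
      then obtain u where "u \<in> set xs" "R u x" using c by blast
      then have "u \<in> A" using snoc.prems(4)[OF \<open>x \<in> A\<close>, of u] by auto
      then show False using True \<open>u \<in> set xs\<close> by blast
    qed
    then show ?thesis using \<open>x \<in> A\<close> snoc.prems(2) by auto
  next
    case False
    have "A \<inter> set xs = set xs"
    proof (rule snoc.IH[OF c(1)])
      fix u w assume "u \<in> A \<inter> set xs" "w \<in> set xs" "R u w \<or> R w u"
      then show "w \<in> A \<inter> set xs" using snoc.prems(4)[of u w] by simp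
    qed (use False in auto)
    then have "set xs \<subseteq> A" by blast
    moreover have "x \<in> A"
    proof -
      obtain u where "u \<in> set xs" "R u x" using c(2) False by (metis IntE empty_iff ex_in_conv list.set(1))
      then show ?thesis using \<open>set xs \<subseteq> A\<close> snoc.prems(4)[of u x] by auto
    qed
    ultimately show ?thesis using snoc.prems(2) by auto
  qed
qed simp

text \<open>Greedy: as long as the enumerated set is proper, \<open>step\<close> supplies a next
  element. For \<open>xs = []\<close> the first element is arbitrary, which is why
  \<open>step\<close> speaks of nonempty \<open>C\<close>.\<close>

lemma chained_extend:
  assumes "finite A" "chained R xs" "distinct xs" "set xs \<subseteq> A"
    and step: "\<And>C. set xs \<subseteq> C ==> C ~= {} ==> C \<subset> A ==> \<exists>u\<in>C. \<exists>w\<in>A - C. R u w"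
  shows "\<exists>ys. chained R (xs @ ys) \<and> distinct (xs @ ys) \<and> set (xs @ ys) = A"
  using assms
proof (induction "card (A - set xs)" arbitrary: xs rule: less_induct)
  case less
  show ?case
  proof (cases "set xs = A")
    case True
    then show ?thesis using less.prems by (intro exI[of _ "[]"]) auto
  next
    case False
    obtain w where w: "w \<in> A - set xs" "xs = [] \<or> (\<exists>u\<in>set xs. R u w)"
    proof (cases "xs = []")
      case True
      then show ?thesis using False less.prems that by auto
    next
      case ne: False
      then show ?thesis using less.prems(5)[of "set xs"] False less.prems(4) that by blast
    qed
    have "\<exists>ys. chained R ((xs @ [w]) @ ys) \<and> distinct ((xs @ [w]) @ ys) \<and> set ((xs @ [w]) @ ys) = A"
    proof (rule less.hyps)
      show "card (A - set (xs @ [w])) < card (A - set xs)"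
        using w less.prems(1) by (intro psubset_card_mono) auto
      show "chained R (xs @ [w])" using less.prems w by (simp add: chained_snoc)
    qed (use less.prems w in \<open>auto intro!: less.prems(5)\<close>)
    then show ?thesis by (metis append.assoc)
  qed
qed

lemma connected_imp_chained:
  assumes "finite A" "\<And>C. C ~= {} ==> C \<subset> A ==> \<exists>u\<in>C. \<exists>w\<in>A - C. R u w"
  shows "\<exists>ys. chained R ys \<and> distinct ys \<and> set ys = A"
  using chained_extend[of A R "[]"] assms by auto

subsection \<open>Orderings between a source set and a target\<close>

text \<open>An st-ordering with the source blown up to a set \<open>B\<close> and the sink to the
  complement of \<open>R\<close>. The list is built from its end: the last element must touch
  \<open>X - R\<close>, and without it the rest of \<open>R\<close> must remain reachable from
  \<open>B\<close>.\<close>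

lemma st_ordering_aux:
  fixes R :: "'a set"
  assumes "finite X" and sym: "\<And>u w. adj u w ==> adj w u"
    and "B ~= {}"
    and conn1: "\<And>x C. x \<in> X ==> C \<subseteq> X - {x} ==> C ~= {} ==>
      (\<And>u w. u \<in> C ==> w \<in> X - {x} ==> adj u w ==> w \<in> C) ==> C = X - {x}"
    and conn2: "\<And>C. C \<subseteq> X - B ==> C ~= {} ==>
      (\<And>u w. u \<in> C ==> w \<in> X - B ==> adj u w ==> w \<in> C) ==> C = X - B"
    and "B \<subseteq> R" "R \<subset> X"
    and reach: "\<And>C. B \<subseteq> C ==> C \<subset> R ==> \<exists>u\<in>C. \<exists>w\<in>R - C. adj u w"
  shows "\<exists>Gs. distinct Gs \<and> set Gs = R - B \<and>
     (\<forall>k<length Gs. (\<exists>u\<in>B \<union> set (take k Gs). adj u (Gs ! k)) \<and>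
        (\<exists>u\<in>set (drop (Suc k) Gs) \<union> (X - R). adj (Gs ! k) u))"
  using assms(6-)
proof (induction "card (R - B)" arbitrary: R rule: less_induct)
  case less
  note BR = less.prems(1) and RX = less.prems(2) and reach = less.prems(3)
  have finR: "finite R" using RX \<open>finite X\<close> finite_subset by blast
  show ?case
  proof (cases "R = B")
    case True
    then show ?thesis by (intro exI[of _ "[]"]) auto
  next
    case False
    \<comment> \<open>\<open>K\<close> holds the candidates for the last position,
      \<open>Re x\<close> is what \<open>B\<close> still reaches inside \<open>R\<close> after the
      removal of \<open>x\<close>, and \<open>W x\<close> is the part that \<open>x\<close> cuts
      off.\<close>
    define K where "K = {x \<in> R - B. \<exists>s\<in>X - R. adj x s}"
    define Re where "Re x = {u. \<exists>b\<in>B. (b, u) \<in> {(p, q). adj p q \<and> p \<in> R - {x} \<and> q \<in> R - {x}}\<^sup>*}" for x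
    define W where "W x = R - {x} - Re x" for x
    have "K ~= {}"
    proof
      assume "K = {}"
      then have "X - R = X - B"
      proof (intro conn2)
        fix u w assume "u \<in> X - R" "w \<in> X - B" "adj u w"
        then show "w \<in> X - R" using \<open>K = {}\<close> sym[of u w] by (auto simp: K_def)
      qed (use BR RX in auto)
      then show False using BR RX False by auto
    qed
    \<comment> \<open>Extremal choice: a candidate that cuts off as little as possible turns out to
      cut off nothing.\<close>
    then obtain x where x: "x \<in> K" and xmin: "\<And>p. p \<in> K ==> card (W x) \<le> card (W p)"
      using arg_min_if_finite(1,2)[of K "\<lambda>p. card (W p)"] finR
      by (metis (no_types, lifting) K_def arg_min_least finite_Diff finite_subset mem_Collect_eq subsetI)
    have xR: "x \<in> R" "x \<notin> B" using x by (auto simp: K_def)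
    have ReR: "Re p \<subseteq> R - {p}" if "p \<notin> B" for p
    proof
      fix u assume "u \<in> Re p"
      then obtain b where "b \<in> B" "(b, u) \<in> {(p', q). adj p' q \<and> p' \<in> R - {p} \<and> q \<in> R - {p}}\<^sup>*"
        by (auto simp: Re_def)
      from this(2) this(1) show "u \<in> R - {p}"
        by (induction) (use BR that in auto)
    qed
    have BRe: "B \<subseteq> Re p" for p by (auto simp: Re_def)
    have Re_step: "w \<in> Re p" if "u \<in> Re p" "adj u w" "w \<in> R - {p}" "p \<notin> B" for u w p
    proof -
      have "u \<in> R - {p}" using ReR that by blast
      then show ?thesis using that unfolding Re_def
        by (auto intro: rtrancl_into_rtrancl)
    qed
    \<comment> \<open>If \<open>x\<close> cut something off, \<open>conn1\<close> would give an edge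
      leaving \<open>W x\<close>. It can only lead out of \<open>R\<close>, so its inner end
      \<open>p\<close> is a candidate as well, and \<open>p\<close> cuts off strictly less because
      \<open>x\<close> is reachable without \<open>p\<close>.\<close>
    have Wx: "W x = {}"
    proof (rule ccontr)
      assume ne: "W x ~= {}"
      have "\<exists>p q. p \<in> W x \<and> q \<in> X - {x} - W x \<and> adj p q"
      proof (rule ccontr)
        assume "\<not> ?thesis"
        then have "W x = X - {x}"
          by (intro conn1) (use ne RX xR in \<open>auto simp: W_def\<close>)
        then show False using BRe[of x] \<open>B ~= {}\<close> BR RX xR by (auto simp: W_def)
      qed
      then obtain p q where pq: "p \<in> W x" "q \<in> X - {x} - W x" "adj p q" by blast
      have "q \<notin> R"
      proof
        assume "q \<in> R"
        then have "q \<in> Re x" using pq by (auto simp: W_def)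
        then have "p \<in> Re x" using Re_step[of q x p] sym pq xR by (auto simp: W_def)
        then show False using pq by (auto simp: W_def)
      qed
      then have pK: "p \<in> K" using pq BRe[of x] by (auto simp: K_def W_def)
      have pB: "p \<notin> B" using pK by (auto simp: K_def)
      have sub: "Re x \<subseteq> Re p"
      proof
        fix u assume "u \<in> Re x"
        then obtain b where b: "b \<in> B" "(b, u) \<in> {(p', q). adj p' q \<and> p' \<in> R - {x} \<and> q \<in> R - {x}}\<^sup>*"
          by (auto simp: Re_def)
        from b(2) have "u \<in> Re x \<and> u \<in> Re p"
        proof induction
          case base
          then show ?case using b BRe by auto
        next
          case (step y z)
          have "z \<in> Re x" using step Re_step[of y x z] xR by auto
          moreover have "z ~= p" using \<open>z \<in> Re x\<close> pq by (auto simp: W_def)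
          ultimately show ?case using step Re_step[of y p z] pB by auto
        qed
        then show "u \<in> Re p" by blast
      qed
      have "\<exists>u\<in>Re x. \<exists>w\<in>R - Re x. adj u w"
        by (rule reach[OF BRe]) (use ReR[of x] xR in auto)
      then obtain u w where uw: "u \<in> Re x" "w \<in> R - Re x" "adj u w" by blast
      then have "w = x" using Re_step[of u x w] xR by auto
      then have "x \<in> Re p" using uw sub Re_step[of u p x] pB pq xR by (auto simp: W_def)
      then have "W p \<subseteq> W x - {p}" using sub by (auto simp: W_def)
      then have "card (W p) < card (W x)"
        using pq(1) finR by (metis W_def card_Diff1_less card_mono finite_Diff le_less_trans)
      then show False using xmin[OF pK] by simp
    qed
    define R' where "R' = R - {x}"
    have "\<exists>Gs. distinct Gs \<and> set Gs = R' - B \<and>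
       (\<forall>k<length Gs. (\<exists>u\<in>B \<union> set (take k Gs). adj u (Gs ! k)) \<and>
          (\<exists>u\<in>set (drop (Suc k) Gs) \<union> (X - R'). adj (Gs ! k) u))"
    proof (rule less.hyps)
      show "card (R' - B) < card (R - B)"
        unfolding R'_def using xR finR by (intro psubset_card_mono) auto
      show "B \<subseteq> R'" "R' \<subset> X" using BR xR RX by (auto simp: R'_def)
      fix C assume C: "B \<subseteq> C" "C \<subset> R'"
      show "\<exists>u\<in>C. \<exists>w\<in>R' - C. adj u w"
      proof (rule ccontr)
        assume no: "\<not> ?thesis"
        have "Re x \<subseteq> C"
        proof
          fix u assume "u \<in> Re x"
          then obtain b where b: "b \<in> B" "(b, u) \<in> {(p', q). adj p' q \<and> p' \<in> R - {x} \<and> q \<in> R - {x}}\<^sup>*"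
            by (auto simp: Re_def)
          from b(2) show "u \<in> C"
            by induction (use b C no in \<open>auto simp: R'_def\<close>)
        qed
        then show False using C Wx by (auto simp: W_def R'_def)
      qed
    qed
    then obtain Gs where Gs: "distinct Gs" "set Gs = R' - B"
      "\<And>k. k < length Gs ==> (\<exists>u\<in>B \<union> set (take k Gs). adj u (Gs ! k))"
      "\<And>k. k < length Gs ==> (\<exists>u\<in>set (drop (Suc k) Gs) \<union> (X - R'). adj (Gs ! k) u)"
      by blast
    have "\<exists>u\<in>Re x. \<exists>w\<in>R - Re x. adj u w"
      by (rule reach[OF BRe]) (use ReR[of x] xR in auto)
    then obtain u w where uw: "u \<in> Re x" "w \<in> R - Re x" "adj u w" by blast
    then have wx: "w = x" using Re_step[of u x w] xR by auto
    have uR: "u \<in> B \<union> set Gs" using uw ReR[of x] xR Gs(2) by (auto simp: R'_def)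
    obtain s where s: "s \<in> X - R" "adj x s" using x by (auto simp: K_def)
    show ?thesis
    proof (intro exI[of _ "Gs @ [x]"] conjI allI impI)
      show "distinct (Gs @ [x])" "set (Gs @ [x]) = R - B"
        using Gs xR by (auto simp: R'_def)
      fix k assume k: "k < length (Gs @ [x])"
      show "\<exists>u\<in>B \<union> set (take k (Gs @ [x])). adj u ((Gs @ [x]) ! k)"
      proof (cases "k < length Gs")
        case True
        then show ?thesis using Gs(3)[OF True] by (simp add: nth_append)
      next
        case False
        then have "k = length Gs" using k by simp
        then show ?thesis using uw wx uR by auto
      qed
      show "\<exists>u\<in>set (drop (Suc k) (Gs @ [x])) \<union> (X - R). adj ((Gs @ [x]) ! k) u"
      proof (cases "k < length Gs")
        case True
        then show ?thesis using Gs(4)[OF True] by (auto simp: nth_append R'_def)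
      next
        case False
        then have "k = length Gs" using k by simp
        then show ?thesis using s by auto
      qed
    qed
  qed
qed

text \<open>The previous lemma with a single target \<open>t\<close>, which is appended at the end.
  Reachability inside \<open>X - {t}\<close> comes from \<open>conn1\<close> at \<open>t\<close>,
  and \<open>conn0\<close> gives \<open>t\<close> itself a neighbour.\<close>

lemma st_ordering:
  assumes "finite X" and sym: "\<And>u w. adj u w ==> adj w u"
    and "B ~= {}" "B \<subset> X"
    and conn0: "\<And>C. C \<subseteq> X ==> C ~= {} ==>
      (\<And>u w. u \<in> C ==> w \<in> X ==> adj u w ==> w \<in> C) ==> C = X"
    and conn1: "\<And>x C. x \<in> X ==> C \<subseteq> X - {x} ==> C ~= {} ==>
      (\<And>u w. u \<in> C ==> w \<in> X - {x} ==> adj u w ==> w \<in> C) ==> C = X - {x}"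
    and conn2: "\<And>C. C \<subseteq> X - B ==> C ~= {} ==>
      (\<And>u w. u \<in> C ==> w \<in> X - B ==> adj u w ==> w \<in> C) ==> C = X - B"
  shows "\<exists>Gs. distinct Gs \<and> set Gs = X - B \<and>
     (\<forall>k<length Gs. (\<exists>u\<in>B \<union> set (take k Gs). adj u (Gs ! k)) \<and>
        (Suc k < length Gs --> (\<exists>u\<in>set (drop (Suc k) Gs). adj (Gs ! k) u)))"
proof -
  obtain t where t: "t \<in> X - B" using \<open>B \<subset> X\<close> by blast
  define R where "R = X - {t}"
  have "\<exists>Gs. distinct Gs \<and> set Gs = R - B \<and>
     (\<forall>k<length Gs. (\<exists>u\<in>B \<union> set (take k Gs). adj u (Gs ! k)) \<and>
        (\<exists>u\<in>set (drop (Suc k) Gs) \<union> (X - R). adj (Gs ! k) u))"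
  proof (rule st_ordering_aux[OF assms(1,2,3) conn1 conn2])
    show "B \<subseteq> R" "R \<subset> X" using t \<open>B \<subset> X\<close> by (auto simp: R_def)
    fix C assume C: "B \<subseteq> C" "C \<subset> R"
    show "\<exists>u\<in>C. \<exists>w\<in>R - C. adj u w"
    proof (rule ccontr)
      assume "\<not> ?thesis"
      then have "R - C = X - {t}"
      proof (intro conn1)
        fix u w assume uw: "u \<in> R - C" "w \<in> X - {t}" "adj u w"
        show "w \<in> R - C"
        proof (rule ccontr)
          assume "w \<notin> R - C"
          then have "w \<in> C" using uw by (auto simp: R_def)
          then show False using \<open>\<not> (\<exists>u\<in>C. \<exists>w\<in>R - C. adj u w)\<close> uw sym[of u w] by blast
        qed
      qed (use t C in \<open>auto simp: R_def\<close>)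
      then show False using C \<open>B ~= {}\<close> by (auto simp: R_def)
    qed
  qed
  then obtain Gs where Gs: "distinct Gs" "set Gs = R - B"
    "\<And>k. k < length Gs ==> (\<exists>u\<in>B \<union> set (take k Gs). adj u (Gs ! k))"
    "\<And>k. k < length Gs ==> (\<exists>u\<in>set (drop (Suc k) Gs) \<union> (X - R). adj (Gs ! k) u)"
    by blast
  have "\<exists>u\<in>X - {t}. adj u t"
  proof (rule ccontr)
    assume "\<not> ?thesis"
    then have no: "\<not> adj u t" if "u \<in> X - {t}" for u using that by blast
    have "{t} = X"
    proof (intro conn0)
      fix u w assume "u \<in> {t}" "w \<in> X" "adj u w"
      then show "w \<in> {t}" using no[of w] sym[of u w] by auto
    qed (use t in auto)
    then show False using \<open>B ~= {}\<close> \<open>B \<subset> X\<close> by auto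
  qed
  then obtain u where u: "u \<in> B \<union> set Gs" "adj u t" using Gs(2) by (auto simp: R_def)
  have XR: "X - R = {t}" using t by (auto simp: R_def)
  show ?thesis
  proof (intro exI[of _ "Gs @ [t]"] conjI allI impI)
    show "distinct (Gs @ [t])" "set (Gs @ [t]) = X - B"
      using Gs t by (auto simp: R_def)
    fix k assume k: "k < length (Gs @ [t])"
    show "\<exists>u\<in>B \<union> set (take k (Gs @ [t])). adj u ((Gs @ [t]) ! k)"
    proof (cases "k < length Gs")
      case True
      then show ?thesis using Gs(3)[OF True] by (simp add: nth_append)
    next
      case False
      then have "k = length Gs" using k by simp
      then show ?thesis using u by auto
    qed
    assume "Suc k < length (Gs @ [t])"
    then have True: "k < length Gs" by simp
    then show "\<exists>u\<in>set (drop (Suc k) (Gs @ [t])). adj ((Gs @ [t]) ! k) u"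
      using Gs(4)[OF True] XR by (auto simp: nth_append)
  qed
qed

section \<open>Incidence counts in polyhedral surfaces\<close>

lemma even_card_sym_diff:
  assumes "finite A" "finite B"
  shows "even (card (sym_diff A B)) \<longleftrightarrow> (even (card A) \<longleftrightarrow> even (card B))"
proof -
  have "card (sym_diff A B) = card (A - B) + card (B - A)"
    by (rule card_Un_disjoint) (use assms in auto)
  moreover have "card A = card (A - B) + card (A \<inter> B)"
    using card_Int_Diff[OF assms(1), of B] by simp
  moreover have "card B = card (B - A) + card (A \<inter> B)"
    using card_Int_Diff[OF assms(2), of A] by (simp add: Int_commute)
  ultimately show ?thesis by presburger
qed

lemma card_2_sub:
  assumes "card T = 2" "S \<subseteq> T" "a \<in> S" "b \<in> T" "b \<notin> S"
  shows "card S = 1"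
proof -
  have "finite T" using assms(1) card.infinite by fastforce
  then have "S \<subseteq> T - {b}" "finite (T - {b})" using assms by auto
  then have "card S \<le> card (T - {b})" by (rule card_mono[rotated])
  also have "\<dots> = 1" using assms \<open>finite T\<close> by simp
  finally have "card S \<le> 1" .
  moreover have "card S ~= 0" using assms \<open>finite T\<close> by (metis card_eq_0_iff empty_iff finite_subset)
  ultimately show ?thesis by simp
qed

text \<open>The incidences of the facets, ridges and peaks of a polyhedral 2-sphere, written downwards:
  members of \<open>X\<close> play the role of cells, of \<open>Y\<close> of edges and of \<open>Z\<close> of vertices.\<close>

locale surface =
  fixes X Y Z :: "'a set set"
  assumes finX: "finite X" and finY: "finite Y" and finZ: "finite Z"
    and edge_X: "\<And>y. y \<in> Y ==> card {x \<in> X. x \<subseteq> y} = 2"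
    and edge_Z: "\<And>y. y \<in> Y ==> card {z \<in> Z. y \<subseteq> z} = 2"
    and flag: "\<And>x z. x \<in> X ==> z \<in> Z ==> x \<subseteq> z ==> card {y \<in> Y. x \<subseteq> y \<and> y \<subseteq> z} = 2"
begin

definition Ed :: "'a set set \<Rightarrow> 'a set set" where "Ed C = {y \<in> Y. \<exists>x\<in>C. x \<subseteq> y}"
definition Pt :: "'a set set \<Rightarrow> 'a set set" where "Pt C = {z \<in> Z. \<exists>x\<in>C. x \<subseteq> z}"
definition Pe :: "'a set set \<Rightarrow> 'a set set" where "Pe I = {z \<in> Z. \<exists>y\<in>I. y \<subseteq> z}"
definition shareZ :: "'a set \<Rightarrow> 'a set \<Rightarrow> bool" where
  "shareZ y y' \<longleftrightarrow> (\<exists>z\<in>Z. y \<subseteq> z \<and> y' \<subseteq> z)"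
definition shareY :: "'a set \<Rightarrow> 'a set \<Rightarrow> bool" where
  "shareY x x' \<longleftrightarrow> (\<exists>y\<in>Y. x \<subseteq> y \<and> x' \<subseteq> y)"

text \<open>Only connectedness is asked for. As every vertex of \<open>x\<close> lies on exactly two
  of its edges (\<open>deg_full\<close>), this already makes the boundary of \<open>x\<close> a
  single cycle.\<close>

definition polygonal :: "'a set \<Rightarrow> bool" where
  "polygonal x \<longleftrightarrow> (\<exists>Is. chained shareZ Is \<and> distinct Is \<and> set Is = Ed {x})"

definition arc :: "'a set set \<Rightarrow> 'a set \<Rightarrow> bool" where
  "arc C x \<longleftrightarrow> Ed C \<inter> Ed {x} ~= {} \<and> Pt C \<inter> Pt {x} \<subseteq> Pe (Ed C \<inter> Ed {x}) \<and>
     (\<exists>Is. chained shareZ Is \<and> distinct Is \<and> set Is = Ed C \<inter> Ed {x})"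

definition pshell :: "'a set list \<Rightarrow> bool" where
  "pshell L \<longleftrightarrow> distinct L \<and> set L \<subseteq> X \<and>
     (\<forall>k<length L. 0 < k --> arc (set (take k L)) (L ! k))"

text \<open>The boundary operator on 2-chains modulo 2.\<close>

definition bd :: "'a set set \<Rightarrow> 'a set set" where
  "bd S = {y \<in> Y. odd (card {x \<in> S. x \<subseteq> y})}"

lemma finEd [simp]: "finite (Ed C)" by (simp add: Ed_def finY)
lemma finPt [simp]: "finite (Pt C)" by (simp add: Pt_def finZ)
lemma finPe [simp]: "finite (Pe C)" by (simp add: Pe_def finZ)

lemma shareY_sym: "shareY y y' ==> shareY y' y" by (auto simp: shareY_def)

lemma Ed_insert: "Ed (insert x C) = Ed C \<union> Ed {x}" by (auto simp: Ed_def)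
lemma Pt_insert: "Pt (insert x C) = Pt C \<union> Pt {x}" by (auto simp: Pt_def)

lemma Ed_Pt_trans: "y \<in> Ed C ==> y \<subseteq> z ==> z \<in> Z ==> z \<in> Pt C"
  unfolding Ed_def Pt_def by (blast intro: order_trans)

lemma pshell_snoc:
  "pshell (L @ [x]) \<longleftrightarrow> pshell L \<and> x \<in> X \<and> x \<notin> set L \<and> (L ~= [] --> arc (set L) x)"
proof -
  have "(\<forall>k<length (L @ [x]). 0 < k --> arc (set (take k (L @ [x]))) ((L @ [x]) ! k)) \<longleftrightarrow>
        (\<forall>k<length L. 0 < k --> arc (set (take k L)) (L ! k)) \<and> (L ~= [] --> arc (set L) x)"
    unfolding length_append_singleton All_less_Suc by (auto simp: nth_append)
  then show ?thesis unfolding pshell_def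
    by (simp only: set_append distinct_append) auto
qed

text \<open>Handshake count: an edge has exactly two vertices, and for an edge of \<open>x\<close>
  both of them belong to \<open>x\<close>.\<close>

lemma degree_sum:
  assumes "x \<in> X" "I \<subseteq> Ed {x}"
  shows "2 * card I = (\<Sum>z\<in>Pt {x}. card {y \<in> I. y \<subseteq> z})"
proof -
  have finI: "finite I" using assms(2) finEd finite_subset by blast
  have Z: "{z \<in> Pt {x}. y \<subseteq> z} = {z \<in> Z. y \<subseteq> z}" if "y \<in> I" for y
    using that assms by (auto simp: Pt_def Ed_def)
  have "(\<Sum>z\<in>Pt {x}. card {y \<in> I. y \<subseteq> z}) = (\<Sum>y\<in>I. card {z \<in> Pt {x}. y \<subseteq> z})"
    by (rule sum_multicount_gen) (use finI in auto)
  also have "\<dots> = (\<Sum>y\<in>I. 2)"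
    by (rule sum.cong) (use Z edge_Z assms in \<open>auto simp: Ed_def\<close>)
  finally show ?thesis by simp
qed

lemma deg_full:
  assumes "x \<in> X" "z \<in> Pt {x}"
  shows "card {y \<in> Ed {x}. y \<subseteq> z} = 2"
proof -
  have "{y \<in> Ed {x}. y \<subseteq> z} = {y \<in> Y. x \<subseteq> y \<and> y \<subseteq> z}" by (auto simp: Ed_def)
  then show ?thesis using assms flag[of x z] by (auto simp: Pt_def)
qed

lemma card_Ed_eq_Pt: "x \<in> X ==> card (Ed {x}) = card (Pt {x})"
  using degree_sum[of x "Ed {x}"] deg_full[of x] by simp

lemma Pe_sub: "I \<subseteq> Ed {x} ==> Pe I \<subseteq> Pt {x}"
  by (auto simp: Pe_def Pt_def Ed_def)

lemma polygonal_closed: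
  assumes "polygonal x" "I \<subseteq> Ed {x}" "I ~= {}"
    and "\<And>y y' z. y \<in> I ==> y' \<in> Ed {x} ==> z \<in> Z ==> y \<subseteq> z ==> y' \<subseteq> z ==> y' \<in> I"
  shows "I = Ed {x}"
proof -
  obtain Is where Is: "chained shareZ Is" "set Is = Ed {x}"
    using assms(1) by (auto simp: polygonal_def)
  have "I = set Is"
    by (rule chained_closed[OF Is(1)])
      (use Is assms in \<open>auto simp: shareZ_def\<close>)
  then show ?thesis using Is by simp
qed

text \<open>The boundary of \<open>x\<close> is one cycle, so a proper nonempty set of its edges has
  to stop at some vertex.\<close>

lemma deg_1_exists:
  assumes "x \<in> X" "polygonal x" "I \<subseteq> Ed {x}" "I ~= {}" "I ~= Ed {x}"
  shows "\<exists>z\<in>Pt {x}. card {y \<in> I. y \<subseteq> z} = 1"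
proof -
  obtain y y' z where *: "y \<in> I" "y' \<in> Ed {x}" "z \<in> Z" "y \<subseteq> z" "y' \<subseteq> z" "y' \<notin> I"
    using polygonal_closed[OF assms(2-4)] assms(5) by blast
  then have z: "z \<in> Pt {x}" by (auto simp: Pt_def Ed_def)
  have "card {y \<in> I. y \<subseteq> z} = 1"
    by (rule card_2_sub[OF deg_full[OF assms(1) z], of _ y y']) (use * assms in auto)
  then show ?thesis using z by blast
qed

lemma deg_le_2:
  assumes "x \<in> X" "I \<subseteq> Ed {x}" "z \<in> Pt {x}"
  shows "card {y \<in> I. y \<subseteq> z} \<le> 2"
  using card_mono[of "{y \<in> Ed {x}. y \<subseteq> z}" "{y \<in> I. y \<subseteq> z}"] deg_full[OF assms(1,3)] assms(2) by auto

text \<open>A union of disjoint paths has more vertices than edges, one more per path. This is read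
  off from the degrees, which are at most 2 and at least once equal to 1.\<close>

lemma card_Pe_ge:
  assumes "x \<in> X" "polygonal x" "I \<subseteq> Ed {x}" "I ~= {}" "I ~= Ed {x}"
  shows "card I + 1 \<le> card (Pe I)"
proof -
  have fin: "finite I" using assms(3) finEd finite_subset by blast
  have 0: "card {y \<in> I. y \<subseteq> z} = 0" if "z \<in> Pt {x} - Pe I" for z
  proof -
    have "{y \<in> I. y \<subseteq> z} = {}" using that by (auto simp: Pe_def Pt_def)
    then show ?thesis by (metis card.empty)
  qed
  have "2 * card I = (\<Sum>z\<in>Pe I. card {y \<in> I. y \<subseteq> z})"
    unfolding degree_sum[OF assms(1,3)]
    by (rule sum.mono_neutral_right) (use Pe_sub[OF assms(3)] 0 in auto)
  also have "\<dots> < (\<Sum>z\<in>Pe I. 2)"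
  proof (rule sum_strict_mono_ex1)
    show "\<forall>z\<in>Pe I. card {y \<in> I. y \<subseteq> z} \<le> 2"
      using deg_le_2[OF assms(1,3)] Pe_sub[OF assms(3)] by blast
    obtain z where z: "z \<in> Pt {x}" "card {y \<in> I. y \<subseteq> z} = 1"
      using deg_1_exists[OF assms] by blast
    then have "z \<in> Pe I" using 0[of z] by fastforce
    then show "\<exists>z\<in>Pe I. card {y \<in> I. y \<subseteq> z} < 2" using z(2) by (intro bexI[of _ z]) simp_all
  qed simp
  finally show ?thesis by simp
qed

text \<open>The first edge brings two vertices, and each later one shares a vertex with an earlier
  edge, so it brings at most one.\<close>

lemma card_Pe_le:
  assumes "chained shareZ Is" "distinct Is" "set Is \<subseteq> Y"
  shows "card (Pe (set Is)) \<le> length Is + 1"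
  using assms
proof (induction Is rule: rev_induct)
  case Nil
  then show ?case by (simp add: Pe_def)
next
  case (snoc y Is)
  have c: "chained shareZ Is" "Is = [] \<or> (\<exists>u\<in>set Is. shareZ u y)"
    using snoc.prems by (auto simp: chained_snoc)
  have y2: "card {z \<in> Z. y \<subseteq> z} = 2" using edge_Z snoc.prems by auto
  show ?case
  proof (cases "Is = []")
    case True
    then show ?thesis using y2 by (simp add: Pe_def)
  next
    case False
    then obtain u z where uz: "u \<in> set Is" "z \<in> Z" "u \<subseteq> z" "y \<subseteq> z"
      using c by (auto simp: shareZ_def)
    have "Pe (set (Is @ [y])) = Pe (set Is) \<union> ({z \<in> Z. y \<subseteq> z} - {z})"
      using uz by (auto simp: Pe_def)
    then have "card (Pe (set (Is @ [y]))) \<le> card (Pe (set Is)) + card ({z \<in> Z. y \<subseteq> z} - {z})"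
      using card_Un_le by metis
    also have "card ({z \<in> Z. y \<subseteq> z} - {z}) = 1" using y2 uz finZ by simp
    also have "card (Pe (set Is)) \<le> length Is + 1" using snoc c by auto
    finally show ?thesis by simp
  qed
qed

text \<open>Two pieces without a common vertex would each have a surplus of one vertex by
  \<open>card_Pe_ge\<close>, and the bound allows a surplus of one in total.\<close>

lemma chain_of_card:
  assumes "x \<in> X" "polygonal x" "I \<subseteq> Ed {x}" "I ~= {}" "I ~= Ed {x}" "card (Pe I) \<le> card I + 1"
  shows "\<exists>Is. chained shareZ Is \<and> distinct Is \<and> set Is = I"
proof (rule connected_imp_chained)
  have finI: "finite I" using assms(3) finEd finite_subset by blast
  then show "finite I" .
  fix C assume C: "C ~= {}" "C \<subset> I"
  show "\<exists>u\<in>C. \<exists>w\<in>I - C. shareZ u w"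
  proof (rule ccontr)
    assume no: "\<not> ?thesis"
    have "Pe I = Pe C \<union> Pe (I - C)" using C by (auto simp: Pe_def)
    moreover have "Pe C \<inter> Pe (I - C) = {}" using no by (auto simp: Pe_def shareZ_def)
    ultimately have "card (Pe I) = card (Pe C) + card (Pe (I - C))"
      using card_Un_disjoint finPe by metis
    moreover have "card C + 1 \<le> card (Pe C)"
      by (rule card_Pe_ge[OF assms(1,2)]) (use C assms in auto)
    moreover have "card (I - C) + 1 \<le> card (Pe (I - C))"
      by (rule card_Pe_ge[OF assms(1,2)]) (use C assms in auto)
    moreover have "card I = card C + card (I - C)"
      using card_Int_Diff[OF finI, of C] C by (simp add: Int_absorb1 psubset_imp_subset)
    ultimately show False using assms(6) by linarith
  qed
qed

subsection \<open>Euler characteristic\<close>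

definition chi :: "'a set set \<Rightarrow> int" where
  "chi C = int (card C) - int (card (Ed C)) + int (card (Pt C))"

text \<open>Inclusion and exclusion. The edges and vertices of the cell \<open>x\<close> cancel,
  being equally many, and what remains of it is the summand 1.\<close>

lemma chi_insert:
  assumes "finite C" "x \<in> X" "x \<notin> C"
  shows "chi (insert x C) = chi C + 1 + int (card (Ed C \<inter> Ed {x})) - int (card (Pt C \<inter> Pt {x}))"
proof -
  have "card (Ed C) + card (Ed {x}) = card (Ed (insert x C)) + card (Ed C \<inter> Ed {x})"
    using card_Un_Int[OF finEd finEd, of C "{x}"] by (simp add: Ed_insert[of x C])
  moreover have "card (Pt C) + card (Pt {x}) = card (Pt (insert x C)) + card (Pt C \<inter> Pt {x})"
    using card_Un_Int[OF finPt finPt, of C "{x}"] by (simp add: Pt_insert[of x C])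
  ultimately show ?thesis using assms card_Ed_eq_Pt[of x] by (simp add: chi_def)
qed

lemma Pe_Ed_sub: "Pe (Ed C \<inter> Ed {x}) \<subseteq> Pt C \<inter> Pt {x}"
  by (auto simp: Pe_def Pt_def Ed_def)

text \<open>Along a nonempty proper part of the boundary, the common vertices outnumber the common
  edges by at least one. Equality will later be the criterion for an arc.\<close>

lemma chi_insert_le:
  assumes "finite C" "x \<in> X" "x \<notin> C" "polygonal x" "Ed C \<inter> Ed {x} ~= {}" "Ed C \<inter> Ed {x} ~= Ed {x}"
  shows "chi (insert x C) \<le> chi C"
proof -
  have "card (Ed C \<inter> Ed {x}) + 1 \<le> card (Pe (Ed C \<inter> Ed {x}))"
    by (rule card_Pe_ge) (use assms in auto)
  also have "\<dots> \<le> card (Pt C \<inter> Pt {x})"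
    by (rule card_mono[OF _ Pe_Ed_sub]) simp
  finally show ?thesis using chi_insert[OF assms(1-3)] by simp
qed

lemma chi_insert_arc:
  assumes "finite C" "x \<in> X" "x \<notin> C" "polygonal x" "Ed C \<inter> Ed {x} ~= Ed {x}" "arc C x"
  shows "chi (insert x C) = chi C"
proof -
  obtain Is where Is: "chained shareZ Is" "distinct Is" "set Is = Ed C \<inter> Ed {x}"
    using assms(6) by (auto simp: arc_def)
  have "Pt C \<inter> Pt {x} = Pe (Ed C \<inter> Ed {x})" using assms(6) Pe_Ed_sub by (auto simp: arc_def)
  moreover have "card (Pe (Ed C \<inter> Ed {x})) \<le> card (Ed C \<inter> Ed {x}) + 1"
    using card_Pe_le[OF Is(1,2)] Is(3) distinct_card[OF Is(2)] by (auto simp: Ed_def)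
  moreover have "card (Ed C \<inter> Ed {x}) + 1 \<le> card (Pe (Ed C \<inter> Ed {x}))"
    by (rule card_Pe_ge) (use assms in \<open>auto simp: arc_def\<close>)
  ultimately show ?thesis using chi_insert[OF assms(1-3)] by simp
qed

lemma chi_insert_whole:
  assumes "finite C" "x \<in> X" "x \<notin> C" "Ed {x} \<subseteq> Ed C"
  shows "chi (insert x C) = chi C + 1"
proof -
  have "Pt {x} \<subseteq> Pt C"
  proof
    fix z assume z: "z \<in> Pt {x}"
    then have "card {y \<in> Ed {x}. y \<subseteq> z} = 2" using deg_full assms by blast
    then have "{y \<in> Ed {x}. y \<subseteq> z} ~= {}" by force
    then obtain y where "y \<in> Ed {x}" "y \<subseteq> z" by blast
    then have "y \<in> Ed C" using assms(4) by blast
    then show "z \<in> Pt C" using z \<open>y \<subseteq> z\<close> unfolding Pt_def Ed_def by blast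
  qed
  then have "Pt C \<inter> Pt {x} = Pt {x}" "Ed C \<inter> Ed {x} = Ed {x}" using assms by auto
  then show ?thesis using chi_insert[OF assms(1-3)] card_Ed_eq_Pt[OF assms(2)] by simp
qed

subsection \<open>Cycles modulo two\<close>

lemma finite_sub_X: "S \<subseteq> X ==> finite S" using finX finite_subset by blast

lemma bd_insert:
  assumes "S \<subseteq> X" "x \<in> X" "x \<notin> S"
  shows "bd (insert x S) = sym_diff (bd S) (Ed {x})"
proof -
  have fin: "finite {x \<in> S. x \<subseteq> y}" for y using finite_sub_X[OF assms(1)] by simp
  have "{u \<in> insert x S. u \<subseteq> y} = (if x \<subseteq> y then insert x {u \<in> S. u \<subseteq> y} else {u \<in> S. u \<subseteq> y})" for y
    by auto
  then have "odd (card {u \<in> insert x S. u \<subseteq> y}) \<longleftrightarrow> (odd (card {u \<in> S. u \<subseteq> y}) ~= (x \<subseteq> y))" for y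
    using assms(3) fin by auto
  then show ?thesis by (auto simp: bd_def Ed_def)
qed

lemma bd_union:
  assumes "S \<subseteq> X" "T \<subseteq> X" "S \<inter> T = {}"
  shows "bd (S \<union> T) = sym_diff (bd S) (bd T)"
proof -
  have "card {u \<in> S \<union> T. u \<subseteq> y} = card {u \<in> S. u \<subseteq> y} + card {u \<in> T. u \<subseteq> y}" for y
  proof -
    have "{u \<in> S \<union> T. u \<subseteq> y} = {u \<in> S. u \<subseteq> y} \<union> {u \<in> T. u \<subseteq> y}" by auto
    moreover have "card \<dots> = card {u \<in> S. u \<subseteq> y} + card {u \<in> T. u \<subseteq> y}"
      by (rule card_Un_disjoint) (use finite_sub_X[OF assms(1)] finite_sub_X[OF assms(2)] assms(3) in auto)
    ultimately show ?thesis by simp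
  qed
  then show ?thesis by (auto simp: bd_def)
qed

lemma even_deg_Ed:
  assumes "x \<in> X" "z \<in> Z"
  shows "even (card {y \<in> Ed {x}. y \<subseteq> z})"
proof (cases "x \<subseteq> z")
  case True
  then show ?thesis using deg_full[of x z] assms by (auto simp: Pt_def)
next
  case False
  then have "{y \<in> Ed {x}. y \<subseteq> z} = {}" by (auto simp: Ed_def)
  then show ?thesis by (metis card.empty even_zero)
qed

lemma sym_diff_deg:
  "{y \<in> sym_diff A B. y \<subseteq> z} = sym_diff {y \<in> A. y \<subseteq> z} {y \<in> B. y \<subseteq> z}"
  by auto

lemma even_deg_sym_diff:
  assumes "finite A" "finite B" "even (card {y \<in> A. y \<subseteq> z})" "even (card {y \<in> B. y \<subseteq> z})"
  shows "even (card {y \<in> sym_diff A B. y \<subseteq> z})"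
  unfolding sym_diff_deg using even_card_sym_diff[of "{y \<in> A. y \<subseteq> z}" "{y \<in> B. y \<subseteq> z}"] assms by simp

text \<open>Boundaries are cycles: this holds for a single cell and is preserved by symmetric
  differences.\<close>

lemma even_bd:
  assumes "S \<subseteq> X" "z \<in> Z"
  shows "even (card {y \<in> bd S. y \<subseteq> z})"
proof -
  have "finite S" using assms finite_sub_X by blast
  from this assms(1) show ?thesis
  proof (induction S rule: finite_induct)
    case empty
    then show ?case by (simp add: bd_def)
  next
    case (insert x S)
    have "finite (bd S)" by (simp add: bd_def finY)
    then show ?case using insert bd_insert[of S x] even_deg_sym_diff[of "bd S" "Ed {x}" z]
      even_deg_Ed[of x z] assms(2) by simp
  qed
qed

text \<open>A mod 2 cycle cannot stop at a vertex that \<open>C\<close> does not touch, so along the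
  new edges of \<open>x\<close> it has no place to start or end. Concretely, if the new edges split
  into \<open>M\<close> inside and \<open>M2\<close> outside the cycle, there are four vertices
  where \<open>I\<close> has degree one, while a connected set of edges has room for two.\<close>

lemma cycle_all_or_none:
  assumes x: "x \<in> X" "polygonal x" and C: "C = {} \<or> arc C x"
    and W: "W \<subseteq> Ed (insert x C)" "\<And>z. z \<in> Z ==> even (card {y \<in> W. y \<subseteq> z})"
  shows "W \<inter> (Ed {x} - Ed C) = {} \<or> Ed {x} - Ed C \<subseteq> W"
proof (rule ccontr)
  assume no: "\<not> ?thesis"
  define M where "M = W \<inter> (Ed {x} - Ed C)"
  define M2 where "M2 = Ed {x} - Ed C - W"
  define I where "I = Ed C \<inter> Ed {x}"
  have ne: "M ~= {}" "M2 ~= {}" using no by (auto simp: M_def M2_def)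
  have sub: "M \<subseteq> Ed {x}" "M2 \<subseteq> Ed {x}" "I \<subseteq> Ed {x}" by (auto simp: M_def M2_def I_def)
  have finI: "finite I" "finite M" "finite M2" using sub finEd finite_subset by blast+
  have tot: "card {y \<in> I. y \<subseteq> z} + card {y \<in> M. y \<subseteq> z} + card {y \<in> M2. y \<subseteq> z} = 2" if "z \<in> Pt {x}" for z
  proof -
    have "{y \<in> Ed {x}. y \<subseteq> z} = {y \<in> I. y \<subseteq> z} \<union> ({y \<in> M. y \<subseteq> z} \<union> {y \<in> M2. y \<subseteq> z})"
      by (auto simp: I_def M_def M2_def)
    moreover have "card \<dots> = card {y \<in> I. y \<subseteq> z} + card ({y \<in> M. y \<subseteq> z} \<union> {y \<in> M2. y \<subseteq> z})"
      by (rule card_Un_disjoint) (use finI in \<open>auto simp: I_def M_def M2_def\<close>)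
    moreover have "card ({y \<in> M. y \<subseteq> z} \<union> {y \<in> M2. y \<subseteq> z}) = card {y \<in> M. y \<subseteq> z} + card {y \<in> M2. y \<subseteq> z}"
      by (rule card_Un_disjoint) (use finI in \<open>auto simp: M_def M2_def\<close>)
    ultimately show ?thesis using deg_full[OF x(1) that] by simp
  qed
  have untouched: "even (card {y \<in> M. y \<subseteq> z})" if "z \<in> Pt {x} - Pt C" for z
  proof -
    have "{y \<in> W. y \<subseteq> z} = {y \<in> M. y \<subseteq> z}"
    proof
      show "{y \<in> M. y \<subseteq> z} \<subseteq> {y \<in> W. y \<subseteq> z}" by (auto simp: M_def)
      have "y \<in> M" if y: "y \<in> W" "y \<subseteq> z" for y
      proof -
        have "y \<notin> Ed C"
        proof
          assume "y \<in> Ed C"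
          then have "z \<in> Pt C"
            by (rule Ed_Pt_trans) (use \<open>z \<in> Pt {x} - Pt C\<close> y(2) in \<open>auto simp: Pt_def\<close>)
          then show False using \<open>z \<in> Pt {x} - Pt C\<close> by blast
        qed
        then show ?thesis using y W(1) Ed_insert[of x C] by (auto simp: M_def)
      qed
      then show "{y \<in> W. y \<subseteq> z} \<subseteq> {y \<in> M. y \<subseteq> z}" by blast
    qed
    then show ?thesis using W(2)[of z] that by (simp add: Pt_def)
  qed
  have noI: "card {y \<in> I. y \<subseteq> z} = 0" if "z \<in> Pt {x} - Pt C" for z
  proof -
    have "z \<in> Z" using that by (auto simp: Pt_def)
    then have "{y \<in> I. y \<subseteq> z} = {}" using that Ed_Pt_trans[of _ C z] by (auto simp: I_def)
    then show ?thesis by (metis card.empty)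
  qed
  define U where "U = Pt C \<inter> Pt {x}"
  have odd_touched: "\<exists>z\<in>U. card {y \<in> A. y \<subseteq> z} = 1" if A: "A = M \<or> A = M2" for A
  proof -
    have "A ~= Ed {x}" "A ~= {}" "A \<subseteq> Ed {x}" using A ne sub by (auto simp: M_def M2_def)
    then obtain z where z: "z \<in> Pt {x}" "card {y \<in> A. y \<subseteq> z} = 1"
      using deg_1_exists[OF x] by blast
    have "z \<in> Pt C"
    proof (rule ccontr)
      assume "z \<notin> Pt C"
      then have "even (card {y \<in> M. y \<subseteq> z})" "card {y \<in> I. y \<subseteq> z} = 0" using untouched noI z by auto
      then show False using tot[OF z(1)] A z(2) by auto
    qed
    then show ?thesis using z by (auto simp: U_def)
  qed
  have "C ~= {}" using odd_touched[of M] by (auto simp: U_def Pt_def)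
  then have arc: "arc C x" using C by blast
  have UPe: "U = Pe I" using arc Pe_Ed_sub by (auto simp: arc_def U_def I_def)
  obtain Is where Is: "chained shareZ Is" "distinct Is" "set Is = I"
    using arc by (auto simp: arc_def I_def)
  have cU: "card U \<le> card I + 1"
    using card_Pe_le[OF Is(1,2)] Is(3) distinct_card[OF Is(2)] by (auto simp: Ed_def UPe I_def)
  have U1: "1 \<le> card {y \<in> I. y \<subseteq> z}" if "z \<in> U" for z
  proof -
    have "{y \<in> I. y \<subseteq> z} ~= {}" using that by (auto simp: UPe Pe_def)
    then show ?thesis using finI by (simp add: Suc_le_eq card_gt_0_iff)
  qed
  \<comment> \<open>Handshake parity: a vertex of odd degree never occurs alone.\<close>
  have two: "\<exists>z1\<in>U. \<exists>z2\<in>U. z1 ~= z2 \<and> card {y \<in> A. y \<subseteq> z1} = 1 \<and> card {y \<in> A. y \<subseteq> z2} = 1"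
    if A: "A = M \<or> A = M2" for A
  proof -
    obtain z1 where z1: "z1 \<in> U" "card {y \<in> A. y \<subseteq> z1} = 1" using odd_touched[OF A] by blast
    have "even (\<Sum>z\<in>Pt {x}. card {y \<in> A. y \<subseteq> z})"
    proof -
      have "A \<subseteq> Ed {x}" using A sub by blast
      then show ?thesis unfolding degree_sum[OF x(1) \<open>A \<subseteq> Ed {x}\<close>, symmetric] by simp
    qed
    moreover have "(\<Sum>z\<in>Pt {x}. card {y \<in> A. y \<subseteq> z}) = 1 + (\<Sum>z\<in>Pt {x} - {z1}. card {y \<in> A. y \<subseteq> z})"
      using sum.remove[of "Pt {x}" z1 "\<lambda>z. card {y \<in> A. y \<subseteq> z}"] z1 by (simp add: U_def)
    ultimately have "odd (\<Sum>z\<in>Pt {x} - {z1}. card {y \<in> A. y \<subseteq> z})" by simp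
    then obtain z2 where z2: "z2 \<in> Pt {x} - {z1}" "odd (card {y \<in> A. y \<subseteq> z2})"
      using dvd_sum[of "Pt {x} - {z1}" 2 "\<lambda>z. card {y \<in> A. y \<subseteq> z}"] by blast
    have c1: "card {y \<in> A. y \<subseteq> z2} = 1"
    proof -
      have "card {y \<in> A. y \<subseteq> z2} \<le> 2" using tot[of z2] z2 A by auto
      moreover have "card {y \<in> A. y \<subseteq> z2} ~= 0" "card {y \<in> A. y \<subseteq> z2} ~= 2" using z2(2) by (metis even_zero, auto)
      ultimately show ?thesis by linarith
    qed
    have "z2 \<in> Pt C"
    proof (rule ccontr)
      assume "z2 \<notin> Pt C"
      then have "even (card {y \<in> M. y \<subseteq> z2})" "card {y \<in> I. y \<subseteq> z2} = 0" using untouched noI z2 by auto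
      then show False using tot[of z2] z2 A c1 by auto
    qed
    then show ?thesis using z1 z2 c1 by (auto simp: U_def)
  qed
  obtain a1 a2 where a: "a1 \<in> U" "a2 \<in> U" "a1 ~= a2" "card {y \<in> M. y \<subseteq> a1} = 1" "card {y \<in> M. y \<subseteq> a2} = 1"
    using two[of M] by blast
  obtain b1 b2 where b: "b1 \<in> U" "b2 \<in> U" "b1 ~= b2" "card {y \<in> M2. y \<subseteq> b1} = 1" "card {y \<in> M2. y \<subseteq> b2} = 1"
    using two[of M2] by blast
  have dI: "card {y \<in> I. y \<subseteq> z} \<le> (if z \<in> {a1, a2, b1, b2} then 1 else 2)" if "z \<in> U" for z
    using tot[of z] that a b by (auto simp: U_def)
  \<comment> \<open>A touched vertex has at least one of its two edges in \<open>I\<close>, hence at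
    most one in \<open>M\<close> and \<open>M2\<close> together. So the pairs \<open>a1\<close>,
    \<open>a2\<close> and \<open>b1\<close>, \<open>b2\<close> are disjoint.\<close>
  have dist: "card {a1, a2, b1, b2} = 4"
  proof -
    have "a1 ~= b1" "a1 ~= b2" "a2 ~= b1" "a2 ~= b2"
      using U1[OF a(1)] U1[OF a(2)] tot[of a1] tot[of a2] a b by (auto simp: U_def)
    then show ?thesis using a b by simp
  qed
  obtain Q where Q: "Q \<subseteq> U" "card Q = 4"
    "\<And>z. z \<in> U ==> card {y \<in> I. y \<subseteq> z} \<le> (if z \<in> Q then 1 else 2)"
    using that[of "{a1, a2, b1, b2}"] a b dist dI by blast
  have finU: "finite U" by (simp add: U_def)
  \<comment> \<open>Four of the touched vertices contribute at most one each, which bounds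
    \<open>2 * card I\<close> by \<open>2 * card U - 4\<close> and contradicts
    \<open>cU\<close>.\<close>
  have "2 * card I = (\<Sum>z\<in>U. card {y \<in> I. y \<subseteq> z})"
    unfolding degree_sum[OF x(1) sub(3)]
  proof (rule sum.mono_neutral_right)
    show "\<forall>z\<in>Pt {x} - U. card {y \<in> I. y \<subseteq> z} = 0" using noI unfolding U_def by blast
  qed (auto simp: U_def)
  also have "\<dots> \<le> (\<Sum>z\<in>U. if z \<in> Q then 1 else 2)"
    by (rule sum_mono) (rule Q(3))
  also have "\<dots> = (\<Sum>z\<in>U - Q. if z \<in> Q then 1 else 2) + (\<Sum>z\<in>Q. if z \<in> Q then 1 else 2)"
    by (rule sum.subset_diff[OF Q(1) finU])
  also have "(\<Sum>z\<in>U - Q. if z \<in> Q then 1 else (2::nat)) = (\<Sum>z\<in>U - Q. 2)"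
    by (rule sum.cong) auto
  also have "\<dots> = 2 * (card U - 4)"
    using card_Diff_subset[of Q U] Q(1,2) finU finite_subset by fastforce
  also have "(\<Sum>z\<in>Q. if z \<in> Q then 1 else (2::nat)) = 4"
    using Q(2) by simp
  finally have "2 * card I \<le> 2 * (card U - 4) + 4" .
  moreover have "4 \<le> card U" using card_mono[OF finU Q(1)] Q(2) by simp
  ultimately show False using cU by linarith
qed

text \<open>The first homology mod 2 of a partial shelling vanishes. If a cycle uses the new edges
  of the last cell, adding the boundary of that cell removes them all and pushes the cycle into the
  earlier cells.\<close>

lemma cycle_is_boundary:
  assumes "pshell L" and pol: "\<And>x. x \<in> X ==> polygonal x"
    and "W \<subseteq> Ed (set L)" "\<And>z. z \<in> Z ==> even (card {y \<in> W. y \<subseteq> z})"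
  shows "\<exists>S\<subseteq>set L. W = bd S"
  using assms(1,3,4)
proof (induction L arbitrary: W rule: rev_induct)
  case Nil
  then show ?case by (auto simp: Ed_def bd_def)
next
  case (snoc x L)
  have L: "pshell L" "x \<in> X" "x \<notin> set L" "L ~= [] --> arc (set L) x" "set L \<subseteq> X"
    using pshell_snoc[THEN iffD1, OF snoc.prems(1)] by (simp_all add: pshell_def)
  have W: "W \<subseteq> Ed (insert x (set L))" using snoc.prems(2) by simp
  have "W \<inter> (Ed {x} - Ed (set L)) = {} \<or> Ed {x} - Ed (set L) \<subseteq> W"
    by (rule cycle_all_or_none) (use L W pol snoc.prems(3) in auto)
  then show ?case
  proof
    assume "W \<inter> (Ed {x} - Ed (set L)) = {}"
    then have "W \<subseteq> Ed (set L)" using W by (auto simp: Ed_insert[of x "set L"])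
    then have "\<exists>S\<subseteq>set L. W = bd S"
      by (rule snoc.IH[OF L(1)]) (rule snoc.prems(3))
    then show ?thesis by auto
  next
    assume all: "Ed {x} - Ed (set L) \<subseteq> W"
    define W' where "W' = sym_diff W (Ed {x})"
    have finW: "finite W" using W finEd finite_subset by blast
    have "\<exists>S\<subseteq>set L. W' = bd S"
    proof (rule snoc.IH[OF L(1)])
      show "W' \<subseteq> Ed (set L)" using all W by (auto simp: W'_def Ed_insert[of x "set L"])
      show "even (card {y \<in> W'. y \<subseteq> z})" if "z \<in> Z" for z
        unfolding W'_def
        by (rule even_deg_sym_diff) (use finW snoc.prems(3) even_deg_Ed L that in auto)
    qed
    then obtain S where S: "S \<subseteq> set L" "W' = bd S" by blast
    have "bd (insert x S) = sym_diff W' (Ed {x})"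
      using bd_insert[of S x] S L by auto
    also have "\<dots> = W" by (auto simp: W'_def)
    finally show ?thesis using S by (intro exI[of _ "insert x S"]) auto
  qed
qed

end

section \<open>Completing partial shellings of a 2-sphere\<close>

lemma (in surface) pshell_chained: "pshell L ==> chained shareY L"
proof (induction L rule: rev_induct)
  case (snoc x L)
  have L: "pshell L" "L ~= [] --> arc (set L) x"
    using pshell_snoc[THEN iffD1, OF snoc.prems] by simp_all
  have "\<exists>u\<in>set L. shareY u x" if "L ~= []"
  proof -
    have "Ed (set L) \<inter> Ed {x} ~= {}" using L(2) that by (simp add: arc_def)
    then obtain y where "y \<in> Ed (set L)" "y \<in> Ed {x}" by blast
    then show ?thesis by (auto simp: Ed_def shareY_def)
  qed
  then show ?case using snoc.IH[OF L(1)] by (auto simp: chained_snoc)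
qed simp

text \<open>Sphericity is encoded by one complete shelling. Connectedness, the separation property
  and the Euler characteristic are all derived from it.\<close>

locale sphere = surface +
  fixes Ls
  assumes full: "pshell Ls" "set Ls = X"
    and pol: "\<And>x. x \<in> X ==> polygonal x"
begin

lemma X_closed:
  assumes "S \<subseteq> X" "S ~= {}" "\<And>u w. u \<in> S ==> w \<in> X ==> shareY u w ==> w \<in> S"
  shows "S = X"
proof -
  have "S = set Ls"
  proof (rule chained_closed[OF pshell_chained[OF full(1)]])
    fix u w assume "u \<in> S" "w \<in> set Ls" "shareY u w \<or> shareY w u"
    then show "w \<in> S" using assms(3)[of u w] full(2) shareY_sym[of w u] by blast
  qed (use assms full in auto)
  then show ?thesis using full by simp
qed

lemma bd_crossing:
  assumes "S \<subseteq> X" "u \<in> S" "w \<in> X" "w \<notin> S" "y \<in> Y" "u \<subseteq> y" "w \<subseteq> y"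
  shows "y \<in> bd S"
proof -
  have "card {x \<in> S. x \<subseteq> y} = 1"
    by (rule card_2_sub[OF edge_X[OF assms(5)], of _ u w]) (use assms in auto)
  then show ?thesis using assms by (simp add: bd_def)
qed

text \<open>The only 2-cycles are zero and the fundamental class: a chain without boundary cannot be
  left across an edge, and the cells are connected across edges.\<close>

lemma bd_empty:
  assumes "S \<subseteq> X" "bd S = {}"
  shows "S = {} \<or> S = X"
proof (rule ccontr)
  assume no: "\<not> ?thesis"
  have "S = X"
  proof (rule X_closed[OF assms(1)])
    fix u w assume "u \<in> S" "w \<in> X" "shareY u w"
    then show "w \<in> S" using bd_crossing[OF assms(1)] assms(2) by (auto simp: shareY_def)
  qed (use no in auto)
  then show False using no by blast
qed

lemma bd_mem_crossing:
  assumes "S \<subseteq> X" "y \<in> bd S"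
  shows "\<exists>u\<in>S. \<exists>w\<in>X - S. u \<subseteq> y \<and> w \<subseteq> y"
proof -
  have y: "y \<in> Y" "odd (card {x \<in> S. x \<subseteq> y})" using assms(2) by (auto simp: bd_def)
  have "{x \<in> S. x \<subseteq> y} ~= {}" using y(2) by (metis card.empty even_zero)
  moreover have "{x \<in> S. x \<subseteq> y} ~= {x \<in> X. x \<subseteq> y}" using y edge_X[OF y(1)] by auto
  ultimately show ?thesis using assms(1) by blast
qed

text \<open>A duality argument. The boundary of a component \<open>C\<close> of the complement
  consists of edges of \<open>B\<close>, so it also bounds some \<open>S\<close> inside
  \<open>B\<close>. Then \<open>C\<close> and \<open>S\<close> together have no boundary and must
  fill the sphere.\<close>

lemma complement_connected:
  assumes "pshell B" "C \<subseteq> X - set B" "C ~= {}"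
    and cl: "\<And>u w. u \<in> C ==> w \<in> X - set B ==> shareY u w ==> w \<in> C"
  shows "C = X - set B"
proof -
  have BX: "set B \<subseteq> X" using assms(1) by (simp add: pshell_def)
  have CX: "C \<subseteq> X" using assms(2) by blast
  have "bd C \<subseteq> Ed (set B)"
  proof
    fix y assume y: "y \<in> bd C"
    then obtain u w where uw: "u \<in> C" "w \<in> X - C" "u \<subseteq> y" "w \<subseteq> y"
      using bd_mem_crossing[OF CX] by blast
    have "y \<in> Y" using y by (simp add: bd_def)
    then have "w \<in> set B" using cl[of u w] uw by (auto simp: shareY_def)
    then show "y \<in> Ed (set B)" using \<open>y \<in> Y\<close> uw by (auto simp: Ed_def)
  qed
  then obtain S where S: "S \<subseteq> set B" "bd C = bd S"
    using cycle_is_boundary[OF assms(1) pol, of "bd C"] even_bd[OF CX] by blast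
  have "bd (C \<union> S) = sym_diff (bd C) (bd S)"
    by (rule bd_union) (use S BX CX assms(2) in auto)
  then have "bd (C \<union> S) = {}" using S by auto
  then have "C \<union> S = {} \<or> C \<union> S = X"
    by (intro bd_empty) (use S BX CX in auto)
  then show ?thesis using assms(2,3) S by auto
qed

lemma pshell_single: "x \<in> X ==> pshell [x]"
  by (simp add: pshell_def)

text \<open>If the whole boundary of \<open>x\<close> lies in the shelled part, it bounds a chain
  there as well, and this chain closes up with \<open>x\<close> to the whole sphere.\<close>

lemma not_whole:
  assumes "pshell B" "x \<in> X" "x \<notin> set B" "Ed {x} \<subseteq> Ed (set B)"
  shows "insert x (set B) = X"
proof -
  have BX: "set B \<subseteq> X" using assms(1) by (simp add: pshell_def)
  obtain S where S: "S \<subseteq> set B" "Ed {x} = bd S"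
    using cycle_is_boundary[OF assms(1) pol assms(4)] even_deg_Ed[OF assms(2)] by blast
  have "bd (insert x S) = sym_diff (bd S) (Ed {x})"
    by (rule bd_insert) (use S BX assms in auto)
  then have "bd (insert x S) = {}" using S by auto
  then have "insert x S = X" using bd_empty[of "insert x S"] S BX assms by auto
  then show ?thesis using S BX assms by auto
qed

text \<open>As far as \<open>chi\<close> can tell, a proper partial shelling is a disk: a single
  cell has value 1, and attaching along an arc changes nothing.\<close>

lemma chi_partial:
  assumes "pshell B" "B ~= []" "set B ~= X"
  shows "chi (set B) = 1"
  using assms
proof (induction B rule: rev_induct)
  case (snoc x B)
  have B: "pshell B" "x \<in> X" "x \<notin> set B" "B ~= [] --> arc (set B) x" "set B \<subseteq> X"
    using pshell_snoc[THEN iffD1, OF snoc.prems(1)] by (simp_all add: pshell_def)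
  show ?case
  proof (cases "B = []")
    case True
    then show ?thesis using B card_Ed_eq_Pt[of x] by (simp add: chi_def)
  next
    case False
    have "set B ~= X" using B by auto
    moreover have "Ed (set B) \<inter> Ed {x} ~= Ed {x}"
      using not_whole[OF B(1-3)] snoc.prems(3) by auto
    ultimately show ?thesis using chi_insert_arc[of "set B" x] B False snoc.IH pol by simp
  qed
qed simp

lemma Ed_rest:
  assumes "x \<in> X"
  shows "Ed {x} \<subseteq> Ed (X - {x})"
proof
  fix y assume y: "y \<in> Ed {x}"
  then have "card {u \<in> X. u \<subseteq> y} = 2" "x \<in> {u \<in> X. u \<subseteq> y}" using edge_X assms by (auto simp: Ed_def)
  then have "card ({u \<in> X. u \<subseteq> y} - {x}) = 1" using finX by simp
  then have "{u \<in> X. u \<subseteq> y} - {x} ~= {}" by (metis card.empty zero_neq_one)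
  then show "y \<in> Ed (X - {x})" using y by (auto simp: Ed_def)
qed

text \<open>In the given complete shelling the last cell closes the disk along its whole boundary
  and raises 1 to 2.\<close>

lemma chi_X:
  assumes "2 \<le> card X"
  shows "chi X = 2"
proof -
  obtain L x where Lx: "Ls = L @ [x]"
    using full(2) assms by (metis card.empty not_numeral_le_zero rev_exhaust set_empty)
  have B: "pshell L" "x \<in> X" "x \<notin> set L" "set L \<subseteq> X"
    using pshell_snoc[THEN iffD1, OF full(1)[unfolded Lx]] by (simp_all add: pshell_def)
  have X: "X = insert x (set L)" using Lx full(2) by auto
  have "L ~= []" using X assms by auto
  then have "chi (set L) = 1" using chi_partial[OF B(1)] B X by auto
  moreover have "Ed {x} \<subseteq> Ed (set L)"
    using Ed_rest[OF B(2)] X B(3) by (metis Diff_insert_absorb)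
  ultimately show ?thesis using chi_insert_whole[of "set L" x] B X by simp
qed

text \<open>In an st-ordering of the remaining cells each one touches earlier cells and, except for
  the last, later ones, so \<open>chi\<close> does not grow before the last step. It is 1 at
  \<open>B\<close> and 1 again before the last cell, hence constant, and then the inequality of
  \<open>card_Pe_ge\<close> is sharp at each step, which means an arc.\<close>

theorem pshell_extend:
  assumes B: "pshell B" "B ~= []"
  shows "\<exists>Gs. pshell (B @ Gs) \<and> set (B @ Gs) = X"
proof (cases "set B = X")
  case True
  then show ?thesis using B by (intro exI[of _ "[]"]) simp
next
  case False
  have BX: "set B \<subset> X" using B False by (auto simp: pshell_def)
  have "\<exists>Gs. distinct Gs \<and> set Gs = X - set B \<and>
     (\<forall>k<length Gs. (\<exists>u\<in>set B \<union> set (take k Gs). shareY u (Gs ! k)) \<and>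
        (Suc k < length Gs --> (\<exists>u\<in>set (drop (Suc k) Gs). shareY (Gs ! k) u)))"
  \<comment> \<open>A single cell and \<open>B\<close> are both partial shellings, so removing
    either leaves the other cells connected.\<close>
  proof (rule st_ordering[OF finX shareY_sym _ BX])
    show "set B ~= {}" using B by simp
  next
    fix C assume "C \<subseteq> X" "C ~= {}" "\<And>u w. u \<in> C ==> w \<in> X ==> shareY u w ==> w \<in> C"
    then show "C = X" by (rule X_closed)
  next
    fix x C assume "x \<in> X" "C \<subseteq> X - {x}" "C ~= {}"
      "\<And>u w. u \<in> C ==> w \<in> X - {x} ==> shareY u w ==> w \<in> C"
    then show "C = X - {x}" using complement_connected[of "[x]" C] pshell_single by simp
  next
    fix C assume "C \<subseteq> X - set B" "C ~= {}"
      "\<And>u w. u \<in> C ==> w \<in> X - set B ==> shareY u w ==> w \<in> C"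
    then show "C = X - set B" by (rule complement_connected[OF B(1)])
  qed
  then obtain Gs where G: "distinct Gs \<and> set Gs = X - set B \<and>
     (\<forall>k<length Gs. (\<exists>u\<in>set B \<union> set (take k Gs). shareY u (Gs ! k)) \<and>
        (Suc k < length Gs --> (\<exists>u\<in>set (drop (Suc k) Gs). shareY (Gs ! k) u)))" ..
  then have Gs: "distinct Gs" "set Gs = X - set B" by simp_all
  have early: "\<exists>u\<in>set B \<union> set (take k Gs). shareY u (Gs ! k)" if "k < length Gs" for k
    using G that by simp
  have late: "\<exists>u\<in>set (drop (Suc k) Gs). shareY (Gs ! k) u" if "Suc k < length Gs" for k
    using G that by simp
  define D where "D k = set B \<union> set (take k Gs)" for k
  have D0: "D 0 = set B" by (simp add: D_def)
  have DX: "D (length Gs) = X" using Gs BX by (auto simp: D_def)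
  have Dsub: "D k \<subseteq> X" for k using Gs(2) BX set_take_subset[of k Gs] by (auto simp: D_def)
  have Dfin: "finite (D k)" for k using Dsub finite_sub_X by blast
  have DSuc: "D (Suc k) = insert (Gs ! k) (D k)" if "k < length Gs" for k
    using that by (auto simp: D_def take_Suc_conv_app_nth)
  have new: "Gs ! k \<in> X" "Gs ! k \<notin> D k" if "k < length Gs" for k
  proof -
    have "Gs ! k \<in> set Gs" using that by simp
    then show "Gs ! k \<in> X" using Gs(2) by blast
    have "Gs ! k \<notin> set (take k Gs)"
      using Gs(1) that by (auto simp: in_set_conv_nth nth_eq_iff_index_eq)
    then show "Gs ! k \<notin> D k" using \<open>Gs ! k \<in> set Gs\<close> Gs(2) by (auto simp: D_def)
  qed
  have touch: "Ed (D k) \<inter> Ed {Gs ! k} ~= {}" if "k < length Gs" for k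
    using early[OF that] by (auto simp: D_def Ed_def shareY_def)
  have proper: "Ed (D k) \<inter> Ed {Gs ! k} ~= Ed {Gs ! k}" if k: "Suc k < length Gs" for k
  proof -
    obtain u y where u: "u \<in> set (drop (Suc k) Gs)" "y \<in> Y" "Gs ! k \<subseteq> y" "u \<subseteq> y"
      using late[OF k] by (auto simp: shareY_def)
    have "u \<notin> set (take (Suc k) Gs)"
      using u(1) Gs(1) by (metis disjoint_iff append_take_drop_id distinct_append)
    then have uD: "u \<notin> insert (Gs ! k) (D k)" "u \<in> X"
      using u(1) Gs(2) DSuc[of k] k in_set_dropD[OF u(1)] by (auto simp: D_def)
    have "y \<notin> Ed (D k)"
    proof
      assume "y \<in> Ed (D k)"
      then obtain v where v: "v \<in> D k" "v \<subseteq> y" by (auto simp: Ed_def)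
      have "v ~= Gs ! k" "v ~= u" "Gs ! k ~= u" using v(1) uD(1) new(2)[of k] k by auto
      then have "card {v, Gs ! k, u} = 3" by simp
      moreover have "card {v, Gs ! k, u} \<le> card {x \<in> X. x \<subseteq> y}"
        by (rule card_mono) (use finX v u uD new[of k] k Dsub[of k] in auto)
      ultimately show False using edge_X[OF u(2)] by simp
    qed
    moreover have "y \<in> Ed {Gs ! k}" using u by (auto simp: Ed_def)
    ultimately show ?thesis by blast
  qed
  have X2: "2 \<le> card X"
  proof -
    obtain a b where "a \<in> set B" "b \<in> X - set B" using B(2) BX by (cases B) auto
    then have "a ~= b" "{a, b} \<subseteq> X" using BX by auto
    then show ?thesis using card_mono[OF finX, of "{a, b}"] by simp
  qed
  have "Gs ~= []" using Gs(2) BX by auto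
  define m where "m = length Gs - 1"
  have m: "length Gs = Suc m" using \<open>Gs ~= []\<close> by (simp add: m_def)
  have step: "chi (D (Suc k)) \<le> chi (D k)" if "k < m" for k
    using chi_insert_le[OF Dfin new(1) new(2) _ touch proper, of k] pol new(1)[of k] DSuc[of k] that m by simp
  have last: "Ed {Gs ! m} \<subseteq> Ed (D m)"
  proof -
    have "X - {Gs ! m} \<subseteq> D m" using DX DSuc[of m] m by auto
    then have "Ed (X - {Gs ! m}) \<subseteq> Ed (D m)" unfolding Ed_def by blast
    then show ?thesis using Ed_rest[OF new(1)[of m]] m by auto
  qed
  \<comment> \<open>The value before the last cell is computed backwards from the value 2 of the
    sphere.\<close>
  have "chi (D (Suc m)) = chi (D m) + 1"
    using chi_insert_whole[OF Dfin new(1) new(2) last] DSuc[of m] m by simp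
  then have chim: "chi (D m) = 1" using chi_X[OF X2] DX m by simp
  have chi0: "chi (D 0) = 1" using chi_partial[OF B False] D0 by simp
  have le: "chi (D j) \<le> chi (D i)" if "i \<le> j" "j \<le> m" for i j
    using that
  proof (induction j rule: dec_induct)
    case (step n)
    then show ?case using \<open>\<And>k. k < m ==> chi (D (Suc k)) \<le> chi (D k)\<close>[of n] by linarith
  qed simp
  have chi1: "chi (D k) = 1" if "k \<le> m" for k
    using le[of 0 k] le[of k m] chi0 chim that by simp
  have arcs: "arc (D k) (Gs ! k)" if k: "k < length Gs" for k
  proof (cases "k = m")
    case True
    have "Ed (D k) \<inter> Ed {Gs ! k} = Ed {Gs ! k}" using last True by blast
    moreover have "Pt {Gs ! k} \<subseteq> Pe (Ed {Gs ! k})"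
    proof
      fix z assume z: "z \<in> Pt {Gs ! k}"
      then have "card {y \<in> Ed {Gs ! k}. y \<subseteq> z} = 2" using deg_full[OF new(1)[OF k]] by blast
      then have "{y \<in> Ed {Gs ! k}. y \<subseteq> z} ~= {}" by (metis card.empty zero_neq_numeral)
      then show "z \<in> Pe (Ed {Gs ! k})" using z by (auto simp: Pe_def Pt_def)
    qed
    ultimately show ?thesis
      using touch[OF k] pol[OF new(1)[OF k]] by (auto simp: arc_def polygonal_def)
  next
    case False
    then have km: "k < m" using k m by simp
    define I where "I = Ed (D k) \<inter> Ed {Gs ! k}"
    have I: "I ~= {}" "I ~= Ed {Gs ! k}" "I \<subseteq> Ed {Gs ! k}"
      using touch[OF k] proper[of k] km m by (auto simp: I_def)
    note x = new(1)[OF k] pol[OF new(1)[OF k]]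
    have "chi (D (Suc k)) = chi (D k) + 1 + int (card I) - int (card (Pt (D k) \<inter> Pt {Gs ! k}))"
      using chi_insert[OF Dfin new(1)[OF k] new(2)[OF k]] DSuc[OF k] by (simp add: I_def)
    then have cP: "card (Pt (D k) \<inter> Pt {Gs ! k}) = card I + 1"
      using chi1[of k] chi1[of "Suc k"] km by simp
    have sub: "Pe I \<subseteq> Pt (D k) \<inter> Pt {Gs ! k}" unfolding I_def by (rule Pe_Ed_sub)
    have ge: "card I + 1 \<le> card (Pe I)" by (rule card_Pe_ge[OF x I(3,1,2)])
    have eq: "Pe I = Pt (D k) \<inter> Pt {Gs ! k}"
      by (rule card_seteq[OF _ sub]) (use ge cP in auto)
    have "\<exists>Is. chained shareZ Is \<and> distinct Is \<and> set Is = I"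
      by (rule chain_of_card[OF x I(3,1,2)]) (use eq cP in auto)
    then show ?thesis using I eq unfolding arc_def I_def by simp
  qed
  have "pshell (B @ take k Gs)" if "k \<le> length Gs" for k
    using that
  proof (induction k)
    case 0
    then show ?case using B by simp
  next
    case (Suc k)
    have "B @ take (Suc k) Gs = (B @ take k Gs) @ [Gs ! k]"
      using Suc.prems by (simp add: take_Suc_conv_app_nth)
    then show ?case
      using pshell_snoc[of "B @ take k Gs" "Gs ! k"] Suc new[of k] arcs[of k] by (simp add: D_def)
  qed
  from this[of "length Gs"] show ?thesis using Gs BX by (intro exI[of _ Gs]) auto
qed

end

text \<open>The covering relation of the order on \<open>L\<close>. In the dual, the covers of
  \<open>F\<close> are the facets of the dual of \<open>F\<close>.\<close>

definition cov :: "'a set set \<Rightarrow> 'a set \<Rightarrow> 'a set set" where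
  "cov L F = {G \<in> L. F \<subset> G \<and> (\<forall>H\<in>L. F \<subset> H \<and> H \<subseteq> G --> H = G)}"

subsection \<open>Shellings of the polar\<close>

text \<open>A shelling of the polar of a polytope, expressed in the lattice \<open>L\<close> of proper faces of the
  polytope itself: \<open>dshell L F Gs\<close> says that the duals of \<open>Gs\<close> form a shelling of the dual of \<open>F\<close>.\<close>

inductive dshell :: "'a set set \<Rightarrow> 'a set \<Rightarrow> 'a set list \<Rightarrow> bool" for L where
  points: "[|distinct Gs; set Gs = cov L F; \<forall>G\<in>set Gs. cov L G = {}|] ==> dshell L F Gs"
| step: "[|distinct Gs; set Gs = cov L F; Gs ~= []; dshell L (hd Gs) Hs;
     \<forall>j. 0 < j \<and> j < length Gs -->
       (\<exists>Ks r. dshell L (Gs ! j) Ks \<and> 1 \<le> r \<and> r \<le> length Ks \<and>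
          (\<forall>X\<in>L. Gs ! j \<subseteq> X --> ((\<exists>i<j. Gs ! i \<subseteq> X) \<longleftrightarrow> (\<exists>k<r. Ks ! k \<subseteq> X))))|]
   ==> dshell L F Gs"

lemma dshell_set: "dshell L F Gs ==> set Gs = cov L F"
  by (auto elim: dshell.cases)

lemma dshell_distinct: "dshell L F Gs ==> distinct Gs"
  by (auto elim: dshell.cases)

lemma cov_sub: "G \<in> cov L F ==> G \<in> L \<and> F \<subseteq> G"
  by (auto simp: cov_def)

text \<open>A \<open>dshell\<close> of a face above \<open>F0\<close> involves only faces above
  \<open>F0\<close>, so an isomorphism between two upper intervals is enough. Vertex figures,
  truncations and affine copies are compared in this way.\<close>

lemma dshell_iso:
  assumes bij: "bij_betw f {G \<in> L. F0 \<subseteq> G} {G \<in> L'. F0' \<subseteq> G}"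
    and iso: "\<And>G H. G \<in> L ==> F0 \<subseteq> G ==> H \<in> L ==> F0 \<subseteq> H ==> f G \<subseteq> f H \<longleftrightarrow> G \<subseteq> H"
    and "dshell L F Gs" "F \<in> L" "F0 \<subseteq> F"
  shows "dshell L' (f F) (map f Gs)"
  using assms(3-5)
proof (induction rule: dshell.induct)
  have fL: "f G \<in> L'" "F0' \<subseteq> f G" if "G \<in> L" "F0 \<subseteq> G" for G
    using bij_betwE[OF bij] that by auto
  have surj: "\<exists>G\<in>L. F0 \<subseteq> G \<and> f G = H" if "H \<in> L'" "F0' \<subseteq> H" for H
  proof -
    have "H \<in> f ` {G \<in> L. F0 \<subseteq> G}" using bij that unfolding bij_betw_def by simp
    then show ?thesis by auto
  qed
  have iso_s: "f G \<subset> f H \<longleftrightarrow> G \<subset> H" if "G \<in> L" "F0 \<subseteq> G" "H \<in> L" "F0 \<subseteq> H" for G H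
    unfolding less_le_not_le using iso[OF that] iso[OF that(3,4,1,2)] by simp
  have covf: "cov L' (f F) = f ` cov L F" if F: "F \<in> L" "F0 \<subseteq> F" for F
  proof
    show "cov L' (f F) \<subseteq> f ` cov L F"
    proof
      fix H assume H: "H \<in> cov L' (f F)"
      then have H1: "H \<in> L'" "f F \<subset> H" and H2: "\<And>K. K \<in> L' ==> f F \<subset> K ==> K \<subseteq> H ==> K = H"
        unfolding cov_def by auto
      have "F0' \<subseteq> H" using H1 fL[OF F] by blast
      then obtain G where G: "G \<in> L" "F0 \<subseteq> G" "f G = H" using surj H1 by blast
      have "F \<subset> G" using iso_s[OF F G(1,2)] H1 G(3) by simp
      moreover have "K = G" if K: "K \<in> L" "F \<subset> K" "K \<subseteq> G" for K
      proof -
        have K0: "F0 \<subseteq> K" using K F by blast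
        have "f K = H"
          by (rule H2) (use fL[OF K(1) K0] iso_s[OF F K(1) K0] iso[OF K(1) K0 G(1,2)] K G in auto)
        then have "f G \<subseteq> f K" using G by simp
        then show ?thesis using iso[OF G(1,2) K(1) K0] K by blast
      qed
      ultimately have "G \<in> cov L F" using G(1) unfolding cov_def by simp
      then show "H \<in> f ` cov L F" using G by blast
    qed
    show "f ` cov L F \<subseteq> cov L' (f F)"
    proof
      fix H assume "H \<in> f ` cov L F"
      then obtain G where G: "G \<in> L" "F \<subset> G" "H = f G"
        and Gm: "\<And>K. K \<in> L ==> F \<subset> K ==> K \<subseteq> G ==> K = G"
        unfolding cov_def by auto
      have G0: "F0 \<subseteq> G" using G F by blast
      have "K = H" if K: "K \<in> L'" "f F \<subset> K" "K \<subseteq> H" for K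
      proof -
        have "F0' \<subseteq> K" using K fL[OF F] by blast
        then obtain M where M: "M \<in> L" "F0 \<subseteq> M" "f M = K" using surj K by blast
        have "M = G" by (rule Gm) (use M iso_s[OF F M(1,2)] iso[OF M(1,2) G(1) G0] K G in auto)
        then show ?thesis using M G by simp
      qed
      then show "H \<in> cov L' (f F)"
        using G fL[OF G(1) G0] iso_s[OF F G(1) G0] unfolding cov_def by simp
    qed
  qed
  have inj: "inj_on f {G \<in> L. F0 \<subseteq> G}" using bij by (simp add: bij_betw_def)
  have dist: "distinct (map f Gs)" if "distinct Gs" "set Gs = cov L F" "F \<in> L" "F0 \<subseteq> F" for Gs F
  proof -
    have "set Gs \<subseteq> {G \<in> L. F0 \<subseteq> G}" using that cov_sub by blast
    then show ?thesis using that(1) inj by (simp add: distinct_map inj_on_subset)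
  qed
  {
    case (points Gs F)
    have "cov L' (f G) = {}" if G: "G \<in> set Gs" for G
    proof -
      have "G \<in> L" "F0 \<subseteq> G" using G points.hyps(2) points.prems cov_sub[of G L F] by auto
      then show ?thesis using covf[of G] points.hyps(3) G by simp
    qed
    then show ?case
      using points.hyps dist[OF points.hyps(1,2) points.prems] covf[OF points.prems]
      by (intro dshell.points) simp_all
  }
  {
    case (step Gs F Hs)
    have GL: "G \<in> L" "F0 \<subseteq> G" if "G \<in> set Gs" for G
      using that step.hyps(2) cov_sub[of G L F] step.prems by auto
    show ?case
    proof (rule dshell.step)
      show "distinct (map f Gs)" by (rule dist[OF step.hyps(1,2) step.prems])
      show "set (map f Gs) = cov L' (f F)" using covf step by simp
      show "map f Gs ~= []" using step by simp
      have "dshell L' (f (hd Gs)) (map f Hs)"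
        using step.IH(1) GL[OF hd_in_set[OF step.hyps(3)]] by blast
      then show "dshell L' (hd (map f Gs)) (map f Hs)" using step.hyps(3) by (simp add: hd_map)
      show "\<forall>j. 0 < j \<and> j < length (map f Gs) -->
        (\<exists>Ks r. dshell L' (map f Gs ! j) Ks \<and> 1 \<le> r \<and> r \<le> length Ks \<and>
          (\<forall>X\<in>L'. map f Gs ! j \<subseteq> X --> ((\<exists>i<j. map f Gs ! i \<subseteq> X) \<longleftrightarrow> (\<exists>k<r. Ks ! k \<subseteq> X))))"
      proof (intro allI impI)
        fix j assume j: "0 < j \<and> j < length (map f Gs)"
        then have "\<exists>Ks r. (dshell L (Gs ! j) Ks \<and>
              (Gs ! j \<in> L --> F0 \<subseteq> Gs ! j --> dshell L' (f (Gs ! j)) (map f Ks))) \<and>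
            1 \<le> r \<and> r \<le> length Ks \<and>
            (\<forall>X\<in>L. Gs ! j \<subseteq> X --> ((\<exists>i<j. Gs ! i \<subseteq> X) \<longleftrightarrow> (\<exists>k<r. Ks ! k \<subseteq> X)))"
          using step.IH(2) by simp
        then obtain Ks r where K: "dshell L (Gs ! j) Ks"
          and IH: "Gs ! j \<in> L --> F0 \<subseteq> Gs ! j --> dshell L' (f (Gs ! j)) (map f Ks)"
          and r: "1 \<le> r" "r \<le> length Ks"
          and eq: "\<forall>X\<in>L. Gs ! j \<subseteq> X --> ((\<exists>i<j. Gs ! i \<subseteq> X) \<longleftrightarrow> (\<exists>k<r. Ks ! k \<subseteq> X))"
          by (elim exE conjE) (rule that)
        have Gj: "Gs ! j \<in> L" "F0 \<subseteq> Gs ! j" using GL j by auto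
        have KL: "Ks ! k \<in> L" "F0 \<subseteq> Ks ! k" if "k < length Ks" for k
        proof -
          have "Ks ! k \<in> cov L (Gs ! j)" using that dshell_set[OF K] nth_mem by blast
          then show "Ks ! k \<in> L" "F0 \<subseteq> Ks ! k" using cov_sub[of "Ks ! k" L "Gs ! j"] Gj by auto
        qed
        show "\<exists>Ks r. dshell L' (map f Gs ! j) Ks \<and> 1 \<le> r \<and> r \<le> length Ks \<and>
          (\<forall>X\<in>L'. map f Gs ! j \<subseteq> X --> ((\<exists>i<j. map f Gs ! i \<subseteq> X) \<longleftrightarrow> (\<exists>k<r. Ks ! k \<subseteq> X)))"
        proof (intro exI[of _ "map f Ks"] exI[of _ r] conjI ballI impI)
          show "dshell L' (map f Gs ! j) (map f Ks)" using IH Gj j by simp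
          show "1 \<le> r" "r \<le> length (map f Ks)" using r by auto
          fix X assume X: "X \<in> L'" "map f Gs ! j \<subseteq> X"
          then have "f (Gs ! j) \<subseteq> X" using j by simp
          then have "F0' \<subseteq> X" using fL[OF Gj] by blast
          then obtain Y where Y: "Y \<in> L" "F0 \<subseteq> Y" "f Y = X" using surj X by blast
          have "Gs ! j \<subseteq> Y" using iso[OF Gj Y(1,2)] Y \<open>f (Gs ! j) \<subseteq> X\<close> by simp
          then have e: "(\<exists>i<j. Gs ! i \<subseteq> Y) \<longleftrightarrow> (\<exists>k<r. Ks ! k \<subseteq> Y)" using eq Y by blast
          have m1: "map f Gs ! i \<subseteq> X \<longleftrightarrow> Gs ! i \<subseteq> Y" if "i < j" for i
            using that j iso[OF GL[of "Gs ! i"] Y(1,2)] Y(3) by simp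
          have m2: "map f Ks ! k \<subseteq> X \<longleftrightarrow> Ks ! k \<subseteq> Y" if "k < r" for k
            using that r iso[OF KL[of k] Y(1,2)] Y(3) by simp
          have "(\<exists>i<j. map f Gs ! i \<subseteq> X) \<longleftrightarrow> (\<exists>i<j. Gs ! i \<subseteq> Y)"
            using m1 by (simp cong: conj_cong)
          moreover have "(\<exists>k<r. map f Ks ! k \<subseteq> X) \<longleftrightarrow> (\<exists>k<r. Ks ! k \<subseteq> Y)"
            using m2 by (simp cong: conj_cong)
          ultimately show "(\<exists>i<j. map f Gs ! i \<subseteq> X) \<longleftrightarrow> (\<exists>k<r. map f Ks ! k \<subseteq> X)"
            using e by simp
        qed
      qed
    qed
  }
qed

section \<open>Translating shellings of a polar into the face lattice\<close>

definition pf :: "'a::euclidean_space set \<Rightarrow> 'a set set" where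
  "pf P = {F. F face_of P \<and> F ~= P}"

text \<open>It is the smallest face containing \<open>x\<close>: on its relative boundary,
  \<open>x\<close> would lie in a facet of it, a smaller face still.\<close>

lemma face_rel_interior_exists:
  fixes P :: "'a::euclidean_space set"
  assumes "polyhedron P" "x \<in> P"
  obtains F where "F face_of P" "x \<in> rel_interior F"
proof -
  define A where "A = {F. F face_of P \<and> x \<in> F}"
  have "P \<in> A" using assms polyhedron_imp_convex face_of_refl by (auto simp: A_def)
  then have F: "\<Inter>A face_of P" by (intro face_of_Inter) (auto simp: A_def)
  have xF: "x \<in> \<Inter>A" by (auto simp: A_def)
  have "x \<in> rel_interior (\<Inter>A)"
  proof (rule ccontr)
    assume "x \<notin> rel_interior (\<Inter>A)"
    then have "x \<in> \<Union>{G. G facet_of \<Inter>A}"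
      using rel_boundary_of_polyhedron[OF face_of_polyhedron_polyhedron[OF assms(1) F]] xF by blast
    then obtain G where G: "G facet_of \<Inter>A" "x \<in> G" by blast
    then have "G \<in> A" using face_of_trans[OF facet_of_imp_face_of F] by (simp add: A_def)
    then have "G = \<Inter>A" using facet_of_imp_subset[OF G(1)] by (intro antisym Inter_lower)
    then show False using G by simp
  qed
  then show thesis using that F by blast
qed

lemma set_take_nth: "r \<le> length xs ==> set (take r xs) = (\<lambda>k. xs ! k) ` {..<r}"
  by (simp add: nth_image[symmetric] atLeast0LessThan)

locale polar_pair =
  fixes P :: "'a::euclidean_space set" and Q :: "'b::euclidean_space set" and \<phi>
  assumes polP: "polytope P" and neP: "P ~= {}" and pol: "combinatorial_polar P Q \<phi>"
begin

lemma bij: "bij_betw \<phi> {F. F face_of P} {G. G face_of Q}"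
  and polQ: "polytope Q"
  and anti: "\<And>F F'. F face_of P ==> F' face_of P ==> F \<subseteq> F' \<longleftrightarrow> \<phi> F' \<subseteq> \<phi> F"
  using pol by (auto simp: combinatorial_polar_def)

lemma P_face: "P face_of P" using polP polytope_imp_convex face_of_refl by blast

lemma phi_face: "F face_of P ==> \<phi> F face_of Q"
  using bij_betwE[OF bij] by auto

lemma phi_surj: "G face_of Q ==> \<exists>F. F face_of P \<and> \<phi> F = G"
proof -
  assume "G face_of Q"
  then have "G \<in> \<phi> ` {F. F face_of P}" using bij unfolding bij_betw_def by simp
  then show ?thesis by auto
qed

lemma phi_eq: "F face_of P ==> F' face_of P ==> \<phi> F = \<phi> F' \<longleftrightarrow> F = F'"
  using anti by (metis order_antisym order_refl)

text \<open>\<open>P\<close> is dual to the empty face of \<open>Q\<close>, which is no cell of a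
  shelling. For this reason \<open>pf\<close> omits \<open>P\<close> but keeps the empty face, the
  dual of \<open>Q\<close>.\<close>

lemma phi_P: "\<phi> P = {}"
proof -
  obtain F where "F face_of P" "\<phi> F = {}" using phi_surj[OF empty_face_of] by blast
  then show ?thesis using anti[OF _ P_face, of F] face_of_imp_subset by blast
qed

lemma phi_empty: "\<phi> {} = Q"
proof -
  have "Q face_of Q" using polQ polytope_imp_convex face_of_refl by blast
  then obtain F where "F face_of P" "\<phi> F = Q" using phi_surj by blast
  then have "Q \<subseteq> \<phi> {}" using anti[of "{}" F] by simp
  then show ?thesis using phi_face[OF empty_face_of] face_of_imp_subset by blast
qed

lemma phi_nonempty: "F \<in> pf P ==> \<phi> F ~= {}"
  using phi_P phi_eq[OF _ P_face] by (auto simp: pf_def)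

lemma phi_sub_face: "F face_of P ==> H face_of P ==> F \<subseteq> H ==> \<phi> H face_of \<phi> F"
  using anti phi_face by (meson face_of_face)

text \<open>\<open>\<phi>\<close> is not known to respect dimensions, so facets are recognised by
  the order alone: nothing fits strictly between a facet and the polytope, and every proper nonempty
  face lies in a facet.\<close>

lemma facets_phi:
  assumes "F \<in> pf P"
  shows "{G. G facet_of \<phi> F} = \<phi> ` cov (pf P) F"
proof
  have F: "F face_of P" using assms by (simp add: pf_def)
  have polF: "polytope (\<phi> F)" using face_of_polytope_polytope[OF polQ phi_face[OF F]] .
  note cvF = polytope_imp_convex[OF polF]
  show "{G. G facet_of \<phi> F} \<subseteq> \<phi> ` cov (pf P) F"
  proof
    fix G assume "G \<in> {G. G facet_of \<phi> F}"
    then have G: "G face_of \<phi> F" "G ~= {}" "aff_dim G = aff_dim (\<phi> F) - 1" by (auto simp: facet_of_def)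
    then have "G face_of Q" using face_of_trans[OF G(1) phi_face[OF F]] by blast
    then obtain H where H: "H face_of P" "\<phi> H = G" using phi_surj by blast
    have FH: "F \<subseteq> H" using anti[OF F H(1)] H face_of_imp_subset[OF G(1)] by simp
    have "F ~= H" using H G by auto
    have HL: "H \<in> pf P" using H G phi_P by (auto simp: pf_def)
    have "K = H" if K: "K \<in> pf P" "F \<subset> K" "K \<subseteq> H" for K
    proof (rule ccontr)
      assume ne: "K ~= H"
      have Kf: "K face_of P" using K by (simp add: pf_def)
      have k1: "\<phi> K face_of \<phi> F" "\<phi> K ~= \<phi> F" using phi_sub_face[OF F Kf] phi_eq[OF F Kf] K by auto
      have k2: "\<phi> H face_of \<phi> K" "\<phi> H ~= \<phi> K" using phi_sub_face[OF Kf H(1)] phi_eq[OF H(1) Kf] K ne by auto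
      have "aff_dim (\<phi> K) < aff_dim (\<phi> F)" by (rule face_of_aff_dim_lt[OF cvF k1])
      moreover have "aff_dim (\<phi> H) < aff_dim (\<phi> K)"
        by (rule face_of_aff_dim_lt[OF face_of_imp_convex[OF k1(1)] k2])
      ultimately show False using G H by simp
    qed
    then show "G \<in> \<phi> ` cov (pf P) F" using H HL FH \<open>F ~= H\<close> unfolding cov_def by blast
  qed
  show "\<phi> ` cov (pf P) F \<subseteq> {G. G facet_of \<phi> F}"
  proof
    fix G assume "G \<in> \<phi> ` cov (pf P) F"
    then obtain H where H: "G = \<phi> H" "H \<in> pf P" "F \<subset> H"
      and min: "\<And>K. K \<in> pf P ==> F \<subset> K ==> K \<subseteq> H ==> K = H"
      unfolding cov_def by auto
    have Hf: "H face_of P" using H by (simp add: pf_def)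
    have "\<phi> H face_of \<phi> F" "\<phi> H ~= \<phi> F" "\<phi> H ~= {}"
      using phi_sub_face[OF F Hf] phi_eq[OF Hf F] H phi_nonempty by auto
    then obtain G0 where G0: "G0 facet_of \<phi> F" "\<phi> H \<subseteq> G0"
      using face_of_polyhedron_subset_facet[OF polytope_imp_polyhedron[OF polF]] by metis
    have "G0 face_of Q" using face_of_trans[OF facet_of_imp_face_of[OF G0(1)] phi_face[OF F]] .
    then obtain K where K: "K face_of P" "\<phi> K = G0" using phi_surj by blast
    have "F \<subseteq> K" using anti[OF F K(1)] K facet_of_imp_subset[OF G0(1)] by simp
    moreover have "F ~= K" using K G0 by auto
    moreover have "K \<subseteq> H" using anti[OF K(1) Hf] K G0 by simp
    moreover have "K \<in> pf P" using K G0 phi_P by (auto simp: pf_def facet_of_def)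
    ultimately have "K = H" using min by blast
    then show "G \<in> {G. G facet_of \<phi> F}" using K G0 H by simp
  qed
qed

lemma phi_point: 
  assumes "F \<in> pf P"
  shows "(\<exists>x. \<phi> F = {x}) \<longleftrightarrow> cov (pf P) F = {}"
proof
  assume "\<exists>x. \<phi> F = {x}"
  then obtain x where x: "\<phi> F = {x}" by blast
  have "\<not> G facet_of {x}" for G
  proof
    assume G: "G facet_of {x}"
    then have "G ~= {}" by (simp add: facet_of_def)
    then have "G = {x}" using facet_of_imp_subset[OF G] by blast
    then show False using G by simp
  qed
  then show "cov (pf P) F = {}" using facets_phi[OF assms] x by auto
next
  assume c: "cov (pf P) F = {}"
  have F: "F face_of P" using assms by (simp add: pf_def)
  have polF: "polytope (\<phi> F)" using face_of_polytope_polytope[OF polQ phi_face[OF F]] .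
  have "\<not> 0 < aff_dim (\<phi> F)"
  proof
    assume "0 < aff_dim (\<phi> F)"
    then obtain G where "G facet_of \<phi> F" using polytope_facet_exists[OF polF] by metis
    then have "G \<in> {G. G facet_of \<phi> F}" by simp
    then show False unfolding facets_phi[OF assms] c by simp
  qed
  moreover have "aff_dim (\<phi> F) ~= -1" using phi_nonempty[OF assms] aff_dim_empty by auto
  ultimately have "aff_dim (\<phi> F) = 0" using aff_dim_geq[of "\<phi> F"] by linarith
  then show "\<exists>x. \<phi> F = {x}" by (simp add: aff_dim_eq_0)
qed

text \<open>A relative interior point of \<open>\<phi> X\<close> lies in exactly those dual faces
  that contain \<open>\<phi> X\<close>. Such test points turn the set equations of
  \<open>shelling\<close> into conditions on the faces \<open>X\<close>.\<close>

lemma phi_rel_interior: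
  assumes "X \<in> pf P"
  shows "\<exists>y. \<forall>F. F face_of P --> (y \<in> \<phi> F \<longleftrightarrow> F \<subseteq> X)"
proof -
  have X: "X face_of P" using assms by (simp add: pf_def)
  have "rel_interior (\<phi> X) ~= {}"
    using rel_interior_eq_empty[of "\<phi> X"] face_of_imp_convex[OF phi_face[OF X]] phi_nonempty[OF assms] by simp
  then obtain y where y: "y \<in> rel_interior (\<phi> X)" by blast
  have yX: "y \<in> \<phi> X" using y rel_interior_subset by blast
  have "y \<in> \<phi> F \<longleftrightarrow> F \<subseteq> X" if F: "F face_of P" for F
  proof
    assume "y \<in> \<phi> F"
    then have "\<phi> X \<subseteq> \<phi> F"
      using subset_of_face_of[OF phi_face[OF F] face_of_imp_subset[OF phi_face[OF X]]] y by blast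
    then show "F \<subseteq> X" using anti[OF F X] by simp
  next
    assume "F \<subseteq> X"
    then show "y \<in> \<phi> F" using anti[OF F X] yX by blast
  qed
  then show ?thesis by blast
qed

definition \<psi> where "\<psi> = inv_into {F. F face_of P} \<phi>"

lemma psi_phi: "F face_of P ==> \<psi> (\<phi> F) = F"
  unfolding \<psi>_def using bij by (simp add: bij_betw_def inv_into_f_f)

text \<open>In \<open>shelling\<close> a cell is merely a set, so the induction carries along the
  face \<open>F\<close> to which it is dual, and \<open>\<psi>\<close> recovers the faces behind the
  facets of the cell.\<close>

lemma shelling_imp_dshell:
  "shelling R Fs ==> F \<in> pf P ==> R = \<phi> F ==> dshell (pf P) F (map \<psi> Fs)"
proof (induction arbitrary: F rule: shelling.induct)
  have covs: "set (map \<psi> Fs) = cov (pf P) F" "distinct (map \<psi> Fs)"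
    "\<And>G. G \<in> set Fs ==> \<psi> G \<in> pf P \<and> \<phi> (\<psi> G) = G \<and> \<psi> G \<in> cov (pf P) F"
    if "distinct Fs" "set Fs = {G. G facet_of \<phi> F}" "F \<in> pf P" for Fs F
  proof -
    have s: "set Fs = \<phi> ` cov (pf P) F" using that facets_phi by simp
    have cf: "G face_of P" if "G \<in> cov (pf P) F" for G using cov_sub[OF that] by (simp add: pf_def)
    show "set (map \<psi> Fs) = cov (pf P) F"
      using s psi_phi cf by (auto simp: image_image image_iff)
    show *: "\<psi> G \<in> pf P \<and> \<phi> (\<psi> G) = G \<and> \<psi> G \<in> cov (pf P) F" if "G \<in> set Fs" for G
      using s psi_phi cf cov_sub that by (metis imageE)
    show "distinct (map \<psi> Fs)"
      using \<open>distinct Fs\<close> * by (simp add: distinct_map inj_on_def) metis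
  qed
  {
    case (points Fs Q' F)
    have s: "set Fs = {G. G facet_of \<phi> F}" using points by simp
    note c = covs[OF points.hyps(1) s points.prems(1)]
    have "cov (pf P) G = {}" if G: "G \<in> set (map \<psi> Fs)" for G
    proof -
      obtain H where H: "H \<in> set Fs" "G = \<psi> H" using G by auto
      then have "G \<in> pf P" "\<phi> G = H" using c(3) by auto
      then show ?thesis using phi_point[of G] points.hyps(3) H by simp
    qed
    then show ?case by (intro dshell.points[OF c(2,1)]) blast
  }
  {
    case (step Fs Q' Hs F)
    have s: "set Fs = {G. G facet_of \<phi> F}" using step.hyps(2) step.prems(2) by simp
    note c = covs[OF step.hyps(1) s step.prems(1)]
    show ?case
    proof (rule dshell.step)
      show "distinct (map \<psi> Fs)" "set (map \<psi> Fs) = cov (pf P) F" using c by auto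
      show "map \<psi> Fs ~= []" using step.hyps(3) by simp
      have "hd Fs \<in> set Fs" using step.hyps(3) by simp
      then show "dshell (pf P) (hd (map \<psi> Fs)) (map \<psi> Hs)"
        using step.IH(1)[of "\<psi> (hd Fs)"] c(3) step.hyps(3) by (simp add: hd_map)
      show "\<forall>j. 0 < j \<and> j < length (map \<psi> Fs) -->
        (\<exists>Ks r. dshell (pf P) (map \<psi> Fs ! j) Ks \<and> 1 \<le> r \<and> r \<le> length Ks \<and>
          (\<forall>X\<in>pf P. map \<psi> Fs ! j \<subseteq> X --> ((\<exists>i<j. map \<psi> Fs ! i \<subseteq> X) \<longleftrightarrow> (\<exists>k<r. Ks ! k \<subseteq> X))))"
      proof (intro allI impI)
        fix j assume j: "0 < j \<and> j < length (map \<psi> Fs)"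
        then have "\<exists>Gs r. (shelling (Fs ! j) Gs \<and>
             (\<forall>F. F \<in> pf P --> Fs ! j = \<phi> F --> dshell (pf P) F (map \<psi> Gs))) \<and>
            1 \<le> r \<and> r \<le> length Gs \<and> Fs ! j \<inter> (\<Union>i<j. Fs ! i) = \<Union> (set (take r Gs))"
          using step.IH(2) by simp
        then obtain Gs r where G: "shelling (Fs ! j) Gs"
          "\<forall>F. F \<in> pf P --> Fs ! j = \<phi> F --> dshell (pf P) F (map \<psi> Gs)"
          "1 \<le> r" "r \<le> length Gs" "Fs ! j \<inter> (\<Union>i<j. Fs ! i) = \<Union> (set (take r Gs))"
          by (elim exE conjE) (rule that)
        have Fi: "\<psi> (Fs ! i) \<in> pf P" "\<phi> (\<psi> (Fs ! i)) = Fs ! i" if "i < length Fs" for i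
          using c(3)[of "Fs ! i"] that by auto
        have d: "dshell (pf P) (\<psi> (Fs ! j)) (map \<psi> Gs)" using G(2) Fi[of j] j by simp
        have Gset: "set Gs = {H. H facet_of \<phi> (\<psi> (Fs ! j))}" "distinct Gs"
          using G(1) Fi[of j] j by (auto elim: shelling.cases)
        note cG = covs(3)[OF Gset(2,1) Fi(1)[of j]]
        show "\<exists>Ks r. dshell (pf P) (map \<psi> Fs ! j) Ks \<and> 1 \<le> r \<and> r \<le> length Ks \<and>
          (\<forall>X\<in>pf P. map \<psi> Fs ! j \<subseteq> X --> ((\<exists>i<j. map \<psi> Fs ! i \<subseteq> X) \<longleftrightarrow> (\<exists>k<r. Ks ! k \<subseteq> X)))"
        proof (intro exI[of _ "map \<psi> Gs"] exI[of _ r] conjI ballI impI)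
          show "dshell (pf P) (map \<psi> Fs ! j) (map \<psi> Gs)" using d j by simp
          show "1 \<le> r" "r \<le> length (map \<psi> Gs)" using G by auto
          fix X assume X: "X \<in> pf P" "map \<psi> Fs ! j \<subseteq> X"
          obtain y where y: "\<forall>F. F face_of P --> (y \<in> \<phi> F \<longleftrightarrow> F \<subseteq> X)"
            using phi_rel_interior[OF X(1)] ..
          have yF: "y \<in> Fs ! i \<longleftrightarrow> map \<psi> Fs ! i \<subseteq> X" if "i < length Fs" for i
            using y[rule_format, of "\<psi> (Fs ! i)"] Fi[OF that] that by (simp add: pf_def)
          have yG: "y \<in> Gs ! k \<longleftrightarrow> map \<psi> Gs ! k \<subseteq> X" if "k < length Gs" for k
            using y[rule_format, of "\<psi> (Gs ! k)"] cG[of "Gs ! k"] that j by (simp add: pf_def)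
          have yF': "y \<in> Fs ! i \<longleftrightarrow> map \<psi> Fs ! i \<subseteq> X" if "i < j" for i
            using yF[of i] that j by simp
          have yG': "y \<in> Gs ! k \<longleftrightarrow> map \<psi> Gs ! k \<subseteq> X" if "k < r" for k
            using yG[of k] that G(4) by simp
          have "(\<exists>i<j. map \<psi> Fs ! i \<subseteq> X) \<longleftrightarrow> (\<exists>i<j. y \<in> Fs ! i)"
            using yF' by blast
          also have "\<dots> \<longleftrightarrow> y \<in> Fs ! j \<inter> (\<Union>i<j. Fs ! i)"
          proof -
            have "y \<in> Fs ! j" using yF[of j] X(2) j by simp
            then show ?thesis by blast
          qed
          also have "\<dots> \<longleftrightarrow> y \<in> \<Union> (set (take r Gs))" using G(5) by simp
          also have "\<dots> \<longleftrightarrow> (\<exists>k<r. y \<in> Gs ! k)"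
            unfolding set_take_nth[OF G(4)] by blast
          also have "\<dots> \<longleftrightarrow> (\<exists>k<r. map \<psi> Gs ! k \<subseteq> X)"
            using yG' by blast
          finally show "(\<exists>i<j. map \<psi> Fs ! i \<subseteq> X) \<longleftrightarrow> (\<exists>k<r. map \<psi> Gs ! k \<subseteq> X)" .
        qed
      qed
    qed
  }
qed

text \<open>For the set equations each point \<open>y\<close> of \<open>Q\<close> needs a face
  \<open>X\<close> that records the dual faces through \<open>y\<close>. It is the one whose dual
  has \<open>y\<close> in its relative interior.\<close>

lemma dshell_imp_shelling:
  "dshell (pf P) F Gs ==> F \<in> pf P ==> shelling (\<phi> F) (map \<phi> Gs)"
proof (induction rule: dshell.induct)
  have dist: "distinct (map \<phi> Gs)" if "distinct Gs" "set Gs = cov (pf P) F" for Gs F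
  proof -
    have "G face_of P" if "G \<in> set Gs" for G
      using cov_sub[of G "pf P" F] that \<open>set Gs = cov (pf P) F\<close> by (simp add: pf_def)
    then show ?thesis using \<open>distinct Gs\<close> phi_eq by (simp add: distinct_map inj_on_def)
  qed
  {
    case (points Gs F)
    have "\<exists>x. G = {x}" if G: "G \<in> set (map \<phi> Gs)" for G
    proof -
      obtain H where H: "H \<in> set Gs" "G = \<phi> H" using G by auto
      then have "H \<in> pf P" using points.hyps(2) cov_sub[of H "pf P" F] by simp
      then show ?thesis using phi_point[of H] points.hyps(3) H by simp
    qed
    moreover have "set (map \<phi> Gs) = {G. G facet_of \<phi> F}"
      using facets_phi[OF points.prems] points.hyps(2) by simp
    ultimately show ?case by (intro shelling.points[OF dist[OF points.hyps(1,2)]]) blast+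
  }
  {
    case (step Gs F Hs)
    have GL: "G \<in> pf P" if "G \<in> set Gs" for G
      using that step.hyps(2) cov_sub[of G "pf P" F] by auto
    show ?case
    proof (rule shelling.step)
      show "distinct (map \<phi> Gs)" by (rule dist[OF step.hyps(1,2)])
      show "set (map \<phi> Gs) = {G. G facet_of \<phi> F}" using facets_phi step by simp
      show "map \<phi> Gs ~= []" using step by simp
      show "shelling (hd (map \<phi> Gs)) (map \<phi> Hs)"
        using step.IH(1) GL[OF hd_in_set[OF step.hyps(3)]] step.hyps(3) by (simp add: hd_map)
      show "\<forall>j. 0 < j \<and> j < length (map \<phi> Gs) -->
         map \<phi> Gs ! j \<inter> (\<Union>i<j. map \<phi> Gs ! i) ~= {} \<and>
         (\<exists>Ks r. shelling (map \<phi> Gs ! j) Ks \<and> 1 \<le> r \<and> r \<le> length Ks \<and>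
                 map \<phi> Gs ! j \<inter> (\<Union>i<j. map \<phi> Gs ! i) = \<Union> (set (take r Ks)))"
      proof (intro allI impI)
        fix j assume j: "0 < j \<and> j < length (map \<phi> Gs)"
        then have "\<exists>Ks r. (dshell (pf P) (Gs ! j) Ks \<and>
             (Gs ! j \<in> pf P --> shelling (\<phi> (Gs ! j)) (map \<phi> Ks))) \<and>
            1 \<le> r \<and> r \<le> length Ks \<and>
            (\<forall>X\<in>pf P. Gs ! j \<subseteq> X --> ((\<exists>i<j. Gs ! i \<subseteq> X) \<longleftrightarrow> (\<exists>k<r. Ks ! k \<subseteq> X)))"
          using step.IH(2) by simp
        then obtain Ks r where K: "dshell (pf P) (Gs ! j) Ks"
          and IH: "Gs ! j \<in> pf P --> shelling (\<phi> (Gs ! j)) (map \<phi> Ks)"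
          and r: "1 \<le> r" "r \<le> length Ks"
          and eqs: "\<forall>X\<in>pf P. Gs ! j \<subseteq> X --> ((\<exists>i<j. Gs ! i \<subseteq> X) \<longleftrightarrow> (\<exists>k<r. Ks ! k \<subseteq> X))"
          by (elim exE conjE) (rule that)
        have eq: "(\<exists>i<j. Gs ! i \<subseteq> X) \<longleftrightarrow> (\<exists>k<r. Ks ! k \<subseteq> X)" if "X \<in> pf P" "Gs ! j \<subseteq> X" for X
          using eqs that by blast
        have Gf: "Gs ! i \<in> pf P" "Gs ! i face_of P" if "i < length Gs" for i
          using GL[of "Gs ! i"] that by (auto simp: pf_def)
        have Kf: "Ks ! k \<in> pf P" "Ks ! k face_of P" "Gs ! j \<subseteq> Ks ! k" if "k < length Ks" for k
        proof -
          have "Ks ! k \<in> cov (pf P) (Gs ! j)" using that dshell_set[OF K] nth_mem by blast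
          then show "Ks ! k \<in> pf P" "Ks ! k face_of P" "Gs ! j \<subseteq> Ks ! k"
            using cov_sub[of "Ks ! k" "pf P" "Gs ! j"] by (auto simp: pf_def)
        qed
        have shape: "\<exists>X\<in>pf P. \<forall>F. F face_of P --> (y \<in> \<phi> F \<longleftrightarrow> F \<subseteq> X)" if y: "y \<in> Q" for y
        proof -
          obtain Y where Y: "Y face_of Q" "y \<in> rel_interior Y"
            using face_rel_interior_exists[OF polytope_imp_polyhedron[OF polQ] y] by blast
          obtain X where X: "X face_of P" "\<phi> X = Y" using phi_surj[OF Y(1)] by blast
          have "X ~= P" using X Y phi_P by auto
          moreover have "y \<in> \<phi> F \<longleftrightarrow> F \<subseteq> X" if F: "F face_of P" for F
          proof
            assume "y \<in> \<phi> F"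
            then have "Y \<subseteq> \<phi> F"
              using subset_of_face_of[OF phi_face[OF F] face_of_imp_subset[OF Y(1)]] Y by blast
            then show "F \<subseteq> X" using anti[OF F X(1)] X by simp
          next
            assume "F \<subseteq> X"
            then show "y \<in> \<phi> F" using anti[OF F X(1)] X Y rel_interior_subset by blast
          qed
          ultimately show ?thesis using X by (auto simp: pf_def)
        qed
        have un: "\<phi> (Gs ! j) \<inter> (\<Union>i<j. \<phi> (Gs ! i)) = (\<Union>k<r. \<phi> (Ks ! k))"
        proof (intro set_eqI)
          fix y
          show "y \<in> \<phi> (Gs ! j) \<inter> (\<Union>i<j. \<phi> (Gs ! i)) \<longleftrightarrow> y \<in> (\<Union>k<r. \<phi> (Ks ! k))"
          proof (cases "y \<in> Q")
            case True
            from shape[OF this] obtain X where X: "X \<in> pf P"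
              and X': "\<forall>F. F face_of P --> (y \<in> \<phi> F \<longleftrightarrow> F \<subseteq> X)" ..
            note X = X X'[rule_format]
            have a: "y \<in> \<phi> (Gs ! i) \<longleftrightarrow> Gs ! i \<subseteq> X" if "i \<le> j" for i
              using X(2)[OF Gf(2)[of i]] that j by simp
            have b: "y \<in> \<phi> (Ks ! k) \<longleftrightarrow> Ks ! k \<subseteq> X" if "k < r" for k
              using X(2)[OF Kf(2)[of k]] that r by simp
            have m1: "y \<in> (\<Union>i<j. \<phi> (Gs ! i)) \<longleftrightarrow> (\<exists>i<j. Gs ! i \<subseteq> X)" using a by force
            have m2: "y \<in> (\<Union>k<r. \<phi> (Ks ! k)) \<longleftrightarrow> (\<exists>k<r. Ks ! k \<subseteq> X)" using b by force
            have c: "Gs ! j \<subseteq> X" if "k < r" "Ks ! k \<subseteq> X" for k using that Kf(3)[of k] r by auto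
            show ?thesis
            proof (cases "Gs ! j \<subseteq> X")
              case True
              then show ?thesis using a[of j] m1 m2 eq[OF X(1) True] by simp
            next
              case False
              then show ?thesis using a[of j] m2 c by auto
            qed
          next
            case False
            have "\<phi> (Gs ! j) \<subseteq> Q" using phi_face[OF Gf(2)[of j]] j face_of_imp_subset by auto
            moreover have "\<phi> (Ks ! k) \<subseteq> Q" if "k < r" for k
              using phi_face[OF Kf(2)[of k]] that r face_of_imp_subset by auto
            ultimately show ?thesis using False by auto
          qed
        qed
        have un': "map \<phi> Gs ! j \<inter> (\<Union>i<j. map \<phi> Gs ! i) = \<Union> (set (take r (map \<phi> Ks)))"
        proof -
          have "(\<Union>i<j. map \<phi> Gs ! i) = (\<Union>i<j. \<phi> (Gs ! i))" using j by auto
          moreover have "\<Union> (set (take r (map \<phi> Ks))) = (\<Union>k<r. \<phi> (Ks ! k))"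
            unfolding take_map set_map set_take_nth[OF r(2)] by blast
          ultimately show ?thesis using un j by simp
        qed
        have "0 < length Ks" using r by linarith
        then have "\<phi> (Ks ! 0) ~= {}" using phi_nonempty Kf(1)[of 0] by blast
        then have ne: "(\<Union>k<r. \<phi> (Ks ! k)) ~= {}" using r by auto
        have "map \<phi> Gs ! j \<inter> (\<Union>i<j. map \<phi> Gs ! i) ~= {}"
          using ne un j by auto
        moreover have "shelling (map \<phi> Gs ! j) (map \<phi> Ks)" using IH Gf(1)[of j] j by simp
        ultimately show "map \<phi> Gs ! j \<inter> (\<Union>i<j. map \<phi> Gs ! i) ~= {} \<and>
         (\<exists>Ks r. shelling (map \<phi> Gs ! j) Ks \<and> 1 \<le> r \<and> r \<le> length Ks \<and>
                 map \<phi> Gs ! j \<inter> (\<Union>i<j. map \<phi> Gs ! i) = \<Union> (set (take r Ks)))"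
          using r un' by (intro conjI exI[of _ "map \<phi> Ks"] exI[of _ r]) auto
      qed
    qed
  }
qed

end

section \<open>Metric polars, and the existence of combinatorial polars\<close>

definition polar_data :: "'a::euclidean_space set \<Rightarrow> 'a set \<Rightarrow> 'a set \<Rightarrow> bool" where
  "polar_data S P Q \<longleftrightarrow> subspace S \<and> polytope P \<and> 0 \<in> rel_interior P \<and> affine hull P = S \<and>
     Q = {y \<in> S. \<forall>x\<in>P. x \<bullet> y \<le> 1}"

definition polar_face :: "'a::euclidean_space set \<Rightarrow> 'a set \<Rightarrow> 'a set" where
  "polar_face Q F = {y \<in> Q. \<forall>x\<in>F. x \<bullet> y = 1}"

text \<open>Polars are formed inside the subspace \<open>S\<close>, which keeps them bounded for
  polytopes that are not full-dimensional. This lemma replaces a separating vector by one in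
  \<open>S\<close>.\<close>

lemma subspace_proj:
  fixes S :: "'a::euclidean_space set"
  assumes "subspace S"
  obtains y where "y \<in> S" "\<And>w. w \<in> S ==> a \<bullet> w = y \<bullet> w"
proof -
  obtain y z where yz: "y \<in> span S" "\<And>w. w \<in> span S ==> orthogonal z w" "a = y + z"
    using orthogonal_subspace_decomp_exists[of S a] by metis
  have S: "span S = S" using assms by (simp add: span_eq_iff)
  have "a \<bullet> w = y \<bullet> w" if "w \<in> S" for w
    using yz(2)[of w] that S yz(3) by (simp add: orthogonal_def inner_add_left)
  then show thesis using that yz(1) S by blast
qed

text \<open>The bipolar theorem. A hyperplane separating \<open>x\<close> from \<open>P\<close> has
  \<open>b < 0\<close> because 0 lies in \<open>P\<close>, and division by \<open>b\<close> turns
  its normal vector into a point of \<open>Q\<close> that excludes \<open>x\<close>.\<close>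

lemma polar_data_bipolar:
  assumes "polar_data S P Q"
  shows "P = {x \<in> S. \<forall>y\<in>Q. y \<bullet> x \<le> 1}"
proof
  have sub: "subspace S" and pP: "polytope P" and zero: "0 \<in> rel_interior P" and aff: "affine hull P = S"
    and Q: "Q = {y \<in> S. \<forall>x\<in>P. x \<bullet> y \<le> 1}"
    using assms unfolding polar_data_def by blast+
  have PS: "P \<subseteq> S" unfolding aff[symmetric] by (rule hull_subset)
  have 0: "0 \<in> P" by (rule subsetD[OF rel_interior_subset zero])
  show "P \<subseteq> {x \<in> S. \<forall>y\<in>Q. y \<bullet> x \<le> 1}" using PS Q by (auto simp: inner_commute)
  show "{x \<in> S. \<forall>y\<in>Q. y \<bullet> x \<le> 1} \<subseteq> P"
  proof
    fix x assume x: "x \<in> {x \<in> S. \<forall>y\<in>Q. y \<bullet> x \<le> 1}"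
    show "x \<in> P"
    proof (rule ccontr)
      assume "x \<notin> P"
      then obtain a b where ab: "a \<bullet> x < b" "\<forall>p\<in>P. b < a \<bullet> p"
        using separating_hyperplane_closed_point[OF polytope_imp_convex[OF pP] polytope_imp_closed[OF pP], of x] by blast
      have b: "b < 0" using ab(2) 0 by force
      obtain y where y: "y \<in> S" "\<And>w. w \<in> S ==> a \<bullet> w = y \<bullet> w"
        using subspace_proj[OF sub, of a] by blast
      define z where "z = (1 / b) *\<^sub>R y"
      have val: "z \<bullet> w = (a \<bullet> w) / b" if "w \<in> S" for w
        using y(2)[OF that] by (simp add: z_def)
      have "p \<bullet> z \<le> 1" if "p \<in> P" for p
      proof -
        have "p \<bullet> z = (a \<bullet> p) / b" using val[of p] that PS by (auto simp: inner_commute)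
        moreover have "b < a \<bullet> p" using ab(2) that by blast
        ultimately show ?thesis using b by (simp add: divide_le_eq_1_neg)
      qed
      moreover have "z \<in> S" using y(1) sub by (simp add: z_def subspace_scale)
      ultimately have "z \<in> Q" by (simp add: Q)
      moreover have "z \<bullet> x > 1" using val[of x] x ab(1) b by (simp add: less_divide_eq_1_neg)
      ultimately show False using x by force
    qed
  qed
qed

text \<open>A ball inside \<open>P\<close> bounds \<open>Q\<close>, a bound on \<open>P\<close> puts
  a ball into \<open>Q\<close>, and a finite set spanning \<open>P\<close> yields finitely many
  halfspaces for \<open>Q\<close>.\<close>

lemma polar_data_sym:
  assumes "polar_data S P Q"
  shows "polar_data S Q P"
proof -
  have sub: "subspace S" and pP: "polytope P" and zero: "0 \<in> rel_interior P" and aff: "affine hull P = S"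
    and Q: "Q = {y \<in> S. \<forall>x\<in>P. x \<bullet> y \<le> 1}"
    using assms unfolding polar_data_def by blast+
  obtain e where e: "e > 0" "ball 0 e \<inter> S \<subseteq> P"
    using zero aff by (auto simp: mem_rel_interior_ball)
  have "norm y \<le> 2 / e" if y: "y \<in> Q" for y
  proof (cases "y = 0")
    case False
    \<comment> \<open>The point of norm \<open>e / 2\<close> in the direction of \<open>y\<close>.
      It lies in \<open>P\<close>, and its product with \<open>y\<close> yields the bound
      \<open>2 / e\<close>.\<close>
    define x where "x = (e / (2 * norm y)) *\<^sub>R y"
    have "norm x < e" using False e by (simp add: x_def)
    moreover have "x \<in> S" using y sub by (simp add: Q x_def subspace_scale)
    ultimately have "x \<in> P" using e by auto
    then have "x \<bullet> y \<le> 1" using y by (simp add: Q)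
    moreover have "x \<bullet> y = e * norm y / 2"
      using False by (simp add: x_def dot_square_norm power2_eq_square)
    ultimately show ?thesis using e by (simp add: field_simps)
  qed (use e in simp)
  then have bQ: "bounded Q" by (auto simp: bounded_iff)
  obtain V where V: "finite V" "P = convex hull V" using pP by (auto simp: polytope_def)
  have Qeq: "Q = S \<inter> \<Inter>((\<lambda>x. {y. x \<bullet> y \<le> 1}) ` V)"
  proof
    show "Q \<subseteq> S \<inter> \<Inter>((\<lambda>x. {y. x \<bullet> y \<le> 1}) ` V)"
      using V(2) hull_subset[of V convex] by (auto simp: Q)
    show "S \<inter> \<Inter>((\<lambda>x. {y. x \<bullet> y \<le> 1}) ` V) \<subseteq> Q"
    proof
      fix y assume y: "y \<in> S \<inter> \<Inter>((\<lambda>x. {y. x \<bullet> y \<le> 1}) ` V)"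
      have "V \<subseteq> {x. y \<bullet> x \<le> 1}" using y by (auto simp: inner_commute)
      then have "convex hull V \<subseteq> {x. y \<bullet> x \<le> 1}"
        using convex_halfspace_le by (rule hull_minimal)
      then show "y \<in> Q" using y V(2) by (auto simp: Q inner_commute)
    qed
  qed
  have "polyhedron (\<Inter>((\<lambda>x. {y. x \<bullet> y \<le> 1}) ` V))"
    by (rule polyhedron_Inter) (use V polyhedron_halfspace_le in auto)
  moreover have "polyhedron S" using affine_imp_polyhedron[OF subspace_imp_affine[OF sub]] .
  ultimately have "polyhedron Q" unfolding Qeq by (rule polyhedron_Int[rotated])
  then have pQ: "polytope Q" using bQ by (simp add: polytope_eq_bounded_polyhedron)
  have QS: "Q \<subseteq> S" by (auto simp: Q)
  have Q0: "0 \<in> Q" using sub by (simp add: Q subspace_0)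
  obtain B where B: "B > 0" "\<And>x. x \<in> P ==> norm x \<le> B"
    using polytope_imp_bounded[OF pP] by (auto simp: bounded_pos)
  have ballQ: "ball 0 (1 / B) \<inter> S \<subseteq> Q"
  proof
    fix y assume y: "y \<in> ball 0 (1 / B) \<inter> S"
    have "x \<bullet> y \<le> 1" if x: "x \<in> P" for x
    proof -
      have "x \<bullet> y \<le> norm x * norm y" by (rule norm_cauchy_schwarz)
      also have "\<dots> \<le> B * (1 / B)" using B x y by (intro mult_mono) auto
      finally show ?thesis using B by simp
    qed
    then show "y \<in> Q" using y by (simp add: Q)
  qed
  have affQ: "affine hull Q = S"
  proof
    show "affine hull Q \<subseteq> S" using QS subspace_imp_affine[OF sub] by (simp add: hull_minimal)
    have sp: "affine hull Q = span Q" by (rule affine_hull_span_0[OF hull_inc[OF Q0]])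
    show "S \<subseteq> affine hull Q"
    proof
      fix y assume y: "y \<in> S"
      show "y \<in> affine hull Q"
      proof (cases "y = 0")
        case True
        then show ?thesis using hull_inc[OF Q0] by simp
      next
        case False
        define z where "z = (1 / (2 * B * norm y)) *\<^sub>R y"
        have "norm z < 1 / B" using False B by (simp add: z_def field_simps)
        then have "z \<in> Q" using ballQ y sub by (auto simp: z_def subspace_scale)
        then have "(2 * B * norm y) *\<^sub>R z \<in> span Q" by (intro span_scale span_base)
        then show ?thesis using sp False B by (simp add: z_def)
      qed
    qed
  qed
  have "0 \<in> rel_interior Q"
    using Q0 ballQ B affQ by (auto simp: mem_rel_interior_ball intro!: exI[of _ "1 / B"])
  then show ?thesis
    using polar_data_bipolar[OF assms] sub pQ affQ by (simp add: polar_data_def)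
qed

lemma polar_face_is_face:
  assumes "polar_data S P Q" "F \<subseteq> P"
  shows "polar_face Q F face_of Q"
proof (cases "F = {}")
  case True
  have "polytope Q" using polar_data_sym[OF assms(1)] by (simp add: polar_data_def)
  then have "Q face_of Q" by (intro face_of_refl polytope_imp_convex)
  then show ?thesis using True by (simp add: polar_face_def)
next
  case False
  have cQ: "convex Q" using polar_data_sym[OF assms(1)] polytope_imp_convex by (auto simp: polar_data_def)
  have "polar_face Q F = \<Inter>((\<lambda>x. Q \<inter> {y. x \<bullet> y = 1}) ` F)" using False by (auto simp: polar_face_def)
  moreover have "\<Inter>((\<lambda>x. Q \<inter> {y. x \<bullet> y = 1}) ` F) face_of Q"
  proof (rule face_of_Inter)
    fix T assume "T \<in> (\<lambda>x. Q \<inter> {y. x \<bullet> y = 1}) ` F"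
    then obtain x where x: "x \<in> F" "T = Q \<inter> {y. x \<bullet> y = 1}" by blast
    have "x \<bullet> y \<le> 1" if "y \<in> Q" for y using x(1) assms that by (auto simp: polar_data_def)
    then show "T face_of Q" unfolding x(2) using face_of_Int_supporting_hyperplane_le[OF cQ] by blast
  qed (use False in simp)
  ultimately show ?thesis by simp
qed

text \<open>A proper face is exposed by a hyperplane that misses 0 and can therefore be normalised
  to level 1. Its normal vector then belongs to \<open>polar_face Q F\<close> and cuts
  \<open>F\<close> out of \<open>P\<close>.\<close>

lemma polar_face_polar_face:
  assumes pd: "polar_data S P Q" and F: "F face_of P"
  shows "polar_face P (polar_face Q F) = F"
proof
  have sub: "subspace S" and pP: "polytope P" and zero: "0 \<in> rel_interior P" and aff: "affine hull P = S"
    and Q: "Q = {y \<in> S. \<forall>x\<in>P. x \<bullet> y \<le> 1}"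
    using pd unfolding polar_data_def by blast+
  have PS: "P \<subseteq> S" unfolding aff[symmetric] by (rule hull_subset)
  have 0: "0 \<in> P" by (rule subsetD[OF rel_interior_subset zero])
  show "F \<subseteq> polar_face P (polar_face Q F)"
    using face_of_imp_subset[OF F] by (auto simp: polar_face_def inner_commute)
  show "polar_face P (polar_face Q F) \<subseteq> F"
  proof (cases "F = P")
    case True
    then show ?thesis by (auto simp: polar_face_def)
  next
    case FP: False
    obtain a b where ab: "P \<subseteq> {x. a \<bullet> x \<le> b}" "F = P \<inter> {x. a \<bullet> x = b}"
      using exposed_face_of_polyhedron[OF polytope_imp_polyhedron[OF pP], of F] F
      by (auto simp: exposed_face_of_def)
    have "0 \<notin> F" using face_of_disjoint_rel_interior[OF F FP] zero by blast
    then have b: "b > 0" using ab 0 by force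
    obtain y where y: "y \<in> S" "\<And>w. w \<in> S ==> a \<bullet> w = y \<bullet> w"
      using subspace_proj[OF sub, of a] by blast
    define z where "z = (1 / b) *\<^sub>R y"
    have val: "w \<bullet> z = (a \<bullet> w) / b" if "w \<in> S" for w
      using y(2)[OF that] by (simp add: z_def inner_commute)
    have zS: "z \<in> S" using y(1) sub by (simp add: z_def subspace_scale)
    have "z \<in> Q" unfolding Q using zS val PS ab(1) b by (auto simp: subset_iff)
    moreover have "w \<bullet> z = 1" if "w \<in> F" for w
      using that val[of w] PS ab(2) b by auto
    ultimately have zF: "z \<in> polar_face Q F" by (simp add: polar_face_def)
    show ?thesis
    proof
      fix x assume x: "x \<in> polar_face P (polar_face Q F)"
      then have "x \<in> P" "z \<bullet> x = 1" using zF by (auto simp: polar_face_def)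
      then have "a \<bullet> x = b" using val[of x] PS b by (auto simp: inner_commute)
      then show "x \<in> F" using \<open>x \<in> P\<close> ab(2) by simp
    qed
  qed
qed

lemma polar_face_anti: "F \<subseteq> F' ==> polar_face Q F' \<subseteq> polar_face Q F"
  by (auto simp: polar_face_def)

lemma polar_data_combinatorial:
  assumes pd: "polar_data S P Q"
  shows "combinatorial_polar P Q (polar_face Q)"
proof -
  note pd' = polar_data_sym[OF pd]
  have "bij_betw (polar_face Q) {F. F face_of P} {G. G face_of Q}"
  proof (rule bij_betw_byWitness[where f' = "polar_face P"])
    show "\<forall>F\<in>{F. F face_of P}. polar_face P (polar_face Q F) = F"
      using polar_face_polar_face[OF pd] by blast
    show "\<forall>G\<in>{G. G face_of Q}. polar_face Q (polar_face P G) = G"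
      using polar_face_polar_face[OF pd'] by blast
    show "polar_face Q ` {F. F face_of P} \<subseteq> {G. G face_of Q}"
      using polar_face_is_face[OF pd] face_of_imp_subset by blast
    show "polar_face P ` {G. G face_of Q} \<subseteq> {F. F face_of P}"
      using polar_face_is_face[OF pd'] face_of_imp_subset by blast
  qed
  moreover have "F \<subseteq> F' \<longleftrightarrow> polar_face Q F' \<subseteq> polar_face Q F" if "F face_of P" "F' face_of P" for F F'
    using polar_face_anti[of F F' Q] polar_face_anti[of "polar_face Q F'" "polar_face Q F" P]
      polar_face_polar_face[OF pd that(1)] polar_face_polar_face[OF pd that(2)] by blast
  moreover have "polytope Q" using pd' by (simp add: polar_data_def)
  ultimately show ?thesis by (simp add: combinatorial_polar_def)
qed

text \<open>A relative interior point is translated to 0, and the metric polar of the translate is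
  taken.\<close>

lemma combinatorial_polar_exists:
  fixes P :: "'a::euclidean_space set"
  assumes "polytope P" "P ~= {}"
  shows "\<exists>(Q :: 'a set) \<phi>. combinatorial_polar P Q \<phi>"
proof -
  obtain c where c: "c \<in> rel_interior P"
    using rel_interior_eq_empty[of P] polytope_imp_convex[OF assms(1)] assms(2) by blast
  define P0 where "P0 = (+) (- c) ` P"
  have pP0: "polytope P0" unfolding P0_def using assms(1) polytope_translation_eq by blast
  have z: "0 \<in> rel_interior P0"
    unfolding P0_def rel_interior_translation using c by (intro image_eqI[of _ _ c]) auto
  then have "0 \<in> affine hull P0" by (meson hull_inc rel_interior_subset subsetD)
  then have aff: "affine hull P0 = span P0" by (rule affine_hull_span_0)
  define Q where "Q = {y \<in> span P0. \<forall>x\<in>P0. x \<bullet> y \<le> 1}"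
  have "polar_data (span P0) P0 Q" using pP0 z aff by (simp add: polar_data_def Q_def)
  then have cp: "combinatorial_polar P0 Q (polar_face Q)" by (rule polar_data_combinatorial)
  define t where "t F = (+) (- c) ` F" for F :: "'a set"
  have ts: "t F \<subseteq> t F' \<longleftrightarrow> F \<subseteq> F'" for F F'
    unfolding t_def by (rule inj_image_subset_iff) simp
  have inj: "inj t" by (rule injI) (use ts in \<open>simp add: set_eq_subset\<close>)
  have tf: "t F face_of P0 \<longleftrightarrow> F face_of P" for F
    unfolding t_def P0_def by (rule face_of_translation_eq)
  have surj: "\<exists>F. t F = G" for G
  proof
    show "t ((+) c ` G) = G" by (simp add: t_def image_image)
  qed
  have bt: "bij_betw t {F. F face_of P} {F. F face_of P0}"
    unfolding bij_betw_def
  proof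
    show "inj_on t {F. F face_of P}" using inj inj_on_subset by blast
    show "t ` {F. F face_of P} = {F. F face_of P0}"
    proof
      show "t ` {F. F face_of P} \<subseteq> {F. F face_of P0}" using tf by blast
      show "{F. F face_of P0} \<subseteq> t ` {F. F face_of P}"
      proof
        fix G assume "G \<in> {F. F face_of P0}"
        moreover obtain F where "t F = G" using surj by blast
        ultimately show "G \<in> t ` {F. F face_of P}" using tf by auto
      qed
    qed
  qed
  have "combinatorial_polar P Q (polar_face Q \<circ> t)"
    unfolding combinatorial_polar_def
  proof (intro conjI allI impI)
    show "polytope Q" using cp by (simp add: combinatorial_polar_def)
    show "bij_betw (polar_face Q \<circ> t) {F. F face_of P} {G. G face_of Q}"
      by (rule bij_betw_trans[OF bt]) (use cp in \<open>simp add: combinatorial_polar_def\<close>)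
    fix F F' assume "F face_of P \<and> F' face_of P"
    then have "t F \<subseteq> t F' \<longleftrightarrow> polar_face Q (t F') \<subseteq> polar_face Q (t F)"
      using cp tf unfolding combinatorial_polar_def by blast
    then show "F \<subseteq> F' \<longleftrightarrow> (polar_face Q \<circ> t) F' \<subseteq> (polar_face Q \<circ> t) F"
      using ts by simp
  qed
  then show ?thesis by blast
qed

text \<open>The polar-free form of \<open>shelling_property\<close>. It starts at the empty face,
  which is dual to the whole polar and is covered by the vertices.\<close>

definition dshelling_property :: "'a::euclidean_space set \<Rightarrow> ('a \<times> 'a) set \<Rightarrow> bool" where
  "dshelling_property P E \<longleftrightarrow>
     (\<exists>vs. topological_sort P E vs \<and> dshell (pf P) {} (map (\<lambda>v. {v}) vs))"

lemma vertices_face: "v \<in> vertices P \<longleftrightarrow> {v} face_of P"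
  by (simp add: vertices_def face_of_singleton)

lemma shelling_property_iff:
  fixes P :: "'a::euclidean_space set"
  assumes "polytope P" "P ~= {}"
  shows "shelling_property P E \<longleftrightarrow> dshelling_property P E"
proof
  have e: "{} \<in> pf P" using assms(2) by (auto simp: pf_def)
  show "dshelling_property P E" if "shelling_property P E"
  proof -
    obtain Q :: "'a set" and \<phi> vs where Q: "combinatorial_polar P Q \<phi>" "topological_sort P E vs"
      "shelling Q (map (\<lambda>v. \<phi> {v}) vs)"
      using \<open>shelling_property P E\<close> by (auto simp: shelling_property_def)
    interpret polar_pair P Q \<phi> by unfold_locales (use assms Q in auto)
    have m: "map \<psi> (map (\<lambda>v. \<phi> {v}) vs) = map (\<lambda>v. {v}) vs"
      using Q(2) psi_phi by (auto simp: topological_sort_def vertices_face)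
    have "dshell (pf P) {} (map \<psi> (map (\<lambda>v. \<phi> {v}) vs))"
      by (rule shelling_imp_dshell[OF Q(3) e]) (simp add: phi_empty)
    from this[unfolded m] show ?thesis using Q(2) unfolding dshelling_property_def by blast
  qed
  show "shelling_property P E" if "dshelling_property P E"
  proof -
    obtain vs where vs: "topological_sort P E vs" "dshell (pf P) {} (map (\<lambda>v. {v}) vs)"
      using \<open>dshelling_property P E\<close> by (auto simp: dshelling_property_def)
    obtain Q :: "'a set" and \<phi> where Q: "combinatorial_polar P Q \<phi>"
      using combinatorial_polar_exists[OF assms] by blast
    interpret polar_pair P Q \<phi> by unfold_locales (use assms Q in auto)
    have "shelling Q (map \<phi> (map (\<lambda>v. {v}) vs))"
      using dshell_imp_shelling[OF vs(2) e] by (simp add: phi_empty)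
    then have "shelling Q (map (\<lambda>v. \<phi> {v}) vs)" by (simp add: comp_def)
    then show ?thesis using Q vs(1) unfolding shelling_property_def by blast
  qed
qed

subsection \<open>Vertex figures\<close>

lemma polytope_hull_vertices: "polytope P ==> P = convex hull (vertices P)"
  unfolding vertices_def
  by (rule Krein_Milman_Minkowski) (auto simp: polytope_imp_compact polytope_imp_convex)

lemma finite_vertices: "polytope P ==> finite (vertices P)"
  unfolding vertices_def using finite_polyhedron_extreme_points polytope_imp_polyhedron by blast

lemma vertices_sub: "vertices P \<subseteq> P"
  by (auto simp: vertices_def extreme_point_of_def)

lemma vertices_of_face: "F face_of P ==> vertices F = vertices P \<inter> F"
  by (auto simp: vertices_def extreme_point_of_face)

lemma vertices_nonempty: "polytope P ==> P ~= {} ==> vertices P ~= {}"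
  using polytope_hull_vertices[of P] by fastforce

lemma affine_bound_vertices:
  assumes "polytope P" "x \<in> P" "\<And>w. w \<in> vertices P ==> c \<bullet> w \<ge> m"
  shows "c \<bullet> x \<ge> m"
proof -
  have "convex hull (vertices P) \<subseteq> {x. c \<bullet> x \<ge> m}"
    by (rule hull_minimal) (use assms(3) convex_halfspace_ge in auto)
  then show ?thesis using assms(2) polytope_hull_vertices[OF assms(1)] by blast
qed

text \<open>A hyperplane weakly separating the vertex \<open>v\<close> from all other vertices meets exactly the
  faces through \<open>v\<close>, even if it passes through other vertices; its section with \<open>P\<close> is
  combinatorially the vertex figure at \<open>v\<close>.\<close>

locale vertex_section =
  fixes P :: "'a::euclidean_space set" and v a :: 'a and b :: real
  assumes polP: "polytope P" and v: "v \<in> vertices P" and av: "b < a \<bullet> v"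
    and others: "\<And>w. w \<in> vertices P ==> w ~= v ==> a \<bullet> w \<le> b"
begin

definition T where "T = P \<inter> {x. a \<bullet> x = b}"

lemma cvP: "convex P" using polP by (rule polytope_imp_convex)
lemma vP: "v \<in> P" using v vertices_sub by blast

lemma polT: "polytope T"
  unfolding T_def using polytope_Int_polyhedron[OF polP polyhedron_hyperplane] .

lemma T_sub: "T \<subseteq> P" and T_val: "g \<in> T ==> a \<bullet> g = b"
  by (auto simp: T_def)

text \<open>Central projection from \<open>v\<close>: no other vertex lies on the side of
  \<open>v\<close>, so every ray from \<open>v\<close> into \<open>P\<close> crosses the hyperplane
  inside \<open>P\<close>.\<close>

lemma radial:
  assumes "x \<in> P" "x ~= v"
  obtains g s where "g \<in> T" "0 < s" "x = v + s *\<^sub>R (g - v)"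
proof -
  define W where "W = vertices P - {v}"
  have hull: "P = convex hull (insert v W)"
    using polytope_hull_vertices[OF polP] v by (simp add: W_def insert_absorb)
  have "W ~= {}" using hull assms by auto
  then obtain u w where uw: "0 \<le> u" "u \<le> 1" "w \<in> convex hull W" "x = (1 - u) *\<^sub>R v + u *\<^sub>R w"
    using assms(1) hull by (auto simp: convex_hull_insert_alt)
  have "u ~= 0" using uw assms by auto
  then have u: "0 < u" using uw by simp
  have "convex hull W \<subseteq> {x. a \<bullet> x \<le> b}"
    by (rule hull_minimal) (use others convex_halfspace_le in \<open>auto simp: W_def\<close>)
  then have aw: "a \<bullet> w \<le> b" using uw by auto
  define l where "l = (a \<bullet> v - b) / (a \<bullet> v - a \<bullet> w)"
  have l: "0 < l" "l \<le> 1" using av aw by (auto simp: l_def)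
  define g where "g = v + l *\<^sub>R (w - v)"
  have "w \<in> P" using uw(3) hull hull_mono[of W "insert v W" convex] by blast
  then have "g \<in> P"
    using cvP vP l convexD_alt[of P v w l] by (simp add: g_def algebra_simps)
  moreover have "a \<bullet> g = b"
  proof -
    have "l * (a \<bullet> v - a \<bullet> w) = a \<bullet> v - b" using av aw by (simp add: l_def)
    then show ?thesis by (simp add: g_def inner_add_right inner_diff_right algebra_simps)
  qed
  ultimately have "g \<in> T" by (simp add: T_def)
  moreover have "x = v + (u / l) *\<^sub>R (g - v)"
    using l uw(4) by (simp add: g_def algebra_simps)
  moreover have "0 < u / l" using u l by simp
  ultimately show thesis using that by blast
qed

text \<open>For \<open>s < 1\<close> the given point lies between \<open>v\<close> and
  \<open>g\<close>, and the extremality of faces applies. For larger \<open>s\<close> the point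
  \<open>g\<close> lies between \<open>v\<close> and the given one, and convexity applies.\<close>

lemma radial_in:
  assumes "F face_of P" "v \<in> F" "g \<in> P" "0 < s" "v + s *\<^sub>R (g - v) \<in> F"
  shows "g \<in> F"
proof (cases "g = v")
  case True
  then show ?thesis using assms by simp
next
  case False
  define x where "x = v + s *\<^sub>R (g - v)"
  have xF: "x \<in> F" using assms by (simp add: x_def)
  show ?thesis
  proof (cases "s < 1")
    case True
    have "x = (1 - s) *\<^sub>R v + s *\<^sub>R g" by (simp add: x_def algebra_simps)
    then have "x \<in> open_segment v g" using True False assms(4) by (auto simp: in_segment)
    then show ?thesis using face_ofD[OF assms(1) _ vP assms(3) xF] by blast
  next
    case False
    have "g = (1 - 1 / s) *\<^sub>R v + (1 / s) *\<^sub>R x"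
      using assms(4) by (simp add: x_def algebra_simps)
    moreover have "(1 - 1 / s) *\<^sub>R v + (1 / s) *\<^sub>R x \<in> F"
      by (rule convexD_alt[OF face_of_imp_convex[OF assms(1)] assms(2) xF]) (use False assms(4) in auto)
    ultimately show ?thesis by simp
  qed
qed

lemma radial_out:
  assumes "F face_of P" "v \<in> F" "g \<in> F" "0 < s" "v + s *\<^sub>R (g - v) \<in> P"
  shows "v + s *\<^sub>R (g - v) \<in> F"
proof -
  define x where "x = v + s *\<^sub>R (g - v)"
  have "g = v + (1 / s) *\<^sub>R (x - v)" using assms(4) by (simp add: x_def algebra_simps)
  then have "x \<in> F" using radial_in[OF assms(1,2), of x "1 / s"] assms x_def by auto
  then show ?thesis by (simp add: x_def)
qed

lemma section_face: "F face_of P ==> F \<inter> {x. a \<bullet> x = b} face_of T"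
  unfolding T_def by (rule face_of_slice) (auto simp: convex_hyperplane)

lemma section_sub_iff:
  assumes "F face_of P" "v \<in> F" "F' face_of P" "v \<in> F'"
  shows "F \<inter> {x. a \<bullet> x = b} \<subseteq> F' \<inter> {x. a \<bullet> x = b} \<longleftrightarrow> F \<subseteq> F'"
proof
  assume L: "F \<inter> {x. a \<bullet> x = b} \<subseteq> F' \<inter> {x. a \<bullet> x = b}"
  show "F \<subseteq> F'"
  proof
    fix x assume x: "x \<in> F"
    show "x \<in> F'"
    proof (cases "x = v")
      case False
      have xP: "x \<in> P" using x face_of_imp_subset[OF assms(1)] by blast
      obtain g s where g: "g \<in> T" "0 < s" "x = v + s *\<^sub>R (g - v)" using radial[OF xP False] by blast
      have "g \<in> F" using radial_in[OF assms(1,2) _ g(2)] g x T_sub by blast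
      then have "g \<in> F'" using L g(1) T_val by blast
      then show ?thesis using radial_out[OF assms(3,4) _ g(2)] g(3) xP by simp
    qed (use assms in simp)
  qed
qed blast

text \<open>For nonempty \<open>G\<close>, the face wanted is the one that has the midpoint of
  \<open>v\<close> and a relative interior point \<open>x\<close> of \<open>G\<close> in its
  relative interior.\<close>

lemma section_surj:
  assumes G: "G face_of T"
  shows "\<exists>F. F face_of P \<and> v \<in> F \<and> F \<inter> {x. a \<bullet> x = b} = G"
proof (cases "G = {}")
  case True
  have "{v} \<inter> {x. a \<bullet> x = b} = {}" using av by auto
  then show ?thesis using True v by (auto simp: vertices_face intro!: exI[of _ "{v}"])
next
  case False
  obtain x where x: "x \<in> rel_interior G"
    using rel_interior_eq_empty[OF face_of_imp_convex[OF G]] False by blast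
  then have xG: "x \<in> G" using rel_interior_subset by blast
  then have xP: "x \<in> P" and ax: "a \<bullet> x = b" using face_of_imp_subset[OF G] T_sub T_val by auto
  define z where "z = midpoint v x"
  have "v ~= x" using av ax by auto
  then have zo: "z \<in> open_segment v x" by (simp add: z_def)
  then have zP: "z \<in> P" using vP xP cvP by (meson convex_contains_open_segment subsetD)
  obtain F where F: "F face_of P" "z \<in> rel_interior F"
    using face_rel_interior_exists[OF polytope_imp_polyhedron[OF polP] zP] .
  have zF: "z \<in> F" using F(2) rel_interior_subset by blast
  have vF: "v \<in> F" "x \<in> F" using face_ofD[OF F(1) zo vP xP zF] by blast+
  have FT: "F \<inter> {x. a \<bullet> x = b} face_of T" by (rule section_face[OF F(1)])
  have "G \<subseteq> F \<inter> {x. a \<bullet> x = b}"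
    using subset_of_face_of[OF FT face_of_imp_subset[OF G]] x vF(2) ax by blast
  moreover have "y \<in> G" if y: "y \<in> F" "a \<bullet> y = b" for y
  proof (cases "y = x")
    case ne: False
    have yT: "y \<in> T" using y face_of_imp_subset[OF F(1)] by (auto simp: T_def)
    \<comment> \<open>The segment from \<open>y\<close> to \<open>z\<close> can be prolonged a
      little inside \<open>F\<close>. Projecting its new end from \<open>v\<close> back to the
      hyperplane gives \<open>g\<close>, and \<open>x\<close> turns out to lie between
      \<open>y\<close> and \<open>g\<close>, so that \<open>y\<close> belongs to
      \<open>G\<close>.\<close>
    obtain e where e: "1 < e" "(1 - e) *\<^sub>R y + e *\<^sub>R z \<in> F"
      using F(2) y(1) convex_rel_interior_iff[OF face_of_imp_convex[OF F(1)]] by blast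
    define y' where "y' = (1 - e) *\<^sub>R y + e *\<^sub>R z"
    have y'P: "y' \<in> P" using e(2) face_of_imp_subset[OF F(1)] by (auto simp: y'_def)
    have z2: "e *\<^sub>R z = (e / 2) *\<^sub>R v + (e / 2) *\<^sub>R x" by (simp add: z_def midpoint_def scaleR_add_right)
    obtain g s where g: "g \<in> T" "0 \<le> s" "y' = v + s *\<^sub>R (g - v)" "s = 0 \<or> 0 < s"
    proof (cases "y' = v")
      case True
      then show thesis using that[of y 0] yT by simp
    next
      case False
      then show thesis using radial[OF y'P] that by (metis less_imp_le)
    qed
    have eq: "(1 - e) *\<^sub>R y + (e / 2) *\<^sub>R v + (e / 2) *\<^sub>R x = v + s *\<^sub>R (g - v)"
      using g(3) unfolding y'_def z2 by (simp add: add.assoc)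
    have "a \<bullet> v + s * (b - a \<bullet> v) - ((1 - e) * b + e / 2 * (a \<bullet> v) + e / 2 * b) = (s - (1 - e / 2)) * (b - a \<bullet> v)"
      by (simp add: field_simps)
    moreover have "(1 - e) * b + e / 2 * (a \<bullet> v) + e / 2 * b = a \<bullet> v + s * (b - a \<bullet> v)"
      using arg_cong[OF eq, of "\<lambda>p. a \<bullet> p"] y(2) ax T_val[OF g(1)] by (simp add: inner_add_right inner_diff_right)
    ultimately have "(s - (1 - e / 2)) * (b - a \<bullet> v) = 0" by linarith
    then have s: "s = 1 - e / 2" using av by simp
    have ex: "(e / 2) *\<^sub>R x = (e - 1) *\<^sub>R y + (1 - e / 2) *\<^sub>R g"
      using eq unfolding s by (simp add: algebra_simps)
    \<comment> \<open>The factor that turns the identity for \<open>x\<close> into a convex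
      combination: \<open>t < 1\<close> is \<open>e > 1\<close>, and \<open>t \<ge> 0\<close> is
      \<open>s \<ge> 0\<close>.\<close>
    define t where "t = (2 - e) / e"
    have t: "0 \<le> t" "t < 1" "1 - t = 2 / e * (e - 1)" "t = 2 / e * (1 - e / 2)"
      using e(1) g(2) unfolding s t_def by (simp_all add: field_simps)
    have "x = (2 / e) *\<^sub>R ((e / 2) *\<^sub>R x)" using e(1) by simp
    then have xy: "x = (1 - t) *\<^sub>R y + t *\<^sub>R g" unfolding ex scaleR_add_right scaleR_scaleR t(3,4)[symmetric] .
    have "t ~= 0" "y ~= g" using xy ne by (auto simp: algebra_simps)
    then have "x \<in> open_segment y g"
      unfolding in_segment using xy t(1,2) by (intro conjI exI[of _ t]) simp_all
    then show ?thesis using face_ofD[OF G _ yT g(1) xG] by blast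
  qed (use xG in simp)
  ultimately show ?thesis using F(1) vF(1) by blast
qed

text \<open>By central projection \<open>F\<close> lies in the affine span of \<open>v\<close> and
  its section, while \<open>v\<close> is off the hyperplane.\<close>

lemma section_aff_dim:
  assumes F: "F face_of P" "v \<in> F"
  shows "aff_dim F = aff_dim (F \<inter> {x. a \<bullet> x = b}) + 1"
proof -
  define G where "G = F \<inter> {x. a \<bullet> x = b}"
  have "F \<subseteq> affine hull (insert v G)"
  proof
    fix x assume x: "x \<in> F"
    show "x \<in> affine hull (insert v G)"
    proof (cases "x = v")
      case True
      then show ?thesis by (simp add: hull_inc)
    next
      case False
      have xP: "x \<in> P" using x face_of_imp_subset[OF F(1)] by blast
      obtain g s where g: "g \<in> T" "0 < s" "x = v + s *\<^sub>R (g - v)" using radial[OF xP False] by blast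
      have "g \<in> F" using radial_in[OF F _ g(2)] g x T_sub by blast
      then have gG: "g \<in> affine hull (insert v G)" using T_val[OF g(1)] by (simp add: hull_inc G_def)
      have vG: "v \<in> affine hull (insert v G)" by (simp add: hull_inc)
      have "x = (1 - s) *\<^sub>R v + s *\<^sub>R g" using g(3) by (simp add: algebra_simps)
      then show ?thesis using mem_affine[OF affine_affine_hull vG gG, of "1 - s" s] by simp
    qed
  qed
  moreover have "insert v G \<subseteq> F" using F by (auto simp: G_def)
  ultimately have "aff_dim F = aff_dim (insert v G)"
    by (metis aff_dim_affine_hull aff_dim_subset antisym)
  moreover have "v \<notin> affine hull G"
  proof
    assume "v \<in> affine hull G"
    moreover have "affine hull G \<subseteq> {x. a \<bullet> x = b}"
      by (rule hull_minimal) (auto simp: G_def affine_hyperplane)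
    ultimately show False using av by auto
  qed
  ultimately show ?thesis by (simp add: aff_dim_insert G_def)
qed

lemma section_bij: "bij_betw (\<lambda>F. F \<inter> {x. a \<bullet> x = b}) {F. F face_of P \<and> v \<in> F} {G. G face_of T}"
  unfolding bij_betw_def
proof
  show "inj_on (\<lambda>F. F \<inter> {x. a \<bullet> x = b}) {F. F face_of P \<and> v \<in> F}"
  proof (rule inj_onI)
    fix F F' assume "F \<in> {F. F face_of P \<and> v \<in> F}" "F' \<in> {F. F face_of P \<and> v \<in> F}"
      "F \<inter> {x. a \<bullet> x = b} = F' \<inter> {x. a \<bullet> x = b}"
    then show "F = F'" using section_sub_iff[of F F'] section_sub_iff[of F' F] by simp
  qed
  show "(\<lambda>F. F \<inter> {x. a \<bullet> x = b}) ` {F. F face_of P \<and> v \<in> F} = {G. G face_of T}"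
  proof
    show "(\<lambda>F. F \<inter> {x. a \<bullet> x = b}) ` {F. F face_of P \<and> v \<in> F} \<subseteq> {G. G face_of T}"
      using section_face by blast
    show "{G. G face_of T} \<subseteq> (\<lambda>F. F \<inter> {x. a \<bullet> x = b}) ` {F. F face_of P \<and> v \<in> F}"
      using section_surj by blast
  qed
qed

lemma P_face: "P face_of P" using cvP by (rule face_of_refl)

lemma section_pf:
  assumes "F face_of P" "v \<in> F"
  shows "F \<inter> {x. a \<bullet> x = b} \<in> pf T \<longleftrightarrow> F \<in> pf P"
proof -
  have "F \<inter> {x. a \<bullet> x = b} = T \<longleftrightarrow> F = P"
    using section_sub_iff[OF assms P_face vP] section_sub_iff[OF P_face vP assms]
    unfolding T_def by blast
  then show ?thesis using section_face[OF assms(1)] assms(1) by (simp add: pf_def)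
qed

definition lift where "lift = inv_into {F. F face_of P \<and> v \<in> F} (\<lambda>F. F \<inter> {x. a \<bullet> x = b})"

lemma lift:
  assumes "G face_of T"
  shows "lift G face_of P" "v \<in> lift G" "lift G \<inter> {x. a \<bullet> x = b} = G"
proof -
  have "G \<in> (\<lambda>F. F \<inter> {x. a \<bullet> x = b}) ` {F. F face_of P \<and> v \<in> F}"
    using section_bij assms unfolding bij_betw_def by simp
  from inv_into_into[OF this] f_inv_into_f[OF this]
  show "lift G face_of P" "v \<in> lift G" "lift G \<inter> {x. a \<bullet> x = b} = G"
    by (simp_all add: lift_def)
qed

lemma lift_section: "F face_of P ==> v \<in> F ==> lift (F \<inter> {x. a \<bullet> x = b}) = F"
  unfolding lift_def by (rule inv_into_f_f) (use section_bij in \<open>auto simp: bij_betw_def\<close>)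

lemma lift_sub_iff:
  assumes "G face_of T" "G' face_of T"
  shows "lift G \<subseteq> lift G' \<longleftrightarrow> G \<subseteq> G'"
  using section_sub_iff[OF lift(1,2)[OF assms(1)] lift(1,2)[OF assms(2)]] lift(3)[OF assms(1)] lift(3)[OF assms(2)]
  by simp

lemma lift_empty: "lift {} = {v}"
proof -
  have "{v} \<inter> {x. a \<bullet> x = b} = {}" using av by auto
  moreover have "{v} face_of P" using v by (simp add: vertices_face)
  ultimately show ?thesis using lift_section[of "{v}"] by simp
qed

text \<open>\<open>lift\<close> is an isomorphism from the proper faces of the section onto those of
  \<open>P\<close> through \<open>v\<close>, and it sends the empty face to
  \<open>{v}\<close>.\<close>

lemma dshell_lift:
  assumes "dshell (pf T) {} Gs" "T ~= {}"
  shows "dshell (pf P) {v} (map lift Gs)"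
proof -
  have img: "lift ` {G \<in> pf T. {} \<subseteq> G} = {F \<in> pf P. {v} \<subseteq> F}"
  proof
    show "lift ` {G \<in> pf T. {} \<subseteq> G} \<subseteq> {F \<in> pf P. {v} \<subseteq> F}"
    proof
      fix F assume "F \<in> lift ` {G \<in> pf T. {} \<subseteq> G}"
      then obtain G where G: "G \<in> pf T" "F = lift G" by blast
      then have Gf: "G face_of T" by (simp add: pf_def)
      show "F \<in> {F \<in> pf P. {v} \<subseteq> F}"
        using lift[OF Gf] section_pf[of F] G by simp
    qed
    show "{F \<in> pf P. {v} \<subseteq> F} \<subseteq> lift ` {G \<in> pf T. {} \<subseteq> G}"
    proof
      fix F assume F: "F \<in> {F \<in> pf P. {v} \<subseteq> F}"
      then have f: "F face_of P" "v \<in> F" by (auto simp: pf_def)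
      have "F \<inter> {x. a \<bullet> x = b} \<in> pf T" using section_pf[OF f] F by simp
      then show "F \<in> lift ` {G \<in> pf T. {} \<subseteq> G}"
        using lift_section[OF f, symmetric] by (intro image_eqI) auto
    qed
  qed
  have sub: "lift G \<subseteq> lift H \<longleftrightarrow> G \<subseteq> H" if "G \<in> pf T" "H \<in> pf T" for G H
    using lift_sub_iff that by (simp add: pf_def)
  have "bij_betw lift {G \<in> pf T. {} \<subseteq> G} {F \<in> pf P. {v} \<subseteq> F}"
    unfolding bij_betw_def
  proof
    show "inj_on lift {G \<in> pf T. {} \<subseteq> G}"
    proof (rule inj_onI)
      fix G H assume "G \<in> {G \<in> pf T. {} \<subseteq> G}" "H \<in> {G \<in> pf T. {} \<subseteq> G}" "lift G = lift H"
      then show "G = H" using sub[of G H] sub[of H G] by simp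
    qed
  qed (rule img)
  then have "dshell (pf P) (lift {}) (map lift Gs)"
    by (rule dshell_iso[OF _ _ assms(1)]) (use sub assms(2) in \<open>auto simp: pf_def\<close>)
  then show ?thesis by (simp add: lift_empty)
qed

end

lemma vertex_section_exists:
  fixes P :: "'a::euclidean_space set"
  assumes "polytope P" "v \<in> vertices P"
  shows "\<exists>a b. vertex_section P v a b"
proof -
  have "{v} face_of P" using assms by (simp add: vertices_face)
  then obtain a c where ac: "P \<subseteq> {x. a \<bullet> x \<le> c}" "{v} = P \<inter> {x. a \<bullet> x = c}"
    using exposed_face_of_polyhedron[OF polytope_imp_polyhedron[OF assms(1)], of "{v}"]
    by (auto simp: exposed_face_of_def)
  define W where "W = vertices P - {v}"
  have fin: "finite W" using finite_vertices[OF assms(1)] by (simp add: W_def)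
  have lt: "a \<bullet> w < c" if "w \<in> W" for w
  proof -
    have "w \<in> P" "w ~= v" using that vertices_sub by (auto simp: W_def)
    then have "a \<bullet> w \<le> c" "w \<notin> P \<inter> {x. a \<bullet> x = c}" using ac by blast+
    then show ?thesis using \<open>w \<in> P\<close> by simp
  qed
  \<comment> \<open>The highest level of another vertex. The entry \<open>c - 1\<close> keeps the
    set nonempty.\<close>
  define b where "b = Max (insert (c - 1) ((\<lambda>w. a \<bullet> w) ` W))"
  have "b < c" unfolding b_def using fin lt by simp
  moreover have "a \<bullet> w \<le> b" if "w \<in> W" for w unfolding b_def using fin that by simp
  moreover have "a \<bullet> v = c"
  proof -
    have "v \<in> P \<inter> {x. a \<bullet> x = c}" using ac(2) by blast
    then show ?thesis by simp
  qed
  ultimately show ?thesis using assms by (intro exI[of _ a] exI[of _ b]) (auto simp: vertex_section_def W_def)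
qed

subsection \<open>Gradedness and the diamond property\<close>

text \<open>Descend through facets containing \<open>F\<close> until \<open>F\<close> itself is such
  a facet.\<close>

lemma face_between_facet:
  fixes P :: "'a::euclidean_space set"
  assumes "polytope G" "F face_of G" "F ~= {}" "F ~= G"
  shows "\<exists>H. H face_of G \<and> F facet_of H"
  using assms
proof (induction "nat (aff_dim G)" arbitrary: G rule: less_induct)
  case less
  obtain K where K: "K facet_of G" "F \<subseteq> K"
    using face_of_polyhedron_subset_facet[OF polytope_imp_polyhedron[OF less.prems(1)] less.prems(2-4)] by blast
  have Kf: "K face_of G" using K(1) by (rule facet_of_imp_face_of)
  show ?case
  proof (cases "F = K")
    case True
    have "G face_of G" using less.prems(1) polytope_imp_convex face_of_refl by blast
    then show ?thesis using K True by blast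
  next
    case False
    have FK: "F face_of K" using face_of_subset[OF less.prems(2) K(2) face_of_imp_subset[OF Kf]] .
    have pK: "polytope K" using face_of_polytope_polytope[OF less.prems(1) Kf] .
    have "aff_dim F < aff_dim K" by (rule face_of_aff_dim_lt[OF polytope_imp_convex[OF pK] FK False])
    moreover have "-1 \<le> aff_dim F" by (rule aff_dim_geq)
    moreover have "aff_dim K = aff_dim G - 1" using K by (simp add: facet_of_def)
    ultimately have "nat (aff_dim K) < nat (aff_dim G)" by simp
    then obtain H where "H face_of K" "F facet_of H"
      using less.hyps[OF _ pK FK less.prems(3) False] by blast
    then show ?thesis using face_of_trans[OF _ Kf] by blast
  qed
qed

lemma aff_dim_vertex_face: "aff_dim F = 0 ==> F face_of P ==> \<exists>v\<in>vertices P. F = {v}"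
  by (metis aff_dim_eq_0 vertices_face)

text \<open>The face lattice is graded by dimension. The empty face fits in with dimension -1, but
  there the existence of vertices takes the place of \<open>face_between_facet\<close>.\<close>

lemma cov_pf:
  fixes P :: "'a::euclidean_space set"
  assumes P: "polytope P" and F: "F face_of P"
  shows "cov (pf P) F = {G \<in> pf P. F \<subseteq> G \<and> aff_dim G = aff_dim F + 1}"
proof
  show "cov (pf P) F \<subseteq> {G \<in> pf P. F \<subseteq> G \<and> aff_dim G = aff_dim F + 1}"
  proof
    fix G assume G: "G \<in> cov (pf P) F"
    then have GL: "G \<in> pf P" "F \<subset> G" and min: "\<And>H. H \<in> pf P ==> F \<subset> H ==> H \<subseteq> G ==> H = G"
      unfolding cov_def by blast+
    have Gf: "G face_of P" "G ~= P" using GL by (auto simp: pf_def)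
    have pG: "polytope G" using face_of_polytope_polytope[OF P Gf(1)] .
    have GP: "G \<subset> P" using Gf face_of_imp_subset by blast
    have "aff_dim G = aff_dim F + 1"
    proof (cases "F = {}")
      case True
      obtain v where v: "v \<in> vertices G" using vertices_nonempty[OF pG] GL(2) by blast
      then have "{v} face_of P" "{v} \<subseteq> G"
        using face_of_trans[OF _ Gf(1)] vertices_sub[of G] by (auto simp: vertices_face[symmetric]) (simp add: vertices_face)
      then have "{v} = G" using min[of "{v}"] GP True by (auto simp: pf_def)
      then show ?thesis using True by auto
    next
      case False
      have FG: "F face_of G" using face_of_subset[OF F _ face_of_imp_subset[OF Gf(1)]] GL by blast
      obtain H where H: "H face_of G" "F facet_of H" using face_between_facet[OF pG FG False] GL by blast
      have "F \<subset> H" using H(2) facet_of_imp_subset facet_of_irrefl by blast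
      moreover have "H \<subseteq> G" using H(1) by (rule face_of_imp_subset)
      moreover have "H \<in> pf P" using face_of_trans[OF H(1) Gf(1)] \<open>H \<subseteq> G\<close> GP by (auto simp: pf_def)
      ultimately have "H = G" using min by blast
      then show ?thesis using H(2) by (simp add: facet_of_def)
    qed
    then show "G \<in> {G \<in> pf P. F \<subseteq> G \<and> aff_dim G = aff_dim F + 1}" using GL by blast
  qed
  show "{G \<in> pf P. F \<subseteq> G \<and> aff_dim G = aff_dim F + 1} \<subseteq> cov (pf P) F"
  proof
    fix G assume G: "G \<in> {G \<in> pf P. F \<subseteq> G \<and> aff_dim G = aff_dim F + 1}"
    have "H = G" if H: "H \<in> pf P" "F \<subset> H" "H \<subseteq> G" for H
    proof (rule ccontr)
      assume ne: "H ~= G"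
      have Hf: "H face_of P" "G face_of P" using H G by (auto simp: pf_def)
      have "F face_of H" using face_of_subset[OF F _ face_of_imp_subset[OF Hf(1)]] H by blast
      then have "aff_dim F < aff_dim H"
        using face_of_aff_dim_lt[OF face_of_imp_convex[OF Hf(1)]] H by blast
      moreover have "H face_of G" using face_of_subset[OF Hf(1) H(3) face_of_imp_subset[OF Hf(2)]] .
      then have "aff_dim H < aff_dim G"
        using face_of_aff_dim_lt[OF face_of_imp_convex[OF Hf(2)] _ ne] by blast
      ultimately show False using G by simp
    qed
    moreover have "F ~= G" using G by auto
    ultimately show "G \<in> cov (pf P) F" using G unfolding cov_def by blast
  qed
qed

lemma segment_vertices:
  fixes G :: "'a::euclidean_space set"
  assumes "polytope G" "aff_dim G = 1"
  obtains u w where "u ~= w" "G = closed_segment u w" "vertices G = {u, w}"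
proof -
  have "G ~= {}" using assms(2) by auto
  moreover have "collinear G" using assms(2) by (simp add: collinear_aff_dim)
  ultimately obtain u w where uw: "G = closed_segment u w"
    using compact_convex_collinear_segment[of G] assms(1) polytope_imp_compact polytope_imp_convex by blast
  have "u ~= w" using uw assms(2) by auto
  moreover have "vertices G = {u, w}"
    by (auto simp: vertices_def uw extreme_point_of_segment)
  ultimately show thesis using uw that by blast
qed

lemma diamond_empty:
  fixes G :: "'a::euclidean_space set"
  assumes "polytope G" "aff_dim G = 1"
  shows "card {H. H face_of G \<and> aff_dim H = 0} = 2"
proof -
  obtain u w where uw: "u ~= w" "vertices G = {u, w}" using segment_vertices[OF assms] by metis
  have "{H. H face_of G \<and> aff_dim H = 0} = {{u}, {w}}"
  proof
    show "{H. H face_of G \<and> aff_dim H = 0} \<subseteq> {{u}, {w}}"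
    proof
      fix H assume "H \<in> {H. H face_of G \<and> aff_dim H = 0}"
      then obtain x where "x \<in> vertices G" "H = {x}" using aff_dim_vertex_face by blast
      moreover from this have "x = u \<or> x = w" using uw(2) by simp
      ultimately show "H \<in> {{u}, {w}}" by auto
    qed
    have "{u} face_of G" "{w} face_of G" using uw(2) vertices_face by blast+
    then show "{{u}, {w}} \<subseteq> {H. H face_of G \<and> aff_dim H = 0}" by simp
  qed
  then show ?thesis using uw(1) by simp
qed

text \<open>Passing to the vertex figure at a vertex of \<open>F\<close> preserves the interval and
  lowers all dimensions by one. In the end \<open>F\<close> is empty and \<open>G\<close> is an edge
  with its two end points.\<close>

lemma diamond:
  fixes P :: "'a::euclidean_space set"
  assumes "polytope P" "F face_of P" "G face_of P" "F \<subseteq> G" "aff_dim G = aff_dim F + 2"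
  shows "card {H. H face_of P \<and> F \<subseteq> H \<and> H \<subseteq> G \<and> aff_dim H = aff_dim F + 1} = 2"
  using assms
proof (induction "nat (aff_dim F + 1)" arbitrary: P F G rule: less_induct)
  case less
  note P = less.prems(1) and F = less.prems(2) and G = less.prems(3) and FG = less.prems(4) and dim = less.prems(5)
  have pG: "polytope G" using face_of_polytope_polytope[OF P G] .
  show ?case
  proof (cases "F = {}")
    case True
    then have "{H. H face_of P \<and> F \<subseteq> H \<and> H \<subseteq> G \<and> aff_dim H = aff_dim F + 1} = {H. H face_of G \<and> aff_dim H = 0}"
      using face_of_face[OF G] by auto
    then show ?thesis using diamond_empty[OF pG] dim True by simp
  next
    case False
    have pF: "polytope F" using face_of_polytope_polytope[OF P F] .
    obtain v where v: "v \<in> vertices F" using vertices_nonempty[OF pF False] by blast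
    then have vF: "v \<in> vertices P" "v \<in> F" using vertices_of_face[OF F] by auto
    obtain a b where "vertex_section P v a b" using vertex_section_exists[OF P vF(1)] by blast
    then interpret vertex_section P v a b .
    define s where "s = (\<lambda>F. F \<inter> {x. a \<bullet> x = b})"
    have vG: "v \<in> G" using vF FG by blast
    have dF: "aff_dim F = aff_dim (s F) + 1" unfolding s_def by (rule section_aff_dim[OF F vF(2)])
    have dG: "aff_dim G = aff_dim (s G) + 1" unfolding s_def by (rule section_aff_dim[OF G vG])
    have "card {H. H face_of T \<and> s F \<subseteq> H \<and> H \<subseteq> s G \<and> aff_dim H = aff_dim (s F) + 1} = 2"
    proof (rule less.hyps)
      have "0 \<le> aff_dim (s F) + 1" using aff_dim_geq[of "s F"] by simp
      then show "nat (aff_dim (s F) + 1) < nat (aff_dim F + 1)" using dF by simp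
      show "polytope T" by (rule polT)
      show "s F face_of T" "s G face_of T" using section_face F G by (simp_all add: s_def)
      show "s F \<subseteq> s G" using FG by (auto simp: s_def)
      show "aff_dim (s G) = aff_dim (s F) + 2" using dF dG dim by simp
    qed
    moreover have "bij_betw s {H. H face_of P \<and> F \<subseteq> H \<and> H \<subseteq> G \<and> aff_dim H = aff_dim F + 1}
      {H. H face_of T \<and> s F \<subseteq> H \<and> H \<subseteq> s G \<and> aff_dim H = aff_dim (s F) + 1}"
      (is "bij_betw s ?A ?B")
      unfolding bij_betw_def
    proof
      have sub: "?A \<subseteq> {H. H face_of P \<and> v \<in> H}" using vF(2) by blast
      show "inj_on s ?A"
        unfolding s_def by (rule inj_on_subset[OF bij_betw_imp_inj_on[OF section_bij] sub])
      show "s ` ?A = ?B"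
      proof
        show "s ` ?A \<subseteq> ?B"
        proof
          fix K assume "K \<in> s ` ?A"
          then obtain H where H: "H face_of P" "F \<subseteq> H" "H \<subseteq> G" "aff_dim H = aff_dim F + 1" "K = s H" by blast
          have "v \<in> H" using H vF by blast
          then have "aff_dim H = aff_dim (s H) + 1" unfolding s_def by (rule section_aff_dim[OF H(1)])
          then show "K \<in> ?B" using H dF section_face[OF H(1)] by (auto simp: s_def)
        qed
        show "?B \<subseteq> s ` ?A"
        proof
          fix K assume K: "K \<in> ?B"
          then have Kf: "K face_of T" by blast
          note l = lift[OF Kf]
          have sl: "s (lift K) = K" using l(3) by (simp add: s_def)
          have "s F \<subseteq> s (lift K)" "s (lift K) \<subseteq> s G" using K sl by simp_all
          then have "F \<subseteq> lift K" "lift K \<subseteq> G"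
            unfolding s_def using section_sub_iff[OF F vF(2) l(1,2)] section_sub_iff[OF l(1,2) G vG] by simp_all
          moreover have "aff_dim (lift K) = aff_dim F + 1"
            using section_aff_dim[OF l(1,2)] K l(3) dF by simp
          ultimately have "lift K \<in> ?A" using l(1) by blast
          with sl[symmetric] show "K \<in> s ` ?A" by (rule image_eqI)
        qed
      qed
    qed
    ultimately show ?thesis using bij_betw_same_card by fastforce
  qed
qed

subsection \<open>Orderings by linear functionals\<close>

text \<open>A multiple of the new vector \<open>d\<close> is added, and each of the finitely many
  vectors forbids at most one coefficient.\<close>

lemma functional_nonzero:
  fixes D :: "'a::euclidean_space set"
  assumes "finite D" "0 \<notin> D"
  shows "\<exists>g. \<forall>d\<in>D. g \<bullet> d ~= 0"
  using assms
proof (induction D rule: finite_induct)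
  case (insert d D)
  then obtain g where g: "\<And>e. e \<in> D ==> g \<bullet> e ~= 0" by auto
  have "finite ((\<lambda>e. - (g \<bullet> e) / (d \<bullet> e)) ` insert d D)" using insert by simp
  then obtain t :: real where t: "t \<notin> (\<lambda>e. - (g \<bullet> e) / (d \<bullet> e)) ` insert d D"
    using ex_new_if_finite[OF infinite_UNIV_char_0] by blast
  have "(g + t *\<^sub>R d) \<bullet> e ~= 0" if e: "e \<in> insert d D" for e
  proof (cases "d \<bullet> e = 0")
    case True
    then have "e ~= d" using insert.prems by auto
    then show ?thesis using g[of e] e True by (simp add: inner_add_left)
  next
    case False
    show ?thesis
    proof
      assume "(g + t *\<^sub>R d) \<bullet> e = 0"
      then have "t = - (g \<bullet> e) / (d \<bullet> e)" using False by (simp add: inner_add_left field_simps)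
      then show False using t e by blast
    qed
  qed
  then show ?case by blast
qed simp

text \<open>Only finitely many differences matter, so a small enough perturbation breaks ties
  without reversing a strict comparison.\<close>

lemma functional_perturb:
  fixes S :: "'a::euclidean_space set" and c :: 'a
  assumes "finite S"
  shows "\<exists>c'. inj_on (\<lambda>x. c' \<bullet> x) S \<and> (\<forall>p\<in>S. \<forall>q\<in>S. c \<bullet> p < c \<bullet> q --> c' \<bullet> p < c' \<bullet> q)"
proof -
  define D where "D = (\<lambda>(p, q). q - p) ` (S \<times> S) - {0}"
  have finD: "finite D" using assms by (simp add: D_def)
  obtain g where g: "\<And>d. d \<in> D ==> g \<bullet> d ~= 0" using functional_nonzero[OF finD] by (auto simp: D_def)
  have "\<forall>d\<in>D. eventually (\<lambda>e. 0 < c \<bullet> d --> 0 < c \<bullet> d + e * (g \<bullet> d)) (at_right 0)"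
  proof
    fix d assume "d \<in> D"
    have "((\<lambda>e. c \<bullet> d + e * (g \<bullet> d)) \<longlongrightarrow> c \<bullet> d + 0 * (g \<bullet> d)) (at_right 0)"
      by (intro tendsto_intros)
    then show "eventually (\<lambda>e. 0 < c \<bullet> d --> 0 < c \<bullet> d + e * (g \<bullet> d)) (at_right 0)"
      using order_tendstoD(1)[of _ "c \<bullet> d" _ 0] by (cases "0 < c \<bullet> d") auto
  qed
  then have "eventually (\<lambda>e. \<forall>d\<in>D. 0 < c \<bullet> d --> 0 < c \<bullet> d + e * (g \<bullet> d)) (at_right 0)"
    using finD by (simp add: eventually_ball_finite)
  moreover have "eventually (\<lambda>e. 0 < e) (at_right (0::real))" by (rule eventually_at_right_less)
  ultimately have "eventually (\<lambda>e. 0 < e \<and> (\<forall>d\<in>D. 0 < c \<bullet> d --> 0 < c \<bullet> d + e * (g \<bullet> d))) (at_right 0)"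
    by eventually_elim simp
  then obtain e where e: "0 < e" "\<And>d. d \<in> D ==> 0 < c \<bullet> d ==> 0 < c \<bullet> d + e * (g \<bullet> d)"
    using eventually_happens'[OF trivial_limit_at_right_real] by blast
  define c' where "c' = c + e *\<^sub>R g"
  have c'd: "c' \<bullet> d = c \<bullet> d + e * (g \<bullet> d)" for d by (simp add: c'_def inner_add_left)
  have DI: "q - p \<in> D" if "p \<in> S" "q \<in> S" "p ~= q" for p q using that by (force simp: D_def)
  have mono: "c' \<bullet> p < c' \<bullet> q" if pq: "p \<in> S" "q \<in> S" "c \<bullet> p < c \<bullet> q" for p q
  proof -
    have "q - p \<in> D" using pq DI by auto
    moreover have "0 < c \<bullet> (q - p)" using pq(3) by (simp add: inner_diff_right)
    ultimately have "0 < c' \<bullet> (q - p)" unfolding c'd by (rule e(2))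
    then show ?thesis by (simp add: inner_diff_right)
  qed
  have "inj_on (\<lambda>x. c' \<bullet> x) S"
  proof (rule inj_onI, rule ccontr)
    fix p q assume pq: "p \<in> S" "q \<in> S" "c' \<bullet> p = c' \<bullet> q" "p ~= q"
    have "c \<bullet> p = c \<bullet> q" using mono[OF pq(1,2)] mono[OF pq(2,1)] pq(3) by linarith
    then have "c \<bullet> (q - p) = 0" "c' \<bullet> (q - p) = 0" using pq(3) by (simp_all add: inner_diff_right)
    then have "e * (g \<bullet> (q - p)) = 0" using c'd[of "q - p"] by simp
    then show False using g[OF DI[OF pq(1,2,4)]] e(1) by simp
  qed
  then show ?thesis using mono by blast
qed

lemma sorted_by_functional:
  fixes S :: "'a::euclidean_space set"
  assumes "finite S" "inj_on (\<lambda>x. c \<bullet> x) S"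
  shows "\<exists>vs. distinct vs \<and> set vs = S \<and> sorted_wrt (\<lambda>x y. c \<bullet> x < c \<bullet> y) vs"
proof -
  obtain xs where xs: "distinct xs" "set xs = S" using finite_distinct_list[OF assms(1)] by blast
  define vs where "vs = sort_key (\<lambda>x. c \<bullet> x) xs"
  have vs: "distinct vs" "set vs = S" using xs by (auto simp: vs_def)
  have "sorted (map (\<lambda>x. c \<bullet> x) vs)" by (simp add: vs_def)
  moreover have "distinct (map (\<lambda>x. c \<bullet> x) vs)" using vs assms(2) by (simp add: distinct_map)
  ultimately have "sorted_wrt (<) (map (\<lambda>x. c \<bullet> x) vs)" by (simp add: strict_sorted_iff)
  then show ?thesis using vs by (auto simp: sorted_wrt_map)
qed

text \<open>The shelling condition for a single vertex \<open>x\<close> listed after the vertices in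
  \<open>A\<close>. \<open>A\<close> is a set because only the faces that it meets count, not the
  order inside it.\<close>

definition vertex_step :: "'a::euclidean_space set \<Rightarrow> 'a set \<Rightarrow> 'a \<Rightarrow> bool" where
  "vertex_step P A x \<longleftrightarrow> (\<exists>Ks r. dshell (pf P) {x} Ks \<and> 1 \<le> r \<and> r \<le> length Ks \<and>
     (\<forall>F\<in>pf P. x \<in> F --> ((\<exists>u\<in>A. u \<in> F) \<longleftrightarrow> (\<exists>k<r. Ks ! k \<subseteq> F))))"

lemma vertex_stepE:
  assumes "vertex_step P A x"
  obtains Ks r where "dshell (pf P) {x} Ks" "1 \<le> r" "r \<le> length Ks"
    "\<And>F. F \<in> pf P ==> x \<in> F ==> (\<exists>u\<in>A. u \<in> F) \<longleftrightarrow> (\<exists>k<r. Ks ! k \<subseteq> F)"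
  using assms unfolding vertex_step_def by (elim exE conjE) (rule that, assumption+, blast)

lemma vertex_stepI:
  assumes "dshell (pf P) {x} Ks" "1 \<le> r" "r \<le> length Ks"
    "\<And>F. F \<in> pf P ==> x \<in> F ==> (\<exists>u\<in>A. u \<in> F) \<longleftrightarrow> (\<exists>k<r. Ks ! k \<subseteq> F)"
  shows "vertex_step P A x"
  unfolding vertex_step_def using assms by (intro exI[of _ Ks] exI[of _ r] conjI ballI impI) simp_all

lemma cov_empty:
  fixes P :: "'a::euclidean_space set"
  assumes "polytope P" "1 \<le> aff_dim P"
  shows "cov (pf P) {} = (\<lambda>v. {v}) ` vertices P"
proof -
  have "cov (pf P) {} = {G \<in> pf P. aff_dim G = 0}" by (subst cov_pf[OF assms(1)]) auto
  also have "\<dots> = (\<lambda>v. {v}) ` vertices P"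
  proof
    show "{G \<in> pf P. aff_dim G = 0} \<subseteq> (\<lambda>v. {v}) ` vertices P"
      using aff_dim_vertex_face by (fastforce simp: pf_def)
    show "(\<lambda>v. {v}) ` vertices P \<subseteq> {G \<in> pf P. aff_dim G = 0}"
      using assms(2) by (auto simp: pf_def vertices_face)
  qed
  finally show ?thesis .
qed

lemma append_Cons_nth:
  assumes "j < length vs"
  shows "vs = take j vs @ vs ! j # drop (Suc j) vs" "(\<exists>i<j. vs ! i \<in> F) \<longleftrightarrow> (\<exists>u\<in>set (take j vs). u \<in> F)"
proof -
  show "vs = take j vs @ vs ! j # drop (Suc j) vs" by (rule id_take_nth_drop[OF assms])
  show "(\<exists>i<j. vs ! i \<in> F) \<longleftrightarrow> (\<exists>u\<in>set (take j vs). u \<in> F)"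
    using set_take_nth[of j vs] assms by auto
qed

lemma dshell_of_steps:
  fixes P :: "'a::euclidean_space set"
  assumes "polytope P" "1 \<le> aff_dim P" and vs: "distinct vs" "set vs = vertices P" "vs ~= []"
    and hd: "dshell (pf P) {hd vs} Hs"
    and step: "\<And>j. 0 < j ==> j < length vs ==> vertex_step P (set (take j vs)) (vs ! j)"
  shows "dshell (pf P) {} (map (\<lambda>v. {v}) vs)"
proof (rule dshell.step)
  show "distinct (map (\<lambda>v. {v}) vs)" using vs(1) by (simp add: distinct_map)
  show "set (map (\<lambda>v. {v}) vs) = cov (pf P) {}" using cov_empty[OF assms(1,2)] vs(2) by simp
  show "map (\<lambda>v. {v}) vs ~= []" using vs(3) by simp
  show "dshell (pf P) (hd (map (\<lambda>v. {v}) vs)) Hs" using hd vs(3) by (simp add: hd_map)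
  show "\<forall>j. 0 < j \<and> j < length (map (\<lambda>v. {v}) vs) -->
    (\<exists>Ks r. dshell (pf P) (map (\<lambda>v. {v}) vs ! j) Ks \<and> 1 \<le> r \<and> r \<le> length Ks \<and>
    (\<forall>X\<in>pf P. map (\<lambda>v. {v}) vs ! j \<subseteq> X -->
      ((\<exists>i<j. map (\<lambda>v. {v}) vs ! i \<subseteq> X) \<longleftrightarrow> (\<exists>k<r. Ks ! k \<subseteq> X))))"
  proof (intro allI impI)
    fix j assume "0 < j \<and> j < length (map (\<lambda>v. {v}) vs)"
    then have j: "0 < j" "j < length vs" by simp_all
    obtain Ks r where K: "dshell (pf P) {vs ! j} Ks" "1 \<le> r" "r \<le> length Ks"
      "\<And>F. F \<in> pf P ==> vs ! j \<in> F ==> (\<exists>u\<in>set (take j vs). u \<in> F) \<longleftrightarrow> (\<exists>k<r. Ks ! k \<subseteq> F)"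
      by (rule vertex_stepE[OF step[OF j]]) (rule that)
    have "(\<exists>i<j. map (\<lambda>v. {v}) vs ! i \<subseteq> X) \<longleftrightarrow> (\<exists>k<r. Ks ! k \<subseteq> X)"
      if X: "X \<in> pf P" "map (\<lambda>v. {v}) vs ! j \<subseteq> X" for X
    proof -
      have "vs ! j \<in> X" using X(2) j(2) by simp
      moreover have "(\<exists>i<j. map (\<lambda>v. {v}) vs ! i \<subseteq> X) \<longleftrightarrow> (\<exists>i<j. vs ! i \<in> X)"
        using j(2) by (auto intro!: arg_cong[where f = Ex])
      ultimately show ?thesis using K(4)[OF X(1)] append_Cons_nth(2)[OF j(2), of X] by simp
    qed
    then show "\<exists>Ks r. dshell (pf P) (map (\<lambda>v. {v}) vs ! j) Ks \<and> 1 \<le> r \<and> r \<le> length Ks \<and>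
      (\<forall>X\<in>pf P. map (\<lambda>v. {v}) vs ! j \<subseteq> X -->
        ((\<exists>i<j. map (\<lambda>v. {v}) vs ! i \<subseteq> X) \<longleftrightarrow> (\<exists>k<r. Ks ! k \<subseteq> X)))"
      using K(1-3) j(2) by (intro exI[of _ Ks] exI[of _ r] conjI ballI impI) simp_all
  qed
qed

text \<open>The dual form of the theorem of Bruggesser and Mani: sweeping a generic hyperplane over the
  polytope lists its vertices in the order of a line shelling of the polar.\<close>

theorem sweep_dshell:
  fixes P :: "'a::euclidean_space set"
  assumes "polytope P" "1 \<le> aff_dim P" "distinct vs" "set vs = vertices P"
    "sorted_wrt (\<lambda>x y. c \<bullet> x < c \<bullet> y) vs"
  shows "dshell (pf P) {} (map (\<lambda>v. {v}) vs)"
  using assms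
proof (induction "nat (aff_dim P)" arbitrary: P c vs rule: less_induct)
  case less
  note P = less.prems(1)
  have neP: "P ~= {}" using less.prems(2) by auto
  have d0: "distinct (map (\<lambda>v. {v}) vs)" "set (map (\<lambda>v. {v}) vs) = cov (pf P) {}"
    using less.prems(3,4) cov_empty[OF P less.prems(2)] by (auto simp: distinct_map)
  show ?case
  proof (cases "aff_dim P = 1")
    case True
    have "cov (pf P) {v} = {}" if "v \<in> vertices P" for v
    proof -
      have "{v} face_of P" using that by (simp add: vertices_face)
      have "aff_dim G < 1" if "G \<in> pf P" for G
        using face_of_aff_dim_lt[OF polytope_imp_convex[OF P], of G] that True by (auto simp: pf_def)
      then have "aff_dim G ~= aff_dim {v} + 1" if "G \<in> pf P" for G using that by fastforce
      then show ?thesis unfolding cov_pf[OF P \<open>{v} face_of P\<close>] by blast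
    qed
    then show ?thesis by (intro dshell.points[OF d0]) (simp add: less.prems(4))
  next
    case False
    then have dim2: "2 \<le> aff_dim P" using less.prems(2) by linarith
    \<comment> \<open>The dual facet at \<open>v\<close> is shelled by sweeping the vertex figure at
      \<open>v\<close> in nearly the same direction, and the faces already reached are those of an
      initial piece.\<close>
    have main: "\<exists>Ks r. dshell (pf P) {v} Ks \<and> r \<le> length Ks \<and>
       ((\<exists>w\<in>vertices P. c \<bullet> w < c \<bullet> v) --> 1 \<le> r) \<and>
       (\<forall>X\<in>pf P. v \<in> X --> ((\<exists>w\<in>vertices P. c \<bullet> w < c \<bullet> v \<and> w \<in> X) \<longleftrightarrow> (\<exists>k<r. Ks ! k \<subseteq> X)))"
      if v: "v \<in> vertices P" for v
    proof -
      obtain a b where "vertex_section P v a b" using vertex_section_exists[OF P v] by blast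
      then interpret vertex_section P v a b .
      have dT: "aff_dim P = aff_dim T + 1" using section_aff_dim[OF P_face vP] by (simp add: T_def)
      have neT: "T ~= {}" using dT dim2 by auto
      have finT: "finite (vertices T)" by (rule finite_vertices[OF polT])
      \<comment> \<open>\<open>c\<close> may have ties on the section. \<open>c'\<close> breaks them
        and still lists every point below the level of \<open>v\<close> before all others, the level
        being measured with \<open>c\<close>.\<close>
      obtain c' where c': "inj_on (\<lambda>x. c' \<bullet> x) (vertices T)"
        "\<And>p q. p \<in> vertices T ==> q \<in> vertices T ==> c \<bullet> p < c \<bullet> q ==> c' \<bullet> p < c' \<bullet> q"
        using functional_perturb[OF finT, of c] by blast
      obtain ps where ps: "distinct ps" "set ps = vertices T" "sorted_wrt (\<lambda>x y. c' \<bullet> x < c' \<bullet> y) ps"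
        using sorted_by_functional[OF finT c'(1)] by blast
      have "dshell (pf T) {} (map (\<lambda>v. {v}) ps)"
        by (rule less.hyps[OF _ polT _ ps]) (use dT dim2 in auto)
      then have d: "dshell (pf P) {v} (map lift (map (\<lambda>v. {v}) ps))" by (rule dshell_lift[OF _ neT])
      define Ks where "Ks = map lift (map (\<lambda>v. {v}) ps)"
      define Lw where "Lw = {p \<in> vertices T. c \<bullet> p < c \<bullet> v}"
      define r where "r = length (takeWhile (\<lambda>p. c \<bullet> p < c \<bullet> v) ps)"
      have r: "r \<le> length ps" unfolding r_def by (rule length_takeWhile_le)
      have low: "c \<bullet> (ps ! k) < c \<bullet> v" if "k < r" for k
      proof -
        have k: "k < length (takeWhile (\<lambda>p. c \<bullet> p < c \<bullet> v) ps)" using that by (simp add: r_def)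
        from nth_mem[OF k] have "takeWhile (\<lambda>p. c \<bullet> p < c \<bullet> v) ps ! k \<in> set (takeWhile (\<lambda>p. c \<bullet> p < c \<bullet> v) ps)" .
        then have "c \<bullet> (takeWhile (\<lambda>p. c \<bullet> p < c \<bullet> v) ps ! k) < c \<bullet> v" using set_takeWhileD by fast
        then show ?thesis unfolding takeWhile_nth[OF k] .
      qed
      have high: "\<not> c \<bullet> (ps ! k) < c \<bullet> v" if k: "r \<le> k" "k < length ps" for k
      proof
        assume lt: "c \<bullet> (ps ! k) < c \<bullet> v"
        have "r < length ps" using k by simp
        then have nr: "\<not> c \<bullet> (ps ! r) < c \<bullet> v" unfolding r_def by (rule nth_length_takeWhile)
        then have "c \<bullet> (ps ! k) < c \<bullet> (ps ! r)" "r ~= k" using lt by auto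
        moreover have "ps ! k \<in> vertices T" "ps ! r \<in> vertices T" using ps(2) k \<open>r < length ps\<close> nth_mem by blast+
        ultimately have "c' \<bullet> (ps ! k) < c' \<bullet> (ps ! r)" using c'(2) by blast
        moreover have "c' \<bullet> (ps ! r) < c' \<bullet> (ps ! k)"
          using ps(3) k \<open>r ~= k\<close> by (simp add: sorted_wrt_iff_nth_less)
        ultimately show False by simp
      qed
      \<comment> \<open>Projection from \<open>v\<close> preserves the sign of
        \<open>c \<bullet> x - c \<bullet> v\<close>, so a face through \<open>v\<close> goes below
        \<open>v\<close> exactly if its section does.\<close>
      have down: "(\<exists>w\<in>vertices P. c \<bullet> w < c \<bullet> v \<and> w \<in> X) \<longleftrightarrow> (\<exists>p\<in>vertices T. c \<bullet> p < c \<bullet> v \<and> p \<in> X)"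
        if X: "X face_of P" "v \<in> X" for X
      proof
        assume "\<exists>w\<in>vertices P. c \<bullet> w < c \<bullet> v \<and> w \<in> X"
        then obtain w where w: "w \<in> vertices P" "c \<bullet> w < c \<bullet> v" "w \<in> X" by blast
        have "w \<in> P" "w ~= v" using w vertices_sub by auto
        then obtain g s where g: "g \<in> T" "0 < s" "w = v + s *\<^sub>R (g - v)" using radial by blast
        have gX: "g \<in> X \<inter> {x. a \<bullet> x = b}"
          using radial_in[OF X _ g(2), of g] g w T_sub T_val by blast
        have "c \<bullet> w = c \<bullet> v + s * (c \<bullet> g - c \<bullet> v)" by (simp add: g(3) inner_add_right inner_diff_right)
        then have "s * (c \<bullet> g - c \<bullet> v) < 0" using w(2) by simp
        then have cg: "c \<bullet> g < c \<bullet> v" using g(2) by (simp add: mult_less_0_iff)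
        have Xf: "X \<inter> {x. a \<bullet> x = b} face_of T" by (rule section_face[OF X(1)])
        have pX: "polytope (X \<inter> {x. a \<bullet> x = b})" by (rule face_of_polytope_polytope[OF polT Xf])
        show "\<exists>p\<in>vertices T. c \<bullet> p < c \<bullet> v \<and> p \<in> X"
        proof (rule ccontr)
          assume "\<not> ?thesis"
          then have "c \<bullet> g \<ge> c \<bullet> v"
            by (intro affine_bound_vertices[OF pX gX]) (auto simp: vertices_of_face[OF Xf])
          then show False using cg by simp
        qed
      next
        assume "\<exists>p\<in>vertices T. c \<bullet> p < c \<bullet> v \<and> p \<in> X"
        then obtain p where p: "c \<bullet> p < c \<bullet> v" "p \<in> X" by blast
        have pX: "polytope X" by (rule face_of_polytope_polytope[OF P X(1)])
        show "\<exists>w\<in>vertices P. c \<bullet> w < c \<bullet> v \<and> w \<in> X"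
        proof (rule ccontr)
          assume "\<not> ?thesis"
          then have "c \<bullet> p \<ge> c \<bullet> v"
            by (intro affine_bound_vertices[OF pX p(2)]) (auto simp: vertices_of_face[OF X(1)])
          then show False using p by simp
        qed
      qed
      have Kk: "Ks ! k \<subseteq> X \<longleftrightarrow> ps ! k \<in> X" if k: "k < length ps" and X: "X face_of P" "v \<in> X" for k X
      proof -
        have pk: "ps ! k \<in> vertices T" using k ps(2) nth_mem by blast
        then have f: "{ps ! k} face_of T" by (simp add: vertices_face)
        have "Ks ! k = lift {ps ! k}" using k by (simp add: Ks_def)
        moreover have "lift {ps ! k} \<subseteq> X \<longleftrightarrow> {ps ! k} \<subseteq> X \<inter> {x. a \<bullet> x = b}"
          using section_sub_iff[OF lift(1,2)[OF f] X] lift(3)[OF f] by simp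
        moreover have "a \<bullet> (ps ! k) = b" using pk vertices_sub T_val by blast
        ultimately show ?thesis by simp
      qed
      have low_iff: "(\<exists>p\<in>vertices T. c \<bullet> p < c \<bullet> v \<and> p \<in> X) \<longleftrightarrow> (\<exists>k<r. ps ! k \<in> X)" for X
      proof
        assume "\<exists>p\<in>vertices T. c \<bullet> p < c \<bullet> v \<and> p \<in> X"
        then obtain p where p: "p \<in> set ps" "c \<bullet> p < c \<bullet> v" "p \<in> X" using ps(2) by blast
        from p(1) obtain k where "k < length ps" "ps ! k = p" unfolding in_set_conv_nth by blast
        then have k: "k < length ps" "c \<bullet> (ps ! k) < c \<bullet> v" "ps ! k \<in> X" using p by simp_all
        then have "k < r" using high[of k] by force
        then show "\<exists>k<r. ps ! k \<in> X" using k by blast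
      next
        assume "\<exists>k<r. ps ! k \<in> X"
        then obtain k where k: "k < r" "ps ! k \<in> X" by blast
        then have "ps ! k \<in> vertices T" using ps(2) r nth_mem[of k ps] by simp
        then show "\<exists>p\<in>vertices T. c \<bullet> p < c \<bullet> v \<and> p \<in> X" using low k by blast
      qed
      have "(\<exists>w\<in>vertices P. c \<bullet> w < c \<bullet> v) --> 1 \<le> r"
      proof
        assume "\<exists>w\<in>vertices P. c \<bullet> w < c \<bullet> v"
        then have "\<exists>w\<in>vertices P. c \<bullet> w < c \<bullet> v \<and> w \<in> P" using vertices_sub by blast
        then have "\<exists>k<r. ps ! k \<in> P" using down[OF P_face vP] low_iff by blast
        then show "1 \<le> r" by auto
      qed
      moreover have "(\<exists>w\<in>vertices P. c \<bullet> w < c \<bullet> v \<and> w \<in> X) \<longleftrightarrow> (\<exists>k<r. Ks ! k \<subseteq> X)"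
        if X: "X \<in> pf P" "v \<in> X" for X
      proof -
        have Xf: "X face_of P" using X by (simp add: pf_def)
        have "Ks ! k \<subseteq> X \<longleftrightarrow> ps ! k \<in> X" if "k < r" for k
          using Kk[OF less_le_trans[OF that r] Xf X(2)] .
        then have "(\<exists>k<r. Ks ! k \<subseteq> X) \<longleftrightarrow> (\<exists>k<r. ps ! k \<in> X)"
          by (simp cong: conj_cong)
        then show ?thesis unfolding down[OF Xf X(2)] low_iff[of X] by (rule sym)
      qed
      moreover have "r \<le> length Ks" using r by (simp add: Ks_def)
      moreover have "dshell (pf P) {v} Ks" using d by (simp add: Ks_def)
      ultimately show ?thesis by (intro exI[of _ Ks] exI[of _ r]) simp
    qed
    have "set vs ~= {}" unfolding less.prems(4) by (rule vertices_nonempty[OF P neP])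
    then have nevs: "vs ~= []" by auto
    have "hd vs \<in> vertices P" using hd_in_set[OF nevs] unfolding less.prems(4) .
    from main[OF this] obtain Hs where Hs: "dshell (pf P) {hd vs} Hs"
      by (elim exE conjE) (rule that)
    show ?thesis
    proof (rule dshell_of_steps[OF P less.prems(2-4) nevs Hs])
      fix j assume j: "0 < j" "j < length vs"
      then have vj: "vs ! j \<in> vertices P" using less.prems(4) nth_mem by blast
      have lt: "c \<bullet> (vs ! i) < c \<bullet> (vs ! k)" if "i < k" "k < length vs" for i k
        using less.prems(5) that by (simp add: sorted_wrt_iff_nth_less)
      have "{w \<in> vertices P. c \<bullet> w < c \<bullet> (vs ! j)} = {w \<in> set vs. c \<bullet> w < c \<bullet> (vs ! j)}"
        unfolding less.prems(4) ..
      also have "\<dots> = set (take j vs)"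
      proof -
        have "c \<bullet> (vs ! i) < c \<bullet> (vs ! j) \<longleftrightarrow> i < j" if "i < length vs" for i
          using lt[of i j] lt[of j i] that j(2) by (cases i j rule: linorder_cases) auto
        note iff = this
        show ?thesis
          unfolding set_take_nth[OF less_imp_le[OF j(2)]]
        proof (intro equalityI subsetI)
          fix w assume "w \<in> {w \<in> set vs. c \<bullet> w < c \<bullet> (vs ! j)}"
          then obtain i where "i < length vs" "w = vs ! i" "c \<bullet> (vs ! i) < c \<bullet> (vs ! j)"
            by (auto simp: in_set_conv_nth)
          then show "w \<in> (!) vs ` {..<j}" using iff by simp
        next
          fix w assume "w \<in> (!) vs ` {..<j}"
          then obtain i where "i < j" "w = vs ! i" by auto
          then show "w \<in> {w \<in> set vs. c \<bullet> w < c \<bullet> (vs ! j)}" using iff j(2) by simp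
        qed
      qed
      finally have early: "{w \<in> vertices P. c \<bullet> w < c \<bullet> (vs ! j)} = set (take j vs)" .
      have "take j vs ~= []" using j by auto
      then have "hd (take j vs) \<in> set (take j vs)" by (rule hd_in_set)
      then have ex: "\<exists>w\<in>vertices P. c \<bullet> w < c \<bullet> (vs ! j)" unfolding early[symmetric] by blast
      from main[OF vj] obtain Ks r where K: "dshell (pf P) {vs ! j} Ks" "r \<le> length Ks"
        "(\<exists>w\<in>vertices P. c \<bullet> w < c \<bullet> (vs ! j)) --> 1 \<le> r"
        "\<forall>X\<in>pf P. vs ! j \<in> X --> ((\<exists>w\<in>vertices P. c \<bullet> w < c \<bullet> (vs ! j) \<and> w \<in> X) \<longleftrightarrow> (\<exists>k<r. Ks ! k \<subseteq> X))"
        by (elim exE conjE) (rule that)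
      show "vertex_step P (set (take j vs)) (vs ! j)"
      proof (rule vertex_stepI[OF K(1) _ K(2)])
        show "1 \<le> r" using K(3) ex by (rule mp)
        fix X assume X: "X \<in> pf P" "vs ! j \<in> X"
        have "(\<exists>u\<in>set (take j vs). u \<in> X) \<longleftrightarrow> (\<exists>w\<in>vertices P. c \<bullet> w < c \<bullet> (vs ! j) \<and> w \<in> X)"
          unfolding early[symmetric] by blast
        then show "(\<exists>u\<in>set (take j vs). u \<in> X) \<longleftrightarrow> (\<exists>k<r. Ks ! k \<subseteq> X)" using K(4) X by simp
      qed
    qed
  qed
qed

lemma dshell_exists:
  fixes P :: "'a::euclidean_space set"
  assumes "polytope P" "1 \<le> aff_dim P"
  shows "\<exists>Gs. dshell (pf P) {} Gs"
proof -
  obtain c where c: "inj_on (\<lambda>x. c \<bullet> x) (vertices P)"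
    using functional_perturb[OF finite_vertices[OF assms(1)]] by blast
  obtain vs where "distinct vs" "set vs = vertices P" "sorted_wrt (\<lambda>x y. c \<bullet> x < c \<bullet> y) vs"
    using sorted_by_functional[OF finite_vertices[OF assms(1)] c] by blast
  then show ?thesis using sweep_dshell[OF assms] by blast
qed

lemma dshell_vertex_exists:
  fixes P :: "'a::euclidean_space set"
  assumes "polytope P" "2 \<le> aff_dim P" "v \<in> vertices P"
  shows "\<exists>Gs. dshell (pf P) {v} Gs"
proof -
  obtain a b where "vertex_section P v a b" using vertex_section_exists[OF assms(1,3)] by blast
  then interpret vertex_section P v a b .
  have dT: "aff_dim P = aff_dim T + 1" using section_aff_dim[OF P_face vP] by (simp add: T_def)
  then have "1 \<le> aff_dim T" "T ~= {}" using assms(2) by auto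
  then show ?thesis using dshell_exists[OF polT] dshell_lift by blast
qed

lemma chained_take: "chained R xs ==> chained R (take r xs)"
  unfolding chained_def by (simp add: nth_take) fastforce

subsection \<open>Shellings at a vertex of a 4-polytope\<close>

locale vertex_of_4polytope =
  fixes P :: "'a::euclidean_space set" and w :: 'a
  assumes polP: "polytope P" and dimP: "aff_dim P = 4" and wV: "w \<in> vertices P"
begin

text \<open>The 2-sphere is the boundary of the facet dual to \<open>w\<close>: edges of
  \<open>P\<close> at \<open>w\<close> are its cells, 2-faces its edges and facets its
  vertices.\<close>

definition "X = {F. F face_of P \<and> w \<in> F \<and> aff_dim F = 1}"
definition "Y = {F. F face_of P \<and> w \<in> F \<and> aff_dim F = 2}"
definition "Z = {F. F face_of P \<and> w \<in> F \<and> aff_dim F = 3}"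

lemma w_face: "{w} face_of P" using wV by (simp add: vertices_face)

lemma P_face: "P face_of P" using polP polytope_imp_convex face_of_refl by blast

text \<open>All three incidence numbers are instances of the diamond property, with
  \<open>{w}\<close> as lower end for \<open>edge_X\<close> and \<open>P\<close> itself as upper end
  for \<open>edge_Z\<close>.\<close>

sublocale surface X Y Z
proof
  have fin: "finite {F. F face_of P}" using finite_polytope_faces[OF polP] .
  show "finite X" "finite Y" "finite Z"
    unfolding X_def Y_def Z_def by (rule finite_subset[OF _ fin], blast)+
  fix y assume y: "y \<in> Y"
  have "{x \<in> X. x \<subseteq> y} = {H. H face_of P \<and> {w} \<subseteq> H \<and> H \<subseteq> y \<and> aff_dim H = aff_dim {w} + 1}"
    by (auto simp: X_def)
  also have "card \<dots> = 2"
    by (rule diamond[OF polP w_face]) (use y in \<open>auto simp: Y_def\<close>)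
  finally show "card {x \<in> X. x \<subseteq> y} = 2" .
  have "{z \<in> Z. y \<subseteq> z} = {H. H face_of P \<and> y \<subseteq> H \<and> H \<subseteq> P \<and> aff_dim H = aff_dim y + 1}"
  proof
    show "{z \<in> Z. y \<subseteq> z} \<subseteq> {H. H face_of P \<and> y \<subseteq> H \<and> H \<subseteq> P \<and> aff_dim H = aff_dim y + 1}"
      using y by (auto simp: Y_def Z_def dest: face_of_imp_subset)
    show "{H. H face_of P \<and> y \<subseteq> H \<and> H \<subseteq> P \<and> aff_dim H = aff_dim y + 1} \<subseteq> {z \<in> Z. y \<subseteq> z}"
      using y by (auto simp: Y_def Z_def)
  qed
  also have "card \<dots> = 2"
    by (rule diamond[OF polP _ P_face]) (use y dimP in \<open>auto simp: Y_def dest: face_of_imp_subset\<close>)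
  finally show "card {z \<in> Z. y \<subseteq> z} = 2" .
next
  fix x z assume xz: "x \<in> X" "z \<in> Z" "x \<subseteq> z"
  have "{y \<in> Y. x \<subseteq> y \<and> y \<subseteq> z} = {H. H face_of P \<and> x \<subseteq> H \<and> H \<subseteq> z \<and> aff_dim H = aff_dim x + 1}"
  proof
    show "{y \<in> Y. x \<subseteq> y \<and> y \<subseteq> z} \<subseteq> {H. H face_of P \<and> x \<subseteq> H \<and> H \<subseteq> z \<and> aff_dim H = aff_dim x + 1}"
      using xz by (auto simp: X_def Y_def)
    show "{H. H face_of P \<and> x \<subseteq> H \<and> H \<subseteq> z \<and> aff_dim H = aff_dim x + 1} \<subseteq> {y \<in> Y. x \<subseteq> y \<and> y \<subseteq> z}"
      using xz by (auto simp: X_def Y_def)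
  qed
  also have "card \<dots> = 2"
    by (rule diamond[OF polP]) (use xz in \<open>auto simp: X_def Z_def\<close>)
  finally show "card {y \<in> Y. x \<subseteq> y \<and> y \<subseteq> z} = 2" .
qed

lemma dim_less: "F \<in> pf P ==> aff_dim F < 4"
  using face_of_aff_dim_lt[OF polytope_imp_convex[OF polP], of F] dimP by (auto simp: pf_def)

lemma in_pf: "F face_of P ==> aff_dim F < 4 ==> F \<in> pf P"
  using dimP by (auto simp: pf_def)

lemma same_dim: "F face_of P ==> H face_of P ==> F \<subseteq> H ==> aff_dim F = aff_dim H ==> F = H"
  using face_of_aff_dim_lt[of H F] face_of_subset[of F P H] face_of_imp_subset[of H P] face_of_imp_convex[of H P]
  by fastforce

lemma cov_w: "cov (pf P) {w} = X"
  unfolding cov_pf[OF polP w_face] by (auto simp: X_def pf_def dimP)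

lemma cov_X: "x \<in> X ==> cov (pf P) x = Ed {x}"
  unfolding Ed_def by (subst cov_pf[OF polP]) (auto simp: X_def Y_def pf_def dimP)

lemma cov_Y: "y \<in> Y ==> cov (pf P) y = {z \<in> Z. y \<subseteq> z}"
  by (subst cov_pf[OF polP]) (auto simp: Y_def Z_def pf_def dimP)

lemma cov_Z: "z \<in> Z ==> cov (pf P) z = {}"
  using dim_less by (subst cov_pf[OF polP]) (fastforce simp: Z_def)+

lemma Ed_nonempty:
  assumes "x \<in> X"
  shows "Ed {x} ~= {}"
proof -
  have x: "x face_of P" "x ~= {}" "x ~= P" using assms dimP by (auto simp: X_def)
  obtain H where H: "H face_of P" "x facet_of H" using face_between_facet[OF polP x] by blast
  have xH: "x \<subseteq> H" by (rule facet_of_imp_subset[OF H(2)])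
  have "w \<in> H" "aff_dim H = 2" using assms xH H(2) by (auto simp: X_def facet_of_def)
  then have "H \<in> Y" using H(1) by (simp add: Y_def)
  then have "H \<in> Ed {x}" using xH by (simp add: Ed_def)
  then show ?thesis by blast
qed

text \<open>A shelling of a polygon is a connected enumeration of its edges, since meeting the
  earlier edges in a nonempty set of end points is all that is demanded.\<close>

lemma dshell_edge_chained:
  assumes x: "x \<in> X" and d: "dshell (pf P) x Ks"
  shows "chained shareZ Ks \<and> distinct Ks \<and> set Ks = Ed {x}"
proof -
  have s: "set Ks = Ed {x}" using dshell_set[OF d] cov_X[OF x] by simp
  have "chained shareZ Ks"
    using d
  proof cases
    case points
    then have "Ks = []"
    proof -
      have "cov (pf P) y ~= {}" if "y \<in> set Ks" for y
      proof -
        have "y \<in> Y" using that s by (auto simp: Ed_def)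
        then have "card (cov (pf P) y) = 2" using cov_Y edge_Z by simp
        then show ?thesis by auto
      qed
      then show ?thesis using points(3) by (metis last_in_set)
    qed
    then show ?thesis by simp
  next
    case (step Hs)
    show ?thesis unfolding chained_def
    proof (intro allI impI)
      fix j assume j: "j < length Ks" "0 < j"
      then have "\<exists>Zs r. dshell (pf P) (Ks ! j) Zs \<and> 1 \<le> r \<and> r \<le> length Zs \<and>
          (\<forall>X\<in>pf P. Ks ! j \<subseteq> X --> ((\<exists>i<j. Ks ! i \<subseteq> X) \<longleftrightarrow> (\<exists>k<r. Zs ! k \<subseteq> X)))"
        using step(5) by blast
      then obtain Zs r where Zs: "dshell (pf P) (Ks ! j) Zs" "1 \<le> r" "r \<le> length Zs"
          "\<forall>X\<in>pf P. Ks ! j \<subseteq> X --> ((\<exists>i<j. Ks ! i \<subseteq> X) \<longleftrightarrow> (\<exists>k<r. Zs ! k \<subseteq> X))"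
        by (elim exE conjE) (rule that)
      have yj: "Ks ! j \<in> Y" using j s nth_mem[of j Ks] by (auto simp: Ed_def)
      \<comment> \<open>As \<open>1 \<le> r\<close>, the first end point in the list is one that an
        earlier edge has reached.\<close>
      have "Zs ! 0 \<in> set Zs" using Zs by (intro nth_mem) linarith
      then have z: "Zs ! 0 \<in> Z" "Ks ! j \<subseteq> Zs ! 0" using dshell_set[OF Zs(1)] cov_Y[OF yj] by auto
      then have "Zs ! 0 \<in> pf P" by (intro in_pf) (auto simp: Z_def)
      moreover have "\<exists>k<r. Zs ! k \<subseteq> Zs ! 0" using Zs(2) by (intro exI[of _ 0]) auto
      ultimately have "\<exists>i<j. Ks ! i \<subseteq> Zs ! 0" using Zs(4) z(2) by simp
      then show "\<exists>i<j. shareZ (Ks ! i) (Ks ! j)" using z by (auto simp: shareZ_def)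
    qed
  qed
  then show ?thesis using s dshell_distinct[OF d] by blast
qed

lemma dshell_Y:
  assumes "y \<in> Y" "distinct Zs" "set Zs = {z \<in> Z. y \<subseteq> z}"
  shows "dshell (pf P) y Zs"
  by (rule dshell.points) (use assms cov_Y cov_Z in auto)

text \<open>The end points of an edge may be listed in any order, so those already reached
  (\<open>Q\<close>) are put first.\<close>

lemma chained_dshell_edge:
  assumes x: "x \<in> X" and K: "chained shareZ Ks" "distinct Ks" "set Ks = Ed {x}"
  shows "dshell (pf P) x Ks"
proof -
  have KY: "Ks ! j \<in> Y" if "j < length Ks" for j using that K(3) nth_mem[of j Ks] by (auto simp: Ed_def)
  have ne: "Ks ~= []" using K(3) Ed_nonempty[OF x] by auto
  have fin: "finite {z \<in> Z. y \<subseteq> z}" for y using finZ by simp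
  obtain Zh where "distinct Zh" "set Zh = {z \<in> Z. Ks ! 0 \<subseteq> z}" using finite_distinct_list[OF fin] by blast
  then have hd: "dshell (pf P) (hd Ks) Zh" using dshell_Y KY[of 0] ne by (simp add: hd_conv_nth)
  show ?thesis
  proof (rule dshell.step[OF K(2) _ ne hd])
    show "set Ks = cov (pf P) x" using K(3) cov_X[OF x] by simp
    show "\<forall>j. 0 < j \<and> j < length Ks -->
       (\<exists>Zs r. dshell (pf P) (Ks ! j) Zs \<and> 1 \<le> r \<and> r \<le> length Zs \<and>
          (\<forall>X\<in>pf P. Ks ! j \<subseteq> X --> ((\<exists>i<j. Ks ! i \<subseteq> X) \<longleftrightarrow> (\<exists>k<r. Zs ! k \<subseteq> X))))"
    proof (intro allI impI)
      fix j assume j: "0 < j \<and> j < length Ks"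
      define Q where "Q = {z \<in> Z. Ks ! j \<subseteq> z \<and> (\<exists>i<j. Ks ! i \<subseteq> z)}"
      define Q' where "Q' = {z \<in> Z. Ks ! j \<subseteq> z} - Q"
      have "finite Q" "finite Q'" using finZ by (auto simp: Q_def Q'_def)
      then obtain qs qs' where qs: "distinct qs" "set qs = Q" "distinct qs'" "set qs' = Q'"
        using finite_distinct_list by metis
      have "Q ~= {}" using K(1) j unfolding chained_def shareZ_def Q_def by blast
      then have l: "1 \<le> length qs" using qs(2) by (cases qs) auto
      have d: "dshell (pf P) (Ks ! j) (qs @ qs')"
        by (rule dshell_Y[OF KY]) (use j qs in \<open>auto simp: Q_def Q'_def\<close>)
      show "\<exists>Zs r. dshell (pf P) (Ks ! j) Zs \<and> 1 \<le> r \<and> r \<le> length Zs \<and>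
          (\<forall>X\<in>pf P. Ks ! j \<subseteq> X --> ((\<exists>i<j. Ks ! i \<subseteq> X) \<longleftrightarrow> (\<exists>k<r. Zs ! k \<subseteq> X)))"
      proof (intro exI[of _ "qs @ qs'"] exI[of _ "length qs"] conjI ballI impI)
        show "dshell (pf P) (Ks ! j) (qs @ qs')" by (rule d)
        show "1 \<le> length qs" by (rule l)
        show "length qs \<le> length (qs @ qs')" by simp
        fix F assume F: "F \<in> pf P" "Ks ! j \<subseteq> F"
        have yj: "Ks ! j \<in> Y" using KY j by blast
        have Ff: "F face_of P" "w \<in> F" using F yj by (auto simp: pf_def Y_def)
        have "(\<exists>k<length qs. (qs @ qs') ! k \<subseteq> F) \<longleftrightarrow> (\<exists>z\<in>Q. z \<subseteq> F)"
        proof -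
          have "Q = (\<lambda>k. (qs @ qs') ! k) ` {..<length qs}"
            unfolding qs(2)[symmetric] using set_take_nth[of "length qs" "qs @ qs'"] by simp
          then show ?thesis by (simp add: Bex_def)
        qed
        also have "\<dots> \<longleftrightarrow> (\<exists>i<j. Ks ! i \<subseteq> F)"
        proof (cases "aff_dim F = 3")
          case True
          then have FZ: "F \<in> Z" using Ff by (simp add: Z_def)
          have "z = F" if "z \<in> Q" "z \<subseteq> F" for z
            using same_dim[of z F] that FZ by (auto simp: Q_def Z_def)
          then have "(\<exists>z\<in>Q. z \<subseteq> F) \<longleftrightarrow> F \<in> Q" by blast
          then show ?thesis using FZ F(2) by (simp add: Q_def)
        next
          case False
          have "aff_dim F = 2"
            using False dim_less[OF F(1)] aff_dim_subset[OF F(2)] yj by (simp add: Y_def)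
          then have eq: "Ks ! j = F" using same_dim[OF _ Ff(1) F(2)] yj by (simp add: Y_def)
          have "\<not> z \<subseteq> F" if "z \<in> Q" for z
            using aff_dim_subset[of z F] that \<open>aff_dim F = 2\<close> by (auto simp: Q_def Z_def)
          moreover have "\<not> Ks ! i \<subseteq> F" if "i < j" for i
          proof
            assume "Ks ! i \<subseteq> F"
            moreover have "Ks ! i \<in> Y" using KY that j by simp
            ultimately have "Ks ! i = F" using same_dim[of "Ks ! i" F] Ff(1) \<open>aff_dim F = 2\<close> by (simp add: Y_def)
            then have "Ks ! i = Ks ! j" using eq by simp
            then show False using K(2) that j by (simp add: nth_eq_iff_index_eq)
          qed
          ultimately show ?thesis by blast
        qed
        finally show "(\<exists>i<j. Ks ! i \<subseteq> F) \<longleftrightarrow> (\<exists>k<length qs. (qs @ qs') ! k \<subseteq> F)" by simp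
      qed
    qed
  qed
qed

lemma prefix_sub_iff:
  assumes "r \<le> length Ks" "set Ks \<subseteq> Y" "y \<in> Y"
  shows "(\<exists>k<r. Ks ! k \<subseteq> y) \<longleftrightarrow> y \<in> set (take r Ks)"
proof -
  have "Ks ! k \<subseteq> y \<longleftrightarrow> Ks ! k = y" if "k < r" for k
  proof -
    have "Ks ! k \<in> Y" using that assms nth_mem[of k Ks] by auto
    then show ?thesis using same_dim[of "Ks ! k" y] assms(3) by (auto simp: Y_def)
  qed
  then show ?thesis unfolding set_take_nth[OF assms(1)] by (auto simp: image_iff)
qed

text \<open>Tested on 2-faces, the equivalence identifies the common edges with the initial piece.
  Tested on facets, it rules out isolated common vertices.\<close>

lemma arc_of_dshell:
  assumes j: "x \<in> X" "dshell (pf P) x Ks" "1 \<le> r" "r \<le> length Ks" and C: "C \<subseteq> X" "x \<notin> C"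
    and eq: "\<And>F. F \<in> Y \<union> Z ==> x \<subseteq> F ==> (\<exists>u\<in>C. u \<subseteq> F) \<longleftrightarrow> (\<exists>k<r. Ks ! k \<subseteq> F)"
  shows "arc C x"
proof -
  have K: "chained shareZ Ks" "distinct Ks" "set Ks = Ed {x}" using dshell_edge_chained[OF j(1,2)] by auto
  have KY: "set Ks \<subseteq> Y" using K(3) by (auto simp: Ed_def)
  have I: "set (take r Ks) = Ed C \<inter> Ed {x}"
  proof
    show "set (take r Ks) \<subseteq> Ed C \<inter> Ed {x}"
    proof
      fix y assume y: "y \<in> set (take r Ks)"
      then have yx: "y \<in> Ed {x}" using K(3) set_take_subset by fastforce
      then have yY: "y \<in> Y" "x \<subseteq> y" by (auto simp: Ed_def)
      then have "\<exists>u\<in>C. u \<subseteq> y" using eq[of y] prefix_sub_iff[OF j(4) KY yY(1)] y by blast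
      then show "y \<in> Ed C \<inter> Ed {x}" using yx yY by (auto simp: Ed_def)
    qed
    show "Ed C \<inter> Ed {x} \<subseteq> set (take r Ks)"
    proof
      fix y assume "y \<in> Ed C \<inter> Ed {x}"
      then have yY: "y \<in> Y" "x \<subseteq> y" "\<exists>u\<in>C. u \<subseteq> y" by (auto simp: Ed_def)
      then show "y \<in> set (take r Ks)" using eq[of y] prefix_sub_iff[OF j(4) KY yY(1)] by blast
    qed
  qed
  have "take r Ks ~= []" using j(3,4) by auto
  then have "Ed C \<inter> Ed {x} ~= {}" unfolding I[symmetric] by simp
  moreover have "Pt C \<inter> Pt {x} \<subseteq> Pe (Ed C \<inter> Ed {x})"
  proof
    fix z assume "z \<in> Pt C \<inter> Pt {x}"
    then have z: "z \<in> Z" "x \<subseteq> z" "\<exists>u\<in>C. u \<subseteq> z" by (auto simp: Pt_def)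
    then obtain k where k: "k < r" "Ks ! k \<subseteq> z" using eq[of z] by blast
    then have "Ks ! k \<in> set (take r Ks)" using set_take_nth[OF j(4)] by blast
    then show "z \<in> Pe (Ed C \<inter> Ed {x})" using k z I by (auto simp: Pe_def)
  qed
  moreover have "chained shareZ (take r Ks)" "distinct (take r Ks)" using K chained_take by auto
  ultimately show ?thesis using I unfolding arc_def by blast
qed

lemma dshell_vertex_pshell:
  assumes d: "dshell (pf P) {w} Gs"
  shows "pshell Gs \<and> set Gs = X"
proof -
  have s: "set Gs = X" using dshell_set[OF d] cov_w by simp
  have dist: "distinct Gs" using dshell_distinct[OF d] .
  have "\<forall>j<length Gs. 0 < j --> arc (set (take j Gs)) (Gs ! j)"
    using d
  proof cases
    case points
    have "Gs = []"
    proof (rule ccontr)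
      assume "Gs ~= []"
      then have "hd Gs \<in> X" using s hd_in_set by blast
      then have "cov (pf P) (hd Gs) ~= {}" using cov_X Ed_nonempty by simp
      then show False using points(3) hd_in_set[OF \<open>Gs ~= []\<close>] by blast
    qed
    then show ?thesis by simp
  next
    case (step Hs)
    show ?thesis
    proof (intro allI impI)
      fix j assume j: "j < length Gs" "0 < j"
      then have "\<exists>Ks r. dshell (pf P) (Gs ! j) Ks \<and> 1 \<le> r \<and> r \<le> length Ks \<and>
          (\<forall>X\<in>pf P. Gs ! j \<subseteq> X --> ((\<exists>i<j. Gs ! i \<subseteq> X) \<longleftrightarrow> (\<exists>k<r. Ks ! k \<subseteq> X)))"
        using step(5) by blast
      then obtain Ks r where Ks: "dshell (pf P) (Gs ! j) Ks" "1 \<le> r" "r \<le> length Ks"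
          "\<forall>X\<in>pf P. Gs ! j \<subseteq> X --> ((\<exists>i<j. Gs ! i \<subseteq> X) \<longleftrightarrow> (\<exists>k<r. Ks ! k \<subseteq> X))"
        by (elim exE conjE) (rule that)
      have tk: "set (take j Gs) = (\<lambda>i. Gs ! i) ` {..<j}" by (rule set_take_nth) (use j in simp)
      show "arc (set (take j Gs)) (Gs ! j)"
      proof (rule arc_of_dshell[OF _ Ks(1-3)])
        show "Gs ! j \<in> X" using s j nth_mem by blast
        show "set (take j Gs) \<subseteq> X" using s set_take_subset by fastforce
        show "Gs ! j \<notin> set (take j Gs)"
          unfolding tk using dist j by (auto simp: nth_eq_iff_index_eq)
        fix F assume F: "F \<in> Y \<union> Z" "Gs ! j \<subseteq> F"
        then have "F \<in> pf P" by (intro in_pf) (auto simp: Y_def Z_def)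
        then show "(\<exists>u\<in>set (take j Gs). u \<subseteq> F) \<longleftrightarrow> (\<exists>k<r. Ks ! k \<subseteq> F)"
          using Ks(4) F(2) unfolding tk by (simp add: Bex_def)
      qed
    qed
  qed
  then show ?thesis using s dist by (simp add: pshell_def)
qed

text \<open>Some shelling at \<open>w\<close> exists, and it contains a shelling of each of its
  cells.\<close>

lemma polygonal_X: "x \<in> X ==> polygonal x"
proof -
  assume x: "x \<in> X"
  obtain Gs where d: "dshell (pf P) {w} Gs" using dshell_vertex_exists[OF polP _ wV] dimP by auto
  have s: "set Gs = X" using dshell_set[OF d] cov_w by simp
  have "\<exists>Ks. dshell (pf P) x Ks"
    using d
  proof cases
    case points
    then have "cov (pf P) x = {}" using x s by blast
    then show ?thesis using cov_X[OF x] Ed_nonempty[OF x] by simp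
  next
    case (step Hs)
    obtain j where j: "j < length Gs" "Gs ! j = x" using x s by (metis in_set_conv_nth)
    show ?thesis
    proof (cases "j = 0")
      case True
      then show ?thesis using step(3,4) j by (metis hd_conv_nth)
    next
      case False
      then have "\<exists>Ks r. dshell (pf P) (Gs ! j) Ks \<and> 1 \<le> r \<and> r \<le> length Ks \<and>
          (\<forall>X\<in>pf P. Gs ! j \<subseteq> X --> ((\<exists>i<j. Gs ! i \<subseteq> X) \<longleftrightarrow> (\<exists>k<r. Ks ! k \<subseteq> X)))"
        using step(5) j(1) by blast
      then show ?thesis using j(2) by blast
    qed
  qed
  then show "polygonal x" using dshell_edge_chained[OF x] unfolding polygonal_def by blast
qed

text \<open>The list required for a cell starts with its arc of common edges. It can be continued
  around the polygon because no proper part of a polygonal boundary is closed.\<close>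

lemma pshell_dshell_vertex:
  assumes G: "pshell Gs" "set Gs = X"
  shows "dshell (pf P) {w} Gs"
proof -
  have dist: "distinct Gs" using G by (simp add: pshell_def)
  have GX: "Gs ! j \<in> X" if "j < length Gs" for j using that G(2) nth_mem by blast
  have "X ~= {}"
  proof -
    have "{w} face_of P" "{w} ~= P" using w_face dimP by auto
    then obtain H where H: "H face_of P" "{w} facet_of H" using face_between_facet[OF polP, of "{w}"] by blast
    then have "H \<in> X" using facet_of_imp_subset[OF H(2)] by (auto simp: X_def facet_of_def)
    then show ?thesis by blast
  qed
  then have ne: "Gs ~= []" using G(2) by auto
  obtain Ks0 where "chained shareZ Ks0" "distinct Ks0" "set Ks0 = Ed {Gs ! 0}"
    using polygonal_X[OF GX[of 0]] ne by (auto simp: polygonal_def)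
  then have hd: "dshell (pf P) (hd Gs) Ks0"
    using chained_dshell_edge GX[of 0] ne by (simp add: hd_conv_nth)
  show ?thesis
  proof (rule dshell.step[OF dist _ ne hd])
    show "set Gs = cov (pf P) {w}" using G cov_w by simp
    show "\<forall>j. 0 < j \<and> j < length Gs -->
       (\<exists>Ks r. dshell (pf P) (Gs ! j) Ks \<and> 1 \<le> r \<and> r \<le> length Ks \<and>
          (\<forall>X\<in>pf P. Gs ! j \<subseteq> X --> ((\<exists>i<j. Gs ! i \<subseteq> X) \<longleftrightarrow> (\<exists>k<r. Ks ! k \<subseteq> X))))"
    proof (intro allI impI)
      fix j assume j: "0 < j \<and> j < length Gs"
      define x where "x = Gs ! j"
      define C where "C = set (take j Gs)"
      have x: "x \<in> X" using GX j by (simp add: x_def)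
      have tk: "C = (\<lambda>i. Gs ! i) ` {..<j}" unfolding C_def by (rule set_take_nth) (use j in simp)
      have CX: "C \<subseteq> X" using G(2) set_take_subset unfolding C_def by fastforce
      have xC: "x \<notin> C" unfolding tk x_def using dist j by (auto simp: nth_eq_iff_index_eq)
      have "arc C x" using G(1) j unfolding pshell_def C_def x_def by blast
      then obtain Is where Is: "chained shareZ Is" "distinct Is" "set Is = Ed C \<inter> Ed {x}"
        and ne: "Ed C \<inter> Ed {x} ~= {}" and Pe: "Pt C \<inter> Pt {x} \<subseteq> Pe (Ed C \<inter> Ed {x})"
        unfolding arc_def by blast
      have "\<exists>ys. chained shareZ (Is @ ys) \<and> distinct (Is @ ys) \<and> set (Is @ ys) = Ed {x}"
      proof (rule chained_extend[OF finEd Is(1,2)])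
        show "set Is \<subseteq> Ed {x}" using Is(3) by blast
        fix D assume D: "set Is \<subseteq> D" "D ~= {}" "D \<subset> Ed {x}"
        show "\<exists>u\<in>D. \<exists>v\<in>Ed {x} - D. shareZ u v"
        proof (rule ccontr)
          assume no: "\<not> ?thesis"
          have "D = Ed {x}"
            by (rule polygonal_closed[OF polygonal_X[OF x]]) (use D no in \<open>auto simp: shareZ_def\<close>)
          then show False using D by blast
        qed
      qed
      then obtain ys where K: "chained shareZ (Is @ ys)" "distinct (Is @ ys)" "set (Is @ ys) = Ed {x}" by blast
      have d: "dshell (pf P) x (Is @ ys)" by (rule chained_dshell_edge[OF x K])
      have KY: "set (Is @ ys) \<subseteq> Y" unfolding K(3) by (auto simp: Ed_def)
      show "\<exists>Ks r. dshell (pf P) (Gs ! j) Ks \<and> 1 \<le> r \<and> r \<le> length Ks \<and>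
          (\<forall>X\<in>pf P. Gs ! j \<subseteq> X --> ((\<exists>i<j. Gs ! i \<subseteq> X) \<longleftrightarrow> (\<exists>k<r. Ks ! k \<subseteq> X)))"
      proof (intro exI[of _ "Is @ ys"] exI[of _ "length Is"] conjI ballI impI)
        show "dshell (pf P) (Gs ! j) (Is @ ys)" using d by (simp add: x_def)
        show "1 \<le> length Is" using Is(3) ne by (cases Is) auto
        show lI: "length Is \<le> length (Is @ ys)" by simp
        fix F assume F: "F \<in> pf P" "Gs ! j \<subseteq> F"
        have xF: "x \<subseteq> F" using F by (simp add: x_def)
        have Ff: "F face_of P" "w \<in> F" using F(1) xF x by (auto simp: pf_def X_def)
        have pre: "(\<exists>i<j. Gs ! i \<subseteq> F) \<longleftrightarrow> (\<exists>u\<in>C. u \<subseteq> F)" unfolding tk by (simp add: Bex_def)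
        have post: "(\<exists>k<length Is. (Is @ ys) ! k \<subseteq> F) \<longleftrightarrow> (\<exists>y\<in>Ed C \<inter> Ed {x}. y \<subseteq> F)"
        proof -
          have "Ed C \<inter> Ed {x} = (\<lambda>k. (Is @ ys) ! k) ` {..<length Is}"
            unfolding Is(3)[symmetric] using set_take_nth[OF lI] by simp
          then show ?thesis by (simp add: Bex_def)
        qed
        have "aff_dim F = 1 \<or> aff_dim F = 2 \<or> aff_dim F = 3"
          using dim_less[OF F(1)] aff_dim_subset[OF xF] x by (auto simp: X_def)
        then have "(\<exists>u\<in>C. u \<subseteq> F) \<longleftrightarrow> (\<exists>y\<in>Ed C \<inter> Ed {x}. y \<subseteq> F)"
        proof (elim disjE)
          assume F1: "aff_dim F = 1"
          then have "x = F" using same_dim[OF _ Ff(1) xF] x by (simp add: X_def)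
          moreover have "u = F" if "u \<in> C" "u \<subseteq> F" for u
            using same_dim[OF _ Ff(1) that(2)] that CX F1 by (auto simp: X_def)
          moreover have "\<not> y \<subseteq> F" if "y \<in> Y" for y
            using aff_dim_subset[of y F] that F1 by (auto simp: Y_def)
          ultimately show ?thesis using xC by (auto simp: Ed_def)
        next
          assume F2: "aff_dim F = 2"
          then have FY: "F \<in> Y" using Ff by (simp add: Y_def)
          have "y = F" if "y \<in> Y" "y \<subseteq> F" for y
            using same_dim[OF _ Ff(1) that(2)] that F2 by (auto simp: Y_def)
          then show ?thesis using FY xF by (auto simp: Ed_def)
        next
          assume F3: "aff_dim F = 3"
          then have FZ: "F \<in> Z" using Ff by (simp add: Z_def)
          show ?thesis
          proof
            assume "\<exists>u\<in>C. u \<subseteq> F"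
            then have "F \<in> Pt C \<inter> Pt {x}" using FZ xF by (auto simp: Pt_def)
            then show "\<exists>y\<in>Ed C \<inter> Ed {x}. y \<subseteq> F" using Pe by (auto simp: Pe_def)
          next
            assume "\<exists>y\<in>Ed C \<inter> Ed {x}. y \<subseteq> F"
            then obtain y u where "u \<in> C" "u \<subseteq> y" "y \<subseteq> F" by (auto simp: Ed_def)
            then show "\<exists>u\<in>C. u \<subseteq> F" by blast
          qed
        qed
        then show "(\<exists>i<j. Gs ! i \<subseteq> F) \<longleftrightarrow> (\<exists>k<length Is. (Is @ ys) ! k \<subseteq> F)"
          unfolding pre post .
      qed
    qed
  qed
qed

text \<open>One shelling at \<open>w\<close> exists by the sweep. It makes the link of
  \<open>w\<close> a \<open>sphere\<close>, in which any partial shelling can be completed.\<close>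

theorem dshell_vertex_extend:
  assumes "pshell B" "B ~= []"
  shows "\<exists>Gs. dshell (pf P) {w} (B @ Gs)"
proof -
  obtain Ls where d: "dshell (pf P) {w} Ls" using dshell_vertex_exists[OF polP _ wV] dimP by auto
  have L: "pshell Ls" "set Ls = X" using dshell_vertex_pshell[OF d] by auto
  interpret sphere X Y Z Ls by unfold_locales (use L polygonal_X in auto)
  show ?thesis using pshell_extend[OF assms] pshell_dshell_vertex by blast
qed

end

section \<open>Edges and adjacency\<close>

lemma adjacent_commute: "adjacent P u w \<longleftrightarrow> adjacent P w u"
  by (simp add: adjacent_def closed_segment_commute)

lemma adjacentD:
  fixes P :: "'a::euclidean_space set"
  assumes "adjacent P u w"
  shows "u ~= w" "u \<in> vertices P" "w \<in> vertices P" "closed_segment u w face_of P"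
proof -
  have e: "closed_segment u w face_of P" "aff_dim (closed_segment u w) = 1"
    using assms by (auto simp: adjacent_def edge_of_def)
  show "u ~= w" using e(2) by auto
  show "u \<in> vertices P" "w \<in> vertices P"
    using extreme_point_of_face[OF e(1)] by (auto simp: vertices_def extreme_point_of_segment)
  show "closed_segment u w face_of P" by (rule e(1))
qed

lemma aff_dim_closed_segment: "u ~= w ==> aff_dim (closed_segment u w) = 1"
  for u w :: "'a::euclidean_space"
  unfolding segment_convex_hull aff_dim_convex_hull aff_dim_2 by simp

lemma adjacentI: "u ~= w ==> closed_segment u w face_of P ==> adjacent P u w"
  by (simp add: adjacent_def edge_of_def aff_dim_closed_segment)

lemma edge_at_vertex:
  fixes P :: "'a::euclidean_space set"
  assumes "polytope P" "F face_of P" "aff_dim F = 1" "v \<in> vertices P" "v \<in> F"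
  shows "\<exists>w. adjacent P v w \<and> F = closed_segment v w"
proof -
  obtain x y where xy: "x ~= y" "F = closed_segment x y" "vertices F = {x, y}"
    using segment_vertices[OF face_of_polytope_polytope[OF assms(1,2)] assms(3)] by blast
  have "v \<in> vertices F" using vertices_of_face[OF assms(2)] assms(4,5) by blast
  then have "v = x \<or> v = y" using xy(3) by simp
  then show ?thesis
  proof
    assume "v = x"
    then show ?thesis using xy assms(2) adjacentI[of x y P] by auto
  next
    assume "v = y"
    then show ?thesis using xy assms(2) adjacentI[of y x P]
      by (intro exI[of _ x]) (simp add: closed_segment_commute)
  qed
qed

lemma edge_eq_vertices:
  fixes P :: "'a::euclidean_space set"
  assumes "polytope P" "F face_of P" "aff_dim F = 1" "x \<in> vertices P" "y \<in> vertices P" "x ~= y" "x \<in> F" "y \<in> F"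
  shows "F = closed_segment x y"
proof -
  obtain w where w: "adjacent P x w" "F = closed_segment x w"
    using edge_at_vertex[OF assms(1-3) assms(4,7)] by blast
  have "y \<in> vertices F" using vertices_of_face[OF assms(2)] assms by blast
  then have "y = x \<or> y = w" unfolding w(2) by (simp add: vertices_def extreme_point_of_segment)
  then show ?thesis using w assms(6) by auto
qed

subsection \<open>Truncation at a simple vertex\<close>

locale simple_cut = vertex_section P v a b
  for P :: "'a::euclidean_space set" and v a :: 'a and b :: real +
  fixes w1 w2 w3 w4 :: 'a
  assumes dimP: "aff_dim P = 4"
    and nbrs: "{w. adjacent P v w} = {w1, w2, w3, w4}"
    and distN: "distinct [w1, w2, w3, w4]"
    and below: "a \<bullet> w1 < b" "a \<bullet> w2 < b" and on: "a \<bullet> w3 = b" "a \<bullet> w4 = b"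
begin

definition "H = {x. a \<bullet> x = b}"
text \<open>The point where the edge from \<open>v\<close> to \<open>w\<close> meets the hyperplane.
  For \<open>w3\<close> and \<open>w4\<close> it is the neighbour itself.\<close>

definition uu :: "'a \<Rightarrow> 'a" where
  "uu w = v + ((a \<bullet> v - b) / (a \<bullet> v - a \<bullet> w)) *\<^sub>R (w - v)"
definition "u1 = uu w1"
definition "u2 = uu w2"

lemma adj_N: "w \<in> {w1, w2, w3, w4} ==> adjacent P v w" using nbrs by blast
lemma N_vert: "w \<in> {w1, w2, w3, w4} ==> w \<in> vertices P" by (rule adjacentD(3)[OF adj_N])
lemma N_neq: "w \<in> {w1, w2, w3, w4} ==> w ~= v" by (rule adjacentD(1)[OF adj_N, symmetric])
lemma N_le: "w \<in> {w1, w2, w3, w4} ==> a \<bullet> w \<le> b" by (rule others[OF N_vert N_neq])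

lemma uu_val: "a \<bullet> w \<le> b ==> a \<bullet> uu w = b"
proof -
  assume le: "a \<bullet> w \<le> b"
  define l where "l = (a \<bullet> v - b) / (a \<bullet> v - a \<bullet> w)"
  have "l * (a \<bullet> v - a \<bullet> w) = a \<bullet> v - b" using av le by (simp add: l_def)
  then show ?thesis by (simp add: uu_def l_def[symmetric] inner_add_right inner_diff_right algebra_simps)
qed

lemma seg_section:
  assumes "w \<in> {w1, w2, w3, w4}"
  shows "closed_segment v w \<inter> H = {uu w}"
proof -
  have le: "a \<bullet> w \<le> b" by (rule N_le[OF assms])
  define l where "l = (a \<bullet> v - b) / (a \<bullet> v - a \<bullet> w)"
  have l: "0 \<le> l" "l \<le> 1" using av le by (auto simp: l_def)
  have u: "uu w = (1 - l) *\<^sub>R v + l *\<^sub>R w" by (simp add: uu_def l_def algebra_simps)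
  show ?thesis
  proof
    show "{uu w} \<subseteq> closed_segment v w \<inter> H"
      using u l uu_val[OF le] by (auto simp: in_segment H_def)
    show "closed_segment v w \<inter> H \<subseteq> {uu w}"
    proof
      fix x assume "x \<in> closed_segment v w \<inter> H"
      then obtain t where t: "x = (1 - t) *\<^sub>R v + t *\<^sub>R w" "a \<bullet> x = b" by (auto simp: in_segment H_def)
      have "a \<bullet> x = (1 - t) * (a \<bullet> v) + t * (a \<bullet> w)" by (simp add: t(1) inner_add_right)
      then have "t * (a \<bullet> v - a \<bullet> w) = a \<bullet> v - b" using t(2) by (simp add: algebra_simps)
      then have "t = l" using av le by (simp add: l_def field_simps)
      then show "x \<in> {uu w}" using t u by simp
    qed
  qed
qed

lemma uu_on: "uu w3 = w3" "uu w4 = w4"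
  using av on by (auto simp: uu_def)

text \<open>Vertices of the section lift to edges at \<open>v\<close>, and these lead to the four
  neighbours.\<close>

lemma vertices_T: "vertices T = {u1, u2, w3, w4}"
proof -
  have "vertices T = uu ` {w1, w2, w3, w4}"
  proof
    show "vertices T \<subseteq> uu ` {w1, w2, w3, w4}"
    proof
      fix p assume "p \<in> vertices T"
      then have p: "{p} face_of T" by (simp add: vertices_face)
      note l = lift[OF p]
      have "aff_dim (lift {p}) = 1" using section_aff_dim[OF l(1,2)] l(3) by simp
      then obtain w where w: "adjacent P v w" "lift {p} = closed_segment v w"
        using edge_at_vertex[OF polP l(1) _ v l(2)] by blast
      then have N: "w \<in> {w1, w2, w3, w4}" using nbrs by blast
      have "{p} = {uu w}" using l(3) w(2) seg_section[OF N] by (simp add: H_def)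
      then show "p \<in> uu ` {w1, w2, w3, w4}" using N by blast
    qed
    show "uu ` {w1, w2, w3, w4} \<subseteq> vertices T"
    proof
      fix p assume "p \<in> uu ` {w1, w2, w3, w4}"
      then obtain w where w: "w \<in> {w1, w2, w3, w4}" "p = uu w" by blast
      have "closed_segment v w face_of P" using adj_N[OF w(1)] by (rule adjacentD(4))
      then have "closed_segment v w \<inter> H face_of T" using section_face by (simp add: H_def)
      then show "p \<in> vertices T" using seg_section[OF w(1)] w(2) by (simp add: vertices_face)
    qed
  qed
  then show ?thesis using uu_on by (simp add: u1_def u2_def)
qed

lemma uu_inj:
  assumes "w \<in> {w1, w2, w3, w4}" "w' \<in> {w1, w2, w3, w4}" "uu w = uu w'"
  shows "w = w'"
proof -
  note f = adjacentD(4)[OF adj_N[OF assms(1)]] adjacentD(4)[OF adj_N[OF assms(2)]]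
  have "closed_segment v w \<inter> H = closed_segment v w' \<inter> H"
    using seg_section[OF assms(1)] seg_section[OF assms(2)] assms(3) by simp
  then have "closed_segment v w = closed_segment v w'"
    using section_sub_iff[OF f(1) _ f(2)] section_sub_iff[OF f(2) _ f(1)] by (simp add: H_def)
  then show ?thesis by (auto simp: closed_segment_eq doubleton_eq_iff)
qed

lemma dist_T: "distinct [u1, u2, w3, w4]"
proof -
  have "inj_on uu (set [w1, w2, w3, w4])" by (rule inj_onI) (rule uu_inj, simp_all)
  then have "distinct (map uu [w1, w2, w3, w4])" using distN by (simp only: distinct_map)
  then show ?thesis by (simp add: u1_def u2_def uu_on)
qed

lemma dim_T: "aff_dim T = 3"
  using section_aff_dim[OF P_face vP] dimP by (simp add: T_def)

text \<open>Four points that span dimension three. So the new facet \<open>T\<close> is a simplex,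
  and every subset of its vertices spans a face.\<close>

lemma indep_T: "\<not> affine_dependent (vertices T)"
proof -
  have "aff_dim (vertices T) = 3"
    using dim_T polytope_hull_vertices[OF polT] by (metis aff_dim_convex_hull)
  moreover have "card (vertices T) = 4" using dist_T by (simp add: vertices_T)
  ultimately show ?thesis
    using finite_vertices[OF polT] by (simp add: affine_independent_iff_card)
qed

lemma T_hull: "T = convex hull {u1, u2, w3, w4}"
  using polytope_hull_vertices[OF polT] vertices_T by simp

lemma T_face_iff: "G face_of T \<longleftrightarrow> (\<exists>c. c \<subseteq> {u1, u2, w3, w4} \<and> G = convex hull c)"
  by (subst T_hull) (rule face_of_convex_hull_affine_independent[OF indep_T[unfolded vertices_T]])

lemma sub_simplex:
  assumes "c \<subseteq> {u1, u2, w3, w4}"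
  shows "vertices (convex hull c) = c" "aff_dim (convex hull c) = int (card c) - 1"
proof -
  have ind: "\<not> affine_dependent c"
    using affine_independent_subset[OF indep_T] assms by (simp add: vertices_T)
  then show "vertices (convex hull c) = c"
    by (auto simp: vertices_def extreme_point_of_convex_hull_affine_independent)
  show "aff_dim (convex hull c) = int (card c) - 1"
    using aff_dim_affine_independent[OF ind] by (simp add: aff_dim_convex_hull)
qed

definition tr :: "'a set \<Rightarrow> 'a set" where "tr F = F \<inter> {x. a \<bullet> x \<le> b}"

lemma tr_face: "F face_of P ==> tr F face_of tr P"
  unfolding tr_def by (rule face_of_slice) (auto simp: convex_halfspace_le)

lemma pol_tr: "polytope (tr P)"
  unfolding tr_def using polytope_Int_polyhedron[OF polP polyhedron_halfspace_le] .

lemma T_face_tr: "T face_of tr P"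
proof -
  have "T = tr P \<inter> {x. a \<bullet> x = b}" by (auto simp: T_def tr_def)
  moreover have "tr P \<inter> {x. a \<bullet> x = b} face_of tr P"
    by (rule face_of_Int_supporting_hyperplane_le) (use polytope_imp_convex[OF pol_tr] in \<open>auto simp: tr_def\<close>)
  ultimately show ?thesis by simp
qed

lemma tr_notin: 
  assumes "F face_of P" "v \<notin> F"
  shows "tr F = F"
proof -
  have "F \<subseteq> {x. a \<bullet> x \<le> b}"
  proof
    fix x assume x: "x \<in> F"
    have pF: "polytope F" by (rule face_of_polytope_polytope[OF polP assms(1)])
    have "(- a) \<bullet> x \<ge> - b"
    proof (rule affine_bound_vertices[OF pF x])
      fix w assume "w \<in> vertices F"
      then have "w \<in> vertices P" "w ~= v" using vertices_of_face[OF assms(1)] assms(2) by auto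
      then show "(- a) \<bullet> w \<ge> - b" using others by simp
    qed
    then show "x \<in> {x. a \<bullet> x \<le> b}" by simp
  qed
  then show ?thesis by (auto simp: tr_def)
qed

text \<open>These faces keep their dimension under \<open>tr\<close>, whereas any other face is cut
  down to a part of \<open>T\<close>.\<close>

definition low :: "'a set \<Rightarrow> bool" where "low F \<longleftrightarrow> (\<exists>x\<in>F. a \<bullet> x < b)"

lemma rel_interior_tr:
  assumes "convex F" "x \<in> rel_interior F" "a \<bullet> x < b"
  shows "x \<in> rel_interior (tr F)"
proof -
  have "rel_interior {x. a \<bullet> x \<le> b} \<supseteq> {x. a \<bullet> x < b}"
    using interior_subset_rel_interior[of "{x. a \<bullet> x \<le> b}"] open_halfspace_lt[of a b]
      interior_maximal[of "{x. a \<bullet> x < b}" "{x. a \<bullet> x \<le> b}"] by fastforce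
  then have x: "x \<in> rel_interior F \<inter> rel_interior {x. a \<bullet> x \<le> b}" using assms by blast
  have "rel_interior (tr F) = rel_interior F \<inter> rel_interior {x. a \<bullet> x \<le> b}"
    unfolding tr_def by (rule convex_rel_interior_inter_two) (use assms(1) x convex_halfspace_le in auto)
  then show ?thesis using x by simp
qed

text \<open>On the way from a point \<open>y\<close> below the hyperplane to a relative interior
  point, all points after \<open>y\<close> are relatively interior, and the first of them are still
  below.\<close>

lemma low_rel_interior:
  assumes "convex F" "low F"
  obtains x where "x \<in> rel_interior F" "a \<bullet> x < b"
proof -
  obtain y where y: "y \<in> F" "a \<bullet> y < b" using assms by (auto simp: low_def)
  then obtain z where z: "z \<in> rel_interior F" using rel_interior_eq_empty[OF assms(1)] by blast
  have "eventually (\<lambda>t. a \<bullet> y + t * (a \<bullet> z - a \<bullet> y) < b) (at_right 0)"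
  proof -
    have "((\<lambda>t. a \<bullet> y + t * (a \<bullet> z - a \<bullet> y)) \<longlongrightarrow> a \<bullet> y + 0 * (a \<bullet> z - a \<bullet> y)) (at_right 0)"
      by (intro tendsto_intros)
    then show ?thesis using y order_tendstoD(2)[of _ "a \<bullet> y" _ b] by simp
  qed
  moreover have "eventually (\<lambda>t. t \<in> {0<..<1}) (at_right (0::real))" by (rule eventually_at_right_real) simp
  ultimately have "eventually (\<lambda>t. t \<in> {0<..<1} \<and> a \<bullet> y + t * (a \<bullet> z - a \<bullet> y) < b) (at_right 0)"
    by eventually_elim simp
  then have "\<exists>t. t \<in> {0<..<1} \<and> a \<bullet> y + t * (a \<bullet> z - a \<bullet> y) < b"
    by (rule eventually_happens'[OF trivial_limit_at_right_real])
  then obtain t where t: "0 < t" "t < 1" "a \<bullet> y + t * (a \<bullet> z - a \<bullet> y) < b" by auto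
  define x where "x = y - t *\<^sub>R (y - z)"
  have "x \<in> rel_interior F" unfolding x_def
    by (rule rel_interior_convex_shrink[OF assms(1) z y(1)]) (use t in auto)
  moreover have "a \<bullet> x < b" using t(3) by (simp add: x_def inner_diff_right algebra_simps)
  ultimately show thesis using that by blast
qed

text \<open>For a \<open>low\<close> face some relative interior point survives the cut, and one
  such point decides whether a face contains \<open>F\<close>.\<close>

lemma tr_sub_iff:
  assumes "F face_of P" "F' face_of P" "low F"
  shows "tr F \<subseteq> tr F' \<longleftrightarrow> F \<subseteq> F'"
proof
  assume L: "tr F \<subseteq> tr F'"
  obtain x where x: "x \<in> rel_interior F" "a \<bullet> x < b"
    using low_rel_interior[OF face_of_imp_convex[OF assms(1)] assms(3)] by blast
  then have "x \<in> tr F" using rel_interior_subset by (auto simp: tr_def)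
  then have "x \<in> F'" using L by (auto simp: tr_def)
  then show "F \<subseteq> F'"
    using subset_of_face_of[OF assms(2) face_of_imp_subset[OF assms(1)]] x by blast
qed (auto simp: tr_def)

lemma tr_aff_dim:
  assumes "convex F" "low F"
  shows "aff_dim (tr F) = aff_dim F"
proof -
  obtain y where y: "y \<in> F" "a \<bullet> y < b" using assms by (auto simp: low_def)
  have "affine hull (F \<inter> {x. a \<bullet> x < b}) = affine hull F"
    by (rule affine_hull_convex_Int_open[OF assms(1) open_halfspace_lt]) (use y in auto)
  moreover have "F \<inter> {x. a \<bullet> x < b} \<subseteq> tr F" "tr F \<subseteq> F" by (auto simp: tr_def)
  ultimately show ?thesis by (metis aff_dim_affine_hull aff_dim_subset antisym)
qed

text \<open>A face that goes below the hyperplane has a relative interior point there. Around it the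
  cut has no effect, so the face is the cut of the face of \<open>P\<close> with that point in its
  relative interior.\<close>

lemma tr_face_cases:
  assumes G: "G face_of tr P"
  shows "G face_of T \<or> (\<exists>F. F face_of P \<and> low F \<and> G = tr F)"
proof (cases "low G")
  case False
  have "G \<subseteq> T"
    using False face_of_imp_subset[OF G] unfolding low_def T_def tr_def by force
  then show ?thesis using face_of_subset[OF G _ face_of_imp_subset[OF T_face_tr]] by blast
next
  case True
  obtain x where x: "x \<in> rel_interior G" "a \<bullet> x < b"
    using low_rel_interior[OF face_of_imp_convex[OF G] True] by blast
  have xP: "x \<in> P" using x rel_interior_subset face_of_imp_subset[OF G] by (auto simp: tr_def)
  obtain F where F: "F face_of P" "x \<in> rel_interior F"
    using face_rel_interior_exists[OF polytope_imp_polyhedron[OF polP] xP] by blast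
  have "x \<in> rel_interior (tr F)" using rel_interior_tr[OF face_of_imp_convex[OF F(1)] F(2) x(2)] .
  then have "G = tr F" using face_of_eq[OF G tr_face[OF F(1)]] x by blast
  moreover have "low F" using F(2) x(2) rel_interior_subset by (auto simp: low_def)
  ultimately show ?thesis using F(1) by blast
qed

lemma open_uu:
  assumes "w = w1 \<or> w = w2"
  shows "uu w \<in> open_segment v w"
proof -
  have lt: "a \<bullet> w < b" using assms below by blast
  define l where "l = (a \<bullet> v - b) / (a \<bullet> v - a \<bullet> w)"
  have "0 < l" "l < 1" using av lt by (auto simp: l_def)
  moreover have "uu w = (1 - l) *\<^sub>R v + l *\<^sub>R w" by (simp add: uu_def l_def algebra_simps)
  ultimately show ?thesis using N_neq[of w] assms by (auto simp: in_segment)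
qed

lemma u_in_iff:
  assumes "F face_of P"
  shows "u1 \<in> F \<longleftrightarrow> v \<in> F \<and> w1 \<in> F" "u2 \<in> F \<longleftrightarrow> v \<in> F \<and> w2 \<in> F"
proof -
  have *: "uu w \<in> F \<longleftrightarrow> v \<in> F \<and> w \<in> F" if w: "w = w1 \<or> w = w2" for w
  proof
    assume "uu w \<in> F"
    then show "v \<in> F \<and> w \<in> F"
      using face_ofD[OF assms open_uu[OF w] vP] N_vert[of w] vertices_sub w by blast
  next
    assume "v \<in> F \<and> w \<in> F"
    then show "uu w \<in> F"
      using open_uu[OF w] face_of_imp_convex[OF assms] segment_open_subset_closed[of v w] 
      by (meson closed_segment_subset subsetD)
  qed
  show "u1 \<in> F \<longleftrightarrow> v \<in> F \<and> w1 \<in> F" "u2 \<in> F \<longleftrightarrow> v \<in> F \<and> w2 \<in> F"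
    using *[of w1] *[of w2] by (auto simp: u1_def u2_def)
qed

lemma u_not_vertex: "u1 \<notin> vertices P" "u2 \<notin> vertices P"
  using open_uu[of w1] open_uu[of w2] vP N_vert[of w1] N_vert[of w2] vertices_sub
  by (auto simp: vertices_def extreme_point_of_def u1_def u2_def)

lemma u_val: "a \<bullet> u1 = b" "a \<bullet> u2 = b"
  using vertices_T vertices_sub[of T] T_val by auto

lemma vertices_tr: "vertices (tr P) = vertices P - {v} \<union> {u1, u2}"
proof
  show "vertices (tr P) \<subseteq> vertices P - {v} \<union> {u1, u2}"
  proof
    fix x assume "x \<in> vertices (tr P)"
    then have x: "{x} face_of tr P" by (simp add: vertices_face)
    from tr_face_cases[OF x] show "x \<in> vertices P - {v} \<union> {u1, u2}"
    proof
      assume "{x} face_of T"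
      then have "x \<in> {u1, u2, w3, w4}" using vertices_T by (simp add: vertices_face[symmetric])
      then show ?thesis using N_vert[of w3] N_vert[of w4] N_neq[of w3] N_neq[of w4] by auto
    next
      assume "\<exists>F. F face_of P \<and> low F \<and> {x} = tr F"
      then obtain F where F: "F face_of P" "low F" "{x} = tr F" by blast
      have "aff_dim F = 0" using tr_aff_dim[OF face_of_imp_convex[OF F(1)] F(2)] F(3) by (metis aff_dim_sing)
      then obtain y where y: "F = {y}" "y \<in> vertices P" using aff_dim_vertex_face[OF _ F(1)] by blast
      then have "x = y" using F(3) by (auto simp: tr_def)
      moreover have "x ~= v" using F(3) av by (auto simp: tr_def)
      ultimately show ?thesis using y by simp
    qed
  qed
  show "vertices P - {v} \<union> {u1, u2} \<subseteq> vertices (tr P)"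
  proof
    fix x assume x: "x \<in> vertices P - {v} \<union> {u1, u2}"
    show "x \<in> vertices (tr P)"
    proof (cases "x \<in> {u1, u2}")
      case True
      then have "x \<in> vertices T" using vertices_T by blast
      then show ?thesis using vertices_of_face[OF T_face_tr] by blast
    next
      case False
      then have "x \<in> vertices P" "x ~= v" using x by auto
      then have "{x} face_of P" "tr {x} = {x}" using tr_notin[of "{x}"] by (auto simp: vertices_face)
      then show ?thesis using tr_face[of "{x}"] by (simp add: vertices_face)
    qed
  qed
qed

lemma vertices_tr_face:
  assumes "F face_of P"
  shows "vertices (tr F) = vertices F - {v} \<union> ({u1, u2} \<inter> F)"
proof -
  have "vertices (tr F) = vertices (tr P) \<inter> tr F" by (rule vertices_of_face[OF tr_face[OF assms]])
  also have "\<dots> = (vertices P - {v} \<union> {u1, u2}) \<inter> F"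
    unfolding vertices_tr using others u_val by (auto simp: tr_def)
  also have "\<dots> = vertices F - {v} \<union> ({u1, u2} \<inter> F)"
    unfolding vertices_of_face[OF assms] by auto
  finally show ?thesis .
qed

lemma dim_tr: "aff_dim (tr P) = 4"
proof -
  have "low P" using below N_vert[of w1] vertices_sub by (auto simp: low_def)
  then show ?thesis using tr_aff_dim[OF cvP] dimP by simp
qed

lemma segment_not_low:
  assumes "\<not> low (closed_segment x y)" "x \<in> tr P" "y \<in> tr P"
  shows "x \<in> T" "y \<in> T"
  using assms by (force simp: low_def T_def tr_def)+

lemma adjacent_tr_T:
  assumes "x \<in> {u1, u2, w3, w4}" "y \<in> {u1, u2, w3, w4}" "x ~= y"
  shows "adjacent (tr P) x y"
proof -
  have "{x, y} \<subseteq> {u1, u2, w3, w4}" using assms(1,2) by blast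
  then have "closed_segment x y face_of T"
    unfolding T_face_iff using segment_convex_hull[of x y] by blast
  then have "closed_segment x y face_of tr P" by (rule face_of_trans[OF _ T_face_tr])
  then show ?thesis by (rule adjacentI[OF assms(3)])
qed

lemma adjacent_tr_iff:
  "adjacent (tr P) x y \<longleftrightarrow> adjacent P x y \<and> x ~= v \<and> y ~= v \<or>
     (x, y) \<in> {(w1, u1), (u1, w1), (w2, u2), (u2, w2)} \<or>
     x \<in> {u1, u2, w3, w4} \<and> y \<in> {u1, u2, w3, w4} \<and> x ~= y"
proof
  assume adj: "adjacent (tr P) x y"
  note ad = adjacentD[OF adj]
  have xt: "x \<in> tr P" "y \<in> tr P" using ad(2,3) vertices_sub by blast+
  show "adjacent P x y \<and> x ~= v \<and> y ~= v \<or>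
     (x, y) \<in> {(w1, u1), (u1, w1), (w2, u2), (u2, w2)} \<or>
     x \<in> {u1, u2, w3, w4} \<and> y \<in> {u1, u2, w3, w4} \<and> x ~= y"
  proof (cases "low (closed_segment x y)")
    case False
    have "x \<in> T" "y \<in> T" using segment_not_low[OF False xt] by auto
    then have "x \<in> vertices T" "y \<in> vertices T" using ad(2,3) vertices_of_face[OF T_face_tr] by auto
    then show ?thesis using ad(1) vertices_T by auto
  next
    case True
    have notT: "\<not> closed_segment x y face_of T"
      using True T_val face_of_imp_subset[of "closed_segment x y" T] by (fastforce simp: low_def)
    obtain F where F: "F face_of P" "low F" "closed_segment x y = tr F"
      using tr_face_cases[OF ad(4)] notT by blast
    have d: "aff_dim F = 1"
      using tr_aff_dim[OF face_of_imp_convex[OF F(1)] F(2)] adj F(3) by (simp add: adjacent_def edge_of_def)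
    have V: "vertices (tr F) = {x, y}"
      unfolding F(3)[symmetric] by (auto simp: vertices_def extreme_point_of_segment)
    show ?thesis
    proof (cases "v \<in> F")
      case False
      then have "F = closed_segment x y" using tr_notin[OF F(1)] F(3) by simp
      moreover from this have "x ~= v" "y ~= v" using False by auto
      ultimately show ?thesis using adjacentI[OF ad(1)] F(1) by simp
    next
      case True
      obtain w where w: "adjacent P v w" "F = closed_segment v w"
        using edge_at_vertex[OF polP F(1) d v True] by blast
      then have wN: "w \<in> {w1, w2, w3, w4}" using nbrs by blast
      \<comment> \<open>The edges from \<open>v\<close> to \<open>w3\<close> and \<open>w4\<close>
        have no point strictly below the hyperplane.\<close>
      have "w ~= w3 \<and> w ~= w4"
      proof (rule ccontr)
        assume "\<not> ?thesis"
        then have "a \<bullet> w = b" using on by auto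
        obtain z where z: "z \<in> closed_segment v w" "a \<bullet> z < b" using F(2) w(2) by (auto simp: low_def)
        then obtain t where t: "0 \<le> t" "t \<le> 1" "z = (1 - t) *\<^sub>R v + t *\<^sub>R w" by (auto simp: in_segment)
        have "a \<bullet> z = (1 - t) * (a \<bullet> v) + t * (a \<bullet> w)" by (simp add: t(3) inner_add_right)
        then have "a \<bullet> z = b + (1 - t) * (a \<bullet> v - b)" using \<open>a \<bullet> w = b\<close> by (simp add: algebra_simps)
        moreover have "0 \<le> (1 - t) * (a \<bullet> v - b)" using t av by simp
        ultimately show False using z by simp
      qed
      then have w12: "w = w1 \<or> w = w2" using wN by blast
      have wF: "w \<in> vertices F" "w ~= v"
        using w N_neq[OF wN] by (auto simp: vertices_def extreme_point_of_segment)
      have "uu w \<in> F" using u_in_iff[OF F(1)] w12 True w(2) by (auto simp: u1_def u2_def)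
      moreover have "uu w \<in> {u1, u2}" using w12 by (auto simp: u1_def u2_def)
      ultimately have "{w, uu w} \<subseteq> {x, y}" using vertices_tr_face[OF F(1)] V wF by auto
      moreover have "w ~= uu w" using open_uu[OF w12] by (auto simp: open_segment_def)
      ultimately have "(x, y) = (w, uu w) \<or> (x, y) = (uu w, w)" by auto
      then show ?thesis using w12 by (auto simp: u1_def u2_def)
    qed
  qed
next
  assume R: "adjacent P x y \<and> x ~= v \<and> y ~= v \<or>
     (x, y) \<in> {(w1, u1), (u1, w1), (w2, u2), (u2, w2)} \<or>
     x \<in> {u1, u2, w3, w4} \<and> y \<in> {u1, u2, w3, w4} \<and> x ~= y"
  have cut: "adjacent (tr P) w (uu w)" if w12: "w = w1 \<or> w = w2" for w
  proof -
    have wN: "w \<in> {w1, w2, w3, w4}" using w12 by blast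
    have f: "closed_segment v w face_of P" by (rule adjacentD(4)[OF adj_N[OF wN]])
    have l: "low (closed_segment v w)" using w12 below by (auto simp: low_def)
    have d1: "aff_dim (closed_segment v w) = 1" using adj_N[OF wN] by (simp add: adjacent_def edge_of_def)
    have d: "aff_dim (tr (closed_segment v w)) = 1" using tr_aff_dim[OF face_of_imp_convex[OF f] l] d1 by simp
    have "v \<in> closed_segment v w" "w \<in> closed_segment v w" by auto
    then have m: "w \<in> tr (closed_segment v w)" "uu w \<in> tr (closed_segment v w)"
      using N_le[OF wN] uu_val[OF N_le[OF wN]] u_in_iff[OF f] w12 by (auto simp: tr_def u1_def u2_def)
    have ne: "w ~= uu w" using open_uu[OF w12] by (auto simp: open_segment_def)
    have "w \<in> vertices (tr P)" "uu w \<in> vertices (tr P)"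
      using vertices_tr N_vert[OF wN] N_neq[OF wN] w12 by (auto simp: u1_def u2_def)
    then have "tr (closed_segment v w) = closed_segment w (uu w)"
      by (intro edge_eq_vertices[OF pol_tr tr_face[OF f] d _ _ ne m])
    then show ?thesis using adjacentI[OF ne, of "tr P"] tr_face[OF f] by simp
  qed
  from R show "adjacent (tr P) x y"
  proof (elim disjE)
    assume A: "adjacent P x y \<and> x ~= v \<and> y ~= v"
    note ad = adjacentD[OF conjunct1[OF A]]
    have "v \<notin> closed_segment x y"
    proof
      assume "v \<in> closed_segment x y"
      then have "v \<in> vertices (closed_segment x y)" using vertices_of_face[OF ad(4)] v by blast
      then show False using A by (auto simp: vertices_def extreme_point_of_segment)
    qed
    then have "tr (closed_segment x y) = closed_segment x y" by (rule tr_notin[OF ad(4)])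
    then show ?thesis using adjacentI[OF ad(1), of "tr P"] tr_face[OF ad(4)] by simp
  next
    assume "(x, y) \<in> {(w1, u1), (u1, w1), (w2, u2), (u2, w2)}"
    then show ?thesis using cut[of w1] cut[of w2] adjacent_commute[of "tr P"] by (auto simp: u1_def u2_def)
  next
    assume "x \<in> {u1, u2, w3, w4} \<and> y \<in> {u1, u2, w3, w4} \<and> x ~= y"
    then show ?thesis by (elim conjE) (rule adjacent_tr_T)
  qed
qed

text \<open>The 2-face spanned by the edges from \<open>v\<close> to \<open>w3\<close> and
  \<open>w4\<close>, found by lifting the edge between these two in the simplex
  \<open>T\<close>.\<close>

lemma face34:
  obtains F where "F face_of P" "v \<in> F" "F \<inter> H = closed_segment w3 w4" "aff_dim F = 2"
proof -
  have "convex hull {w3, w4} face_of T" using T_face_iff[of "convex hull {w3, w4}"] by blast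
  then have G: "closed_segment w3 w4 face_of T" by (simp add: segment_convex_hull)
  note l = lift[OF G]
  have ne: "w3 ~= w4" using distN by simp
  have "aff_dim (closed_segment w3 w4) = 1" using ne by (rule aff_dim_closed_segment)
  then have "aff_dim (lift (closed_segment w3 w4)) = 2" using section_aff_dim[OF l(1,2)] l(3) by simp
  then show thesis using that[OF l(1,2)] l(3) by (simp add: H_def)
qed

text \<open>The intersection of \<open>F\<close> with the 2-face of \<open>face34\<close> is a
  proper face of that polygon and contains \<open>w3\<close> and \<open>w4\<close>, so it is an
  edge.\<close>

lemma adjacent_w34:
  assumes F: "F face_of P" "w3 \<in> F" "w4 \<in> F" "v \<notin> F"
  shows "adjacent P w3 w4"
proof -
  obtain K where K: "K face_of P" "v \<in> K" "K \<inter> H = closed_segment w3 w4" "aff_dim K = 2" by (rule face34)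
  have ne: "w3 ~= w4" using distN by simp
  have wK: "w3 \<in> K" "w4 \<in> K" using K(3) by auto
  have I: "F \<inter> K face_of P" by (rule face_of_Int[OF F(1) K(1)])
  have IK: "F \<inter> K face_of K" using face_of_subset[OF I _ face_of_imp_subset[OF K(1)]] by blast
  have "aff_dim (F \<inter> K) < 2"
    using face_of_aff_dim_lt[OF face_of_imp_convex[OF K(1)] IK] K F(4) by auto
  moreover have "1 \<le> aff_dim (F \<inter> K)"
  proof -
    have "aff_dim {w3, w4} \<le> aff_dim (F \<inter> K)" by (rule aff_dim_subset) (use F wK in auto)
    then show ?thesis using ne by (simp add: aff_dim_2)
  qed
  ultimately have d: "aff_dim (F \<inter> K) = 1" by simp
  have "F \<inter> K = closed_segment w3 w4"
    by (rule edge_eq_vertices[OF polP I d]) (use N_vert ne F wK in auto)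
  then show ?thesis using adjacentI[OF ne, of P] I by simp
qed

text \<open>A segment from \<open>v\<close> to a point of \<open>F\<close> below the hyperplane
  crosses [\<open>w3\<close>, \<open>w4\<close>] in between. If the latter were an edge, its
  extremality would force \<open>v\<close> into it.\<close>

lemma low_not_adjacent:
  assumes F: "F face_of P" "v \<in> F" "F \<inter> H = closed_segment w3 w4" "low F"
  shows "\<not> adjacent P w3 w4"
proof
  assume "adjacent P w3 w4"
  then have f: "closed_segment w3 w4 face_of P" by (rule adjacentD(4))
  obtain x where x: "x \<in> F" "a \<bullet> x < b" using F(4) by (auto simp: low_def)
  define l where "l = (a \<bullet> v - b) / (a \<bullet> v - a \<bullet> x)"
  have l: "0 < l" "l < 1" using av x by (auto simp: l_def)
  define z where "z = (1 - l) *\<^sub>R v + l *\<^sub>R x"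
  have "v ~= x" using av x by auto
  then have zo: "z \<in> open_segment v x" using l by (auto simp: z_def in_segment)
  have "z \<in> F" unfolding z_def
    by (rule convexD_alt[OF face_of_imp_convex[OF F(1)] F(2) x(1)]) (use l in auto)
  moreover have "a \<bullet> z = b"
  proof -
    have "l * (a \<bullet> v - a \<bullet> x) = a \<bullet> v - b" using av x by (simp add: l_def)
    then show ?thesis by (simp add: z_def inner_add_right algebra_simps)
  qed
  ultimately have "z \<in> closed_segment w3 w4" using F(3) by (auto simp: H_def)
  then have "v \<in> closed_segment w3 w4"
    using face_ofD[OF f zo vP] x F(1) face_of_imp_subset by blast
  then have "v \<in> H" using F(3) by blast
  then show False using av by (simp add: H_def)
qed

end

section \<open>Acyclic orientations and systems of disjoint paths\<close>

lemma acyclic_sink_exists: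
  assumes "acyclic E" "finite A" "A ~= {}"
  shows "\<exists>x\<in>A. \<forall>y\<in>A. (x, y) \<notin> E" "\<exists>x\<in>A. \<forall>y\<in>A. (y, x) \<notin> E"
proof -
  define r where "r = E \<inter> A \<times> A"
  have fin: "finite r" using assms(2) by (simp add: r_def)
  have ac: "acyclic r" using acyclic_subset[OF assms(1)] by (simp add: r_def)
  obtain a where a: "a \<in> A" using assms(3) by blast
  have wf1: "wf (r\<inverse>)" using finite_acyclic_wf_converse[OF fin ac] .
  obtain x where x: "x \<in> A" "\<And>y. (y, x) \<in> r\<inverse> ==> y \<notin> A" by (rule wfE_min[OF wf1 a]) (rule that)
  show "\<exists>x\<in>A. \<forall>y\<in>A. (x, y) \<notin> E"
  proof (intro bexI[OF _ x(1)] ballI notI)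
    fix y assume y: "y \<in> A" "(x, y) \<in> E"
    then have "(y, x) \<in> r\<inverse>" using x(1) by (simp add: r_def)
    then show False using x(2) y(1) by blast
  qed
  have wf2: "wf r" using finite_acyclic_wf[OF fin ac] .
  obtain x where x: "x \<in> A" "\<And>y. (y, x) \<in> r ==> y \<notin> A" by (rule wfE_min[OF wf2 a]) (rule that)
  show "\<exists>x\<in>A. \<forall>y\<in>A. (y, x) \<notin> E"
  proof (intro bexI[OF _ x(1)] ballI notI)
    fix y assume y: "y \<in> A" "(y, x) \<in> E"
    then have "(y, x) \<in> r" using x(1) by (simp add: r_def)
    then show False using x(2) y(1) by blast
  qed
qed

text \<open>Acyclicity provides a source and a sink in each nonempty face, so uniqueness is all that
  remains.\<close>

lemma unique_sink_orientationI:
  fixes P :: "'a::euclidean_space set"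
  assumes "polytope P" "acyclic E"
    and "\<And>H x y. H face_of P ==> H ~= {} ==> is_source E H x ==> is_source E H y ==> x = y"
    and "\<And>H x y. H face_of P ==> H ~= {} ==> is_sink E H x ==> is_sink E H y ==> x = y"
  shows "unique_sink_orientation P E"
  unfolding unique_sink_orientation_def
proof (intro allI impI)
  fix H assume "H face_of P \<and> H ~= {}"
  then have H: "H face_of P" "H ~= {}" by blast+
  have pH: "polytope H" by (rule face_of_polytope_polytope[OF assms(1) H(1)])
  note V = finite_vertices[OF pH] vertices_nonempty[OF pH H(2)]
  have "\<exists>x. is_source E H x" "\<exists>x. is_sink E H x"
    using acyclic_sink_exists[OF assms(2) V] by (auto simp: is_source_def is_sink_def face_arcs_def)
  then show "(\<exists>!v. is_source E H v) \<and> (\<exists>!v. is_sink E H v)" using assms(3,4)[OF H] by blast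
qed

lemma acyclic_add_sink:
  assumes "acyclic r" "u \<notin> Domain r" "u \<notin> A"
  shows "acyclic (r \<union> A \<times> {u})"
proof -
  have *: "(x, y) \<in> r\<^sup>+ \<or> y = u" if "(x, y) \<in> (r \<union> A \<times> {u})\<^sup>+" for x y
    using that
  proof induction
    case (step y z)
    then show ?case using assms(2,3) by (auto intro: trancl_into_trancl)
  qed auto
  show ?thesis unfolding acyclic_def
  proof (intro allI notI)
    fix x assume x: "(x, x) \<in> (r \<union> A \<times> {u})\<^sup>+"
    then have "x = u" using *[OF x] assms(1) by (auto simp: acyclic_def)
    then obtain z where "(u, z) \<in> r \<union> A \<times> {u}" using tranclD[OF x] by blast
    then show False using assms(2,3) by auto
  qed
qed

lemma directed_path_split:
  assumes "directed_path A s t p" "s ~= t"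
  obtains q where "p = q @ [t]" "q ~= []" "hd q = s" "distinct q" "t \<notin> set q"
    "successively (\<lambda>u w. (u, w) \<in> A) q" "(last q, t) \<in> A"
proof -
  have p: "p ~= []" "hd p = s" "last p = t" "distinct p" "successively (\<lambda>u w. (u, w) \<in> A) p"
    using assms(1) by (auto simp: directed_path_def)
  define q where "q = butlast p"
  have pq: "p = q @ [t]" using p(1,3) by (metis append_butlast_last_id q_def)
  have ne: "q ~= []" using pq p(2) assms(2) by auto
  show thesis
    by (rule that[OF pq ne]) (use p pq ne in \<open>auto simp: successively_append_iff\<close>)
qed

lemma directed_pathI:
  assumes "q ~= []" "hd q = s" "distinct q" "successively (\<lambda>u w. (u, w) \<in> A) q"
    "(last q, t) \<in> A" "t \<notin> set q"
  shows "directed_path A s t (q @ [t])"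
  using assms by (auto simp: directed_path_def successively_append_iff)

lemma successively_change:
  assumes "successively P xs" "\<And>x y. x \<in> set xs ==> y \<in> set xs ==> P x y ==> Q x y"
  shows "successively Q xs"
  using assms by (auto simp: successively_conv_nth)

lemma distinct_hd_last: "distinct q ==> q ~= [] ==> hd q = last q ==> q = [hd q]"
  by (cases q) (auto split: if_splits)

definition paths_exist :: "('a \<times> 'a) set \<Rightarrow> 'a \<Rightarrow> 'a \<Rightarrow> int \<Rightarrow> bool" where
  "paths_exist A s t k \<longleftrightarrow> (\<exists>\<P>. finite \<P> \<and> int (card \<P>) = k \<and>
     (\<forall>p\<in>\<P>. directed_path A s t p) \<and> (\<forall>p\<in>\<P>. \<forall>q\<in>\<P>. p ~= q --> set p \<inter> set q \<subseteq> {s, t}))"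

lemma paths_existE:
  assumes "paths_exist A s t k"
  obtains Q where "finite Q" "int (card Q) = k" "\<And>p. p \<in> Q ==> directed_path A s t p"
    "\<And>p q. p \<in> Q ==> q \<in> Q ==> p ~= q ==> set p \<inter> set q \<subseteq> {s, t}"
  using assms unfolding paths_exist_def by (elim exE conjE) (rule that, assumption+, blast+)

lemma paths_existI:
  assumes "finite Q" "int (card Q) = k" "\<And>p. p \<in> Q ==> directed_path A s t p"
    "\<And>p q. p \<in> Q ==> q \<in> Q ==> p ~= q ==> set p \<inter> set q \<subseteq> {s, t}"
  shows "paths_exist A s t k"
  unfolding paths_exist_def using assms by (intro exI[of _ Q] conjI ballI impI) simp_all

lemma holt_klee_iff:
  "holt_klee P E \<longleftrightarrow> unique_sink_orientation P E \<and>
     (\<forall>H s t. H face_of P \<and> H ~= {} \<and> is_source E H s \<and> is_sink E H t -->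
        paths_exist (face_arcs E H) s t (aff_dim H))"
  by (simp add: holt_klee_def paths_exist_def)

lemma directed_path_arcs_vertices:
  assumes "directed_path (face_arcs E F) s t p" "s \<in> vertices F"
  shows "set p \<subseteq> vertices F"
proof
  fix x assume "x \<in> set p"
  then obtain i where i: "i < length p" "p ! i = x" by (auto simp: in_set_conv_nth)
  show "x \<in> vertices F"
  proof (cases i)
    case 0
    then have "x = s" using i assms(1) by (auto simp: directed_path_def hd_conv_nth)
    then show ?thesis using assms(2) by simp
  next
    case (Suc k)
    have "successively (\<lambda>u w. (u, w) \<in> face_arcs E F) p" using assms(1) by (simp add: directed_path_def)
    then have "(p ! k, p ! Suc k) \<in> face_arcs E F" using i(1) Suc by (simp add: successively_conv_nth)
    then show ?thesis using i(2) Suc by (simp add: face_arcs_def)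
  qed
qed

subsection \<open>The digraph of the truncation\<close>

locale cut_digraph = simple_cut +
  fixes E :: "('a \<times> 'a) set"
  assumes dig: "polytopal_digraph P E" and acy: "acyclic E" and hk: "holt_klee P E"
    and sink_v: "is_sink E P v" and ord: "(w4, w3) \<notin> E\<^sup>+"
begin

text \<open>The simplex gets the linear order \<open>w3\<close>, \<open>w4\<close>,
  \<open>u1\<close>, \<open>u2\<close>, and \<open>w1\<close>, \<open>w2\<close> now point to their
  cut points. The direction between \<open>w3\<close> and \<open>w4\<close> agrees with
  \<open>E\<close> if they are adjacent there, and creates no cycle if they are not; both are due to
  \<open>ord\<close>.\<close>

definition E' :: "('a \<times> 'a) set" where
  "E' = {(x, y) \<in> E. y ~= v} \<union> {(w1, u1), (w2, u2), (u1, u2), (w3, w4), (w3, u1), (w3, u2), (w4, u1), (w4, u2)}"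

lemma E_adj: "(x, y) \<in> E ==> adjacent P x y" using dig by (auto simp: polytopal_digraph_def)
lemma E_vert: assumes "(x, y) \<in> E" shows "x \<in> vertices P" "y \<in> vertices P"
  using adjacentD[OF E_adj[OF assms]] by auto
lemma E_one: "adjacent P x y ==> ((x, y) \<in> E) ~= ((y, x) \<in> E)" using dig by (auto simp: polytopal_digraph_def)
lemma v_no_out: "(v, y) \<notin> E"
  using sink_v E_vert[of v y] by (auto simp: is_sink_def face_arcs_def)
lemma to_v_N: "(w, v) \<in> E ==> w \<in> {w1, w2, w3, w4}"
  using E_adj[of w v] adjacent_commute[of P w v] nbrs by blast
lemma w43: "(w4, w3) \<notin> E" using ord by auto
lemma uso: "unique_sink_orientation P E" using hk by (simp add: holt_klee_def)

lemma u_E: "(x, u1) \<notin> E" "(x, u2) \<notin> E" "(u1, x) \<notin> E" "(u2, x) \<notin> E"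
  using E_vert u_not_vertex by blast+

lemma dist_all: "distinct [v, w1, w2, w3, w4, u1, u2]"
proof -
  have w: "w ~= u1 \<and> w ~= u2" if "w \<in> {w1, w2, w3, w4}" for w
    using u_not_vertex N_vert[OF that] by auto
  have "v ~= u1" "v ~= u2" using u_not_vertex v by auto
  then show ?thesis
    using distN dist_T N_neq[of w1] N_neq[of w2] N_neq[of w3] N_neq[of w4] w[of w1] w[of w2] w[of w3] w[of w4]
    by simp
qed

lemma E'_u1: "(x, u1) \<in> E' \<longleftrightarrow> x = w1 \<or> x = w3 \<or> x = w4"
  and E'_u2: "(x, u2) \<in> E' \<longleftrightarrow> x = w2 \<or> x = u1 \<or> x = w3 \<or> x = w4"
  and E'_from_u1: "(u1, x) \<in> E' \<longleftrightarrow> x = u2"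
  and E'_from_u2: "(u2, x) \<notin> E'"
  using dist_all u_E by (auto simp: E'_def)

lemma E'_old: "x \<notin> {u1, u2} ==> y \<notin> {u1, u2} ==> (x, y) \<in> E' \<longleftrightarrow> (x, y) \<in> E \<and> y ~= v \<or> (x, y) = (w3, w4)"
  by (auto simp: E'_def)

text \<open>By \<open>ord\<close> the arc from \<open>w3\<close> to \<open>w4\<close> closes no
  cycle. Then \<open>u1\<close> and \<open>u2\<close> are added one after the other, each as a
  sink.\<close>

lemma acy': "acyclic E'"
proof -
  have "(w4, w3) \<notin> E\<^sup>*" using ord distN by (auto simp: rtrancl_eq_or_trancl)
  then have "acyclic (insert (w3, w4) E)" using acy by simp
  then have "acyclic (insert (w3, w4) E \<union> {w1, w3, w4} \<times> {u1})"
    by (rule acyclic_add_sink) (use dist_all u_E in auto)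
  then have "acyclic ((insert (w3, w4) E \<union> {w1, w3, w4} \<times> {u1}) \<union> {w2, u1, w3, w4} \<times> {u2})"
    by (rule acyclic_add_sink) (use dist_all u_E in auto)
  then show ?thesis by (rule acyclic_subset) (auto simp: E'_def)
qed

lemma dig': "polytopal_digraph (tr P) E'"
  unfolding polytopal_digraph_def
proof (intro conjI allI impI)
  fix x y assume "(x, y) \<in> E'"
  then have "(x, y) \<in> E \<and> y ~= v \<or>
    (x, y) \<in> {(w1, u1), (w2, u2), (u1, u2), (w3, w4), (w3, u1), (w3, u2), (w4, u1), (w4, u2)}"
    by (auto simp: E'_def)
  then show "adjacent (tr P) x y"
  proof
    assume "(x, y) \<in> E \<and> y ~= v"
    then show ?thesis unfolding adjacent_tr_iff using E_adj v_no_out by blast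
  next
    assume "(x, y) \<in> {(w1, u1), (w2, u2), (u1, u2), (w3, w4), (w3, u1), (w3, u2), (w4, u1), (w4, u2)}"
    then show ?thesis unfolding adjacent_tr_iff using dist_T by auto
  qed
next
  fix x y assume "adjacent (tr P) x y"
  then have "(x, y) \<in> E' \<or> (y, x) \<in> E'"
    unfolding adjacent_tr_iff
  proof (elim disjE)
    assume "adjacent P x y \<and> x ~= v \<and> y ~= v"
    then show ?thesis using E_one[of x y] by (auto simp: E'_def)
  qed (auto simp: E'_def)
  moreover have "\<not> ((x, y) \<in> E' \<and> (y, x) \<in> E')"
    using acy' unfolding acyclic_def by (meson r_into_trancl' trancl_trans)
  ultimately show "((x, y) \<in> E') ~= ((y, x) \<in> E')" by blast
qed

lemma T_tournament:
  assumes "x \<in> {u1, u2, w3, w4}" "y \<in> {u1, u2, w3, w4}" "x ~= y"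
  shows "(x, y) \<in> E' \<or> (y, x) \<in> E'"
  using dig' adjacent_tr_T[OF assms] unfolding polytopal_digraph_def by blast

text \<open>The only possible new arc between old vertices joins \<open>w3\<close> to
  \<open>w4\<close>. If both lie in a face without \<open>v\<close>, they were adjacent before and
  the arc is old.\<close>

lemma arcs_notin:
  assumes F: "F face_of P" "v \<notin> F"
  shows "face_arcs E' F = face_arcs E F"
proof -
  have "(x, y) \<in> E' \<longleftrightarrow> (x, y) \<in> E" if "x \<in> vertices F" "y \<in> vertices F" for x y
  proof -
    have xy: "x \<in> vertices P" "y \<in> vertices P" "x \<in> F" "y \<in> F" using that vertices_of_face[OF F(1)] by auto
    then have nu: "x \<notin> {u1, u2}" "y \<notin> {u1, u2}" using u_not_vertex by auto
    have "(x, y) = (w3, w4) --> (x, y) \<in> E"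
      using adjacent_w34[OF F(1) _ _ F(2)] E_one[of w3 w4] w43 xy by auto
    then show ?thesis unfolding E'_old[OF nu] using xy F(2) by auto
  qed
  then show ?thesis by (auto simp: face_arcs_def)
qed

lemma arcs_tr:
  assumes F: "F face_of P" and x: "x \<in> vertices F" "x ~= v" and y: "y \<in> vertices F" "y ~= v" and e: "(x, y) \<in> E"
  shows "(x, y) \<in> face_arcs E' (tr F)"
  using assms vertices_tr_face[OF F] by (auto simp: face_arcs_def E'_def)

lemma sink_F:
  assumes "F face_of P" "v \<in> F"
  shows "is_sink E F v"
  using assms v v_no_out vertices_of_face[OF assms(1)] by (auto simp: is_sink_def face_arcs_def)

lemma uso_source_unique: "F face_of P ==> is_source E F x ==> is_source E F y ==> x = y"
  and uso_sink_unique: "F face_of P ==> is_sink E F x ==> is_sink E F y ==> x = y"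
proof -
  have ne: "F ~= {}" if "x \<in> vertices F" for F and x :: 'a using that vertices_sub by blast
  have ex: "F face_of P ==> F ~= {} ==> (\<exists>!v. is_source E F v) \<and> (\<exists>!v. is_sink E F v)" for F
    using uso by (simp add: unique_sink_orientation_def)
  show "x = y" if "F face_of P" "is_source E F x" "is_source E F y"
  proof -
    have "F ~= {}" using that(2) ne unfolding is_source_def by blast
    then have "\<exists>!v. is_source E F v" using ex[OF that(1)] by simp
    then show ?thesis using that(2,3) by blast
  qed
  show "x = y" if "F face_of P" "is_sink E F x" "is_sink E F y"
  proof -
    have "F ~= {}" using that(2) ne unfolding is_sink_def by blast
    then have "\<exists>!v. is_sink E F v" using ex[OF that(1)] by simp
    then show ?thesis using that(2,3) by blast
  qed
qed

lemma sink_unique: "F face_of P ==> v \<in> F ==> is_sink E F x ==> x = v"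
  by (rule uso_sink_unique[OF _ _ sink_F])

text \<open>Any other vertex had an outgoing arc in \<open>F\<close>, whose sink is
  \<open>v\<close>. The arc survives unless it ends in \<open>v\<close>, and then one to the cut
  point replaces it.\<close>

lemma sink_tr:
  assumes F: "F face_of P" "v \<in> F" and x: "is_sink E' (tr F) x"
  shows "x \<in> {u1, u2, w3, w4}"
proof (rule ccontr)
  assume no: "x \<notin> {u1, u2, w3, w4}"
  have xV: "x \<in> vertices F" "x ~= v" using x no vertices_tr_face[OF F(1)] by (auto simp: is_sink_def)
  then have "\<not> is_sink E F x" using sink_unique[OF F] by blast
  then obtain y where y: "(x, y) \<in> E" "y \<in> vertices F" using xV by (auto simp: is_sink_def face_arcs_def)
  show False
  proof (cases "y = v")
    case False
    then show False using arcs_tr[OF F(1) xV y(2) False y(1)] x by (auto simp: is_sink_def)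
  next
    case True
    then have "x = w1 \<or> x = w2" using to_v_N y(1) no by blast
    moreover have "x \<in> F" using xV vertices_of_face[OF F(1)] by blast
    ultimately have "uu x \<in> {u1, u2} \<inter> F \<and> (x, uu x) \<in> E'"
      using u_in_iff[OF F(1)] F(2) E'_u1 E'_u2 by (auto simp: u1_def u2_def)
    then have "(x, uu x) \<in> face_arcs E' (tr F)"
      using vertices_tr_face[OF F(1)] xV by (auto simp: face_arcs_def)
    then show False using x by (auto simp: is_sink_def)
  qed
qed

text \<open>A cut point in \<open>F\<close> has an incoming arc from its neighbour \<open>w1\<close>
  or \<open>w2\<close>, which lies in \<open>F\<close> too. So the source is old, and no incoming
  arc of an old vertex is lost.\<close>

lemma source_tr:
  assumes F: "F face_of P" "v \<in> F" and x: "is_source E' (tr F) x"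
  shows "is_source E F x"
proof -
  have V: "vertices (tr F) = vertices F - {v} \<union> ({u1, u2} \<inter> F)" by (rule vertices_tr_face[OF F(1)])
  have wF: "w \<in> vertices (tr F)" if "w \<in> {w1, w2}" "w \<in> F" for w
    using that V N_vert[of w] N_neq[of w] vertices_of_face[OF F(1)] by auto
  have "x ~= u1"
  proof
    assume "x = u1"
    then have "u1 \<in> F" using x V u_not_vertex vertices_of_face[OF F(1)] by (auto simp: is_source_def)
    then have "w1 \<in> F" using u_in_iff[OF F(1)] by blast
    then have "(w1, u1) \<in> face_arcs E' (tr F)" using wF[of w1] x \<open>x = u1\<close> E'_u1 by (auto simp: face_arcs_def is_source_def)
    then show False using x \<open>x = u1\<close> by (auto simp: is_source_def)
  qed
  moreover have "x ~= u2"
  proof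
    assume "x = u2"
    then have "u2 \<in> F" using x V u_not_vertex vertices_of_face[OF F(1)] by (auto simp: is_source_def)
    then have "w2 \<in> F" using u_in_iff[OF F(1)] by blast
    then have "(w2, u2) \<in> face_arcs E' (tr F)" using wF[of w2] x \<open>x = u2\<close> E'_u2 by (auto simp: face_arcs_def is_source_def)
    then show False using x \<open>x = u2\<close> by (auto simp: is_source_def)
  qed
  ultimately have xV: "x \<in> vertices F" "x ~= v" using x V by (auto simp: is_source_def)
  have "(y, x) \<notin> face_arcs E F" for y
  proof
    assume "(y, x) \<in> face_arcs E F"
    then have y: "(y, x) \<in> E" "y \<in> vertices F" by (auto simp: face_arcs_def)
    then have "y ~= v" using v_no_out by auto
    then show False using arcs_tr[OF F(1) y(2) _ xV y(1)] x by (auto simp: is_source_def)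
  qed
  then show ?thesis using xV by (simp add: is_source_def)
qed

lemma source_sink_notin:
  assumes "F face_of P" "v \<notin> F"
  shows "is_source E' F = is_source E F" "is_sink E' F = is_sink E F"
  using arcs_notin[OF assms] by (auto simp: is_source_def is_sink_def fun_eq_iff)

text \<open>\<open>E'\<close> is a tournament on the simplex, so two sources or two sinks would be
  joined by an arc.\<close>

lemma T_face_unique:
  assumes "G face_of T"
  shows "is_source E' G x ==> is_source E' G y ==> x = y" "is_sink E' G x ==> is_sink E' G y ==> x = y"
proof -
  have V: "vertices G \<subseteq> {u1, u2, w3, w4}" using vertices_of_face[OF assms] vertices_T by blast
  show "x = y" if "is_source E' G x" "is_source E' G y"
    using that V T_tournament[of x y] by (auto simp: is_source_def face_arcs_def)
  show "x = y" if "is_sink E' G x" "is_sink E' G y"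
    using that V T_tournament[of x y] by (auto simp: is_sink_def face_arcs_def)
qed

lemma uso': "unique_sink_orientation (tr P) E'"
proof (rule unique_sink_orientationI[OF pol_tr acy'])
  fix G x y assume G: "G face_of tr P" "G ~= {}"
  show "x = y" if s: "is_source E' G x" "is_source E' G y"
    using tr_face_cases[OF G(1)]
  proof (elim disjE exE conjE)
    assume "G face_of T"
    then show ?thesis using T_face_unique(1) s by blast
  next
    fix F assume F: "F face_of P" "low F" "G = tr F"
    show ?thesis
    proof (cases "v \<in> F")
      case True
      then show ?thesis using source_tr[OF F(1) True] s F(3) uso_source_unique[OF F(1)] by blast
    next
      case False
      then show ?thesis using s source_sink_notin[OF F(1) False] tr_notin[OF F(1) False] F(3) uso_source_unique[OF F(1)] by auto
    qed
  qed
  show "x = y" if s: "is_sink E' G x" "is_sink E' G y"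
    using tr_face_cases[OF G(1)]
  proof (elim disjE exE conjE)
    assume "G face_of T"
    then show ?thesis using T_face_unique(2) s by blast
  next
    fix F assume F: "F face_of P" "low F" "G = tr F"
    show ?thesis
    proof (cases "v \<in> F")
      case True
      have "x \<in> {u1, u2, w3, w4}" "y \<in> {u1, u2, w3, w4}" using sink_tr[OF F(1) True] s F(3) by blast+
      then show ?thesis using T_tournament[of x y] s by (auto simp: is_sink_def face_arcs_def)
    next
      case False
      then show ?thesis using s source_sink_notin[OF F(1) False] tr_notin[OF F(1) False] F(3) uso_sink_unique[OF F(1)] by auto
    qed
  qed
qed

lemma hk_P: "F face_of P ==> F ~= {} ==> is_source E F s ==> is_sink E F t ==> paths_exist (face_arcs E F) s t (aff_dim F)"
  using hk unfolding holt_klee_iff by blast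

text \<open>All other vertices are joined from \<open>s\<close> and to \<open>t\<close>. The direct
  arc and the paths with one intermediate vertex are as many as the dimension.\<close>

lemma paths_simplex:
  assumes G: "G face_of T" and st: "is_source E' G s" "is_sink E' G t"
  shows "paths_exist (face_arcs E' G) s t (aff_dim G)"
proof -
  obtain c where c: "c \<subseteq> {u1, u2, w3, w4}" "G = convex hull c" using G T_face_iff by blast
  have V: "vertices G = c" and d: "aff_dim G = int (card c) - 1" using sub_simplex[OF c(1)] c(2) by auto
  have fin: "finite c" using c(1) finite_subset by blast
  have stc: "s \<in> c" "t \<in> c" using st V by (auto simp: is_source_def is_sink_def)
  have sx: "(s, x) \<in> face_arcs E' G" if "x \<in> c" "x ~= s" for x
    using T_tournament[of s x] that stc c(1) st(1) V by (auto simp: is_source_def face_arcs_def)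
  have xt: "(x, t) \<in> face_arcs E' G" if "x \<in> c" "x ~= t" for x
    using T_tournament[of x t] that stc c(1) st(2) V by (auto simp: is_sink_def face_arcs_def)
  show ?thesis
  proof (cases "s = t")
    case True
    have "x = s" if "x \<in> c" for x
    proof (rule ccontr)
      assume "x ~= s"
      then have "(s, x) \<in> face_arcs E' G" using sx that by blast
      then show False using st(2) True by (auto simp: is_sink_def)
    qed
    then have "c = {s}" using stc by blast
    then show ?thesis unfolding d by (intro paths_existI[of "{}"]) simp_all
  next
    case False
    define Q where "Q = insert [s, t] ((\<lambda>x. [s, x, t]) ` (c - {s, t}))"
    have "card ((\<lambda>x. [s, x, t]) ` (c - {s, t})) = card (c - {s, t})" by (rule card_image) (auto simp: inj_on_def)
    also have "\<dots> = card c - 2" using stc False fin by (subst card_Diff_subset) auto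
    finally have "card Q = Suc (card c - 2)"
      unfolding Q_def using fin by (subst card_insert_disjoint) auto
    moreover have "2 \<le> card c" using card_mono[OF fin, of "{s, t}"] stc False by simp
    ultimately have "int (card Q) = aff_dim G" using d by simp
    moreover have "finite Q" using fin by (simp add: Q_def)
    moreover have "directed_path (face_arcs E' G) s t p" if "p \<in> Q" for p
      using that sx xt False stc by (auto simp: Q_def directed_path_def)
    moreover have "set p \<inter> set q \<subseteq> {s, t}" if "p \<in> Q" "q \<in> Q" "p ~= q" for p q using that by (auto simp: Q_def)
    ultimately show ?thesis by (intro paths_existI[of Q]) simp_all
  qed
qed

text \<open>The Holt-Klee paths of \<open>F\<close> to its sink \<open>v\<close>, with
  \<open>v\<close> removed at the end. What is left stops at neighbours of \<open>v\<close> and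
  survives the cut.\<close>

lemma stems:
  assumes F: "F face_of P" "v \<in> F" and s: "is_source E' (tr F) s"
  obtains S where "finite S" "int (card S) = aff_dim F"
    "\<And>q. q \<in> S ==> q ~= [] \<and> hd q = s \<and> distinct q \<and> successively (\<lambda>u w. (u, w) \<in> face_arcs E F) q \<and>
       last q \<in> {w1, w2, w3, w4} \<and> set q \<subseteq> vertices F - {v}"
    "\<And>p q. p \<in> S ==> q \<in> S ==> p ~= q ==> set p \<inter> set q \<subseteq> {s}"
proof -
  have sF: "is_source E F s" by (rule source_tr[OF F s])
  have sV: "s \<in> vertices F" using sF by (simp add: is_source_def)
  have sv: "s ~= v"
  proof
    assume "s = v"
    then have "v \<in> vertices (tr F)" using s by (simp add: is_source_def)
    then show False using vertices_tr_face[OF F(1)] dist_all by auto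
  qed
  have "F ~= {}" using F(2) by blast
  then have pe: "paths_exist (face_arcs E F) s v (aff_dim F)" by (rule hk_P[OF F(1) _ sF sink_F[OF F]])
  obtain Q where Q: "finite Q" "int (card Q) = aff_dim F"
    and Qp: "\<And>p. p \<in> Q ==> directed_path (face_arcs E F) s v p"
    and Qd: "\<And>p q. p \<in> Q ==> q \<in> Q ==> p ~= q ==> set p \<inter> set q \<subseteq> {s, v}"
    by (rule paths_existE[OF pe]) (rule that)
  have ex: "\<exists>q. p = q @ [v] \<and> q ~= [] \<and> hd q = s \<and> distinct q \<and> v \<notin> set q \<and>
      successively (\<lambda>u w. (u, w) \<in> face_arcs E F) q \<and> (last q, v) \<in> face_arcs E F" if p: "p \<in> Q" for p
    by (rule directed_path_split[OF Qp[OF p] sv]) (intro exI conjI, assumption+)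
  have split: "p = butlast p @ [v] \<and> butlast p ~= [] \<and> hd (butlast p) = s \<and> distinct (butlast p) \<and>
      v \<notin> set (butlast p) \<and> successively (\<lambda>u w. (u, w) \<in> face_arcs E F) (butlast p) \<and>
      (last (butlast p), v) \<in> face_arcs E F" if p: "p \<in> Q" for p
    using ex[OF p] by (elim exE conjE) simp
  have sub: "set (butlast p) \<subseteq> set p" for p :: "'a list" using in_set_butlastD by fast
  show thesis
  proof (rule that[of "butlast ` Q"])
    show "finite (butlast ` Q)" using Q by simp
    have "inj_on butlast Q"
    proof (rule inj_onI)
      fix p q assume "p \<in> Q" "q \<in> Q" and e: "butlast p = butlast q"
      then have "p = butlast p @ [v]" "q = butlast q @ [v]" using split by blast+
      then show "p = q" unfolding e by simp
    qed
    then show "int (card (butlast ` Q)) = aff_dim F" using card_image Q by fastforce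
  next
    fix q assume "q \<in> butlast ` Q"
    then obtain p where p: "p \<in> Q" "q = butlast p" by blast
    have "last q \<in> {w1, w2, w3, w4}"
      using split[OF p(1)] by (intro to_v_N) (simp add: p(2) face_arcs_def)
    moreover have "set q \<subseteq> vertices F - {v}"
      using directed_path_arcs_vertices[OF Qp[OF p(1)] sV] sub[of p] split[OF p(1)] unfolding p(2) by blast
    ultimately show "q ~= [] \<and> hd q = s \<and> distinct q \<and> successively (\<lambda>u w. (u, w) \<in> face_arcs E F) q \<and>
       last q \<in> {w1, w2, w3, w4} \<and> set q \<subseteq> vertices F - {v}"
      using split[OF p(1)] unfolding p(2) by simp
  next
    fix q q' assume "q \<in> butlast ` Q" "q' \<in> butlast ` Q" and ne: "q ~= q'"
    then obtain p p' where p: "p \<in> Q" "q = butlast p" "p' \<in> Q" "q' = butlast p'" by blast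
    have "p ~= p'" using ne p(2,4) by blast
    then have "set p \<inter> set p' \<subseteq> {s, v}" using Qd p(1,3) by blast
    then show "set q \<inter> set q' \<subseteq> {s}"
      using sub[of p] sub[of p'] split[OF p(1)] unfolding p(2,4) by blast
  qed
qed

lemma stem_arcs:
  assumes F: "F face_of P" and q: "successively (\<lambda>u w. (u, w) \<in> face_arcs E F) q" "set q \<subseteq> vertices F - {v}"
  shows "successively (\<lambda>u w. (u, w) \<in> face_arcs E' (tr F)) q"
proof (rule successively_change[OF q(1)])
  fix x y assume xy: "x \<in> set q" "y \<in> set q" "(x, y) \<in> face_arcs E F"
  then have "x \<in> vertices F" "x ~= v" "y \<in> vertices F" "y ~= v" "(x, y) \<in> E"
    using q(2) by (auto simp: face_arcs_def)
  then show "(x, y) \<in> face_arcs E' (tr F)" by (rule arcs_tr[OF F])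
qed

text \<open>For different stems a common last vertex could only be \<open>s\<close>, and then both
  consist of \<open>s\<close> alone.\<close>

lemma stem_last_unique:
  assumes "p ~= []" "hd p = s" "distinct p" "q ~= []" "hd q = s" "distinct q" "last p = last q"
    "p ~= q ==> set p \<inter> set q \<subseteq> {s}"
  shows "p = q"
proof (rule ccontr)
  assume ne: "p ~= q"
  have "last p \<in> set p" "last q \<in> set q" using assms(1,4) by simp_all
  then have "last p = s" using assms(7) assms(8)[OF ne] by auto
  then have "p = [s]" "q = [s]"
    using distinct_hd_last[of p] distinct_hd_last[of q] assms by simp_all
  then show False using ne by simp
qed

text \<open>The stems end at different neighbours of \<open>v\<close> and continue by a single arc
  to the new sink, \<open>u2\<close> or \<open>u1\<close>. Only a stem ending at \<open>w1\<close>,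
  in case the sink is \<open>u2\<close>, makes a detour over \<open>u1\<close>.\<close>

lemma paths_cut:
  assumes F: "F face_of P" "v \<in> F" and w12: "w1 \<in> F \<or> w2 \<in> F"
    and st: "is_source E' (tr F) s" "is_sink E' (tr F) t"
  shows "paths_exist (face_arcs E' (tr F)) s t (aff_dim F)"
proof -
  have V: "vertices (tr F) = vertices F - {v} \<union> ({u1, u2} \<inter> F)" by (rule vertices_tr_face[OF F(1)])
  have uF: "u1 \<in> F \<longleftrightarrow> w1 \<in> F" "u2 \<in> F \<longleftrightarrow> w2 \<in> F" using u_in_iff[OF F(1)] F(2) by auto
  have uV: "u1 \<notin> vertices F" "u2 \<notin> vertices F" using u_not_vertex vertices_of_face[OF F(1)] by auto
  have FV: "x \<in> F" if "x \<in> vertices F" for x using that vertices_of_face[OF F(1)] by auto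
  have tV: "t \<in> vertices (tr F)" using st(2) by (simp add: is_sink_def)
  have no_out: "(t, y) \<notin> E'" if "y \<in> vertices (tr F)" for y
    using st(2) tV that by (auto simp: is_sink_def face_arcs_def)
  have tT: "t \<in> {u1, u2, w3, w4}" by (rule sink_tr[OF F st(2)])
  have t: "t = (if w2 \<in> F then u2 else u1)"
  proof (cases "w2 \<in> F")
    case True
    then have "u2 \<in> vertices (tr F)" using V uF by simp
    then have "(t, u2) \<notin> E'" by (rule no_out)
    then have "t = u2" using tT unfolding E'_u2 by blast
    then show ?thesis using True by simp
  next
    case False
    then have "u1 \<in> vertices (tr F)" "t ~= u2" using V uF uV w12 tV by auto
    then have "(t, u1) \<notin> E'" by (intro no_out)
    then have "t = u1" using tT \<open>t ~= u2\<close> unfolding E'_u1 by blast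
    then show ?thesis using False by simp
  qed
  have tu: "t \<in> {u1, u2}" by (simp add: t)
  obtain S where S: "finite S" "int (card S) = aff_dim F"
    and stem: "\<And>q. q \<in> S ==> q ~= [] \<and> hd q = s \<and> distinct q \<and> successively (\<lambda>u w. (u, w) \<in> face_arcs E F) q \<and>
       last q \<in> {w1, w2, w3, w4} \<and> set q \<subseteq> vertices F - {v}"
    and Sd: "\<And>p q. p \<in> S ==> q \<in> S ==> p ~= q ==> set p \<inter> set q \<subseteq> {s}"
    by (rule stems[OF F st(1)]) (rule that)
  have path': "successively (\<lambda>u w. (u, w) \<in> face_arcs E' (tr F)) q" if q: "q \<in> S" for q
    using stem_arcs[OF F(1)] stem[OF q] by blast
  have noU: "u1 \<notin> set q" "u2 \<notin> set q" if "q \<in> S" for q using stem[OF that] uV by blast+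
  have lastV: "last q \<in> vertices F" "last q \<in> vertices (tr F)" if "q \<in> S" for q
  proof -
    have "last q \<in> set q" using stem[OF that] by simp
    then show "last q \<in> vertices F" "last q \<in> vertices (tr F)" using stem[OF that] V by blast+
  qed
  have last_unique: "p = q" if pq: "p \<in> S" "q \<in> S" "last p = last q" for p q
    using stem_last_unique[of p s q] stem[OF pq(1)] stem[OF pq(2)] Sd[OF pq(1,2)] pq(3) by blast
  define g where "g q = (if w2 \<in> F \<and> last q = w1 then (q @ [u1]) @ [t] else q @ [t])" for q
  have gp: "directed_path (face_arcs E' (tr F)) s t (g q)" if q: "q \<in> S" for q
  proof (cases "w2 \<in> F \<and> last q = w1")
    case True
    have "w1 \<in> F" using lastV(1)[OF q] True FV by blast
    then have u1V: "u1 \<in> vertices (tr F)" using V uF by simp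
    have "(w1, u1) \<in> face_arcs E' (tr F)" using lastV(2)[OF q] True u1V E'_u1 by (simp add: face_arcs_def)
    moreover have "(u1, t) \<in> face_arcs E' (tr F)" using u1V tV True t E'_from_u1 by (simp add: face_arcs_def)
    moreover have "t ~= u1" using t True dist_T by auto
    moreover have "t \<notin> set q" using noU[OF q] tu by auto
    ultimately have "directed_path (face_arcs E' (tr F)) s t ((q @ [u1]) @ [t])"
      using stem[OF q] path'[OF q] noU[OF q] True
      by (intro directed_pathI) (simp_all add: successively_append_iff)
    then show ?thesis using True by (simp add: g_def)
  next
    case False
    have "(last q, t) \<in> E'"
    proof (cases "w2 \<in> F")
      case True
      then show ?thesis using False stem[OF q] t E'_u2 by auto
    next
      case no: False
      have "last q ~= w2" using lastV(1)[OF q] FV no by blast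
      then show ?thesis using no stem[OF q] t E'_u1 by auto
    qed
    then have "(last q, t) \<in> face_arcs E' (tr F)" using lastV(2)[OF q] tV by (simp add: face_arcs_def)
    moreover have "t \<notin> set q" using noU[OF q] tu by auto
    ultimately have "directed_path (face_arcs E' (tr F)) s t (q @ [t])"
      using stem[OF q] path'[OF q] by (intro directed_pathI) simp_all
    moreover have "g q = q @ [t]" using False by (auto simp: g_def)
    ultimately show ?thesis by simp
  qed
  \<comment> \<open>Deleting the new points recovers the stem, which gives both injectivity of
    \<open>g\<close> and disjointness on old vertices.\<close>
  have filt: "filter (\<lambda>x. x \<notin> {u1, u2}) (g q) = q" if "q \<in> S" for q
  proof -
    have "filter (\<lambda>x. x \<notin> {u1, u2}) q = q"
      using noU[OF that] by (intro filter_True) auto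
    then show ?thesis using tu by (auto simp: g_def)
  qed
  have inj: "inj_on g S" by (rule inj_on_inverseI[where g = "filter (\<lambda>x. x \<notin> {u1, u2})"]) (rule filt)
  have disj: "set (g p) \<inter> set (g q) \<subseteq> {s, t}" if pq: "p \<in> S" "q \<in> S" "p ~= q" for p q
  proof
    fix x assume x: "x \<in> set (g p) \<inter> set (g q)"
    show "x \<in> {s, t}"
    proof (cases "x \<in> {u1, u2}")
      case False
      then have "x \<in> set (filter (\<lambda>x. x \<notin> {u1, u2}) (g p))" "x \<in> set (filter (\<lambda>x. x \<notin> {u1, u2}) (g q))"
        using x by simp_all
      then have "x \<in> set p" "x \<in> set q" unfolding filt[OF pq(1)] filt[OF pq(2)] .
      then show ?thesis using Sd[OF pq] by blast
    next
      case True
      show ?thesis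
      proof (rule ccontr)
        assume xst: "x \<notin> {s, t}"
        have "last r = w1" if r: "r \<in> S" "x \<in> set (g r)" for r
        proof (rule ccontr)
          assume "last r ~= w1"
          then have "x \<in> set r" using r(2) xst by (simp add: g_def)
          then show False using noU[OF r(1)] True by auto
        qed
        then have "last p = w1" "last q = w1" using pq x by blast+
        then show False using last_unique[OF pq(1,2)] pq(3) by simp
      qed
    qed
  qed
  show ?thesis
  proof (rule paths_existI[of "g ` S"])
    show "finite (g ` S)" using S by simp
    show "int (card (g ` S)) = aff_dim F" using card_image[OF inj] S by simp
    show "directed_path (face_arcs E' (tr F)) s t p" if "p \<in> g ` S" for p using gp that by blast
    show "set p \<inter> set q \<subseteq> {s, t}" if pq: "p \<in> g ` S" "q \<in> g ` S" and ne: "p ~= q" for p q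
    proof -
      obtain p' q' where "p' \<in> S" "p = g p'" "q' \<in> S" "q = g q'" using pq by blast
      then show ?thesis using disj[of p' q'] ne by blast
    qed
  qed
qed

text \<open>Without \<open>w1\<close> and \<open>w2\<close>, the section of \<open>F\<close> can
  only have the vertices \<open>w3\<close> and \<open>w4\<close>. If one of them were missing,
  \<open>F\<close> would be a vertex or an edge that does not go below the hyperplane.\<close>

lemma low_face34:
  assumes F: "F face_of P" "v \<in> F" "low F" and w12: "w1 \<notin> F" "w2 \<notin> F"
  shows "F \<inter> H = closed_segment w3 w4" "aff_dim F = 2" "w3 \<in> F" "w4 \<in> F"
proof -
  have FH: "F \<inter> H face_of T" using section_face[OF F(1)] by (simp add: H_def)
  have dim: "aff_dim F = aff_dim (F \<inter> H) + 1" using section_aff_dim[OF F(1,2)] by (simp add: H_def)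
  have "vertices (F \<inter> H) = vertices T \<inter> (F \<inter> H)" by (rule vertices_of_face[OF FH])
  also have "\<dots> = {w3, w4} \<inter> F"
    unfolding vertices_T using u_in_iff[OF F(1)] w12 on by (auto simp: H_def)
  finally have V: "vertices (F \<inter> H) = {w3, w4} \<inter> F" .
  have hull: "F \<inter> H = convex hull ({w3, w4} \<inter> F)"
    using polytope_hull_vertices[OF face_of_polytope_polytope[OF polT FH]] V by simp
  have d: "aff_dim F = int (card ({w3, w4} \<inter> F))"
  proof -
    have "{w3, w4} \<inter> F \<subseteq> {u1, u2, w3, w4}" by auto
    then show ?thesis unfolding dim hull using sub_simplex(2) by simp
  qed
  obtain x where x: "x \<in> F" "a \<bullet> x < b" using F(3) by (auto simp: low_def)
  have "w3 \<in> F \<and> w4 \<in> F"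
  proof (rule ccontr)
    assume n: "\<not> (w3 \<in> F \<and> w4 \<in> F)"
    have "aff_dim F = 0 \<or> aff_dim F = 1"
    proof -
      have "card ({w3, w4} \<inter> F) \<le> 1"
        using n by (cases "w3 \<in> F"; cases "w4 \<in> F") auto
      then show ?thesis unfolding d by linarith
    qed
    then show False
    proof
      assume "aff_dim F = 0"
      then obtain y where "F = {y}" using aff_dim_eq_0 by blast
      then show False using F(2) x av by auto
    next
      assume "aff_dim F = 1"
      then obtain w where w: "adjacent P v w" "F = closed_segment v w"
        using edge_at_vertex[OF polP F(1) _ v F(2)] by blast
      then have "w \<in> {w1, w2, w3, w4}" "w \<in> F" using nbrs by auto
      then have aw: "a \<bullet> w = b" using w12 on by auto
      obtain l where l: "0 \<le> l" "l \<le> 1" "x = (1 - l) *\<^sub>R v + l *\<^sub>R w" using x(1) w(2) by (auto simp: in_segment)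
      have "a \<bullet> x = b + (1 - l) * (a \<bullet> v - b)" by (simp add: l(3) inner_add_right aw algebra_simps)
      moreover have "0 \<le> (1 - l) * (a \<bullet> v - b)" using l av by simp
      ultimately show False using x(2) by simp
    qed
  qed
  then show "w3 \<in> F" "w4 \<in> F" by simp_all
  then have c: "{w3, w4} \<inter> F = {w3, w4}" by auto
  show "F \<inter> H = closed_segment w3 w4" using hull unfolding c segment_convex_hull .
  show "aff_dim F = 2" using d distN unfolding c by simp
qed

text \<open>The two stems of the polygon end at \<open>w3\<close> and \<open>w4\<close>. The latter
  is the new sink, and the stem at \<open>w3\<close> reaches it along the new edge.\<close>

lemma paths_34:
  assumes F: "F face_of P" "v \<in> F" "low F" and w12: "w1 \<notin> F" "w2 \<notin> F"
    and st: "is_source E' (tr F) s" "is_sink E' (tr F) t"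
  shows "paths_exist (face_arcs E' (tr F)) s t (aff_dim F)"
proof -
  note L = low_face34[OF F w12]
  have nadj: "\<not> adjacent P w3 w4" by (rule low_not_adjacent[OF F(1,2) L(1) F(3)])
  have V: "vertices (tr F) = vertices F - {v} \<union> ({u1, u2} \<inter> F)" by (rule vertices_tr_face[OF F(1)])
  have uF: "u1 \<notin> F" "u2 \<notin> F" using u_in_iff[OF F(1)] w12 by auto
  have uV: "u1 \<notin> vertices F" "u2 \<notin> vertices F" using u_not_vertex vertices_of_face[OF F(1)] by auto
  have FV: "x \<in> F" if "x \<in> vertices F" for x using that vertices_of_face[OF F(1)] by auto
  have wV: "w3 \<in> vertices (tr F)" "w4 \<in> vertices (tr F)"
    using V L(3,4) N_vert[of w3] N_vert[of w4] N_neq[of w3] N_neq[of w4] vertices_of_face[OF F(1)] by auto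
  have e34: "(w3, w4) \<in> face_arcs E' (tr F)" using wV by (simp add: face_arcs_def E'_def)
  have "t \<in> {u1, u2, w3, w4}" by (rule sink_tr[OF F(1,2) st(2)])
  moreover have "t \<in> vertices (tr F)" using st(2) by (simp add: is_sink_def)
  moreover have "t ~= w3" using st(2) e34 by (auto simp: is_sink_def)
  ultimately have t: "t = w4" using V uF uV by auto
  have s: "s ~= w4" using st(1) e34 by (auto simp: is_source_def)
  obtain S where S: "finite S" "int (card S) = aff_dim F"
    and stem: "\<And>q. q \<in> S ==> q ~= [] \<and> hd q = s \<and> distinct q \<and> successively (\<lambda>u w. (u, w) \<in> face_arcs E F) q \<and>
       last q \<in> {w1, w2, w3, w4} \<and> set q \<subseteq> vertices F - {v}"
    and Sd: "\<And>p q. p \<in> S ==> q \<in> S ==> p ~= q ==> set p \<inter> set q \<subseteq> {s}"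
    by (rule stems[OF F(1,2) st(1)]) (rule that)
  have path': "successively (\<lambda>u w. (u, w) \<in> face_arcs E' (tr F)) q" if q: "q \<in> S" for q
    using stem_arcs[OF F(1)] stem[OF q] by blast
  have last_unique: "p = q" if pq: "p \<in> S" "q \<in> S" "last p = last q" for p q
    using stem_last_unique[of p s q] stem[OF pq(1)] stem[OF pq(2)] Sd[OF pq(1,2)] pq(3) by blast
  have last34: "last q = w3 \<or> last q = w4" if q: "q \<in> S" for q
  proof -
    have "last q \<in> set q" using stem[OF q] by simp
    then have "last q \<in> F" using stem[OF q] FV by blast
    then show ?thesis using stem[OF q] w12 by auto
  qed
  have "card S = 2" using S(2) L(2) by simp
  then obtain p0 q0 where pq0: "S = {p0, q0}" "p0 ~= q0" by (auto simp: card_2_iff)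
  then have "last p0 ~= last q0" using last_unique by blast
  then have "\<exists>p q. p \<in> S \<and> q \<in> S \<and> last p = w3 \<and> last q = w4"
    using last34[of p0] last34[of q0] pq0(1) by auto
  then obtain p q where pq: "p \<in> S" "q \<in> S" "last p = w3" "last q = w4" by blast
  have ne: "p ~= q" using pq distN by auto
  have sd: "set p \<inter> set q \<subseteq> {s}" by (rule Sd[OF pq(1,2) ne])
  have "w4 \<in> set q" using stem[OF pq(2)] pq(4) last_in_set by blast
  then have w4p: "w4 \<notin> set p" using sd s by blast
  have P1: "directed_path (face_arcs E' (tr F)) s t (p @ [w4])"
    unfolding t using stem[OF pq(1)] path'[OF pq(1)] w4p e34 pq(3) by (intro directed_pathI) simp_all
  have P2: "directed_path (face_arcs E' (tr F)) s t q"
    unfolding t using stem[OF pq(2)] path'[OF pq(2)] pq(4) by (simp add: directed_path_def)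
  \<comment> \<open>Otherwise the second stem would itself use an arc from \<open>w3\<close> to
    \<open>w4\<close>, which are not adjacent in \<open>P\<close>.\<close>
  have N: "p @ [w4] ~= q"
  proof
    assume e: "p @ [w4] = q"
    have "successively (\<lambda>u w. (u, w) \<in> face_arcs E F) (p @ [w4])" using stem[OF pq(2)] e by simp
    then have "(w3, w4) \<in> face_arcs E F" using stem[OF pq(1)] pq(3) by (simp add: successively_append_iff)
    then have "(w3, w4) \<in> E" by (simp add: face_arcs_def)
    then show False using E_adj nadj by blast
  qed
  show ?thesis
  proof (rule paths_existI[of "{p @ [w4], q}"])
    show "finite {p @ [w4], q}" by simp
    show "int (card {p @ [w4], q}) = aff_dim F" using N L(2) by simp
    show "directed_path (face_arcs E' (tr F)) s t x" if "x \<in> {p @ [w4], q}" for x using P1 P2 that by auto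
    have "set (p @ [w4]) \<inter> set q \<subseteq> {s, t}" using sd t by auto
    then show "set x \<inter> set y \<subseteq> {s, t}" if "x \<in> {p @ [w4], q}" "y \<in> {p @ [w4], q}" "x ~= y" for x y
      using that by blast
  qed
qed

lemma hk': "holt_klee (tr P) E'"
  unfolding holt_klee_iff
proof (intro conjI allI impI uso')
  fix G s t assume "G face_of tr P \<and> G ~= {} \<and> is_source E' G s \<and> is_sink E' G t"
  then have G: "G face_of tr P" and st: "is_source E' G s" "is_sink E' G t" and ne: "G ~= {}" by simp_all
  from tr_face_cases[OF G] show "paths_exist (face_arcs E' G) s t (aff_dim G)"
  proof (elim disjE exE conjE)
    assume "G face_of T"
    then show ?thesis using st by (rule paths_simplex)
  next
    fix F assume F: "F face_of P" "low F" "G = tr F"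
    have d: "aff_dim (tr F) = aff_dim F" by (rule tr_aff_dim[OF face_of_imp_convex[OF F(1)] F(2)])
    show ?thesis
    proof (cases "v \<in> F")
      case False
      have e: "G = F" using F(3) tr_notin[OF F(1) False] by simp
      show ?thesis unfolding e arcs_notin[OF F(1) False]
        by (rule hk_P[OF F(1)]) (use ne st source_sink_notin[OF F(1) False] in \<open>simp_all add: e\<close>)
    next
      case True
      note st' = st[unfolded F(3)]
      show ?thesis unfolding F(3) d
        by (cases "w1 \<in> F \<or> w2 \<in> F")
          (use paths_cut[OF F(1) True _ st'] paths_34[OF F(1) True F(2) _ _ st'] in blast)+
    qed
  qed
qed

lemma sink_u2: "is_sink E' (tr P) u2"
  using vertices_tr E'_from_u2 by (simp add: is_sink_def face_arcs_def)

text \<open>The new sink has four neighbours again, which makes the truncation repeatable.\<close>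

lemma nbrs_u2: "{w. adjacent (tr P) u2 w} = {u1, w2, w3, w4}"
proof -
  have "\<not> adjacent P u2 w" for w using adjacentD(2)[of P u2 w] u_not_vertex by blast
  then show ?thesis unfolding adjacent_tr_iff using dist_all by auto
qed

lemma card_vertices_tr: "card (vertices (tr P)) = card (vertices P) + 1"
proof -
  have fin: "finite (vertices P)" by (rule finite_vertices[OF polP])
  have "card (vertices P - {v} \<union> {u1, u2}) = card (vertices P - {v}) + card {u1, u2}"
    by (rule card_Un_disjoint) (use fin u_not_vertex in auto)
  also have "\<dots> = card (vertices P) - 1 + 2" using v fin dist_T by simp
  also have "\<dots> = card (vertices P) + 1"
    using v fin card_gt_0_iff[of "vertices P"] by auto
  finally show ?thesis unfolding vertices_tr .
qed

lemma truncation: "truncation_of P (tr P)"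
  unfolding truncation_of_def
proof (intro exI conjI)
  show "simple_vertex P v" unfolding simple_vertex_def nbrs using v dimP distN by simp
  show "{w \<in> vertices P. b < a \<bullet> w} = {v}" using others v av by force
  show "tr P = P \<inter> {x. a \<bullet> x \<le> b}" by (simp add: tr_def)
  show "card (vertices (tr P)) = card (vertices P) + 1" by (rule card_vertices_tr)
qed

end

lemma chained_map:
  assumes "chained R (map f xs)" "\<And>x y. x \<in> set xs ==> y \<in> set xs ==> R (f x) (f y) ==> S x y"
  shows "chained S xs"
  unfolding chained_def
proof (intro allI impI)
  fix k assume k: "k < length xs" "0 < k"
  then obtain i where i: "i < k" "R (map f xs ! i) (map f xs ! k)"
    using assms(1) unfolding chained_def by fastforce
  then have "S (xs ! i) (xs ! k)" using k by (intro assms(2)) simp_all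
  then show "\<exists>i<k. S (xs ! i) (xs ! k)" using i(1) by blast
qed

lemma edge_vertex_dim:
  fixes P :: "'a::euclidean_space set"
  assumes "polytope P" "v \<in> vertices P" "F face_of P" "v \<in> F" "F ~= {v}"
  shows "\<exists>H. H face_of P \<and> v \<in> H \<and> H \<subseteq> F \<and> aff_dim H = 1"
proof -
  have pF: "polytope F" by (rule face_of_polytope_polytope[OF assms(1,3)])
  have "{v} face_of F" using assms vertices_of_face[OF assms(3)] by (simp add: vertices_face[symmetric])
  then obtain H where H: "H face_of F" "{v} facet_of H"
    using face_between_facet[OF pF, of "{v}"] assms(5) by auto
  have "H face_of P" by (rule face_of_trans[OF H(1) assms(3)])
  moreover have "v \<in> H" "aff_dim H = 1" using H(2) facet_of_imp_subset[OF H(2)] by (auto simp: facet_of_def)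
  ultimately show ?thesis using face_of_imp_subset[OF H(1)] by blast
qed

subsection \<open>Shellings at the vertices on the cutting hyperplane\<close>

text \<open>\<open>w\<close> is one of the two neighbours on the hyperplane and \<open>wb\<close>
  the other. The prefixes \<open>old\<close> and \<open>new\<close> refer to the links of
  \<open>w\<close> before and after the cut.\<close>

locale cut_vertex = simple_cut +
  fixes w wb :: 'a
  assumes wwb: "w = w3 \<and> wb = w4 \<or> w = w4 \<and> wb = w3"
begin

lemma w_on: "a \<bullet> w = b" "a \<bullet> wb = b" using wwb on by auto
lemma w_neq: "w ~= wb" "w ~= v" "wb ~= v" using wwb distN N_neq[of w3] N_neq[of w4] by auto
lemma wP: "w \<in> vertices P" "wb \<in> vertices P" using wwb N_vert[of w3] N_vert[of w4] by auto
lemma w_low: "a \<bullet> w \<le> b" "a \<bullet> wb \<le> b" using w_on by simp_all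
lemma wtr: "w \<in> vertices (tr P)" "wb \<in> vertices (tr P)" using vertices_tr wP w_neq by auto
lemma w_T: "w \<in> {u1, u2, w3, w4}" "wb \<in> {u1, u2, w3, w4}" using wwb by auto

sublocale old: vertex_of_4polytope P w
  by unfold_locales (use polP dimP wP in auto)

sublocale new: vertex_of_4polytope "tr P" w
  by unfold_locales (use pol_tr dim_tr wtr in auto)

lemma old_X: "F \<in> old.X \<longleftrightarrow> F face_of P \<and> w \<in> F \<and> aff_dim F = 1"
  and old_Y: "F \<in> old.Y \<longleftrightarrow> F face_of P \<and> w \<in> F \<and> aff_dim F = 2"
  and old_Z: "F \<in> old.Z \<longleftrightarrow> F face_of P \<and> w \<in> F \<and> aff_dim F = 3"
  and new_X: "F \<in> new.X \<longleftrightarrow> F face_of tr P \<and> w \<in> F \<and> aff_dim F = 1"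
  and new_Y: "F \<in> new.Y \<longleftrightarrow> F face_of tr P \<and> w \<in> F \<and> aff_dim F = 2"
  and new_Z: "F \<in> new.Z \<longleftrightarrow> F face_of tr P \<and> w \<in> F \<and> aff_dim F = 3"
  by (auto simp: old.X_def old.Y_def old.Z_def new.X_def new.Y_def new.Z_def)

definition e0 where "e0 = closed_segment w wb"
text \<open>The cells that both links have in common. The old link has one more, the edge to
  \<open>v\<close>; the new one has the edges to \<open>u1\<close> and \<open>u2\<close>, and
  \<open>e0\<close>, which may or may not be in \<open>D\<close>.\<close>

definition D where "D = {closed_segment w y |y. adjacent P w y \<and> y ~= v}"

lemma on_H: "y \<in> vertices P ==> a \<bullet> y = b ==> y ~= w ==> y = wb"
proof -
  assume y: "y \<in> vertices P" "a \<bullet> y = b" "y ~= w"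
  have "{y} \<inter> H face_of T" using section_face[of "{y}"] y(1) by (simp add: H_def vertices_face)
  then have "{y} face_of T" using y(2) by (simp add: H_def)
  then have "y \<in> {u1, u2, w3, w4}" using vertices_T by (simp add: vertices_face[symmetric])
  then show "y = wb" using y u_not_vertex wwb by auto
qed

lemma adj_tr_w: "adjacent (tr P) w y \<longleftrightarrow> adjacent P w y \<and> y ~= v \<or> y = u1 \<or> y = u2 \<or> y = wb"
proof -
  have "w ~= w1" "w ~= w2" "w ~= u1" "w ~= u2" using wwb distN dist_T by auto
  then show ?thesis
    unfolding adjacent_tr_iff using w_T w_neq wwb dist_T adjacentD(1)[of P w w] by auto
qed

lemma De0_form: "c \<in> insert e0 D ==>
    \<exists>y. c = closed_segment w y \<and> adjacent (tr P) w y \<and> y \<in> vertices P \<and> y ~= w \<and> (y = wb \<or> a \<bullet> y < b)"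
proof -
  assume "c \<in> insert e0 D"
  then show ?thesis
  proof
    assume "c = e0"
    then show ?thesis using wP w_neq adj_tr_w[of wb] by (auto simp: e0_def)
  next
    assume "c \<in> D"
    then obtain y where y: "c = closed_segment w y" "adjacent P w y" "y ~= v" by (auto simp: D_def)
    have yP: "y \<in> vertices P" "y ~= w" using adjacentD(1,3)[OF y(2)] by auto
    have "a \<bullet> y \<le> b" using others[OF yP(1) y(3)] .
    then have "y = wb \<or> a \<bullet> y < b" using on_H[OF yP(1) _ yP(2)] by (cases "a \<bullet> y = b") auto
    then show ?thesis using y yP adj_tr_w[of y] by blast
  qed
qed

lemma De0_low: "c \<in> insert e0 D ==> c \<subseteq> {x. a \<bullet> x \<le> b}"
proof -
  assume "c \<in> insert e0 D"
  then obtain y where y: "c = closed_segment w y" "y = wb \<or> a \<bullet> y < b" using De0_form by blast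
  then have "a \<bullet> y \<le> b" using w_low by auto
  then show ?thesis unfolding y(1) using w_low convex_halfspace_le[of a b] by (intro closed_segment_subset) auto
qed

lemma sub_tr: "c \<in> insert e0 D ==> c \<subseteq> tr F \<longleftrightarrow> c \<subseteq> F"
  using De0_low by (auto simp: tr_def)

lemma De0_new: "c \<in> insert e0 D ==> c \<in> new.X"
proof -
  assume "c \<in> insert e0 D"
  then obtain y where y: "c = closed_segment w y" "adjacent (tr P) w y" using De0_form by blast
  then show ?thesis using adjacentD(1,4)[OF y(2)] by (simp add: new_X aff_dim_closed_segment)
qed

lemma D_old: "c \<in> D ==> c \<in> old.X"
proof -
  assume "c \<in> D"
  then obtain y where y: "c = closed_segment w y" "adjacent P w y" by (auto simp: D_def)
  then show ?thesis using adjacentD(1,4)[OF y(2)] by (simp add: old_X aff_dim_closed_segment)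
qed

lemma w_in: "c \<in> insert e0 D ==> w \<in> c" using De0_new by (auto simp: new_X)

lemma two_below:
  assumes "c \<in> insert e0 D" "x \<in> insert e0 D" "c ~= x"
  shows "\<exists>y. y \<in> c \<union> x \<and> a \<bullet> y < b"
proof -
  obtain y where y: "c = closed_segment w y" "y = wb \<or> a \<bullet> y < b" using De0_form[OF assms(1)] by blast
  obtain y' where y': "x = closed_segment w y'" "y' = wb \<or> a \<bullet> y' < b" using De0_form[OF assms(2)] by blast
  have "\<not> (y = wb \<and> y' = wb)" using y(1) y'(1) assms(3) by blast
  then have "a \<bullet> y < b \<or> a \<bullet> y' < b" using y(2) y'(2) by blast
  then show ?thesis unfolding y(1) y'(1) by (meson UnI1 UnI2 ends_in_segment(2))
qed

lemma two_low:
  assumes "c \<in> insert e0 D" "x \<in> insert e0 D" "c ~= x" "c \<subseteq> F" "x \<subseteq> F"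
  shows "low F"
  using two_below[OF assms(1-3)] assms(4,5) unfolding low_def by blast

text \<open>Of two different cells at least one ends strictly below the hyperplane. So a face
  containing both is not part of \<open>T\<close>, and between such cells the two links have the
  same incidences.\<close>

lemma two_tr:
  assumes "c \<in> insert e0 D" "x \<in> insert e0 D" "c ~= x" "c \<subseteq> G" "x \<subseteq> G" "G face_of tr P"
  obtains F where "F face_of P" "low F" "G = tr F" "c \<subseteq> F" "x \<subseteq> F" "aff_dim F = aff_dim G"
proof -
  have "\<not> G face_of T"
  proof
    assume "G face_of T"
    then have "G \<subseteq> T" by (rule face_of_imp_subset)
    then show False using two_low[OF assms(1-5)] T_val by (auto simp: low_def)
  qed
  then obtain F where F: "F face_of P" "low F" "G = tr F" using tr_face_cases[OF assms(6)] by blast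
  have "c \<subseteq> F" "x \<subseteq> F" using assms(4,5) unfolding F(3) by (auto simp: tr_def)
  then show thesis using that F tr_aff_dim[OF face_of_imp_convex[OF F(1)] F(2)] by simp
qed

lemma Ed_tr:
  assumes "C \<subseteq> insert e0 D" "x \<in> insert e0 D" "x \<notin> C"
  shows "tr ` (old.Ed C \<inter> old.Ed {x}) = new.Ed C \<inter> new.Ed {x}"
    and "K \<in> old.Ed C \<inter> old.Ed {x} ==> low K"
    and "K \<in> old.Ed C \<inter> old.Ed {x} ==> K face_of P"
proof -
  show K: "K face_of P" if "K \<in> old.Ed C \<inter> old.Ed {x}" for K using that by (auto simp: old.Ed_def old_Y)
  show lowK: "low K" if KI: "K \<in> old.Ed C \<inter> old.Ed {x}" for K
  proof -
    obtain c where c: "c \<in> C" "c \<subseteq> K" "x \<subseteq> K" using KI by (auto simp: old.Ed_def)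
    have "c \<in> insert e0 D" "c ~= x" using c(1) assms by blast+
    then show ?thesis using two_low assms(2) c by blast
  qed
  show "tr ` (old.Ed C \<inter> old.Ed {x}) = new.Ed C \<inter> new.Ed {x}"
  proof
    show "tr ` (old.Ed C \<inter> old.Ed {x}) \<subseteq> new.Ed C \<inter> new.Ed {x}"
    proof
      fix G assume "G \<in> tr ` (old.Ed C \<inter> old.Ed {x})"
      then obtain F where F: "F \<in> old.Ed C \<inter> old.Ed {x}" "G = tr F" by blast
      obtain c where c: "c \<in> C" "c \<subseteq> F" "x \<subseteq> F" "aff_dim F = 2" "w \<in> F"
        using F(1) by (auto simp: old.Ed_def old_Y)
      have "c \<in> insert e0 D" using c(1) assms by blast
      then have "c \<subseteq> G" "x \<subseteq> G" unfolding F(2) using c sub_tr assms(2) by blast+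
      moreover have "G \<in> new.Y"
        unfolding F(2) new_Y using tr_face[OF K[OF F(1)]] c w_low
          tr_aff_dim[OF face_of_imp_convex[OF K[OF F(1)]] lowK[OF F(1)]] by (simp add: tr_def)
      ultimately show "G \<in> new.Ed C \<inter> new.Ed {x}" using c(1) by (auto simp: new.Ed_def)
    qed
    show "new.Ed C \<inter> new.Ed {x} \<subseteq> tr ` (old.Ed C \<inter> old.Ed {x})"
    proof
      fix G assume "G \<in> new.Ed C \<inter> new.Ed {x}"
      then obtain c where c: "c \<in> C" "c \<subseteq> G" "x \<subseteq> G" "aff_dim G = 2" "G face_of tr P"
        by (auto simp: new.Ed_def new_Y)
      have ci: "c \<in> insert e0 D" "c ~= x" using c(1) assms by blast+
      obtain F where F: "F face_of P" "low F" "G = tr F" "c \<subseteq> F" "x \<subseteq> F" "aff_dim F = aff_dim G"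
        by (rule two_tr[OF ci(1) assms(2) ci(2) c(2,3,5)]) (rule that)
      have "F \<in> old.Y" unfolding old_Y using F c(4) w_in[OF ci(1)] by auto
      then have "F \<in> old.Ed C \<inter> old.Ed {x}" using F(4,5) c(1) by (auto simp: old.Ed_def)
      then show "G \<in> tr ` (old.Ed C \<inter> old.Ed {x})" using F(3) by blast
    qed
  qed
qed

text \<open>Every edge and vertex of the links entering \<open>arc C x\<close> contains
  \<open>x\<close> and a further cell of \<open>C\<close>. It is therefore the cut of a
  \<open>low\<close> face, and \<open>tr\<close> carries it between the links.\<close>

lemma arc_transfer:
  assumes CD: "C \<subseteq> D" and xD: "x \<in> D" and xC: "x \<notin> C" and arc: "new.arc C x"
  shows "old.arc C x"
proof -
  have CD': "C \<subseteq> insert e0 D" "x \<in> insert e0 D" using CD xD by auto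
  define I where "I = old.Ed C \<inter> old.Ed {x}"
  have trI: "new.Ed C \<inter> new.Ed {x} = tr ` I" unfolding I_def by (rule Ed_tr(1)[OF CD' xC, symmetric])
  have I: "K face_of P" "low K" if "K \<in> I" for K using Ed_tr(2,3)[OF CD' xC] that unfolding I_def by blast+
  obtain Is where ne: "tr ` I ~= {}" and pt: "new.Pt C \<inter> new.Pt {x} \<subseteq> new.Pe (tr ` I)"
    and Is: "chained new.shareZ Is" "distinct Is" "set Is = tr ` I"
    using arc unfolding new.arc_def trI by blast
  have inj: "inj_on tr I"
  proof (rule inj_onI)
    fix K K' assume K: "K \<in> I" "K' \<in> I" "tr K = tr K'"
    then show "K = K'"
      using tr_sub_iff[OF I(1)[OF K(1)] I(1)[OF K(2)] I(2)[OF K(1)]]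
        tr_sub_iff[OF I(1)[OF K(2)] I(1)[OF K(1)] I(2)[OF K(2)]] by blast
  qed
  define Js where "Js = map (inv_into I tr) Is"
  have mJ: "map tr Js = Is"
    unfolding Js_def map_map by (rule map_idI) (simp add: Is(3) f_inv_into_f)
  have sJ: "set Js = I"
  proof -
    have "set Js = inv_into I tr ` tr ` I" by (simp add: Js_def Is(3))
    then show ?thesis using inj by (simp add: inv_into_image_cancel)
  qed
  have dJ: "distinct Js" using Is(2) unfolding mJ[symmetric] by (simp add: distinct_map)
  have xw: "w \<in> x" by (rule w_in[OF CD'(2)])
  have chain: "chained old.shareZ Js"
  proof (rule chained_map)
    show "chained new.shareZ (map tr Js)" using Is(1) mJ by simp
    fix K K' assume K: "K \<in> set Js" "K' \<in> set Js" and sh: "new.shareZ (tr K) (tr K')"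
    have KI: "K \<in> I" "K' \<in> I" using K sJ by blast+
    obtain G where G: "G face_of tr P" "aff_dim G = 3" "tr K \<subseteq> G" "tr K' \<subseteq> G"
      using sh by (auto simp: new.shareZ_def new_Z)
    obtain c where c: "c \<in> C" "c \<subseteq> K" "x \<subseteq> K" using KI(1) by (auto simp: I_def old.Ed_def)
    have ci: "c \<in> insert e0 D" "c ~= x" using c(1) CD xC by blast+
    have "c \<subseteq> tr K" "x \<subseteq> tr K" using c(2,3) sub_tr[OF ci(1), of K] sub_tr[OF CD'(2), of K] by simp_all
    then have cG: "c \<subseteq> G" "x \<subseteq> G" using order_trans[OF _ G(3)] by simp_all
    obtain F where F: "F face_of P" "low F" "G = tr F" "c \<subseteq> F" "x \<subseteq> F" "aff_dim F = aff_dim G"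
      by (rule two_tr[OF ci(1) CD'(2) ci(2) cG G(1)]) (rule that)
    have "K \<subseteq> F" "K' \<subseteq> F"
      using tr_sub_iff[OF I(1)[OF KI(1)] F(1) I(2)[OF KI(1)]] tr_sub_iff[OF I(1)[OF KI(2)] F(1) I(2)[OF KI(2)]]
        G(3,4) F(3) by simp_all
    moreover have "F \<in> old.Z" unfolding old_Z using F G(2) xw by auto
    ultimately show "old.shareZ K K'" unfolding old.shareZ_def by blast
  qed
  have "old.Pt C \<inter> old.Pt {x} \<subseteq> old.Pe I"
  proof
    fix F assume F: "F \<in> old.Pt C \<inter> old.Pt {x}"
    then obtain c where c: "c \<in> C" "c \<subseteq> F" "x \<subseteq> F" "F face_of P" "aff_dim F = 3" "F \<in> old.Z"
      by (auto simp: old.Pt_def old_Z)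
    have ci: "c \<in> insert e0 D" "c ~= x" using c(1) CD xC by blast+
    have lowF: "low F" by (rule two_low[OF ci(1) CD'(2) ci(2) c(2,3)])
    have wF: "w \<in> tr F" using xw c(3) w_low by (auto simp: tr_def)
    have "tr F \<in> new.Z"
      unfolding new_Z using tr_face[OF c(4)] wF tr_aff_dim[OF face_of_imp_convex[OF c(4)] lowF] c(5) by simp
    moreover have "c \<subseteq> tr F" "x \<subseteq> tr F" using c(2,3) sub_tr[OF ci(1), of F] sub_tr[OF CD'(2), of F] by simp_all
    ultimately have "tr F \<in> new.Pt C \<inter> new.Pt {x}" using c(1) by (auto simp: new.Pt_def)
    then obtain K where K: "K \<in> I" "tr K \<subseteq> tr F" using pt by (auto simp: new.Pe_def)
    then have "K \<subseteq> F" using tr_sub_iff[OF I(1)[OF K(1)] c(4) I(2)[OF K(1)]] by simp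
    then show "F \<in> old.Pe I" using K(1) c(6) by (auto simp: old.Pe_def)
  qed
  then show ?thesis
    unfolding old.arc_def I_def[symmetric] using ne chain dJ sJ by blast
qed

text \<open>\<open>F\<close> contains \<open>v\<close>, since otherwise \<open>w3\<close> and
  \<open>w4\<close> would be adjacent, and faces through \<open>v\<close> are compared by their
  sections.\<close>

lemma face34_sub:
  assumes K: "K face_of P" "v \<in> K" "K \<inter> H = closed_segment w3 w4"
    and F: "F face_of P" "w3 \<in> F" "w4 \<in> F" and nadj: "\<not> adjacent P w3 w4"
  shows "K \<subseteq> F"
proof -
  have vF: "v \<in> F" using adjacent_w34[OF F] nadj by blast
  have "closed_segment w3 w4 \<subseteq> F" using F face_of_imp_convex[OF F(1)] by (simp add: closed_segment_subset)
  then have "K \<inter> H \<subseteq> F \<inter> H" using K(3) by blast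
  then show ?thesis using section_sub_iff[OF K(1,2) F(1) vF] by (simp add: H_def)
qed

lemma e0_not_D: "e0 \<notin> D ==> \<not> adjacent P w3 w4"
proof
  assume "e0 \<notin> D" "adjacent P w3 w4"
  then have "adjacent P w wb" using wwb adjacent_commute by metis
  then show False using \<open>e0 \<notin> D\<close> w_neq by (auto simp: D_def e0_def)
qed

text \<open>If \<open>[w3, w4]\<close> is a new edge then it lies in a single 2-face of \<open>P\<close>, which has only one
  further edge at \<open>w\<close>.\<close>

lemma e0_near:
  assumes K: "K face_of P" "v \<in> K" "K \<inter> H = closed_segment w3 w4" "aff_dim K = 2" and e0D: "e0 \<notin> D"
  shows "x \<in> D ==> G \<in> new.Y ==> e0 \<subseteq> G ==> x \<subseteq> G ==> x \<subseteq> K"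
    and "x \<in> D ==> x' \<in> D ==> x \<subseteq> K ==> x' \<subseteq> K ==> x = x'"
proof -
  have nadj: "\<not> adjacent P w3 w4" by (rule e0_not_D[OF e0D])
  show "x \<subseteq> K" if x: "x \<in> D" and G: "G \<in> new.Y" "e0 \<subseteq> G" "x \<subseteq> G"
  proof -
    have "e0 \<in> insert e0 D" "x \<in> insert e0 D" "e0 ~= x" "G face_of tr P" "aff_dim G = 2"
      using x e0D G(1) by (auto simp: new_Y)
    from two_tr[OF this(1-3) G(2,3) this(4)] this(5)
    obtain F where F: "F face_of P" "G = tr F" "e0 \<subseteq> F" "x \<subseteq> F" "aff_dim F = 2" by metis
    have "w3 \<in> F" "w4 \<in> F" using F(3) wwb by (auto simp: e0_def)
    then have "K \<subseteq> F" using face34_sub[OF K(1-3) F(1) _ _ nadj] by blast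
    then have "K = F" using old.same_dim[OF K(1) F(1)] K(4) F(5) by simp
    then show ?thesis using F(4) by simp
  qed
  show "x = x'" if x: "x \<in> D" "x' \<in> D" "x \<subseteq> K" "x' \<subseteq> K"
  proof (rule ccontr)
    assume ne: "x ~= x'"
    have wK: "w \<in> K" using K(3) wwb by auto
    then have KY: "K \<in> old.Y" using K by (simp add: old_Y)
    have vw: "adjacent P v w" using adj_N[of w] wwb by blast
    then have wv: "closed_segment w v face_of P" using adjacentD(4) closed_segment_commute by metis
    have wvX: "closed_segment w v \<in> old.X" using wv w_neq by (simp add: old_X aff_dim_closed_segment)
    have wvK: "closed_segment w v \<subseteq> K" using wK K(1,2) by (simp add: closed_segment_subset face_of_imp_convex)
    have nD: "closed_segment w v ~= y" if "y \<in> D" for y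
    proof
      assume "closed_segment w v = y"
      then have "closed_segment w v \<subseteq> {x. a \<bullet> x \<le> b}" using De0_low[of y] that by blast
      then show False using av by auto
    qed
    \<comment> \<open>A polygon has two edges at \<open>w\<close>, and in \<open>K\<close> one of
      them leads to \<open>v\<close>.\<close>
    have "{closed_segment w v, x, x'} \<subseteq> {x \<in> old.X. x \<subseteq> K}" using wvX wvK x D_old by blast
    moreover have "card {closed_segment w v, x, x'} = 3" using ne nD[OF x(1)] nD[OF x(2)] by simp
    moreover have "finite {x \<in> old.X. x \<subseteq> K}" using old.finX by simp
    ultimately have "3 \<le> card {x \<in> old.X. x \<subseteq> K}" using card_mono by metis
    then show False using old.edge_X[OF KY] by simp
  qed
qed

text \<open>Suppose that \<open>e0\<close> is a new edge. By \<open>pos\<close>, once the list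
  contains more than \<open>e0\<close> alone, the only cell of \<open>D\<close> that can share an
  edge with \<open>e0\<close> is already in it. So later cells share no edge with \<open>e0\<close>,
  and dropping \<open>e0\<close> leaves their arcs unchanged.\<close>

lemma pshell_restrict:
  assumes "new.pshell L" "set L \<subseteq> insert e0 D"
  shows "old.pshell (filter (\<lambda>x. x \<in> D) L)"
proof -
  obtain K where K: "K face_of P" "v \<in> K" "K \<inter> H = closed_segment w3 w4" "aff_dim K = 2"
    by (rule face34)
  have pos: "L = [e0] \<or> (\<exists>x0\<in>set L \<inter> D. x0 \<subseteq> K)"
    if "new.pshell L" "set L \<subseteq> insert e0 D" "e0 \<in> set L" "e0 \<notin> D" for L
    using that(1-3)
  proof (induction L rule: rev_induct)
    case (snoc x L)
    note e0D = that(4)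
    have L: "new.pshell L" "x \<notin> set L" "L ~= [] --> new.arc (set L) x" "set L \<subseteq> insert e0 D" "x \<in> insert e0 D"
      using new.pshell_snoc[THEN iffD1, OF snoc.prems(1)] snoc.prems(2) by simp_all
    show ?case
    proof (cases "e0 \<in> set L")
      case False
      then have x: "x = e0" using snoc.prems(3) by simp
      show ?thesis
      proof (cases "L = []")
        case False
        then obtain G where G: "G \<in> new.Ed (set L)" "G \<in> new.Ed {e0}" using L(3) x by (auto simp: new.arc_def)
        then obtain c where c: "c \<in> set L" "c \<subseteq> G" "e0 \<subseteq> G" "G \<in> new.Y" by (auto simp: new.Ed_def)
        have "c \<in> D" using c(1) L(4) \<open>e0 \<notin> set L\<close> by auto
        then have "c \<subseteq> K" using e0_near(1)[OF K e0D] c by blast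
        then show ?thesis using c(1) \<open>c \<in> D\<close> by auto
      qed (simp add: x)
    next
      case True
      then have xD: "x \<in> D" using L(2,5) by auto
      from snoc.IH[OF L(1,4) True] show ?thesis
      proof
        assume Le: "L = [e0]"
        then obtain G where "e0 \<subseteq> G" "x \<subseteq> G" "G \<in> new.Y" using L(3) by (auto simp: new.arc_def new.Ed_def)
        then have "x \<subseteq> K" using e0_near(1)[OF K e0D xD] by blast
        then show ?thesis using xD by auto
      next
        assume "\<exists>x0\<in>set L \<inter> D. x0 \<subseteq> K"
        then show ?thesis by auto
      qed
    qed
  qed simp
  show ?thesis
    using assms
  proof (induction L rule: rev_induct)
    case (snoc x L)
    have L: "new.pshell L" "x \<notin> set L" "L ~= [] --> new.arc (set L) x" "set L \<subseteq> insert e0 D" "x \<in> insert e0 D"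
      using new.pshell_snoc[THEN iffD1, OF snoc.prems(1)] snoc.prems(2) by simp_all
    have IH: "old.pshell (filter (\<lambda>x. x \<in> D) L)" by (rule snoc.IH[OF L(1,4)])
    show ?case
    proof (cases "x \<in> D")
      case False
      then show ?thesis using IH by simp
    next
      case xD: True
      define C where "C = set (filter (\<lambda>x. x \<in> D) L)"
      have CD: "C \<subseteq> D" "x \<notin> C" using L(2) by (auto simp: C_def)
      have "old.arc C x" if ne: "filter (\<lambda>x. x \<in> D) L ~= []"
      proof (rule arc_transfer[OF CD(1) xD CD(2)])
        have "L ~= []" using ne by auto
        then have arc: "new.arc (set L) x" using L(3) by blast
        show "new.arc C x"
        proof (cases "set L \<subseteq> D")
          case True
          then have "C = set L" by (auto simp: C_def)
          then show ?thesis using arc by simp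
        next
          case False
          then have e0: "e0 \<in> set L" "e0 \<notin> D" using L(4) by auto
          then have SL: "set L = insert e0 C" using L(4) by (auto simp: C_def)
          have "L ~= [e0]" using ne e0 by auto
          then obtain x0 where x0: "x0 \<in> set L" "x0 \<in> D" "x0 \<subseteq> K" using pos[OF L(1,4) e0] by blast
          then have "\<not> x \<subseteq> K" using e0_near(2)[OF K e0(2) xD x0(2)] L(2) by blast
          then have "G \<notin> new.Ed {e0} \<inter> new.Ed {x}" for G
            using e0_near(1)[OF K e0(2) xD] by (auto simp: new.Ed_def)
          then have E: "new.Ed (insert e0 C) \<inter> new.Ed {x} = new.Ed C \<inter> new.Ed {x}"
            by (subst new.Ed_insert) blast
          have "new.Pt C \<subseteq> new.Pt (insert e0 C)" by (subst new.Pt_insert) blast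
          then show ?thesis using arc unfolding SL new.arc_def E by blast
        qed
      qed
      then show ?thesis
        using IH xD D_old[OF xD] CD(2) by (simp add: old.pshell_snoc C_def)
    qed
  qed (simp add: old.pshell_def)
qed

end

text \<open>Splitting the list as \<open>A @ x # B\<close> in place of indices lets the conditions
  pass through \<open>filter\<close>. The premise \<open>A ~= []\<close> exempts the first vertex,
  where any shelling of the dual facet will do.\<close>

definition shelling_order :: "'a::euclidean_space set \<Rightarrow> ('a \<times> 'a) set \<Rightarrow> 'a list \<Rightarrow> bool" where
  "shelling_order P E vs \<longleftrightarrow> distinct vs \<and> set vs = vertices P \<and>
     (\<forall>A x B. vs = A @ x # B --> (\<forall>y. (y, x) \<in> E --> y \<in> set A) \<and> (A ~= [] --> vertex_step P (set A) x))"

lemma cov_vertex_nonempty: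
  fixes P :: "'a::euclidean_space set"
  assumes "polytope P" "2 \<le> aff_dim P" "x \<in> vertices P"
  shows "cov (pf P) {x} ~= {}"
proof -
  have PP: "P face_of P" using assms(1) polytope_imp_convex face_of_refl by blast
  have "P ~= {x}" using assms(2) by auto
  then obtain H where "H face_of P" "x \<in> H" "aff_dim H = 1"
    using edge_vertex_dim[OF assms(1,3) PP] assms(3) vertices_sub by blast
  then have "H \<in> cov (pf P) {x}"
    unfolding cov_pf[OF assms(1) assms(3)[unfolded vertices_face]] using assms(2) by (auto simp: pf_def)
  then show ?thesis by blast
qed

lemma dshelling_property_order:
  fixes P :: "'a::euclidean_space set"
  assumes P: "polytope P" "2 \<le> aff_dim P" and E: "polytopal_digraph P E"
  shows "dshelling_property P E \<longleftrightarrow> (\<exists>vs. shelling_order P E vs)"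
proof
  have EV: "y \<in> vertices P" if "(y, x) \<in> E" for x y
    using E that adjacentD(2)[of P y x] by (auto simp: polytopal_digraph_def)
  have "P ~= {}" using P(2) by auto
  then have neV: "vertices P ~= {}" by (rule vertices_nonempty[OF P(1)])
  show "\<exists>vs. shelling_order P E vs" if "dshelling_property P E"
  proof -
    obtain vs where top: "topological_sort P E vs" and d: "dshell (pf P) {} (map (\<lambda>v. {v}) vs)"
      using \<open>dshelling_property P E\<close> by (auto simp: dshelling_property_def)
    have vs: "distinct vs" "set vs = vertices P"
      and ord: "\<And>i j. i < length vs ==> j < length vs ==> (vs ! i, vs ! j) \<in> E ==> i < j"
      using top by (auto simp: topological_sort_def)
    have step: "vertex_step P (set (take j vs)) (vs ! j)" if j: "0 < j" "j < length vs" for j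
      using d
    proof cases
      \<comment> \<open>Impossible in dimension at least 2, where every vertex is covered by an
        edge.\<close>
      case points
      have "vs ! j \<in> vertices P" "{vs ! j} \<in> set (map (\<lambda>v. {v}) vs)" using j nth_mem[of j vs] vs(2) by auto
      then show ?thesis using points(3) cov_vertex_nonempty[OF P] by blast
    next
      case (step Hs)
      from step(5)[rule_format, of j] j obtain Ks r where K: "dshell (pf P) {vs ! j} Ks" "1 \<le> r" "r \<le> length Ks"
        "\<forall>X\<in>pf P. map (\<lambda>v. {v}) vs ! j \<subseteq> X --> (\<exists>i<j. map (\<lambda>v. {v}) vs ! i \<subseteq> X) = (\<exists>k<r. Ks ! k \<subseteq> X)"
        by auto
      have "(\<exists>u\<in>set (take j vs). u \<in> F) \<longleftrightarrow> (\<exists>k<r. Ks ! k \<subseteq> F)" if F: "F \<in> pf P" "vs ! j \<in> F" for F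
      proof -
        have "(\<exists>i<j. map (\<lambda>v. {v}) vs ! i \<subseteq> F) \<longleftrightarrow> (\<exists>k<r. Ks ! k \<subseteq> F)"
          using K(4)[rule_format, OF F(1)] F(2) j(2) by simp
        moreover have "(\<exists>i<j. map (\<lambda>v. {v}) vs ! i \<subseteq> F) \<longleftrightarrow> (\<exists>i<j. vs ! i \<in> F)"
          using j(2) by (auto intro!: arg_cong[where f = Ex])
        ultimately show ?thesis using append_Cons_nth(2)[OF j(2), of F] by simp
      qed
      then show ?thesis by (rule vertex_stepI[OF K(1-3)])
    qed
    have "shelling_order P E vs"
      unfolding shelling_order_def
    proof (intro conjI allI impI vs)
      fix A x B assume AB: "vs = A @ x # B"
      then have j: "length A < length vs" "vs ! length A = x" "take (length A) vs = A" by simp_all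
      show "y \<in> set A" if yx: "(y, x) \<in> E" for y
      proof -
        obtain i where i: "i < length vs" "vs ! i = y" using EV[OF yx] vs(2) by (metis in_set_conv_nth)
        then have "i < length A" using ord[OF i(1) j(1)] yx j(2) by simp
        then show ?thesis using i AB nth_mem[of i A] by (simp add: nth_append)
      qed
      show "vertex_step P (set A) x" if "A ~= []" using step[of "length A"] that j by simp
    qed
    then show ?thesis by blast
  qed
  show "dshelling_property P E" if "\<exists>vs. shelling_order P E vs"
  proof -
    obtain vs where "shelling_order P E vs" using \<open>\<exists>vs. shelling_order P E vs\<close> by blast
    then have vs: "distinct vs" "set vs = vertices P"
      and ord: "\<And>A x B y. vs = A @ x # B ==> (y, x) \<in> E ==> y \<in> set A"
      and step: "\<And>A x B. vs = A @ x # B ==> A ~= [] ==> vertex_step P (set A) x"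
      by (auto simp: shelling_order_def)
    have "topological_sort P E vs"
      unfolding topological_sort_def
    proof (intro conjI allI impI vs)
      fix i j assume ij: "i < length vs \<and> j < length vs \<and> (vs ! i, vs ! j) \<in> E"
      then have "vs ! i \<in> set (take j vs)" using ord[OF append_Cons_nth(1)] by blast
      then obtain i' where "i' < j" "vs ! i' = vs ! i" using ij set_take_nth[of j vs] by auto
      then show "i < j" using ij vs(1) nth_eq_iff_index_eq[of vs i' i] by auto
    qed
    moreover have "dshell (pf P) {} (map (\<lambda>v. {v}) vs)"
    proof -
      have ne: "vs ~= []" using neV vs(2) by (cases vs) simp_all
      have "hd vs \<in> set vs" using ne by simp
      then have "hd vs \<in> vertices P" by (simp add: vs(2))
      then obtain Hs where Hs: "dshell (pf P) {hd vs} Hs" using dshell_vertex_exists[OF P] by blast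
      show ?thesis
      proof (rule dshell_of_steps[OF P(1) _ vs ne Hs])
        show "1 \<le> aff_dim P" using P(2) by simp
        fix j assume j: "0 < j" "j < length vs"
        then have "take j vs ~= []" by auto
        then show "vertex_step P (set (take j vs)) (vs ! j)" by (rule step[OF append_Cons_nth(1)[OF j(2)]])
      qed
    qed
    ultimately show ?thesis unfolding dshelling_property_def by blast
  qed
qed

text \<open>A face through \<open>x\<close> other than \<open>{x}\<close> contains both another
  vertex and an edge at \<open>x\<close>, so a whole shelling serves as its own initial
  piece.\<close>

lemma vertex_step_last:
  fixes P :: "'a::euclidean_space set"
  assumes P: "polytope P" "2 \<le> aff_dim P" and x: "x \<in> vertices P"
  shows "vertex_step P (vertices P - {x}) x"
proof -
  obtain Ks where K: "dshell (pf P) {x} Ks" using dshell_vertex_exists[OF P x] by blast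
  have sK: "set Ks = {G \<in> pf P. {x} \<subseteq> G \<and> aff_dim G = 1}"
    using dshell_set[OF K] cov_pf[OF P(1) x[unfolded vertices_face]] by simp
  have "Ks ~= []" using dshell_set[OF K] cov_vertex_nonempty[OF P x] by auto
  then have len: "1 \<le> length Ks" by (simp add: Suc_le_eq)
  show ?thesis
  proof (rule vertex_stepI[OF K len order_refl])
    fix F assume F: "F \<in> pf P" "x \<in> F"
    then have fF: "F face_of P" by (simp add: pf_def)
    have pF: "polytope F" by (rule face_of_polytope_polytope[OF P(1) fF])
    show "(\<exists>u\<in>vertices P - {x}. u \<in> F) \<longleftrightarrow> (\<exists>k<length Ks. Ks ! k \<subseteq> F)"
    proof (cases "F = {x}")
      case True
      have "\<not> Ks ! k \<subseteq> F" if "k < length Ks" for k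
      proof
        assume "Ks ! k \<subseteq> F"
        moreover have "aff_dim (Ks ! k) = 1" using nth_mem[OF that] sK by auto
        ultimately show False using aff_dim_subset[of "Ks ! k" F] True by simp
      qed
      then show ?thesis using True by auto
    next
      case False
      obtain G where G: "G face_of P" "x \<in> G" "G \<subseteq> F" "aff_dim G = 1"
        using edge_vertex_dim[OF P(1) x fF F(2) False] by blast
      then have "G \<in> set Ks" unfolding sK using P(2) by (auto simp: pf_def)
      then have R: "\<exists>k<length Ks. Ks ! k \<subseteq> F" using G(3) by (auto simp: in_set_conv_nth)
      have "vertices F ~= {x}"
      proof
        assume "vertices F = {x}"
        then have "F = {x}" using polytope_hull_vertices[OF pF] by simp
        then show False using False by simp
      qed
      moreover have "x \<in> vertices F" using vertices_of_face[OF fF] x F(2) by blast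
      ultimately show ?thesis using R vertices_of_face[OF fF] by blast
    qed
  qed
qed

lemma filter_eq_append_Cons:
  assumes "filter p xs = A @ x # B"
  shows "\<exists>A' B'. xs = A' @ x # B' \<and> filter p A' = A \<and> filter p B' = B \<and> p x"
  using assms
proof (induction xs arbitrary: A)
  case (Cons z xs)
  show ?case
  proof (cases "p z \<and> A = []")
    case True
    then show ?thesis using Cons.prems by (intro exI[of _ "[]"] exI[of _ xs]) simp
  next
    case False
    define A1 where "A1 = (if p z then tl A else A)"
    have A: "A = (if p z then z # A1 else A1)" using Cons.prems False by (cases A) (auto simp: A1_def)
    have "filter p xs = A1 @ x # B" using Cons.prems A by (simp split: if_splits)
    then obtain A' B' where "xs = A' @ x # B' \<and> filter p A' = A1 \<and> filter p B' = B \<and> p x" using Cons.IH by blast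
    then show ?thesis using A by (intro exI[of _ "z # A'"] exI[of _ B']) auto
  qed
qed simp

section \<open>Pulling a shelling order back from the truncation\<close>

context cut_vertex begin

text \<open>The edges from \<open>w\<close> to \<open>A\<close> begin a shelling of the new link.
  Restricted to edges of \<open>P\<close> they form a partial shelling of the old link, which is
  then completed there. \<open>near\<close> takes care of faces that \<open>A\<close> reaches only
  along the new edge to \<open>wb\<close>.\<close>

lemma arc_at_w:
  assumes A: "A \<subseteq> vertices (tr P)" "w \<notin> A" "u1 \<notin> A" "u2 \<notin> A"
    and near: "\<And>K y. K face_of P ==> v \<in> K ==> K \<inter> H = closed_segment w3 w4 ==> aff_dim K = 2 ==> low K ==>
        wb \<in> A ==> adjacent (tr P) w y ==> y \<in> K ==> y ~= wb ==> y \<in> A"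
    and new: "vertex_step (tr P) A w"
    and ne: "A ~= {}"
  shows "vertex_step P A w"
proof -
  obtain Ks r where K: "dshell (pf (tr P)) {w} Ks" "1 \<le> r" "r \<le> length Ks"
    and eq: "\<And>F. F \<in> pf (tr P) ==> w \<in> F ==> (\<exists>u\<in>A. u \<in> F) \<longleftrightarrow> (\<exists>k<r. Ks ! k \<subseteq> F)"
    by (rule vertex_stepE[OF new]) (rule that)
  have pK: "new.pshell Ks" "set Ks = new.X" using new.dshell_vertex_pshell[OF K(1)] by blast+
  have segX: "closed_segment w y \<in> new.X" if "adjacent (tr P) w y" for y
    using adjacentD(1,4)[OF that] by (simp add: new_X aff_dim_closed_segment)
  \<comment> \<open>The step condition, tested at a single edge of \<open>tr P\<close> at
    \<open>w\<close>.\<close>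
  have memL: "closed_segment w y \<in> set (take r Ks) \<longleftrightarrow> y \<in> A" if ad: "adjacent (tr P) w y" for y
  proof -
    have X: "closed_segment w y \<in> new.X" by (rule segX[OF ad])
    then have cpf: "closed_segment w y \<in> pf (tr P)" using new.in_pf by (simp add: new_X)
    have "(\<exists>u\<in>A. u \<in> closed_segment w y) \<longleftrightarrow> y \<in> A"
    proof
      assume "\<exists>u\<in>A. u \<in> closed_segment w y"
      then obtain u where u: "u \<in> A" "u \<in> closed_segment w y" by blast
      then have "u \<in> vertices (closed_segment w y)" using vertices_of_face[OF adjacentD(4)[OF ad]] A(1) by blast
      then have "u = w \<or> u = y" by (simp add: vertices_def extreme_point_of_segment)
      then show "y \<in> A" using u(1) A(2) by blast
    qed auto
    moreover have "(\<exists>k<r. Ks ! k \<subseteq> closed_segment w y) \<longleftrightarrow> closed_segment w y \<in> set (take r Ks)"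
    proof -
      have "Ks ! k \<subseteq> closed_segment w y \<longleftrightarrow> Ks ! k = closed_segment w y" if "k < r" for k
      proof -
        have "Ks ! k \<in> new.X" using that K(3) pK(2) nth_mem[of k Ks] by auto
        then show ?thesis using X new.same_dim[of "Ks ! k" "closed_segment w y"] by (auto simp: new_X)
      qed
      then show ?thesis unfolding set_take_nth[OF K(3)] by auto
    qed
    ultimately show ?thesis using eq[OF cpf] by simp
  qed
  have Xform: "\<exists>y. c = closed_segment w y \<and> adjacent (tr P) w y" if c: "c \<in> new.X" for c
  proof -
    have "c face_of tr P" "w \<in> c" "aff_dim c = 1" using c by (simp_all add: new_X)
    then show ?thesis using edge_at_vertex[OF pol_tr _ _ wtr(1)] by blast
  qed
  have L: "new.pshell (take r Ks)"
  proof -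
    have "take r Ks @ drop r Ks = Ks" by simp
    have "new.pshell (take n Ks)" for n
      using pK(1) unfolding new.pshell_def by (auto simp: min_def dest: in_set_takeD)
    then show ?thesis .
  qed
  have Lsub: "set (take r Ks) \<subseteq> insert e0 D"
  proof
    fix c assume c: "c \<in> set (take r Ks)"
    then have "c \<in> new.X" using pK(2) in_set_takeD by fast
    then obtain y where y: "c = closed_segment w y" "adjacent (tr P) w y" using Xform by blast
    then have "y \<in> A" using memL c by blast
    then have "y ~= u1" "y ~= u2" using A by blast+
    then have "adjacent P w y \<and> y ~= v \<or> y = wb" using y(2) adj_tr_w by blast
    then show "c \<in> insert e0 D" unfolding y(1) D_def e0_def by blast
  qed
  define B where "B = filter (\<lambda>c. c \<in> D) (take r Ks)"
  have pB: "old.pshell B" unfolding B_def by (rule pshell_restrict[OF L Lsub])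
  have vtr: "v \<notin> vertices (tr P)" unfolding vertices_tr using v u_not_vertex by auto
  have memB: "closed_segment w y \<in> set B" if "adjacent P w y" "y \<in> A" for y
  proof -
    have "y ~= v" using that(2) A(1) vtr by blast
    then have "closed_segment w y \<in> D" "adjacent (tr P) w y" unfolding D_def adj_tr_w using that(1) by blast+
    then show ?thesis using memL that(2) by (simp add: B_def)
  qed
  have Bform: "\<exists>y\<in>A. c = closed_segment w y" if c: "c \<in> set B" for c
  proof -
    have c': "c \<in> set (take r Ks)" using c by (simp add: B_def)
    then have "c \<in> new.X" using pK(2) in_set_takeD by fast
    then obtain y where "c = closed_segment w y" "adjacent (tr P) w y" using Xform by blast
    then show ?thesis using memL c' by blast
  qed
  \<comment> \<open>Needed for the step condition in \<open>P\<close>: a face through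
    \<open>w\<close> that meets \<open>A\<close> contains an edge of \<open>P\<close>, not just of
    \<open>tr P\<close>, from \<open>w\<close> to \<open>A\<close>.\<close>
  have hit: "\<exists>y\<in>A. adjacent P w y \<and> y \<in> F"
    if F: "F face_of P" "w \<in> F" and u: "u \<in> A" "u \<in> F" for F u
  proof -
    have trF: "x \<in> tr F" if "x \<in> A" "x \<in> F" for x
    proof -
      have "x \<in> tr P" using that(1) A(1) vertices_sub by blast
      then show ?thesis using that(2) by (simp add: tr_def)
    qed
    have "\<exists>y\<in>A. adjacent (tr P) w y \<and> y \<in> F"
    proof (cases "low F")
      case True
      have "u \<in> tr F" "w \<in> tr F" using trF u F(2) w_low by (auto simp: tr_def)
      show ?thesis
      proof (cases "F = P")
        case False
        have "tr F ~= tr P"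
        proof
          assume "tr F = tr P"
          have "low P" using True face_of_imp_subset[OF F(1)] by (auto simp: low_def)
          then have "P \<subseteq> F" using tr_sub_iff[OF P_face F(1)] \<open>tr F = tr P\<close> by simp
          then show False using False face_of_imp_subset[OF F(1)] by blast
        qed
        then have "tr F \<in> pf (tr P)" using tr_face[OF F(1)] by (simp add: pf_def)
        then obtain k where k: "k < r" "Ks ! k \<subseteq> tr F" using eq \<open>w \<in> tr F\<close> \<open>u \<in> tr F\<close> u(1) by blast
        have kL: "Ks ! k \<in> set (take r Ks)" using k(1) set_take_nth[OF K(3)] by auto
        then have "Ks ! k \<in> new.X" using pK(2) in_set_takeD by fast
        then obtain y where y: "Ks ! k = closed_segment w y" "adjacent (tr P) w y" using Xform by blast
        then have "y \<in> A" using memL kL by simp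
        moreover have "y \<in> F" using k(2) y(1) ends_in_segment(2)[of y w] by (auto simp: tr_def)
        ultimately show ?thesis using y(2) by blast
      next
        \<comment> \<open>\<open>tr P\<close> is no proper face, so the step condition cannot be
          tested at it; instead \<open>1 \<le> r\<close> supplies an edge.\<close>
        case True
        have "0 < r" using K(2) by simp
        then have kL: "Ks ! 0 \<in> set (take r Ks)" using set_take_nth[OF K(3)] by auto
        then have X0: "Ks ! 0 \<in> new.X" using pK(2) in_set_takeD by fast
        then obtain y where y: "Ks ! 0 = closed_segment w y" "adjacent (tr P) w y" using Xform by blast
        then have "y \<in> A" using memL kL by simp
        moreover have "y \<in> tr P" using adjacentD(3)[OF y(2)] vertices_sub by blast
        ultimately show ?thesis using y(2) True by (auto simp: tr_def)
      qed
    next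
      case False
      have "a \<bullet> u = b" using trF[OF u] False u(2) by (force simp: low_def tr_def)
      have "u \<in> vertices P" using u(1) A vertices_tr by blast
      then have "u = wb" using on_H \<open>a \<bullet> u = b\<close> u(1) A(2) by blast
      then show ?thesis using u adj_tr_w[of wb] by blast
    qed
    then obtain y where y: "y \<in> A" "adjacent (tr P) w y" "y \<in> F" by blast
    show ?thesis
    proof (cases "adjacent P w y")
      case False
      then have ywb: "y = wb" using y(1,2) adj_tr_w A by blast
      have nadj: "\<not> adjacent P w3 w4" using False ywb wwb adjacent_commute by metis
      obtain K where K: "K face_of P" "v \<in> K" "K \<inter> H = closed_segment w3 w4" "aff_dim K = 2" by (rule face34)
      have "w3 \<in> F" "w4 \<in> F" using F(2) y(3) ywb wwb by auto
      then have KF: "K \<subseteq> F" using face34_sub[OF K(1-3) F(1) _ _ nadj] by blast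
      \<comment> \<open>Otherwise the hyperplane would support \<open>K\<close> along
        [\<open>w3\<close>, \<open>w4\<close>] and make this segment an edge of
        \<open>P\<close>.\<close>
      have lowK: "low K"
      proof (rule ccontr)
        assume "\<not> low K"
        then have "\<And>x. x \<in> K ==> a \<bullet> x \<ge> b" by (force simp: low_def)
        then have "K \<inter> H face_of K"
          unfolding H_def using face_of_imp_convex[OF K(1)] by (intro face_of_Int_supporting_hyperplane_ge) auto
        then have "closed_segment w3 w4 face_of P" using K(1,3) face_of_trans by metis
        then show False using nadj adjacentI distN by auto
      qed
      have wK: "w \<in> K" "wb \<in> K" using K(3) wwb by auto
      have wtK: "w \<in> tr K" using wK w_low by (simp add: tr_def)
      have tK: "tr K \<in> new.Y"
        using tr_face[OF K(1)] wtK tr_aff_dim[OF face_of_imp_convex[OF K(1)] lowK] K(4)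
        by (simp add: new_Y)
      have e0X: "e0 \<in> new.X" using De0_new by blast
      \<comment> \<open>The polygon \<open>tr K\<close> has a second edge at \<open>w\<close>
        besides \<open>e0\<close>, and \<open>near\<close> puts its other end into
        \<open>A\<close>.\<close>
      have "card {x \<in> new.X. x \<subseteq> tr K} = 2" by (rule new.edge_X[OF tK])
      then have "{x \<in> new.X. x \<subseteq> tr K} ~= {e0}" by auto
      moreover have "e0 \<subseteq> tr K"
        unfolding e0_def using wK w_low face_of_imp_convex[OF tr_face[OF K(1)]]
        by (intro closed_segment_subset) (auto simp: tr_def)
      ultimately obtain c where c: "c \<in> new.X" "c \<subseteq> tr K" "c ~= e0" using e0X by blast
      obtain z where z: "c = closed_segment w z" "adjacent (tr P) w z" using Xform[OF c(1)] by blast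
      have zK: "z \<in> K" using c(2) z(1) by (auto simp: tr_def)
      have "z ~= wb" using c(3) z(1) by (auto simp: e0_def)
      then have "z \<in> A" using near[OF K lowK _ z(2) zK] y(1) ywb by blast
      moreover have "adjacent P w z" using z(2) adj_tr_w \<open>z \<in> A\<close> \<open>z ~= wb\<close> A by blast
      ultimately show ?thesis using zK KF by blast
    qed (use y in blast)
  qed
  have "B ~= []"
  proof -
    obtain u where u: "u \<in> A" using ne by blast
    then have "u \<in> P" using A(1) vertices_sub[of "tr P"] by (auto simp: tr_def)
    then obtain y where "y \<in> A" "adjacent P w y" using hit[OF P_face _ u] wP vertices_sub by blast
    then show ?thesis using memB by force
  qed
  then obtain Gs where Gs: "dshell (pf P) {w} (B @ Gs)" using old.dshell_vertex_extend[OF pB] by blast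
  show ?thesis
  proof (rule vertex_stepI[OF Gs, of "length B"])
    show "1 \<le> length B" using \<open>B ~= []\<close> by (simp add: Suc_le_eq)
    show "length B \<le> length (B @ Gs)" by simp
    fix F assume F: "F \<in> pf P" "w \<in> F"
    then have fF: "F face_of P" by (simp add: pf_def)
    have "(\<exists>k<length B. (B @ Gs) ! k \<subseteq> F) \<longleftrightarrow> (\<exists>k<length B. B ! k \<subseteq> F)"
      by (simp add: nth_append cong: conj_cong)
    also have "\<dots> \<longleftrightarrow> (\<exists>c\<in>set B. c \<subseteq> F)" unfolding set_conv_nth by blast
    also have "\<dots> \<longleftrightarrow> (\<exists>u\<in>A. u \<in> F)"
    proof
      assume "\<exists>c\<in>set B. c \<subseteq> F"
      then obtain c where c: "c \<in> set B" "c \<subseteq> F" by blast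
      then obtain y where "y \<in> A" "c = closed_segment w y" using Bform by blast
      then show "\<exists>u\<in>A. u \<in> F" using c(2) ends_in_segment(2)[of y w] by blast
    next
      assume "\<exists>u\<in>A. u \<in> F"
      then obtain u where u: "u \<in> A" "u \<in> F" by blast
      obtain y where y: "y \<in> A" "adjacent P w y" "y \<in> F" using hit[OF fF F(2) u] by blast
      then have "closed_segment w y \<subseteq> F" using F(2) face_of_imp_convex[OF fF] by (simp add: closed_segment_subset)
      then show "\<exists>c\<in>set B. c \<subseteq> F" using memB[OF y(2,1)] by blast
    qed
    finally show "(\<exists>u\<in>A. u \<in> F) \<longleftrightarrow> (\<exists>k<length B. (B @ Gs) ! k \<subseteq> F)" by blast
  qed
qed

end

context cut_digraph begin

text \<open>Strictly below the hyperplane, \<open>tr\<close> is an isomorphism between the faces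
  through \<open>x\<close> before and after the cut. Discarding \<open>u1\<close> and
  \<open>u2\<close> loses no face: any face of \<open>P\<close> through one of them also contains
  \<open>w1\<close> or \<open>w2\<close> respectively, which \<open>closed\<close> puts into
  \<open>A\<close>.\<close>

lemma step_below:
  assumes x: "x \<in> vertices P" "a \<bullet> x < b" and A: "A \<subseteq> vertices (tr P)"
    and closed: "u1 \<in> A ==> w1 \<in> A" "u2 \<in> A ==> w2 \<in> A" and new: "vertex_step (tr P) A x"
  shows "vertex_step P (A - {u1, u2}) x"
proof -
  obtain Ks r where K: "dshell (pf (tr P)) {x} Ks" "1 \<le> r" "r \<le> length Ks"
    and eq: "\<And>F. F \<in> pf (tr P) ==> x \<in> F ==> (\<exists>u\<in>A. u \<in> F) \<longleftrightarrow> (\<exists>k<r. Ks ! k \<subseteq> F)"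
    by (rule vertex_stepE[OF new]) (rule that)
  have xv: "x ~= v" using x av by auto
  have fx: "{x} face_of P" using x(1) by (simp add: vertices_face)
  have xtr: "x \<in> tr F" if "x \<in> F" for F using that x(2) by (simp add: tr_def)
  have lowF: "low F" if "x \<in> F" for F using that x(2) by (auto simp: low_def)
  define S where "S = {F \<in> pf P. {x} \<subseteq> F}"
  define S' where "S' = {F \<in> pf (tr P). {x} \<subseteq> F}"
  have iso: "tr F \<subseteq> tr F' \<longleftrightarrow> F \<subseteq> F'" if "F face_of P" "F' face_of P" "x \<in> F" for F F'
    by (rule tr_sub_iff[OF that(1,2) lowF[OF that(3)]])
  have xP: "x \<in> P" using x(1) vertices_sub by blast
  have im: "tr F \<in> S'" if F: "F \<in> S" for F
  proof -
    have F': "F face_of P" "F ~= P" "x \<in> F" using F by (auto simp: S_def pf_def)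
    have "tr F ~= tr P" using iso[OF P_face F'(1) xP] F'(2) face_of_imp_subset[OF F'(1)] by blast
    then show ?thesis using tr_face[OF F'(1)] xtr[OF F'(3)] by (simp add: S'_def pf_def)
  qed
  have surj: "\<exists>F\<in>S. tr F = G" if G: "G \<in> S'" for G
  proof -
    have G': "G face_of tr P" "G ~= tr P" "x \<in> G" using G by (auto simp: S'_def pf_def)
    have "\<not> G face_of T"
    proof
      assume "G face_of T"
      then have "x \<in> T" using G'(3) face_of_imp_subset by blast
      then show False using T_val x(2) by auto
    qed
    then obtain F where F: "F face_of P" "G = tr F" using tr_face_cases[OF G'(1)] by blast
    have "x \<in> F" "F ~= P" using G'(2,3) F(2) by (auto simp: tr_def)
    then show ?thesis using F by (auto simp: S_def pf_def)
  qed
  have bij: "bij_betw tr S S'"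
    unfolding bij_betw_def
  proof
    show "inj_on tr S"
    proof (rule inj_onI)
      fix F F' assume "F \<in> S" "F' \<in> S" and e: "tr F = tr F'"
      then have F: "F face_of P" "F' face_of P" "x \<in> F" "x \<in> F'" by (auto simp: S_def pf_def)
      show "F = F'" using iso[OF F(1,2,3)] iso[OF F(2,1,4)] e by simp
    qed
    show "tr ` S = S'"
    proof
      show "tr ` S \<subseteq> S'" using im by blast
      show "S' \<subseteq> tr ` S" using surj by blast
    qed
  qed
  define g where "g = inv_into S tr"
  have g: "g G \<in> S" "tr (g G) = G" if "G \<in> S'" for G
  proof -
    have "G \<in> tr ` S" using bij that by (simp add: bij_betw_def)
    then show "g G \<in> S" "tr (g G) = G" by (simp_all add: g_def inv_into_into f_inv_into_f)
  qed
  have gF: "g G face_of P" "x \<in> g G" if "G \<in> S'" for G using g(1)[OF that] by (simp_all add: S_def pf_def)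
  have giso: "g G \<subseteq> F \<longleftrightarrow> G \<subseteq> tr F" if "G \<in> S'" "F face_of P" for G F
    using iso[OF gF(1)[OF that(1)] that(2) gF(2)[OF that(1)]] g(2)[OF that(1)] by simp
  have mem: "G \<in> S' \<longleftrightarrow> G \<in> pf (tr P) \<and> {x} \<subseteq> G" for G by (simp add: S'_def)
  have xS: "{x} \<in> S" using fx dimP by (auto simp: S_def pf_def)
  have tx: "tr {x} = {x}" using x(2) by (auto simp: tr_def)
  then have xS': "{x} \<in> S'" using im[OF xS] by simp
  have gx: "g {x} = {x}"
    unfolding g_def by (rule inv_into_f_eq) (use bij xS tx in \<open>simp_all add: bij_betw_def\<close>)
  have "bij_betw g {G \<in> pf (tr P). {x} \<subseteq> G} {G \<in> pf P. {x} \<subseteq> G}"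
    using bij_betw_inv_into[OF bij] unfolding g_def S_def S'_def .
  moreover have "g G \<subseteq> g G' \<longleftrightarrow> G \<subseteq> G'" if "G \<in> pf (tr P)" "{x} \<subseteq> G" "G' \<in> pf (tr P)" "{x} \<subseteq> G'" for G G'
    using giso[of G "g G'"] gF(1)[of G'] g(2)[of G'] that mem by simp
  ultimately have d: "dshell (pf P) (g {x}) (map g Ks)"
    by (rule dshell_iso[OF _ _ K(1)]) (use xS' mem in simp_all)
  have KS: "Ks ! k \<in> S'" if "k < length Ks" for k
    using nth_mem[OF that] dshell_set[OF K(1)] cov_sub[of "Ks ! k" "pf (tr P)" "{x}"] by (simp add: mem)
  show ?thesis
  proof (rule vertex_stepI[OF d[unfolded gx]])
    show "1 \<le> r" by (rule K(2))
    show "r \<le> length (map g Ks)" using K(3) by simp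
    fix F assume F: "F \<in> pf P" "x \<in> F"
    then have fF: "F face_of P" by (simp add: pf_def)
    have "F \<in> S" using F by (simp add: S_def)
    then have FS': "tr F \<in> S'" by (rule im)
    have "map g Ks ! k \<subseteq> F \<longleftrightarrow> Ks ! k \<subseteq> tr F" if "k < r" for k
      using giso[OF KS fF, of k] K(3) that by simp
    then have "(\<exists>k<r. map g Ks ! k \<subseteq> F) \<longleftrightarrow> (\<exists>k<r. Ks ! k \<subseteq> tr F)" by (simp cong: conj_cong)
    also have "\<dots> \<longleftrightarrow> (\<exists>u\<in>A. u \<in> tr F)" using eq[of "tr F"] FS' mem by simp
    also have "\<dots> \<longleftrightarrow> (\<exists>u\<in>A. u \<in> F)"
    proof -
      have "u \<in> tr F \<longleftrightarrow> u \<in> F" if "u \<in> A" for u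
        using that A vertices_sub[of "tr P"] by (auto simp: tr_def)
      then show ?thesis by blast
    qed
    also have "\<dots> \<longleftrightarrow> (\<exists>u\<in>A - {u1, u2}. u \<in> F)"
    proof
      assume "\<exists>u\<in>A. u \<in> F"
      then obtain u where u: "u \<in> A" "u \<in> F" by blast
      have w12: "w1 \<notin> {u1, u2}" "w2 \<notin> {u1, u2}" using dist_all by auto
      consider "u = u1" | "u = u2" | "u \<notin> {u1, u2}" by blast
      then show "\<exists>u\<in>A - {u1, u2}. u \<in> F"
      proof cases
        case 1
        show ?thesis
        proof (rule bexI)
          show "w1 \<in> F" using u(2) 1 u_in_iff(1)[OF fF] by simp
          show "w1 \<in> A - {u1, u2}" using closed(1) u(1) 1 w12(1) by simp
        qed
      next
        case 2
        show ?thesis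
        proof (rule bexI)
          show "w2 \<in> F" using u(2) 2 u_in_iff(2)[OF fF] by simp
          show "w2 \<in> A - {u1, u2}" using closed(2) u(1) 2 w12(2) by simp
        qed
      qed (use u in blast)
    qed blast
    finally show "(\<exists>u\<in>A - {u1, u2}. u \<in> F) \<longleftrightarrow> (\<exists>k<r. map g Ks ! k \<subseteq> F)" by simp
  qed
qed

text \<open>Three kinds of vertices: \<open>step_below\<close> serves those off the hyperplane,
  \<open>arc_at_w\<close> serves \<open>w3\<close> and \<open>w4\<close>, and
  \<open>vertex_step_last\<close> serves \<open>v\<close>.\<close>

lemma dshelling_tr: 
  assumes "dshelling_property (tr P) E'"
  shows "dshelling_property P E"
proof -
  obtain vs' where "shelling_order (tr P) E' vs'"
    using assms dshelling_property_order[OF pol_tr _ dig'] dim_tr by auto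
  then have vs': "distinct vs'" "set vs' = vertices (tr P)"
    and ord: "\<And>A x B y. vs' = A @ x # B ==> (y, x) \<in> E' ==> y \<in> set A"
    and step: "\<And>A x B. vs' = A @ x # B ==> A ~= [] ==> vertex_step (tr P) (set A) x"
    by (auto simp: shelling_order_def)
  have vtr: "v \<notin> vertices (tr P)" unfolding vertices_tr using v u_not_vertex by auto
  define old where "old = (\<lambda>x. x \<notin> {u1, u2})"
  define vs where "vs = filter old vs' @ [v]"
  have dist: "distinct vs"
    unfolding vs_def using vs' v u_not_vertex by (auto simp: vertices_tr)
  have set_f: "set (filter old vs') = vertices P - {v}"
    using vs'(2) u_not_vertex by (auto simp: vertices_tr old_def)
  then have sv: "set vs = vertices P" using v by (auto simp: vs_def)
  have "shelling_order P E vs"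
    unfolding shelling_order_def
  proof (intro conjI allI impI dist sv)
    fix A x B assume AB: "vs = A @ x # B"
    have last_or: "x = v \<and> set A = vertices P - {v} \<or>
        (\<exists>A' B'. vs' = A' @ x # B' \<and> filter old A' = A \<and> old x)"
    proof (cases B rule: rev_cases)
      case Nil
      then show ?thesis using AB set_f by (simp add: vs_def)
    next
      case (snoc C z)
      then have "filter old vs' = A @ x # C" using AB by (simp add: vs_def)
      then show ?thesis using filter_eq_append_Cons by metis
    qed
    show "y \<in> set A" if yx: "(y, x) \<in> E" for y
      using last_or
    proof (elim disjE conjE exE)
      assume x: "x = v" and sA: "set A = vertices P - {v}"
      then show ?thesis using E_vert[OF yx] v_no_out yx by blast
    next
      fix A' B' assume s: "vs' = A' @ x # B'" "filter old A' = A" "old x"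
      have "x \<in> set vs'" by (simp add: s(1))
      then have "x ~= v" using vs'(2) vtr by auto
      then have "(y, x) \<in> E'" using yx by (simp add: E'_def)
      then have "y \<in> set A'" by (rule ord[OF s(1)])
      moreover have "old y" using E_vert[OF yx] u_not_vertex by (auto simp: old_def)
      ultimately show ?thesis using s(2) by auto
    qed
    show "vertex_step P (set A) x" if ne: "A ~= []"
      using last_or
    proof (elim disjE conjE exE)
      assume x: "x = v" and sA: "set A = vertices P - {v}"
      show ?thesis unfolding x sA by (rule vertex_step_last[OF polP _ v]) (simp add: dimP)
    next
      fix A' B' assume s: "vs' = A' @ x # B'" "filter old A' = A" "old x"
      have sA: "set A = set A' - {u1, u2}" using s(2) by (auto simp: old_def)
      have "A' ~= []" using ne s(2) by auto
      then have new: "vertex_step (tr P) (set A') x" by (rule step[OF s(1)])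
      have A'V: "set A' \<subseteq> vertices (tr P)" using s(1) vs'(2) by auto
      have xA': "x \<notin> set A'" using s(1) vs'(1) by auto
      have "x \<in> vertices (tr P)" using s(1) vs'(2) by auto
      then have x: "x \<in> vertices P" "x ~= v" using s(3) vertices_tr by (auto simp: old_def)
      have closed: "z \<in> set A'" if y: "y \<in> set A'" and zy: "(z, y) \<in> E'" for y z
      proof -
        obtain A1 A2 where "A' = A1 @ y # A2" using split_list[OF y] by blast
        then have "vs' = A1 @ y # (A2 @ x # B')" "set A1 \<subseteq> set A'" using s(1) by auto
        then show ?thesis using ord zy by blast
      qed
      show ?thesis
      proof (cases "x = w3 \<or> x = w4")
        case False
        have "a \<bullet> x < b"
        proof -
          have "a \<bullet> x \<le> b" using others x by blast
          moreover have "a \<bullet> x ~= b"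
          proof
            assume ax: "a \<bullet> x = b"
            have "{x} \<inter> H face_of T" using section_face[of "{x}"] x(1) by (simp add: H_def vertices_face)
            then have "{x} face_of T" using ax by (simp add: H_def)
            then have "x \<in> {u1, u2, w3, w4}" using vertices_T by (simp add: vertices_face[symmetric])
            then show False using False s(3) by (simp add: old_def)
          qed
          ultimately show ?thesis by simp
        qed
        then show ?thesis
          unfolding sA using closed E'_u1 E'_u2 by (intro step_below[OF x(1) _ A'V _ _ new]) blast+
      next
        case True
        define wb where "wb = (if x = w3 then w4 else w3)"
        interpret cut_vertex P v a b w1 w2 w3 w4 x wb
          by unfold_locales (use True distN in \<open>auto simp: wb_def\<close>)
        \<comment> \<open>Both cut points receive arcs from \<open>w3\<close> and \<open>w4\<close>,
          so they come later in the order.\<close>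
        have nu: "u1 \<notin> set A'" "u2 \<notin> set A'"
          using closed[of u1 x] closed[of u2 x] xA' True E'_u1 E'_u2 by blast+
        then have sA': "set A = set A'" unfolding sA by simp
        show ?thesis
          unfolding sA'
        proof (rule arc_at_w[OF A'V xA' nu _ new])
          show "set A' ~= {}" using \<open>A' ~= []\<close> by simp
          fix K y assume K: "K face_of P" "v \<in> K" "K \<inter> H = closed_segment w3 w4" "aff_dim K = 2" "low K"
            and wbA: "wb \<in> set A'" and y: "adjacent (tr P) x y" "y \<in> K" "y ~= wb"
          \<comment> \<open>Here \<open>wb\<close> is already listed, and \<open>w4\<close> never
            precedes \<open>w3\<close>, so the vertex in question is \<open>w4\<close>.\<close>
          have "x ~= w3"
          proof
            assume "x = w3"
            then have "(w3, wb) \<in> E'" by (simp add: wb_def E'_def)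
            then show False using closed[OF wbA] xA' \<open>x = w3\<close> by blast
          qed
          then have x4: "x = w4" "wb = w3" using True by (simp_all add: wb_def)
          have vK: "vertices (tr K) = vertices (tr P) \<inter> tr K" by (rule vertices_of_face[OF tr_face[OF K(1)]])
          have yT: "y \<in> tr P" "y \<in> vertices (tr P)" using adjacentD(3)[OF y(1)] vertices_sub by blast+
          then have yK: "y \<in> vertices (tr K)" using y(2) vK by (simp add: tr_def)
          have wK: "w3 \<in> vertices (tr K)" "w4 \<in> vertices (tr K)"
            using vK K(3) on wtr x4 by (auto simp: tr_def)
          have e34: "(w3, w4) \<in> E'" by (simp add: E'_def)
          have uK: "u1 \<notin> K" "u2 \<notin> K"
          proof -
            have f: "closed_segment w3 w4 face_of T" using section_face[OF K(1)] K(3) by (simp add: H_def)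
            have "vertices (closed_segment w3 w4) = {w3, w4}"
              by (auto simp: vertices_def extreme_point_of_segment)
            then have seg: "vertices T \<inter> closed_segment w3 w4 = {w3, w4}" using vertices_of_face[OF f] by simp
            have no: "u \<notin> closed_segment w3 w4" if u: "u \<in> vertices T" "u ~= w3" "u ~= w4" for u
            proof
              assume "u \<in> closed_segment w3 w4"
              then have "u \<in> {w3, w4}" unfolding seg[symmetric] using u(1) by blast
              then show False using u(2,3) by simp
            qed
            have "u1 ~= w3" "u1 ~= w4" "u2 ~= w3" "u2 ~= w4" using dist_all by auto
            then have "u1 \<notin> closed_segment w3 w4" "u2 \<notin> closed_segment w3 w4"
              using no[of u1] no[of u2] vertices_T by simp_all
            then show "u1 \<notin> K" "u2 \<notin> K" using K(3) u_val by (auto simp: H_def)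
          qed
          have "tr K ~= {}" using wK vertices_sub by blast
          \<comment> \<open>The sink of the cut 2-face lies in the simplex and can only be
            \<open>w4\<close>. Hence the other neighbour \<open>y\<close> of \<open>w4\<close> in it
            has its arc directed to \<open>w4\<close> and was listed before.\<close>
          then have "\<exists>!t. is_sink E' (tr K) t"
            using uso' tr_face[OF K(1)] by (simp add: unique_sink_orientation_def)
          then obtain t where t: "is_sink E' (tr K) t" by (rule ex1E)
          have tV: "t \<in> vertices (tr K)" and tout: "\<And>z. z \<in> vertices (tr K) ==> (t, z) \<notin> E'"
            using t by (auto simp: is_sink_def face_arcs_def)
          have "t \<in> {u1, u2, w3, w4}" by (rule sink_tr[OF K(1,2) t])
          moreover have "t \<in> K" using tV vertices_sub[of "tr K"] by (auto simp: tr_def)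
          moreover have "t ~= w3" using tout[OF wK(2)] e34 by blast
          ultimately have "t = w4" using uK by blast
          then have "(x, y) \<notin> E'" using tout[OF yK] x4 by simp
          then have "(y, x) \<in> E'" using dig' y(1) unfolding polytopal_digraph_def by blast
          then show "y \<in> set A'" by (rule ord[OF s(1)])
        qed
      qed
    qed
  qed
  then show ?thesis using dshelling_property_order[OF polP _ dig] dimP by auto
qed

end

text \<open>The four edge directions at \<open>v\<close> generate a cone containing
  \<open>P\<close>. By dimension they are independent, so a functional can be prescribed on them
  freely.\<close>

lemma simple_cut_exists:
  fixes P :: "'a::euclidean_space set"
  assumes P: "polytope P" "aff_dim P = 4" and v: "v \<in> vertices P"
    and nbrs: "{w. adjacent P v w} = {w1, w2, w3, w4}" and dist: "distinct [w1, w2, w3, w4]"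
  shows "\<exists>a b. simple_cut P v a b w1 w2 w3 w4"
proof -
  obtain a0 b0 where "vertex_section P v a0 b0" using vertex_section_exists[OF P(1) v] by blast
  then interpret S: vertex_section P v a0 b0 .
  define N where "N = {w1, w2, w3, w4}"
  have finN: "finite N" by (simp add: N_def)
  have Nadj: "adjacent P v w" if "w \<in> N" for w using nbrs that by (auto simp: N_def)
  define C where "C = {x. \<exists>t. (\<forall>w\<in>N. 0 \<le> t w) \<and> x - v = (\<Sum>w\<in>N. t w *\<^sub>R (w - v))}"
  have cvC: "convex C"
  proof (rule convexI)
    fix x y and p q :: real assume xy: "x \<in> C" "y \<in> C" and pq: "0 \<le> p" "0 \<le> q" "p + q = 1"
    obtain t where t: "\<forall>w\<in>N. 0 \<le> t w" "x - v = (\<Sum>w\<in>N. t w *\<^sub>R (w - v))" using xy(1) by (auto simp: C_def)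
    obtain s where s: "\<forall>w\<in>N. 0 \<le> s w" "y - v = (\<Sum>w\<in>N. s w *\<^sub>R (w - v))" using xy(2) by (auto simp: C_def)
    have "p *\<^sub>R x + q *\<^sub>R y - v = p *\<^sub>R (x - v) + q *\<^sub>R (y - v)"
    proof -
      have "v = (p + q) *\<^sub>R v" using pq by simp
      then show ?thesis by (simp add: algebra_simps)
    qed
    also have "\<dots> = (\<Sum>w\<in>N. (p * t w + q * s w) *\<^sub>R (w - v))"
      unfolding t(2) s(2) by (simp add: scaleR_sum_right sum.distrib[symmetric] scaleR_add_left)
    finally show "p *\<^sub>R x + q *\<^sub>R y \<in> C"
      unfolding C_def using t(1) s(1) pq by (intro CollectI exI[of _ "\<lambda>w. p * t w + q * s w"]) simp
  qed
  have verC: "p \<in> C" if p: "p \<in> vertices S.T" for p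
  proof -
    have f: "{p} face_of S.T" using p by (simp add: vertices_face)
    note l = S.lift[OF f]
    have "aff_dim (S.lift {p}) = 1" using S.section_aff_dim[OF l(1,2)] l(3) by simp
    then obtain w where w: "adjacent P v w" "S.lift {p} = closed_segment v w"
      using edge_at_vertex[OF P(1) l(1) _ v l(2)] by blast
    have wN: "w \<in> N" using w(1) nbrs by (auto simp: N_def)
    have "p \<in> closed_segment v w" using l(3) w(2) by blast
    then obtain u where u: "0 \<le> u" "p = (1 - u) *\<^sub>R v + u *\<^sub>R w" by (auto simp: in_segment)
    have "p - v = u *\<^sub>R (w - v)" using u(2) by (simp add: algebra_simps)
    also have "\<dots> = (\<Sum>x\<in>N. (if x = w then u *\<^sub>R (x - v) else 0))" using finN wN by (simp add: sum.delta)
    also have "\<dots> = (\<Sum>x\<in>N. (if x = w then u else 0) *\<^sub>R (x - v))" by (rule sum.cong) auto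
    finally show ?thesis
      unfolding C_def using u(1) by (intro CollectI exI[of _ "\<lambda>x. if x = w then u else 0"]) simp
  qed
  have "S.T \<subseteq> C"
  proof -
    have "convex hull (vertices S.T) \<subseteq> C" by (rule hull_minimal) (use verC cvC in auto)
    then show ?thesis using polytope_hull_vertices[OF S.polT] by simp
  qed
  \<comment> \<open>Each point of \<open>P\<close> lies on a ray through the section, whose vertices
    lie on the edges at \<open>v\<close>.\<close>
  have PC: "x \<in> C" if x: "x \<in> P" for x
  proof (cases "x = v")
    case True
    then show ?thesis unfolding C_def by (intro CollectI exI[of _ "\<lambda>_. 0"]) simp
  next
    case False
    obtain g s where g: "g \<in> S.T" "0 < s" "x = v + s *\<^sub>R (g - v)" by (rule S.radial[OF x False]) (rule that)
    then obtain t where t: "\<forall>w\<in>N. 0 \<le> t w" "g - v = (\<Sum>w\<in>N. t w *\<^sub>R (w - v))" using \<open>S.T \<subseteq> C\<close> by (auto simp: C_def)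
    have "x - v = s *\<^sub>R (g - v)" using g(3) by simp
    also have "\<dots> = (\<Sum>w\<in>N. (s * t w) *\<^sub>R (w - v))" unfolding t(2) by (simp add: scaleR_sum_right)
    finally show ?thesis unfolding C_def using t(1) g(2) by (intro CollectI exI[of _ "\<lambda>w. s * t w"]) simp
  qed
  define B where "B = (\<lambda>w. w - v) ` N"
  have cB: "card B \<le> 4"
  proof -
    have "card B \<le> card N" unfolding B_def by (rule card_image_le[OF finN])
    then show ?thesis using dist by (simp add: N_def)
  qed
  have "(+) (- v) ` P \<subseteq> span B"
  proof
    fix y assume "y \<in> (+) (- v) ` P"
    then obtain x where x: "x \<in> P" "y = x - v" by auto
    then obtain t where "y = (\<Sum>w\<in>N. t w *\<^sub>R (w - v))" using PC by (auto simp: C_def)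
    moreover have "t w *\<^sub>R (w - v) \<in> span B" if "w \<in> N" for w
      using that by (intro span_scale span_base) (simp add: B_def)
    ultimately show "y \<in> span B" by (simp add: span_sum)
  qed
  then have "dim ((+) (- v) ` P) \<le> dim (span B)" by (rule dim_subset)
  moreover have "aff_dim P = int (dim ((+) (- v) ` P))"
    by (rule aff_dim_eq_dim) (use S.vP hull_subset[of P affine] in blast)
  ultimately have "card B \<le> dim (span B)" using P(2) cB by simp
  then have ind: "independent B"
    using card_le_dim_spanning[of B "span B"] finN by (simp add: B_def span_superset)
  \<comment> \<open>The hyperplane will be one unit below \<open>v\<close>: the value -1 puts
    \<open>w3\<close> and \<open>w4\<close> on it, the value -2 puts \<open>w1\<close> and
    \<open>w2\<close> below.\<close>
  define f :: "'a \<Rightarrow> real" where "f y = (if y = w3 - v \<or> y = w4 - v then - 1 else - 2)" for y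
  obtain g where g: "linear g" "\<And>y. y \<in> B ==> g y = f y" using linear_independent_extend[OF ind, of f] by blast
  \<comment> \<open>The vector representing the functional \<open>g\<close>.\<close>
  define a where "a = adjoint g 1"
  have ag: "a \<bullet> x = g x" for x using adjoint_works[OF g(1), of x 1] by (simp add: a_def inner_commute)
  have aN: "a \<bullet> w - a \<bullet> v = f (w - v)" if "w \<in> N" for w
    using g(2)[of "w - v"] that linear_diff[OF g(1)] by (simp add: ag B_def)
  have aw: "a \<bullet> w1 - a \<bullet> v = - 2" "a \<bullet> w2 - a \<bullet> v = - 2" "a \<bullet> w3 - a \<bullet> v = - 1" "a \<bullet> w4 - a \<bullet> v = - 1"
    using aN[of w1] aN[of w2] aN[of w3] aN[of w4] dist by (auto simp: N_def f_def)
  define b where "b = a \<bullet> v - 1"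
  have others: "a \<bullet> w \<le> b" if w: "w \<in> vertices P" "w ~= v" for w
  proof -
    have wP: "w \<in> P" using w(1) vertices_sub by blast
    then obtain t where t: "\<forall>w\<in>N. 0 \<le> t w" "w - v = (\<Sum>x\<in>N. t x *\<^sub>R (x - v))" using PC by (auto simp: C_def)
    have val: "a \<bullet> w - a \<bullet> v = (\<Sum>x\<in>N. t x * f (x - v))"
    proof -
      have "a \<bullet> w - a \<bullet> v = a \<bullet> (w - v)" by (simp add: inner_diff_right)
      also have "\<dots> = (\<Sum>x\<in>N. t x * (a \<bullet> x - a \<bullet> v))" unfolding t(2) by (simp add: inner_sum_right inner_diff_right)
      also have "\<dots> = (\<Sum>x\<in>N. t x * f (x - v))" by (rule sum.cong) (simp_all add: aN)
      finally show ?thesis .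
    qed
    have "(\<Sum>x\<in>N. t x * f (x - v)) \<le> (\<Sum>x\<in>N. - t x)"
      by (rule sum_mono) (use t(1) in \<open>auto simp: f_def\<close>)
    then have le: "a \<bullet> w - a \<bullet> v \<le> - (\<Sum>x\<in>N. t x)" unfolding val by (simp add: sum_negf)
    \<comment> \<open>If the coefficients sum to at least 1, the level drops by at least 1.
      Otherwise \<open>w\<close> lies in the hull of \<open>v\<close> and its neighbours, and being
      a vertex of \<open>P\<close> it is one of them.\<close>
    show ?thesis
    proof (cases "1 \<le> (\<Sum>x\<in>N. t x)")
      case True
      then show ?thesis using le by (simp add: b_def)
    next
      case False
      have vN: "v \<notin> N" using Nadj adjacentD(1) by blast
      have "w = (1 - sum t N) *\<^sub>R v + (\<Sum>x\<in>N. t x *\<^sub>R x)"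
        using t(2) by (simp add: scaleR_diff_right sum_subtractf scaleR_sum_left[symmetric] algebra_simps)
      moreover have "(1 - sum t N) *\<^sub>R v + (\<Sum>x\<in>N. t x *\<^sub>R x) \<in> convex hull (insert v N)"
      proof -
        define s where "s = t(v := 1 - sum t N)"
        have e: "(\<Sum>x\<in>insert v N. s x *\<^sub>R x) = (1 - sum t N) *\<^sub>R v + (\<Sum>x\<in>N. t x *\<^sub>R x)"
          unfolding sum.insert[OF finN vN] s_def using vN by (auto intro!: sum.cong)
        have "sum s (insert v N) = 1"
        proof -
          have "sum s N = sum t N" unfolding s_def using vN by (auto intro!: sum.cong)
          then show ?thesis unfolding sum.insert[OF finN vN] by (simp add: s_def)
        qed
        moreover have "\<forall>x\<in>insert v N. 0 \<le> s x" using t(1) False by (simp add: s_def)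
        ultimately have "(\<Sum>x\<in>insert v N. s x *\<^sub>R x) \<in> convex hull (insert v N)"
          by (intro convex_sum) (use finN in \<open>auto intro: hull_inc\<close>)
        then show ?thesis unfolding e .
      qed
      ultimately have hull: "w \<in> convex hull (insert v N)" by simp
      have "insert v N \<subseteq> P" using S.vP Nadj adjacentD(3) vertices_sub by blast
      then have "convex hull (insert v N) \<subseteq> P" using S.cvP by (rule hull_minimal)
      then have "w extreme_point_of convex hull (insert v N)"
        using w(1) hull unfolding vertices_def extreme_point_of_def by blast
      then have "w \<in> N" using extreme_point_of_convex_hull w(2) by blast
      then show ?thesis using aw by (auto simp: N_def b_def)
    qed
  qed
  have "simple_cut P v a b w1 w2 w3 w4"
    by unfold_locales (use P v nbrs dist others aw in \<open>simp_all add: b_def\<close>)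
  then show ?thesis by blast
qed

lemma cut_exists:
  fixes P :: "'a::euclidean_space set"
  assumes P: "polytope P" "aff_dim P = 4" and E: "polytopal_digraph P E" "acyclic E" "holt_klee P E"
    and no: "\<not> dshelling_property P E" and v: "is_sink E P v" "card {w. adjacent P v w} = 4"
  shows "\<exists>P' E' v'. truncation_of P P' \<and> polytope P' \<and> aff_dim P' = 4 \<and> card (vertices P') = card (vertices P) + 1 \<and>
    polytopal_digraph P' E' \<and> acyclic E' \<and> holt_klee P' E' \<and> \<not> dshelling_property P' E' \<and>
    is_sink E' P' v' \<and> card {w. adjacent P' v' w} = 4"
proof -
  have vV: "v \<in> vertices P" using v(1) by (simp add: is_sink_def)
  have "finite {w. adjacent P v w}" using v(2) card.infinite by fastforce
  then obtain ws where ws: "set ws = {w. adjacent P v w}" "distinct ws" using finite_distinct_list by blast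
  then have "length ws = 4" using v(2) distinct_card by fastforce
  then obtain p1 p2 p3 p4 where wl: "ws = [p1, p2, p3, p4]" by (auto simp: numeral_eq_Suc length_Suc_conv)
  \<comment> \<open>By acyclicity at most one of the two can be reached from the other, so
    \<open>ord\<close> is achieved by naming them suitably.\<close>
  have "\<exists>w3 w4. {w3, w4} = {p3, p4} \<and> w3 ~= w4 \<and> (w4, w3) \<notin> E\<^sup>+"
  proof (cases "(p4, p3) \<in> E\<^sup>+")
    case False
    then show ?thesis using ws(2) wl by (intro exI[of _ p3] exI[of _ p4]) simp
  next
    case True
    then have "(p3, p4) \<notin> E\<^sup>+" using E(2) trancl_trans unfolding acyclic_def by metis
    then show ?thesis using ws(2) wl by (intro exI[of _ p4] exI[of _ p3]) auto
  qed
  then obtain w3 w4 where w34: "{w3, w4} = {p3, p4}" "w3 ~= w4" "(w4, w3) \<notin> E\<^sup>+" by blast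
  have n: "{w. adjacent P v w} = {p1, p2, w3, w4}" using ws(1) wl w34(1) by (simp add: insert_commute)
  have d: "distinct [p1, p2, w3, w4]" using ws(2) wl w34(1,2) by (auto simp: doubleton_eq_iff)
  obtain a b where "simple_cut P v a b p1 p2 w3 w4" using simple_cut_exists[OF P vV n d] by blast
  then interpret C: simple_cut P v a b p1 p2 w3 w4 .
  interpret C: cut_digraph P v a b p1 p2 w3 w4 E
    by unfold_locales (use E v w34 in auto)
  have "card {w. adjacent (C.tr P) C.u2 w} = 4"
    unfolding C.nbrs_u2 using C.dist_all by auto
  then show ?thesis
    using C.truncation C.pol_tr C.dim_tr C.card_vertices_tr C.dig' C.acy' C.hk' C.dshelling_tr no C.sink_u2
    by (intro exI[of _ "C.tr P"] exI[of _ C.E'] exI[of _ C.u2] conjI) blast+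
qed

lemma take_filter_prefix:
  "take (length (filter p (take r xs))) (filter p xs) = filter p (take r xs)"
proof -
  have "filter p xs = filter p (take r xs) @ filter p (drop r xs)"
    unfolding filter_append[symmetric] append_take_drop_id ..
  then show ?thesis by simp
qed

lemma length_filter_take_le: "length (filter p (take r xs)) \<le> length (filter p xs)"
  using take_filter_prefix[of p r xs] by (metis length_take min.cobounded1)

lemma ex_prefix_iff: "r \<le> length xs ==> (\<exists>k<r. xs ! k \<subseteq> F) \<longleftrightarrow> (\<exists>K\<in>set (take r xs). K \<subseteq> F)"
  unfolding set_take_nth by auto

subsection \<open>Pyramids\<close>

locale pyramid =
  fixes P :: "'a::euclidean_space set" and a :: 'a
  assumes polP: "polytope P" and dimP: "2 \<le> aff_dim P" and apex: "a \<notin> affine hull P"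
begin

definition Py where "Py F = convex hull (insert a F)"

lemma cvP: "convex P" using polP by (rule polytope_imp_convex)
lemma P_face: "P face_of P" using cvP by (rule face_of_refl)
lemma neP: "P ~= {}" using dimP by auto
lemma a_notin: "a \<notin> P" using apex hull_subset[of P affine] by blast

lemma Py_vertices: "Py P = convex hull (insert a (vertices P))"
  unfolding Py_def using polytope_hull_vertices[OF polP] hull_insert[of convex a "vertices P"] by simp

lemma pol_Py: "polytope (Py P)"
  unfolding Py_vertices using finite_vertices[OF polP] by (simp add: polytope_convex_hull)

lemma faces: "G face_of Py P \<longleftrightarrow> G face_of P \<or> (\<exists>F. F face_of P \<and> G = Py F)"
proof -
  have "a \<notin> affine hull (vertices P)"
    using apex polytope_hull_vertices[OF polP] affine_hull_convex_hull by metis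
  then show ?thesis
    unfolding Py_vertices
    using face_of_convex_hull_insert_eq[OF finite_vertices[OF polP], of a G]
    by (simp add: Py_def polytope_hull_vertices[OF polP, symmetric])
qed

lemma P_face_Py: "F face_of P ==> F face_of Py P" and Py_face: "F face_of P ==> Py F face_of Py P"
  using faces by blast+

lemma a_Py: "a \<in> Py F" unfolding Py_def by (rule hull_inc) simp
lemma sub_Py: "F \<subseteq> Py F" unfolding Py_def using hull_subset[of "insert a F" convex] by blast

text \<open>A combination with positive weight on the apex could be solved for the apex, which would
  then lie in the affine hull of \<open>P\<close>.\<close>

lemma Py_Int:
  assumes F: "F face_of P" and z: "z \<in> Py F" "z \<in> affine hull P"
  shows "z \<in> F"
proof (cases "F = {}")
  case True
  then show ?thesis using z apex by (simp add: Py_def)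
next
  case False
  obtain u x where u: "0 \<le> u" "u \<le> 1" "x \<in> F" "z = (1 - u) *\<^sub>R a + u *\<^sub>R x"
    using z(1) False face_of_imp_convex[OF F] by (auto simp: Py_def convex_hull_insert_alt hull_same)
  have "u = 1"
  proof (rule ccontr)
    assume "u ~= 1"
    then have "1 - u ~= 0" by simp
    have "(1 - u) *\<^sub>R a = z - u *\<^sub>R x" using u(4) by simp
    moreover have "a = (1 / (1 - u)) *\<^sub>R ((1 - u) *\<^sub>R a)" using \<open>1 - u ~= 0\<close> by simp
    ultimately have "a = (1 / (1 - u)) *\<^sub>R (z - u *\<^sub>R x)" by simp
    then have ae: "a = (1 / (1 - u)) *\<^sub>R z + (- u / (1 - u)) *\<^sub>R x" by (simp add: scaleR_diff_right)
    have "x \<in> affine hull P" using u(3) face_of_imp_subset[OF F] hull_subset[of P affine] by blast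
    moreover have "1 / (1 - u) + (- u / (1 - u)) = 1" using \<open>1 - u ~= 0\<close> by (simp add: field_simps)
    ultimately have "(1 / (1 - u)) *\<^sub>R z + (- u / (1 - u)) *\<^sub>R x \<in> affine hull P"
      by (intro mem_affine[OF affine_affine_hull z(2)])
    then show False using ae apex by simp
  qed
  then show ?thesis using u by simp
qed

lemma vertices_Py: "vertices (Py P) = insert a (vertices P)"
proof
  show "vertices (Py P) \<subseteq> insert a (vertices P)"
    unfolding Py_vertices vertices_def[of "convex hull _"] using extreme_point_of_convex_hull by blast
  have "Py {} face_of Py P" by (rule Py_face) simp
  then have "a \<in> vertices (Py P)" by (simp add: Py_def vertices_face)
  moreover have "vertices P \<subseteq> vertices (Py P)" using vertices_of_face[OF P_face_Py[OF P_face]] by blast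
  ultimately show "insert a (vertices P) \<subseteq> vertices (Py P)" by blast
qed

lemma a_not_vertex: "F face_of P ==> a \<notin> vertices F"
  using a_notin vertices_sub[of F] face_of_imp_subset by blast

lemma vertices_Py_face:
  assumes F: "F face_of P"
  shows "vertices (Py F) = insert a (vertices F)"
proof -
  have "vertices (Py F) = insert a (vertices P) \<inter> Py F"
    using vertices_of_face[OF Py_face[OF F]] vertices_Py by simp
  moreover have "vertices P \<inter> Py F = vertices P \<inter> F"
  proof
    show "vertices P \<inter> Py F \<subseteq> vertices P \<inter> F"
      using Py_Int[OF F] vertices_sub[of P] hull_subset[of P affine] by blast
  qed (use sub_Py in blast)
  ultimately show ?thesis using a_Py vertices_of_face[OF F] by blast
qed

lemma aff_dim_Py: "F face_of P ==> aff_dim (Py F) = aff_dim F + 1"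
proof -
  assume F: "F face_of P"
  have "a \<notin> affine hull F" using apex hull_mono[OF face_of_imp_subset[OF F], of affine] by blast
  then show ?thesis unfolding Py_def aff_dim_convex_hull by (simp add: aff_dim_insert)
qed

lemma adjacent_Py:
  "adjacent (Py P) x y \<longleftrightarrow> adjacent P x y \<or> x = a \<and> y \<in> vertices P \<or> y = a \<and> x \<in> vertices P"
proof
  have apexadj: "adjacent (Py P) a x" if x: "x \<in> vertices P" for x
  proof (rule adjacentI)
    show "a ~= x" using a_not_vertex[OF P_face] x by blast
    have "Py {x} face_of Py P" using x by (intro Py_face) (simp add: vertices_face)
    then show "closed_segment a x face_of Py P" by (simp add: Py_def segment_convex_hull)
  qed
  assume "adjacent P x y \<or> x = a \<and> y \<in> vertices P \<or> y = a \<and> x \<in> vertices P"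
  then show "adjacent (Py P) x y"
  proof (elim disjE conjE)
    assume "adjacent P x y"
    then show ?thesis using adjacentD(1,4)[of P x y] P_face_Py adjacentI by blast
  next
    assume "x = a" "y \<in> vertices P"
    then show ?thesis using apexadj by simp
  next
    assume "y = a" "x \<in> vertices P"
    then show ?thesis using apexadj adjacent_commute by metis
  qed
next
  assume ad: "adjacent (Py P) x y"
  note d = adjacentD[OF ad]
  show "adjacent P x y \<or> x = a \<and> y \<in> vertices P \<or> y = a \<and> x \<in> vertices P"
  proof (cases "x = a \<or> y = a")
    case True
    then show ?thesis using d(1-3) vertices_Py by auto
  next
    case False
    then have xy: "x \<in> vertices P" "y \<in> vertices P" using d(2,3) vertices_Py by auto
    have "closed_segment x y \<subseteq> P" using xy vertices_sub cvP by (intro closed_segment_subset) auto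
    then have "closed_segment x y face_of P"
      by (rule face_of_subset[OF d(4) _ sub_Py])
    then show ?thesis using adjacentI[OF d(1)] by blast
  qed
qed

lemma P_pf: "P \<in> pf (Py P)"
  using P_face_Py[OF P_face] a_Py[of P] a_notin by (auto simp: pf_def)

lemma pf_sub: "F \<in> pf P ==> F \<in> pf (Py P)"
  using P_face_Py a_Py[of P] a_notin face_of_imp_subset by (auto simp: pf_def)

lemma cov_Py: "F \<in> pf P ==> cov (pf P) F = {G \<in> cov (pf (Py P)) F. G \<in> pf P}"
proof -
  assume F: "F \<in> pf P"
  then have fF: "F face_of P" by (simp add: pf_def)
  show ?thesis
    unfolding cov_pf[OF polP fF] cov_pf[OF pol_Py P_face_Py[OF fF]] using pf_sub by blast
qed

lemma sub_P_pf: "G \<in> pf (Py P) ==> G \<subseteq> P ==> G ~= P ==> G \<in> pf P"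
  using face_of_subset[of G "Py P" P] sub_Py by (auto simp: pf_def)

lemma sub_pf: "G \<in> pf (Py P) ==> G \<subseteq> X ==> X \<in> pf P ==> G \<in> pf P"
proof -
  assume G: "G \<in> pf (Py P)" "G \<subseteq> X" "X \<in> pf P"
  have "X \<subseteq> P" "X ~= P" using G(3) face_of_imp_subset by (auto simp: pf_def)
  then show ?thesis using sub_P_pf[OF G(1)] G(2) by blast
qed

text \<open>Above \<open>F\<close>, the faces of the pyramid that avoid the apex are those of
  \<open>P\<close>, including \<open>P\<close> itself as a proper face. Filtering the lists keeps
  initial pieces initial, and testing the condition at \<open>P\<close> shows that they stay
  nonempty.\<close>

lemma dshell_base:
  "dshell (pf (Py P)) F Gs ==> F \<in> pf P ==> dshell (pf P) F (filter (\<lambda>G. G \<in> pf P) Gs)"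
proof (induction rule: dshell.induct)
  case (points Gs F)
  show ?case
  proof (rule dshell.points)
    show "distinct (filter (\<lambda>G. G \<in> pf P) Gs)" using points by simp
    show "set (filter (\<lambda>G. G \<in> pf P) Gs) = cov (pf P) F" using points by (simp add: cov_Py)
    show "\<forall>G\<in>set (filter (\<lambda>G. G \<in> pf P) Gs). cov (pf P) G = {}" using points by (simp add: cov_Py)
  qed
next
  case (step Gs F Hs)
  note F = step.prems
  have fF: "F face_of P" using F by (simp add: pf_def)
  define ok where "ok = (\<lambda>G. G \<in> pf P)"
  have d: "distinct (filter ok Gs)" using step by simp
  have s: "set (filter ok Gs) = cov (pf P) F" using step by (simp add: cov_Py ok_def)
  have covQ: "set Gs = cov (pf (Py P)) F" by (rule step)
  have dimG: "aff_dim G = aff_dim F + 1" "G \<in> pf (Py P)" if "G \<in> set Gs" for G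
    using that unfolding covQ cov_pf[OF pol_Py P_face_Py[OF fF]] by auto
  have ex: "\<exists>Ks r. dshell (pf (Py P)) (Gs ! j) Ks \<and> (Gs ! j \<in> pf P --> dshell (pf P) (Gs ! j) (filter ok Ks)) \<and>
      1 \<le> r \<and> r \<le> length Ks \<and> (\<forall>X\<in>pf (Py P). Gs ! j \<subseteq> X --> (\<exists>i<j. Gs ! i \<subseteq> X) = (\<exists>k<r. Ks ! k \<subseteq> X))"
    if "0 < j" "j < length Gs" for j
    using step.IH(2)[rule_format, of j] that unfolding ok_def by blast
  show ?case
  proof (cases "(\<forall>G\<in>set (filter ok Gs). cov (pf P) G = {})")
    case True
    then show ?thesis using dshell.points[OF d s] by (simp add: ok_def)
  next
    case False
    then obtain G0 where "G0 \<in> set (filter ok Gs)" by blast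
    then have ne: "filter ok Gs ~= []" using length_pos_if_in_set by fastforce
    \<comment> \<open>The entries of \<open>Ks\<close> have dimension \<open>aff_dim F + 2\<close>.
      By this bound none of them is \<open>P\<close>, so an entry inside \<open>P\<close> is a
      proper face of it.\<close>
    have small: "aff_dim F + 2 < aff_dim P"
    proof -
      obtain G K where GK: "G \<in> set (filter ok Gs)" "K \<in> cov (pf P) G" using False by blast
      then have G: "G \<in> pf P" "aff_dim G = aff_dim F + 1" using dimG by (auto simp: ok_def)
      then have "K \<in> pf P" "aff_dim K = aff_dim G + 1"
        using GK(2) cov_pf[OF polP, of G] by (auto simp: pf_def)
      then show ?thesis using G(2) face_of_aff_dim_lt[OF cvP, of K] by (simp add: pf_def)
    qed
    have "\<exists>Hs. dshell (pf P) (hd (filter ok Gs)) Hs"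
    proof -
      have "hd (filter ok Gs) \<in> set (filter ok Gs)" by (rule hd_in_set[OF ne])
      then obtain j where j: "j < length Gs" "Gs ! j = hd (filter ok Gs)" "Gs ! j \<in> pf P"
        by (auto simp: in_set_conv_nth ok_def)
      show ?thesis
      proof (cases "j = 0")
        case True
        have "hd Gs = Gs ! 0" using j(1) by (cases Gs) auto
        then show ?thesis using step.IH(1) j True by metis
      next
        case False
        then show ?thesis using ex[of j] j by auto
      qed
    qed
    then obtain Hs' where Hs': "dshell (pf P) (hd (filter ok Gs)) Hs'" by blast
    have "dshell (pf P) F (filter ok Gs)"
    proof (rule dshell.step[OF d s ne Hs'], intro allI impI)
      fix j' assume j': "0 < j' \<and> j' < length (filter ok Gs)"
      have sp: "filter ok Gs = take j' (filter ok Gs) @ filter ok Gs ! j' # drop (Suc j') (filter ok Gs)"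
        by (rule id_take_nth_drop) (use j' in simp)
      obtain A B where AB: "Gs = A @ filter ok Gs ! j' # B" "filter ok A = take j' (filter ok Gs)"
        using filter_eq_append_Cons[OF sp] by blast
      define j where "j = length A"
      have j: "j < length Gs" "Gs ! j = filter ok Gs ! j'" "take j Gs = A"
        by (subst AB(1), simp add: j_def)+
      have okj: "Gs ! j \<in> pf P" using nth_mem[of j' "filter ok Gs"] j' j(2) by (auto simp: ok_def)
      have "filter ok A ~= []" unfolding AB(2) using j' by auto
      then obtain i where i: "i \<in> set A" "ok i" by (auto simp: filter_empty_conv)
      then have "A ~= []" by auto
      then have "0 < j" by (simp add: j_def)
      obtain Ks r where K: "dshell (pf (Py P)) (Gs ! j) Ks" "dshell (pf P) (Gs ! j) (filter ok Ks)"
        "1 \<le> r" "r \<le> length Ks"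
        and eq: "\<forall>X\<in>pf (Py P). Gs ! j \<subseteq> X --> (\<exists>i<j. Gs ! i \<subseteq> X) = (\<exists>k<r. Ks ! k \<subseteq> X)"
        using ex[OF \<open>0 < j\<close> j(1)] okj by blast
      have pre: "(\<exists>i<j. Gs ! i \<subseteq> X) \<longleftrightarrow> (\<exists>G\<in>set A. G \<subseteq> X)" for X
        using ex_prefix_iff[of j Gs X] j by simp
      have Kpf: "L \<in> pf (Py P)" "aff_dim L = aff_dim F + 2" if "L \<in> set Ks" for L
      proof -
        have f: "Gs ! j face_of P" using okj by (simp add: pf_def)
        have "L \<in> cov (pf (Py P)) (Gs ! j)" using dshell_set[OF K(1)] that by simp
        then have "L \<in> pf (Py P)" "aff_dim L = aff_dim (Gs ! j) + 1"
          unfolding cov_pf[OF pol_Py P_face_Py[OF f]] by auto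
        then show "L \<in> pf (Py P)" "aff_dim L = aff_dim F + 2" using dimG(1)[OF nth_mem[OF j(1)]] by auto
      qed
      define r' where "r' = length (filter ok (take r Ks))"
      have tk: "take r' (filter ok Ks) = filter ok (take r Ks)" unfolding r'_def by (rule take_filter_prefix)
      have r'le: "r' \<le> length (filter ok Ks)" unfolding r'_def by (rule length_filter_take_le)
      have "1 \<le> r'"
      proof -
        have "i \<subseteq> P" "Gs ! j \<subseteq> P" using i(2) okj face_of_imp_subset by (auto simp: ok_def pf_def)
        then have "\<exists>k<r. Ks ! k \<subseteq> P" using eq P_pf pre[of P] i(1) by blast
        then obtain L where L: "L \<in> set (take r Ks)" "L \<subseteq> P" unfolding ex_prefix_iff[OF K(4)] by blast
        then have LK: "L \<in> set Ks" by (meson in_set_takeD)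
        have "L ~= P" using Kpf(2)[OF LK] small by auto
        then have "ok L" using sub_P_pf[OF Kpf(1)[OF LK] L(2)] by (simp add: ok_def)
        then have "filter ok (take r Ks) ~= []" using L(1) by (auto simp: filter_empty_conv)
        then show ?thesis by (simp add: r'_def Suc_le_eq)
      qed
      have "(\<exists>i<j'. filter ok Gs ! i \<subseteq> X) \<longleftrightarrow> (\<exists>k<r'. filter ok Ks ! k \<subseteq> X)"
        if X: "X \<in> pf P" "filter ok Gs ! j' \<subseteq> X" for X
      proof -
        have "(\<exists>i<j'. filter ok Gs ! i \<subseteq> X) \<longleftrightarrow> (\<exists>G\<in>set (filter ok A). G \<subseteq> X)"
          using ex_prefix_iff[of j' "filter ok Gs" X] j' AB(2) by simp
        also have "\<dots> \<longleftrightarrow> (\<exists>G\<in>set A. G \<subseteq> X)"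
        proof -
          have "ok G" if "G \<in> set A" "G \<subseteq> X" for G
          proof -
            have "G \<in> set Gs" using that(1) by (subst AB(1)) simp
            then show ?thesis using sub_pf[OF dimG(2) that(2) X(1)] by (simp add: ok_def)
          qed
          then show ?thesis by auto
        qed
        also have "\<dots> \<longleftrightarrow> (\<exists>L\<in>set (take r Ks). L \<subseteq> X)"
          using eq[rule_format, OF pf_sub[OF X(1)]] X(2) j(2) pre[of X] ex_prefix_iff[OF K(4), of X] by simp
        also have "\<dots> \<longleftrightarrow> (\<exists>L\<in>set (filter ok (take r Ks)). L \<subseteq> X)"
        proof -
          have "ok L" if "L \<in> set (take r Ks)" "L \<subseteq> X" for L
          proof -
            have "L \<in> set Ks" using that(1) by (meson in_set_takeD)
            then show ?thesis using sub_pf[OF Kpf(1) that(2) X(1)] by (simp add: ok_def)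
          qed
          then show ?thesis by auto
        qed
        also have "\<dots> \<longleftrightarrow> (\<exists>k<r'. filter ok Ks ! k \<subseteq> X)"
          using ex_prefix_iff[OF r'le, of X] tk by simp
        finally show ?thesis .
      qed
      then show "\<exists>Ks r. dshell (pf P) (filter ok Gs ! j') Ks \<and> 1 \<le> r \<and> r \<le> length Ks \<and>
          (\<forall>X\<in>pf P. filter ok Gs ! j' \<subseteq> X -->
             (\<exists>i<j'. filter ok Gs ! i \<subseteq> X) = (\<exists>k<r. Ks ! k \<subseteq> X))"
        using K(2) j(2) \<open>1 \<le> r'\<close> r'le by (intro exI[of _ "filter ok Ks"] exI[of _ r'] conjI ballI impI) simp_all
    qed
    then show ?thesis by (simp add: ok_def)
  qed
qed

text \<open>The apex is dropped from the order, and at every other vertex the list of edges is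
  filtered as in \<open>dshell_base\<close>.\<close>

lemma dshelling_base:
  assumes E: "polytopal_digraph P E" and E': "polytopal_digraph (Py P) (E \<union> {a} \<times> vertices P)"
    and sh: "dshelling_property (Py P) (E \<union> {a} \<times> vertices P)"
  shows "dshelling_property P E"
proof -
  have "aff_dim (Py P) = aff_dim P + 1" by (rule aff_dim_Py[OF P_face])
  then have "2 \<le> aff_dim (Py P)" using dimP by simp
  then obtain vs' where "shelling_order (Py P) (E \<union> {a} \<times> vertices P) vs'"
    using sh dshelling_property_order[OF pol_Py _ E'] by auto
  then have vs': "distinct vs'" "set vs' = insert a (vertices P)"
    and ord: "\<And>A x B y. vs' = A @ x # B ==> (y, x) \<in> E \<union> {a} \<times> vertices P ==> y \<in> set A"
    and step: "\<And>A x B. vs' = A @ x # B ==> A ~= [] ==> vertex_step (Py P) (set A) x"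
    by (auto simp: shelling_order_def vertices_Py)
  have aV: "a \<notin> vertices P" by (rule a_not_vertex[OF P_face])
  define vs where "vs = filter (\<lambda>x. x ~= a) vs'"
  have d: "distinct vs" "set vs = vertices P" using vs' aV by (auto simp: vs_def)
  have "shelling_order P E vs"
    unfolding shelling_order_def
  proof (intro conjI allI impI d)
    fix A x B assume AB: "vs = A @ x # B"
    obtain A' B' where s: "vs' = A' @ x # B'" "filter (\<lambda>x. x ~= a) A' = A" "x ~= a"
      using filter_eq_append_Cons[OF AB[unfolded vs_def]] by blast
    have "x \<in> set vs" by (simp add: AB)
    then have x: "x \<in> vertices P" by (simp add: d)
    have sA: "set A = set A' - {a}" using s(2) by auto
    have AV: "set A \<subseteq> vertices P" using AB d(2) by auto
    show "y \<in> set A" if yx: "(y, x) \<in> E" for y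
    proof -
      have "y \<in> set A'" using ord[OF s(1)] yx by blast
      moreover have "y \<in> vertices P"
        using yx E adjacentD(2)[of P y x] by (auto simp: polytopal_digraph_def)
      ultimately show ?thesis using sA aV by blast
    qed
    show "vertex_step P (set A) x" if ne: "A ~= []"
    proof -
      have "A' ~= []" using ne s(2) by auto
      then have new: "vertex_step (Py P) (set A') x" by (rule step[OF s(1)])
      obtain Ks r where K: "dshell (pf (Py P)) {x} Ks" "1 \<le> r" "r \<le> length Ks"
        and eq: "\<And>F. F \<in> pf (Py P) ==> x \<in> F ==> (\<exists>u\<in>set A'. u \<in> F) \<longleftrightarrow> (\<exists>k<r. Ks ! k \<subseteq> F)"
        by (rule vertex_stepE[OF new]) (rule that)
      define ok where "ok = (\<lambda>G. G \<in> pf P)"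
      have fx: "{x} face_of P" using x by (simp add: vertices_face)
      have "{x} \<in> pf P" using fx dimP by (auto simp: pf_def)
      then have dK: "dshell (pf P) {x} (filter ok Ks)" unfolding ok_def by (rule dshell_base[OF K(1)])
      have Kpf: "L \<in> pf (Py P)" "aff_dim L = 1" if "L \<in> set Ks" for L
      proof -
        have "L \<in> cov (pf (Py P)) {x}" using dshell_set[OF K(1)] that by simp
        then show "L \<in> pf (Py P)" "aff_dim L = 1"
          unfolding cov_pf[OF pol_Py P_face_Py[OF fx]] by auto
      qed
      define r' where "r' = length (filter ok (take r Ks))"
      have tk: "take r' (filter ok Ks) = filter ok (take r Ks)" unfolding r'_def by (rule take_filter_prefix)
      have r'le: "r' \<le> length (filter ok Ks)" unfolding r'_def by (rule length_filter_take_le)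
      have xP: "x \<in> P" using x vertices_sub by blast
      have "1 \<le> r'"
      proof -
        obtain u where "u \<in> set A" using ne by (cases A) auto
        then have "u \<in> set A'" "u \<in> P" using sA AV vertices_sub by blast+
        then have "\<exists>k<r. Ks ! k \<subseteq> P" using eq[OF P_pf xP] by blast
        then obtain L where L: "L \<in> set (take r Ks)" "L \<subseteq> P" unfolding ex_prefix_iff[OF K(3)] by blast
        then have LK: "L \<in> set Ks" by (meson in_set_takeD)
        have "L ~= P" using Kpf(2)[OF LK] dimP by auto
        then have "ok L" using sub_P_pf[OF Kpf(1)[OF LK] L(2)] by (simp add: ok_def)
        then have "filter ok (take r Ks) ~= []" using L(1) by (auto simp: filter_empty_conv)
        then show ?thesis by (simp add: r'_def Suc_le_eq)
      qed
      show ?thesis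
      proof (rule vertex_stepI[OF dK \<open>1 \<le> r'\<close> r'le])
        fix F assume F: "F \<in> pf P" "x \<in> F"
        have "a \<notin> F" using F(1) a_notin face_of_imp_subset by (auto simp: pf_def)
        then have "(\<exists>u\<in>set A. u \<in> F) \<longleftrightarrow> (\<exists>u\<in>set A'. u \<in> F)" unfolding sA by blast
        also have "\<dots> \<longleftrightarrow> (\<exists>L\<in>set (take r Ks). L \<subseteq> F)"
          using eq[OF pf_sub[OF F(1)] F(2)] ex_prefix_iff[OF K(3), of F] by simp
        also have "\<dots> \<longleftrightarrow> (\<exists>L\<in>set (filter ok (take r Ks)). L \<subseteq> F)"
        proof -
          have "ok L" if "L \<in> set (take r Ks)" "L \<subseteq> F" for L
          proof -
            have "L \<in> set Ks" using that(1) by (meson in_set_takeD)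
            then show ?thesis using sub_pf[OF Kpf(1) that(2) F(1)] by (simp add: ok_def)
          qed
          then show ?thesis by auto
        qed
        also have "\<dots> \<longleftrightarrow> (\<exists>k<r'. filter ok Ks ! k \<subseteq> F)"
          using ex_prefix_iff[OF r'le, of F] tk by simp
        finally show "(\<exists>u\<in>set A. u \<in> F) \<longleftrightarrow> (\<exists>k<r'. filter ok Ks ! k \<subseteq> F)" .
      qed
    qed
  qed
  then show ?thesis using dshelling_property_order[OF polP dimP E] by blast
qed

end

locale pyramid_digraph = pyramid +
  fixes E :: "('a \<times> 'a) set"
  assumes dig: "polytopal_digraph P E" and acy: "acyclic E" and hk: "holt_klee P E"
begin

text \<open>The apex becomes the source of every face containing it, so the arcs and sinks of the
  base are undisturbed.\<close>

definition E' where "E' = E \<union> {a} \<times> vertices P"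

lemma aV: "a \<notin> vertices P" by (rule a_not_vertex[OF P_face])
lemma E_vert: assumes "(x, y) \<in> E" shows "x \<in> vertices P" "y \<in> vertices P"
  using dig assms adjacentD(2,3)[of P x y] by (auto simp: polytopal_digraph_def)
lemma E_a: "(x, a) \<notin> E" "(a, x) \<notin> E" using E_vert aV by blast+
lemma uso: "unique_sink_orientation P E" using hk by (simp add: holt_klee_def)

lemma dig': "polytopal_digraph (Py P) E'"
  unfolding polytopal_digraph_def
proof (intro conjI allI impI)
  fix x y
  show "adjacent (Py P) x y" if "(x, y) \<in> E'"
    using that dig unfolding adjacent_Py E'_def polytopal_digraph_def by blast
  show "((x, y) \<in> E') ~= ((y, x) \<in> E')" if ad: "adjacent (Py P) x y"
    using ad unfolding adjacent_Py
  proof (elim disjE conjE)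
    assume xy: "adjacent P x y"
    then have "x ~= a" "y ~= a" using adjacentD(2,3)[OF xy] aV by auto
    then have "(x, y) \<in> E' \<longleftrightarrow> (x, y) \<in> E" "(y, x) \<in> E' \<longleftrightarrow> (y, x) \<in> E" by (auto simp: E'_def)
    then show ?thesis using xy dig by (simp add: polytopal_digraph_def)
  qed (use aV E_a in \<open>auto simp: E'_def\<close>)
qed

text \<open>Reversing all arcs turns the added source into an added sink.\<close>

lemma acy': "acyclic E'"
proof -
  have "acyclic (E\<inverse> \<union> vertices P \<times> {a})"
    by (rule acyclic_add_sink) (use acy aV E_a in auto)
  moreover have "E'\<inverse> = E\<inverse> \<union> vertices P \<times> {a}" by (auto simp: E'_def)
  ultimately show ?thesis using acyclic_converse[of E'] by simp
qed

lemma arcs_base: "F face_of P ==> face_arcs E' F = face_arcs E F"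
  using a_not_vertex[of F] by (auto simp: face_arcs_def E'_def)

lemma arcs_Py:
  assumes F: "F face_of P"
  shows "face_arcs E' (Py F) = face_arcs E F \<union> {a} \<times> vertices F"
proof -
  have "vertices F \<subseteq> vertices P" using vertices_of_face[OF F] by blast
  then show ?thesis
    using a_not_vertex[OF F] aV E_a unfolding face_arcs_def E'_def vertices_Py_face[OF F] by blast
qed

lemma source_base: "F face_of P ==> is_source E' F = is_source E F"
  and sink_base: "F face_of P ==> is_sink E' F = is_sink E F"
  by (auto simp: is_source_def is_sink_def arcs_base fun_eq_iff)

lemma source_Py: "F face_of P ==> is_source E' (Py F) x ==> x = a"
  by (auto simp: is_source_def arcs_Py vertices_Py_face)

lemma sink_Py: 
  assumes F: "F face_of P" "F ~= {}" and x: "is_sink E' (Py F) x"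
  shows "is_sink E F x"
proof -
  have "vertices F ~= {}" by (rule vertices_nonempty[OF face_of_polytope_polytope[OF polP F(1)] F(2)])
  then have "x ~= a" using x by (auto simp: is_sink_def arcs_Py[OF F(1)])
  then show ?thesis using x by (auto simp: is_sink_def arcs_Py[OF F(1)] vertices_Py_face[OF F(1)])
qed

lemma uso_P:
  assumes "F face_of P" "F ~= {}"
  shows "\<exists>!x. is_source E F x" "\<exists>!x. is_sink E F x"
  using uso assms by (auto simp: unique_sink_orientation_def)

lemma uso': "unique_sink_orientation (Py P) E'"
proof (rule unique_sink_orientationI[OF pol_Py acy'])
  fix G x y assume G: "G face_of Py P" "G ~= {}"
  show "x = y" if s: "is_source E' G x" "is_source E' G y"
    using G(1) unfolding faces
  proof (elim disjE exE conjE)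
    assume F: "G face_of P"
    then have "is_source E G x" "is_source E G y" using s source_base[OF F] by simp_all
    then show ?thesis using uso_P(1)[OF F G(2)] by blast
  next
    fix F assume F: "F face_of P" "G = Py F"
    then show ?thesis using source_Py[OF F(1)] s by blast
  qed
  show "x = y" if s: "is_sink E' G x" "is_sink E' G y"
    using G(1) unfolding faces
  proof (elim disjE exE conjE)
    assume F: "G face_of P"
    then have "is_sink E G x" "is_sink E G y" using s sink_base[OF F] by simp_all
    then show ?thesis using uso_P(2)[OF F G(2)] by blast
  next
    fix F assume F: "F face_of P" "G = Py F"
    show ?thesis
    proof (cases "F = {}")
      case True
      have "vertices ({} :: 'a set) = {}" by (simp add: vertices_def)
      then have "vertices G = {a}" using vertices_Py_face[OF F(1)] F(2) True by simp
      then show ?thesis using s by (simp add: is_sink_def)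
    next
      case False
      have "is_sink E F x" "is_sink E F y" using s F(2) sink_Py[OF F(1) False] by blast+
      then show ?thesis using uso_P(2)[OF F(1) False] by blast
    qed
  qed
qed

text \<open>A sink among the remaining vertices has no arc to the source \<open>s\<close> either, so
  it would be a second sink of \<open>F\<close>.\<close>

lemma single_if_source_sink:
  assumes F: "F face_of P" "F ~= {}" and s: "is_source E F s" "is_sink E F s"
  shows "F = {s}"
proof -
  have pF: "polytope F" by (rule face_of_polytope_polytope[OF polP F(1)])
  have sV: "s \<in> vertices F" using s by (simp add: is_source_def)
  have "vertices F - {s} = {}"
  proof (rule ccontr)
    assume "vertices F - {s} ~= {}"
    then obtain x where x: "x \<in> vertices F - {s}" "\<forall>y\<in>vertices F - {s}. (x, y) \<notin> E"
      using acyclic_sink_exists(1)[OF acy, of "vertices F - {s}"] finite_vertices[OF pF] by auto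
    have "(x, s) \<notin> E" using s(1) x(1) sV by (auto simp: is_source_def face_arcs_def)
    then have "is_sink E F x" using x by (auto simp: is_sink_def face_arcs_def)
    then have "x = s" using uso_P(2)[OF F] s(2) by blast
    then show False using x(1) by blast
  qed
  then have "vertices F = {s}" using sV by blast
  then show ?thesis using polytope_hull_vertices[OF pF] by simp
qed

text \<open>The arc from the apex to \<open>t\<close> is the additional path. In the others the apex
  takes the place of \<open>s\<close>, except that a path consisting of the arc from
  \<open>s\<close> to \<open>t\<close> would then coincide with the additional one and is led
  through \<open>s\<close> instead.\<close>

lemma paths_Py:
  assumes F: "F face_of P" "F ~= {}" and t: "is_sink E F t"
  shows "paths_exist (face_arcs E' (Py F)) a t (aff_dim F + 1)"
proof -
  obtain s where s: "is_source E F s" using uso_P(1)[OF F] by blast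
  have A: "face_arcs E' (Py F) = face_arcs E F \<union> {a} \<times> vertices F" by (rule arcs_Py[OF F(1)])
  have stV: "s \<in> vertices F" "t \<in> vertices F" using s t by (auto simp: is_source_def is_sink_def)
  have aF: "a \<notin> vertices F" by (rule a_not_vertex[OF F(1)])
  then have at: "a ~= t" "a ~= s" using stV by auto
  have path_at: "directed_path (face_arcs E' (Py F)) a t [a, t]"
    using at stV by (simp add: directed_path_def A)
  show ?thesis
  proof (cases "s = t")
    case True
    then have "F = {s}" using single_if_source_sink[OF F s] t by simp
    then have "aff_dim F = 0" by simp
    then show ?thesis using path_at by (intro paths_existI[of "{[a, t]}"]) simp_all
  next
    case False
    have pe: "paths_exist (face_arcs E F) s t (aff_dim F)"
      using hk F s t unfolding holt_klee_iff by blast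
    obtain Q where Q: "finite Q" "int (card Q) = aff_dim F"
      and Qp: "\<And>p. p \<in> Q ==> directed_path (face_arcs E F) s t p"
      and Qd: "\<And>p q. p \<in> Q ==> q \<in> Q ==> p ~= q ==> set p \<inter> set q \<subseteq> {s, t}"
      by (rule paths_existE[OF pe]) (rule that)
    define g where "g p = (if p = [s, t] then [a, s, t] else a # tl p)" for p
    have form: "\<exists>q. p = s # q \<and> q ~= [] \<and> last q = t \<and> s \<notin> set q \<and> distinct q \<and> hd q \<in> vertices F \<and>
        set q \<subseteq> vertices F \<and> successively (\<lambda>u w. (u, w) \<in> face_arcs E F) q" if p: "p \<in> Q" for p
    proof -
      have d: "p ~= []" "hd p = s" "last p = t" "distinct p" "successively (\<lambda>u w. (u, w) \<in> face_arcs E F) p"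
        using Qp[OF p] by (auto simp: directed_path_def)
      have V: "set p \<subseteq> vertices F" by (rule directed_path_arcs_vertices[OF Qp[OF p] stV(1)])
      obtain q where q: "p = s # q" using d(1,2) by (cases p) auto
      have "q ~= []" using d(3) False q by auto
      then show ?thesis using d V q by (intro exI[of _ q]) (auto simp: successively_Cons)
    qed
    have gp: "directed_path (face_arcs E' (Py F)) a t (g p)" if p: "p \<in> Q" for p
    proof (cases "p = [s, t]")
      case True
      have "(s, t) \<in> face_arcs E F" using Qp[OF p] True by (simp add: directed_path_def)
      then show ?thesis using True at False stV by (simp add: g_def directed_path_def A)
    next
      case no: False
      obtain q where q: "p = s # q" "q ~= []" "last q = t" "distinct q" "hd q \<in> vertices F"
        "set q \<subseteq> vertices F" "successively (\<lambda>u w. (u, w) \<in> face_arcs E F) q" using form[OF p] by blast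
      have "successively (\<lambda>u w. (u, w) \<in> face_arcs E' (Py F)) q"
        by (rule successively_change[OF q(7)]) (simp add: A)
      moreover have "a \<notin> set q" using q(6) aF by blast
      moreover have "(a, hd q) \<in> face_arcs E' (Py F)" using q(5) A by simp
      ultimately show ?thesis using no q by (simp add: g_def directed_path_def successively_Cons)
    qed
    have gs: "set (g p) \<inter> set (g q) \<subseteq> {a, t} \<and> g p ~= g q" if pq: "p \<in> Q" "q \<in> Q" "p ~= q" for p q
    proof -
      obtain p' where p': "p = s # p'" "s \<notin> set p'" using form[OF pq(1)] by blast
      obtain q' where q': "q = s # q'" "s \<notin> set q'" using form[OF pq(2)] by blast
      have "set p' \<inter> set q' \<subseteq> {t}" using Qd[OF pq] p' q' by auto
      moreover have "p' ~= q'" using pq(3) p'(1) q'(1) by blast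
      ultimately show ?thesis using p' q' by (auto simp: g_def)
    qed
    have inj: "inj_on g Q" by (rule inj_onI) (use gs in blast)
    have new: "[a, t] \<notin> g ` Q"
    proof
      assume "[a, t] \<in> g ` Q"
      then obtain p where p: "p \<in> Q" "g p = [a, t]" by auto
      obtain q where "p = s # q" using form[OF p(1)] by blast
      then show False using p(2) by (auto simp: g_def split: if_splits)
    qed
    show ?thesis
    proof (rule paths_existI[of "insert [a, t] (g ` Q)"])
      show "finite (insert [a, t] (g ` Q))" using Q by simp
      show "int (card (insert [a, t] (g ` Q))) = aff_dim F + 1" using new Q card_image[OF inj] by simp
      show "directed_path (face_arcs E' (Py F)) a t p" if "p \<in> insert [a, t] (g ` Q)" for p
        using that gp path_at by blast
      show "set p \<inter> set q \<subseteq> {a, t}" if pq: "p \<in> insert [a, t] (g ` Q)" "q \<in> insert [a, t] (g ` Q)" "p ~= q" for p q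
      proof (cases "p = [a, t] \<or> q = [a, t]")
        case True
        then show ?thesis by auto
      next
        case no: False
        then obtain p' q' where "p' \<in> Q" "p = g p'" "q' \<in> Q" "q = g q'" using pq(1,2) by blast
        then show ?thesis using gs[of p' q'] pq(3) by blast
      qed
    qed
  qed
qed

lemma hk': "holt_klee (Py P) E'"
  unfolding holt_klee_iff
proof (intro conjI allI impI uso')
  fix G s t assume "G face_of Py P \<and> G ~= {} \<and> is_source E' G s \<and> is_sink E' G t"
  then have G: "G face_of Py P" and st: "is_source E' G s" "is_sink E' G t" and ne: "G ~= {}" by simp_all
  from G show "paths_exist (face_arcs E' G) s t (aff_dim G)"
    unfolding faces
  proof (elim disjE exE conjE)
    assume F: "G face_of P"
    then show ?thesis
      using hk st ne unfolding holt_klee_iff arcs_base[OF F] source_base[OF F] sink_base[OF F] by blast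
  next
    fix F assume F: "F face_of P" "G = Py F"
    have s: "s = a" using source_Py[OF F(1)] st(1) F(2) by blast
    show ?thesis
    proof (cases "F = {}")
      case True
      then show ?thesis unfolding F(2) by (intro paths_existI[of "{}"]) (simp_all add: Py_def)
    next
      case False
      have "is_sink E F t" using sink_Py[OF F(1) False] st(2) F(2) by blast
      then show ?thesis unfolding s F(2) aff_dim_Py[OF F(1)] by (rule paths_Py[OF F(1) False])
    qed
  qed
qed

lemma card_vertices_Py: "card (vertices (Py P)) = card (vertices P) + 1"
  unfolding vertices_Py using aV finite_vertices[OF polP] by simp

end

lemma pyramid_exists:
  fixes P :: "'a::euclidean_space set"
  assumes P: "polytope P" "2 \<le> aff_dim P" "aff_dim P < DIM('a)"
    and E: "polytopal_digraph P E" "acyclic E" "holt_klee P E" and no: "\<not> dshelling_property P E"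
  shows "\<exists>P' E'. pyramid_over P P' \<and> polytope P' \<and> aff_dim P' = aff_dim P + 1 \<and>
    card (vertices P') = card (vertices P) + 1 \<and>
    polytopal_digraph P' E' \<and> acyclic E' \<and> holt_klee P' E' \<and> \<not> dshelling_property P' E'"
proof -
  have "affine hull P ~= UNIV" using P(3) by (simp add: aff_dim_eq_full[symmetric])
  then obtain a where a: "a \<notin> affine hull P" by blast
  interpret pyramid_digraph P a E by unfold_locales (use P E a in auto)
  have "pyramid_over P (Py P)" unfolding pyramid_over_def Py_def using a by blast
  then show ?thesis
    using pol_Py aff_dim_Py[OF P_face] card_vertices_Py dig' acy' hk' no dshelling_base[OF E(1)] unfolding E'_def
    by (intro exI[of _ "Py P"] exI[of _ "E \<union> {a} \<times> vertices P"] conjI) blast+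
qed

lemma adjacent_iff: "adjacent P x y \<longleftrightarrow> x ~= y \<and> closed_segment x y face_of P"
  using adjacentD(1,4) adjacentI by blast

subsection \<open>Affine copies\<close>

text \<open>Injectivity is required on the subspace \<open>S\<close> of directions, because the
  affine hull of \<open>P\<close> need not contain 0. By linearity it carries over to the
  hull.\<close>

locale affine_copy =
  fixes f :: "'b::euclidean_space \<Rightarrow> 'a::euclidean_space" and P :: "'b set" and S :: "'b set"
  assumes lin: "linear f" and subS: "subspace S" and injS: "inj_on f S"
    and diff: "\<And>x y. x \<in> affine hull P ==> y \<in> affine hull P ==> x - y \<in> S"
    and polP: "polytope P" and neP: "P ~= {}"
begin

lemma sub_hull: "x \<in> P ==> x \<in> affine hull P" by (rule hull_inc)

lemma inj_hull: "inj_on f (affine hull P)"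
proof (rule inj_onI)
  fix x y assume xy: "x \<in> affine hull P" "y \<in> affine hull P" "f x = f y"
  have "f (x - y) = f 0" using xy(3) linear_diff[OF lin] linear_0[OF lin] by simp
  then have "x - y = 0" using injS diff[OF xy(1,2)] subspace_0[OF subS] by (auto dest: inj_onD)
  then show "x = y" by simp
qed

lemma inj_P: "inj_on f P" using inj_hull sub_hull by (auto simp: inj_on_def)

lemma f_comb: "f ((1 - u) *\<^sub>R x + u *\<^sub>R y) = (1 - u) *\<^sub>R f x + u *\<^sub>R f y"
  by (simp add: linear_add[OF lin] linear_scale[OF lin])

lemma comb_hull: "x \<in> affine hull P ==> y \<in> affine hull P ==> (1 - u) *\<^sub>R x + u *\<^sub>R y \<in> affine hull P"
  by (rule mem_affine[OF affine_affine_hull]) simp_all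

lemma open_segment_f:
  assumes "x \<in> P" "y \<in> P" "z \<in> P"
  shows "f z \<in> open_segment (f x) (f y) \<longleftrightarrow> z \<in> open_segment x y"
proof -
  have "f z = (1 - u) *\<^sub>R f x + u *\<^sub>R f y \<longleftrightarrow> z = (1 - u) *\<^sub>R x + u *\<^sub>R y" for u
    unfolding f_comb[symmetric] using inj_hull assms comb_hull sub_hull by (metis inj_on_eq_iff)
  moreover have "f x = f y \<longleftrightarrow> x = y" using inj_P assms by (auto dest: inj_onD)
  ultimately show ?thesis by (simp add: in_segment)
qed

lemma convex_f:
  assumes "C \<subseteq> P"
  shows "convex (f ` C) \<longleftrightarrow> convex C"
proof
  assume L: "convex (f ` C)"
  show "convex C"
    unfolding convex_alt
  proof (intro ballI allI impI)
    fix x y and u :: real assume xy: "x \<in> C" "y \<in> C" "0 \<le> u \<and> u \<le> 1"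
    then have "(1 - u) *\<^sub>R f x + u *\<^sub>R f y \<in> f ` C" using L unfolding convex_alt by blast
    then obtain z where z: "z \<in> C" "f ((1 - u) *\<^sub>R x + u *\<^sub>R y) = f z" unfolding f_comb by auto
    have "(1 - u) *\<^sub>R x + u *\<^sub>R y = z"
      by (rule inj_onD[OF inj_hull z(2)]) (use xy z assms comb_hull sub_hull in blast)+
    then show "(1 - u) *\<^sub>R x + u *\<^sub>R y \<in> C" using z(1) by simp
  qed
next
  assume "convex C"
  then show "convex (f ` C)" by (rule convex_linear_image[OF lin])
qed

lemma face_f:
  assumes "C \<subseteq> P"
  shows "f ` C face_of f ` P \<longleftrightarrow> C face_of P"
proof -
  have mem: "f x \<in> f ` C \<longleftrightarrow> x \<in> C" if "x \<in> P" for x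
    using inj_on_image_mem_iff[OF inj_P that assms] .
  have "(\<forall>x\<in>f ` P. \<forall>y\<in>f ` P. \<forall>z\<in>f ` C. z \<in> open_segment x y --> x \<in> f ` C \<and> y \<in> f ` C) \<longleftrightarrow>
      (\<forall>x\<in>P. \<forall>y\<in>P. \<forall>z\<in>C. z \<in> open_segment x y --> x \<in> C \<and> y \<in> C)"
    using open_segment_f mem assms by (simp add: subset_iff)
  then show ?thesis
    unfolding face_of_def convex_f[OF assms] using assms by (simp add: image_mono)
qed

lemma sub_f: "C \<subseteq> P ==> D \<subseteq> P ==> f ` C \<subseteq> f ` D \<longleftrightarrow> C \<subseteq> D"
  by (rule inj_on_image_subset_iff[OF inj_P])

text \<open>The preimage is taken inside \<open>P\<close>, as \<open>f\<close> may identify points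
  elsewhere.\<close>

definition h where "h G = {x \<in> P. f x \<in> G}"

lemma h_f:
  assumes "C \<subseteq> P"
  shows "h (f ` C) = C"
  using inj_on_image_mem_iff[OF inj_P _ assms] assms unfolding h_def by blast

lemma faces_f: "G face_of f ` P ==> h G face_of P \<and> f ` h G = G"
proof -
  assume G: "G face_of f ` P"
  have e: "f ` h G = G" unfolding h_def using face_of_imp_subset[OF G] by auto
  moreover have "h G \<subseteq> P" by (auto simp: h_def)
  ultimately show ?thesis using face_f[of "h G"] G by simp
qed

lemma vertices_f: "H \<subseteq> P ==> H face_of P ==> vertices (f ` H) = f ` vertices H"
proof -
  assume H: "H \<subseteq> P" "H face_of P"
  have fH: "f ` H face_of f ` P" using face_f[OF H(1)] H(2) by simp
  have vP: "vertices (f ` P) = f ` vertices P"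
  proof
    show "vertices (f ` P) \<subseteq> f ` vertices P"
    proof
      fix y assume y: "y \<in> vertices (f ` P)"
      then obtain x where x: "x \<in> P" "y = f x" using vertices_sub by blast
      have "f ` {x} face_of f ` P" using y x(2) by (simp add: vertices_face)
      then have "{x} face_of P" using face_f[of "{x}"] x(1) by simp
      then show "y \<in> f ` vertices P" using x(2) by (simp add: vertices_face)
    qed
    show "f ` vertices P \<subseteq> vertices (f ` P)"
    proof
      fix y assume "y \<in> f ` vertices P"
      then obtain x where x: "x \<in> vertices P" "y = f x" by blast
      then have "{x} face_of P" by (simp add: vertices_face)
      moreover from this have "{x} \<subseteq> P" by (rule face_of_imp_subset)
      ultimately have "f ` {x} face_of f ` P" using face_f by blast
      then show "y \<in> vertices (f ` P)" using x(2) by (simp add: vertices_face)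
    qed
  qed
  have "f ` (vertices P \<inter> H) = f ` vertices P \<inter> f ` H"
    by (rule inj_on_image_Int[OF inj_P vertices_sub H(1)])
  then show ?thesis
    unfolding vertices_of_face[OF fH] vertices_of_face[OF H(2)] vP by simp
qed

lemma aff_dim_f:
  assumes "C \<subseteq> P"
  shows "aff_dim (f ` C) = aff_dim C"
proof (cases "C = {}")
  case False
  then obtain p where p: "p \<in> C" by blast
  define D where "D = (+) (- p) ` C"
  have "D \<subseteq> S"
  proof
    fix y assume "y \<in> D"
    then obtain x where x: "x \<in> C" "y = x - p" by (auto simp: D_def)
    then show "y \<in> S" using diff[of x p] assms p sub_hull by blast
  qed
  then have "span D \<subseteq> S" by (rule span_minimal[OF _ subS])
  then have "inj_on f (span D)" using injS by (rule inj_on_subset[rotated])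
  then have dimD: "dim (f ` D) = dim D" by (rule dim_image_eq[OF lin])
  have "f ` D = (+) (- f p) ` f ` C"
    unfolding D_def image_image by (rule image_cong) (simp_all add: linear_diff[OF lin])
  then have "aff_dim (f ` C) = int (dim (f ` D))"
    using aff_dim_eq_dim[of "f p" "f ` C"] p hull_inc[of "f p" "f ` C" affine] by simp
  also have "\<dots> = int (dim D)" by (simp only: dimD)
  also have "\<dots> = aff_dim C"
    using aff_dim_eq_dim[of p C] p hull_inc[of p C affine] by (simp add: D_def)
  finally show ?thesis .
qed simp

lemma adjacent_f:
  assumes "x \<in> P" "y \<in> P"
  shows "adjacent (f ` P) (f x) (f y) \<longleftrightarrow> adjacent P x y"
proof -
  have "closed_segment x y \<subseteq> P" using assms polytope_imp_convex[OF polP] by (simp add: closed_segment_subset)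
  then have "closed_segment (f x) (f y) face_of f ` P \<longleftrightarrow> closed_segment x y face_of P"
    using face_f closed_segment_linear_image[OF lin] by simp
  moreover have "f x = f y \<longleftrightarrow> x = y" using inj_P assms by (auto dest: inj_onD)
  ultimately show ?thesis by (simp add: adjacent_iff)
qed

lemma pol_f: "polytope (f ` P)" by (rule polytope_linear_image[OF lin polP])

lemma P_face: "P face_of P" using polP polytope_imp_convex face_of_refl by blast

lemma card_vertices_f: "card (vertices (f ` P)) = card (vertices P)"
  unfolding vertices_f[OF subset_refl P_face]
  by (rule card_image) (rule inj_on_subset[OF inj_P vertices_sub])

lemma adjacent_image: "x \<in> P ==> {w. adjacent (f ` P) (f x) w} = f ` {w. adjacent P x w}"
proof -
  assume x: "x \<in> P"
  have "\<exists>y\<in>P. w = f y" if "adjacent (f ` P) (f x) w" for w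
    using adjacentD(3)[OF that] vertices_sub by blast
  moreover have "y \<in> P" if "adjacent P x y" for y using adjacentD(3)[OF that] vertices_sub by blast
  ultimately show ?thesis using adjacent_f[OF x] by blast
qed

lemma card_adjacent_f: "x \<in> P ==> card {w. adjacent (f ` P) (f x) w} = card {w. adjacent P x w}"
proof -
  assume x: "x \<in> P"
  have "{w. adjacent P x w} \<subseteq> P" using adjacentD(3) vertices_sub by blast
  then show ?thesis unfolding adjacent_image[OF x] by (intro card_image inj_on_subset[OF inj_P])
qed

end

locale digraph_copy = affine_copy f P S
  for f :: "'b::euclidean_space \<Rightarrow> 'a::euclidean_space" and P S +
  fixes E :: "('b \<times> 'b) set"
  assumes dig: "polytopal_digraph P E" and acy: "acyclic E" and hk: "holt_klee P E"
begin

definition E' where "E' = map_prod f f ` E"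

lemma EP: assumes "(x, y) \<in> E" shows "x \<in> P" "y \<in> P"
  using dig assms adjacentD(2,3)[of P x y] vertices_sub by (auto simp: polytopal_digraph_def)

lemma E'_f: "x \<in> P ==> y \<in> P ==> (f x, f y) \<in> E' \<longleftrightarrow> (x, y) \<in> E"
proof
  assume xy: "x \<in> P" "y \<in> P" and "(f x, f y) \<in> E'"
  then obtain x' y' where e: "(x', y') \<in> E" "f x = f x'" "f y = f y'" by (auto simp: E'_def)
  then have "x = x'" "y = y'" using xy EP[OF e(1)] inj_P by (auto dest: inj_onD)
  then show "(x, y) \<in> E" using e(1) by simp
next
  assume "(x, y) \<in> E"
  then have "map_prod f f (x, y) \<in> E'" unfolding E'_def by (rule imageI)
  then show "(f x, f y) \<in> E'" by simp
qed

lemma E'_form: "(x, y) \<in> E' ==> \<exists>x'\<in>P. \<exists>y'\<in>P. x = f x' \<and> y = f y' \<and> (x', y') \<in> E"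
proof -
  assume "(x, y) \<in> E'"
  then obtain x' y' where e: "(x', y') \<in> E" "x = f x'" "y = f y'" by (auto simp: E'_def)
  then show ?thesis using EP[OF e(1)] by blast
qed

lemma dig': "polytopal_digraph (f ` P) E'"
  unfolding polytopal_digraph_def
proof (intro conjI allI impI)
  fix x y
  show "adjacent (f ` P) x y" if xy: "(x, y) \<in> E'"
  proof -
    obtain x' y' where e: "x' \<in> P" "y' \<in> P" "x = f x'" "y = f y'" "(x', y') \<in> E" using E'_form[OF xy] by blast
    then have "adjacent P x' y'" using dig by (simp add: polytopal_digraph_def)
    then show ?thesis using adjacent_f e by simp
  qed
  show "((x, y) \<in> E') ~= ((y, x) \<in> E')" if ad: "adjacent (f ` P) x y"
  proof -
    have "x \<in> f ` P" "y \<in> f ` P" using adjacentD(2,3)[OF ad] vertices_sub by blast+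
    then obtain x' y' where e: "x' \<in> P" "y' \<in> P" "x = f x'" "y = f y'" by blast
    then have "adjacent P x' y'" using adjacent_f ad by simp
    then show ?thesis using e E'_f dig by (simp add: polytopal_digraph_def)
  qed
qed

text \<open>For the finite relation \<open>E\<close> acyclicity is wellfoundedness, which passes to
  the image along the inverse of \<open>f\<close> on \<open>P\<close>.\<close>

lemma acy': "acyclic E'"
proof -
  have "E \<subseteq> vertices P \<times> vertices P"
  proof (rule subrelI)
    fix x y assume "(x, y) \<in> E"
    then have "adjacent P x y" using dig by (simp add: polytopal_digraph_def)
    then show "(x, y) \<in> vertices P \<times> vertices P" using adjacentD(2,3) by blast
  qed
  then have "finite E" using finite_vertices[OF polP] finite_subset by blast
  then have "wf (inv_image E (inv_into P f))" using finite_acyclic_wf acy by blast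
  moreover have "E' \<subseteq> inv_image E (inv_into P f)"
  proof (rule subrelI)
    fix x y assume "(x, y) \<in> E'"
    then obtain x' y' where "x' \<in> P" "y' \<in> P" "x = f x'" "y = f y'" "(x', y') \<in> E" using E'_form by blast
    then show "(x, y) \<in> inv_image E (inv_into P f)" using inj_P by (simp add: inv_into_f_f)
  qed
  ultimately have "wf E'" by (rule wf_subset)
  then show ?thesis by (rule wf_acyclic)
qed

lemma source_f:
  assumes H: "H face_of P" and x: "x \<in> P"
  shows "is_source E' (f ` H) (f x) \<longleftrightarrow> is_source E H x" "is_sink E' (f ` H) (f x) \<longleftrightarrow> is_sink E H x"
proof -
  have HP: "H \<subseteq> P" by (rule face_of_imp_subset[OF H])
  have V: "vertices (f ` H) = f ` vertices H" by (rule vertices_f[OF HP H])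
  have VP: "vertices H \<subseteq> P" using vertices_sub HP by blast
  have m: "f y \<in> f ` vertices H \<longleftrightarrow> y \<in> vertices H" if "y \<in> P" for y
    by (rule inj_on_image_mem_iff[OF inj_P that VP])
  have "(\<forall>u. (u, f x) \<notin> face_arcs E' (f ` H)) \<longleftrightarrow> (\<forall>u. (u, x) \<notin> face_arcs E H)"
  proof -
    have "(\<exists>u. (u, f x) \<in> face_arcs E' (f ` H)) \<longleftrightarrow> (\<exists>u\<in>vertices H. (f u, f x) \<in> E' \<and> f x \<in> f ` vertices H)"
      unfolding face_arcs_def V by blast
    also have "\<dots> \<longleftrightarrow> (\<exists>u\<in>vertices H. (u, x) \<in> E \<and> x \<in> vertices H)"
      using E'_f[OF _ x] m[OF x] VP by (auto simp: subset_iff)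
    also have "\<dots> \<longleftrightarrow> (\<exists>u. (u, x) \<in> face_arcs E H)" unfolding face_arcs_def by blast
    finally show ?thesis by blast
  qed
  then show "is_source E' (f ` H) (f x) \<longleftrightarrow> is_source E H x" unfolding is_source_def V m[OF x] by simp
  have "(\<forall>u. (f x, u) \<notin> face_arcs E' (f ` H)) \<longleftrightarrow> (\<forall>u. (x, u) \<notin> face_arcs E H)"
  proof -
    have "(\<exists>u. (f x, u) \<in> face_arcs E' (f ` H)) \<longleftrightarrow> (\<exists>u\<in>vertices H. (f x, f u) \<in> E' \<and> f x \<in> f ` vertices H)"
      unfolding face_arcs_def V by blast
    also have "\<dots> \<longleftrightarrow> (\<exists>u\<in>vertices H. (x, u) \<in> E \<and> x \<in> vertices H)"
      using E'_f[OF x] m[OF x] VP by (auto simp: subset_iff)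
    also have "\<dots> \<longleftrightarrow> (\<exists>u. (x, u) \<in> face_arcs E H)" unfolding face_arcs_def by blast
    finally show ?thesis by blast
  qed
  then show "is_sink E' (f ` H) (f x) \<longleftrightarrow> is_sink E H x" unfolding is_sink_def V m[OF x] by simp
qed

lemma source_form:
  assumes H: "H face_of P"
  shows "is_source E' (f ` H) y ==> \<exists>x\<in>P. y = f x \<and> is_source E H x"
    and "is_sink E' (f ` H) y ==> \<exists>x\<in>P. y = f x \<and> is_sink E H x"
proof -
  have HP: "H \<subseteq> P" by (rule face_of_imp_subset[OF H])
  have ex: "\<exists>x\<in>P. y = f x" if "y \<in> vertices (f ` H)" using that vertices_sub[of "f ` H"] HP by blast
  show "\<exists>x\<in>P. y = f x \<and> is_source E H x" if s: "is_source E' (f ` H) y"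
  proof -
    obtain x where "x \<in> P" "y = f x" using ex s by (auto simp: is_source_def)
    then show ?thesis using source_f(1)[OF H] s by blast
  qed
  show "\<exists>x\<in>P. y = f x \<and> is_sink E H x" if s: "is_sink E' (f ` H) y"
  proof -
    obtain x where "x \<in> P" "y = f x" using ex s by (auto simp: is_sink_def)
    then show ?thesis using source_f(2)[OF H] s by blast
  qed
qed

lemma uso': "unique_sink_orientation (f ` P) E'"
proof (rule unique_sink_orientationI[OF pol_f acy'])
  fix G x y assume G: "G face_of f ` P" "G ~= {}"
  obtain H where H: "H face_of P" "G = f ` H" using faces_f[OF G(1)] by metis
  have "H ~= {}" using G(2) H(2) by blast
  then have u: "\<exists>!x. is_source E H x" "\<exists>!x. is_sink E H x"
    using hk H(1) by (auto simp: holt_klee_def unique_sink_orientation_def)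
  show "x = y" if "is_source E' G x" "is_source E' G y"
  proof -
    obtain x' y' where "x = f x'" "is_source E H x'" "y = f y'" "is_source E H y'"
      using source_form(1)[OF H(1)] \<open>is_source E' G x\<close> \<open>is_source E' G y\<close> unfolding H(2) by metis
    then show ?thesis using u(1) by blast
  qed
  show "x = y" if "is_sink E' G x" "is_sink E' G y"
  proof -
    obtain x' y' where "x = f x'" "is_sink E H x'" "y = f y'" "is_sink E H y'"
      using source_form(2)[OF H(1)] \<open>is_sink E' G x\<close> \<open>is_sink E' G y\<close> unfolding H(2) by metis
    then show ?thesis using u(2) by blast
  qed
qed

lemma hk': "holt_klee (f ` P) E'"
  unfolding holt_klee_iff
proof (intro conjI allI impI uso')
  fix G s t assume "G face_of f ` P \<and> G ~= {} \<and> is_source E' G s \<and> is_sink E' G t"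
  then have G: "G face_of f ` P" "G ~= {}" and st: "is_source E' G s" "is_sink E' G t" by simp_all
  obtain H where H: "H face_of P" "G = f ` H" using faces_f[OF G(1)] by metis
  have Hne: "H ~= {}" using G(2) H(2) by blast
  have HP: "H \<subseteq> P" by (rule face_of_imp_subset[OF H(1)])
  obtain s' where s': "s' \<in> P" "s = f s'" "is_source E H s'" using source_form(1)[OF H(1)] st(1) H(2) by blast
  obtain t' where t': "t' \<in> P" "t = f t'" "is_sink E H t'" using source_form(2)[OF H(1)] st(2) H(2) by blast
  have pe: "paths_exist (face_arcs E H) s' t' (aff_dim H)"
    using hk H(1) Hne s'(3) t'(3) unfolding holt_klee_iff by blast
  obtain Q where Q: "finite Q" "int (card Q) = aff_dim H"
    and Qp: "\<And>p. p \<in> Q ==> directed_path (face_arcs E H) s' t' p"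
    and Qd: "\<And>p q. p \<in> Q ==> q \<in> Q ==> p ~= q ==> set p \<inter> set q \<subseteq> {s', t'}"
    by (rule paths_existE[OF pe]) (rule that)
  have sV: "s' \<in> vertices H" using s'(3) by (simp add: is_source_def)
  have sub: "set p \<subseteq> P" if "p \<in> Q" for p
    using directed_path_arcs_vertices[OF Qp[OF that] sV] vertices_sub[of H] HP by blast
  have arcs: "(f x, f y) \<in> face_arcs E' G" if "(x, y) \<in> face_arcs E H" for x y
    using that vertices_f[OF HP H(1)] unfolding face_arcs_def H(2) E'_def by force
  have path: "directed_path (face_arcs E' G) s t (map f p)" if p: "p \<in> Q" for p
  proof -
    have d: "p ~= []" "hd p = s'" "last p = t'" "distinct p" "successively (\<lambda>u w. (u, w) \<in> face_arcs E H) p"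
      using Qp[OF p] by (auto simp: directed_path_def)
    have "distinct (map f p)" using d(4) inj_on_subset[OF inj_P sub[OF p]] by (simp add: distinct_map)
    moreover have "successively (\<lambda>u w. (f u, f w) \<in> face_arcs E' G) p"
      by (rule successively_change[OF d(5)]) (rule arcs)
    ultimately show ?thesis
      using d s'(2) t'(2) by (simp add: directed_path_def hd_map last_map successively_map)
  qed
  have inj: "inj_on (map f) Q"
  proof (rule inj_onI)
    fix p q assume pq: "p \<in> Q" "q \<in> Q" "map f p = map f q"
    have "set p \<union> set q \<subseteq> P" using sub pq by blast
    then have "inj_on f (set p \<union> set q)" by (rule inj_on_subset[OF inj_P])
    then show "p = q" using pq(3) by (simp add: inj_on_map_eq_map)
  qed
  show "paths_exist (face_arcs E' G) s t (aff_dim G)"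
  proof (rule paths_existI[of "map f ` Q"])
    show "finite (map f ` Q)" using Q by simp
    show "int (card (map f ` Q)) = aff_dim G" using card_image[OF inj] Q aff_dim_f[OF HP] H(2) by simp
    show "directed_path (face_arcs E' G) s t p" if "p \<in> map f ` Q" for p using that path by blast
    show "set p \<inter> set q \<subseteq> {s, t}" if pq: "p \<in> map f ` Q" "q \<in> map f ` Q" "p ~= q" for p q
    proof -
      obtain p' q' where p': "p' \<in> Q" "p = map f p'" "q' \<in> Q" "q = map f q'" using pq by blast
      then have "set p' \<inter> set q' \<subseteq> {s', t'}" using Qd pq(3) by blast
      then have "f ` (set p' \<inter> set q') \<subseteq> {s, t}" using s'(2) t'(2) by blast
      moreover have "f ` (set p' \<inter> set q') = f ` set p' \<inter> f ` set q'"
        by (rule inj_on_image_Int[OF inj_P sub[OF p'(1)] sub[OF p'(3)]])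
      ultimately show ?thesis using p' by simp
    qed
  qed
qed

text \<open>\<open>h\<close> identifies the proper faces of the copy with those of \<open>P\<close>,
  so \<open>dshell_iso\<close> applies from the empty face upwards.\<close>

lemma dshelling_f:
  assumes "dshelling_property (f ` P) E'"
  shows "dshelling_property P E"
proof -
  obtain ws where ws: "topological_sort (f ` P) E' ws" "dshell (pf (f ` P)) {} (map (\<lambda>v. {v}) ws)"
    using assms by (auto simp: dshelling_property_def)
  have wd: "distinct ws" "set ws = f ` vertices P"
    and word: "\<And>i j. i < length ws ==> j < length ws ==> (ws ! i, ws ! j) \<in> E' ==> i < j"
    using ws(1) vertices_f[OF subset_refl P_face] by (auto simp: topological_sort_def)
  define vs where "vs = map (inv_into P f) ws"
  have VP: "vertices P \<subseteq> P" by (rule vertices_sub)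
  have inv: "inv_into P f (f x) = x" if "x \<in> vertices P" for x using that VP inj_P by (auto intro: inv_into_f_f)
  have fv: "f (inv_into P f w) = w" if "w \<in> set ws" for w using that wd(2) inv by auto
  have mv: "map f vs = ws" unfolding vs_def map_map by (rule map_idI) (simp add: fv)
  have dv: "distinct vs" using wd(1) unfolding mv[symmetric] by (simp add: distinct_map)
  have sv: "set vs = vertices P"
  proof -
    have "set vs = inv_into P f ` f ` vertices P" by (simp add: vs_def wd(2))
    also have "\<dots> = vertices P" unfolding image_image using inv by simp
    finally show ?thesis .
  qed
  have len: "length vs = length ws" by (simp add: vs_def)
  have top: "topological_sort P E vs"
    unfolding topological_sort_def
  proof (intro conjI allI impI dv sv)
    fix i j assume ij: "i < length vs \<and> j < length vs \<and> (vs ! i, vs ! j) \<in> E"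
    then have "(f (vs ! i), f (vs ! j)) \<in> E'" by (force simp: E'_def)
    moreover have "f (vs ! i) = ws ! i" "f (vs ! j) = ws ! j" unfolding mv[symmetric] using ij by simp_all
    ultimately show "i < j" using word ij len by simp
  qed
  have hP: "h (f ` P) = P" by (rule h_f) simp
  have hpf: "h G \<in> pf P" if "G \<in> pf (f ` P)" for G
    using faces_f[of G] that by (auto simp: pf_def)
  have hsub: "h G \<subseteq> h G' \<longleftrightarrow> G \<subseteq> G'" if "G \<in> pf (f ` P)" "G' \<in> pf (f ` P)" for G G'
  proof -
    have "G face_of f ` P" "G' face_of f ` P" using that by (simp_all add: pf_def)
    then have e: "f ` h G = G" "f ` h G' = G'" using faces_f by blast+
    have "h G \<subseteq> P" "h G' \<subseteq> P" by (auto simp: h_def)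
    then show ?thesis using sub_f[of "h G" "h G'"] e by simp
  qed
  have bij: "bij_betw h {G \<in> pf (f ` P). {} \<subseteq> G} {G \<in> pf P. {} \<subseteq> G}"
    unfolding bij_betw_def
  proof
    show "inj_on h {G \<in> pf (f ` P). {} \<subseteq> G}"
      by (rule inj_onI) (use hsub in blast)
    show "h ` {G \<in> pf (f ` P). {} \<subseteq> G} = {G \<in> pf P. {} \<subseteq> G}"
    proof
      show "h ` {G \<in> pf (f ` P). {} \<subseteq> G} \<subseteq> {G \<in> pf P. {} \<subseteq> G}" using hpf by blast
      show "{G \<in> pf P. {} \<subseteq> G} \<subseteq> h ` {G \<in> pf (f ` P). {} \<subseteq> G}"
      proof
        fix F assume "F \<in> {G \<in> pf P. {} \<subseteq> G}"
        then have F: "F face_of P" "F ~= P" "F \<subseteq> P" using face_of_imp_subset by (auto simp: pf_def)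
        have e: "h (f ` F) = F" by (rule h_f[OF F(3)])
        have "f ` F face_of f ` P" using face_f[OF F(3)] F(1) by simp
        moreover have "f ` F ~= f ` P" using e hP F(2) by metis
        ultimately have "f ` F \<in> {G \<in> pf (f ` P). {} \<subseteq> G}" by (simp add: pf_def)
        then show "F \<in> h ` {G \<in> pf (f ` P). {} \<subseteq> G}" using e by (metis image_eqI)
      qed
    qed
  qed
  have "{} \<in> pf (f ` P)" using neP by (auto simp: pf_def)
  then have "dshell (pf P) (h {}) (map h (map (\<lambda>v. {v}) ws))"
    by (intro dshell_iso[OF bij hsub ws(2)]) simp_all
  moreover have "h {} = {}" by (simp add: h_def)
  moreover have "map h (map (\<lambda>v. {v}) ws) = map (\<lambda>v. {v}) vs"
  proof -
    have "h {f x} = {x}" if "x \<in> set vs" for x using h_f[of "{x}"] that sv VP by auto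
    then show ?thesis unfolding mv[symmetric] by simp
  qed
  ultimately show ?thesis unfolding dshelling_property_def using top by auto
qed

end

text \<open>The directions of \<open>P\<close> span a subspace that fits isometrically into the
  target space, and preservation of norms yields injectivity.\<close>

lemma copy_exists:
  fixes P :: "'b::euclidean_space set"
  assumes P: "polytope P" "P ~= {}" "aff_dim P \<le> DIM('a::euclidean_space)"
    and E: "polytopal_digraph P E" "acyclic E" "holt_klee P E" and no: "\<not> dshelling_property P E"
    and v: "is_sink E P v"
  shows "\<exists>(P' :: 'a set) E' v'. extension_of P P' \<and> polytope P' \<and> aff_dim P' = aff_dim P \<and>
    card (vertices P') = card (vertices P) \<and>
    polytopal_digraph P' E' \<and> acyclic E' \<and> holt_klee P' E' \<and> \<not> dshelling_property P' E' \<and>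
    is_sink E' P' v' \<and> card {w. adjacent P' v' w} = card {w. adjacent P v w}"
proof -
  obtain p where p: "p \<in> P" using P(2) by blast
  define S where "S = span ((+) (- p) ` P)"
  have subS: "subspace S" by (simp add: S_def)
  have "int (dim S) = aff_dim P"
    using aff_dim_eq_dim[of p P] p hull_inc[of p P affine] by (simp add: S_def dim_span)
  then have "dim S \<le> dim (UNIV :: 'a set)" using P(3) by (simp add: dim_UNIV)
  then obtain f :: "'b \<Rightarrow> 'a" where f: "linear f" "\<And>x. x \<in> S ==> norm (f x) = norm x"
    using isometry_subset_subspace[OF subS subspace_UNIV] by metis
  have inj: "inj_on f S"
  proof (rule inj_onI)
    fix x y assume xy: "x \<in> S" "y \<in> S" "f x = f y"
    then have "norm (f (x - y)) = norm (x - y)" using f(2) subspace_diff[OF subS] by blast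
    then show "x = y" using xy(3) linear_diff[OF f(1)] by simp
  qed
  have hull: "x - p \<in> S" if "x \<in> affine hull P" for x
  proof -
    have "x \<in> (\<lambda>y. p + y) ` span ((\<lambda>x. - p + x) ` (P - {p}))"
      using that affine_hull_span2[OF p] by simp
    then obtain y where y: "y \<in> span ((\<lambda>x. - p + x) ` (P - {p}))" "x = p + y" by blast
    have "span ((\<lambda>x. - p + x) ` (P - {p})) \<subseteq> S" unfolding S_def by (rule span_mono) auto
    then show ?thesis using y by auto
  qed
  have diff: "x - y \<in> S" if "x \<in> affine hull P" "y \<in> affine hull P" for x y
    using subspace_diff[OF subS hull[OF that(1)] hull[OF that(2)]] by simp
  interpret digraph_copy f P S E 
    by (intro digraph_copy.intro affine_copy.intro digraph_copy_axioms.intro f(1) subS inj diff P(1,2) E)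
  have ext: "extension_of P (f ` P)"
    using extension_of.copy[OF f(1) inj_hull, of 0] by simp
  have vP: "v \<in> P" using v vertices_sub by (auto simp: is_sink_def)
  show ?thesis
    using ext pol_f aff_dim_f[OF subset_refl] card_vertices_f dig' acy' hk' no dshelling_f
      source_f(2)[OF P_face vP] v card_adjacent_f[OF vP]
    by (intro exI[of _ "f ` P"] exI[of _ E'] exI[of _ "f v"] conjI) blast+
qed

theorem theorem2:
  fixes P\<^sub>0 :: "'b::euclidean_space set" and E\<^sub>0 :: "('b \<times> 'b) set" and v :: 'b
    and n\<^sub>0 d n :: nat
  assumes "polytope P\<^sub>0" and "aff_dim P\<^sub>0 = 4" and "card (vertices P\<^sub>0) = n\<^sub>0"
    and "X_type P\<^sub>0 E\<^sub>0"
    and "is_sink E\<^sub>0 P\<^sub>0 v" and "card {w. adjacent P\<^sub>0 v w} = 4"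
    and "4 \<le> d" and "d \<le> DIM('a::euclidean_space)" and "n\<^sub>0 + d - 4 \<le> n"
  shows "\<exists>P :: 'a set. extension_of P\<^sub>0 P \<and> polytope P \<and> aff_dim P = int d \<and>
           card (vertices P) = n \<and> (\<exists>E. X_type P E)"
proof -
  \<comment> \<open>The invariant of all steps, stated with the polar-free
    \<open>dshelling_property\<close>. The four neighbours of the sink are tracked separately,
    during the truncations only.\<close>
  define good :: "'a set \<Rightarrow> ('a \<times> 'a) set \<Rightarrow> bool" where
    "good P E \<longleftrightarrow> extension_of P\<^sub>0 P \<and> polytope P \<and> polytopal_digraph P E \<and> acyclic E \<and> holt_klee P E \<and>
       \<not> dshelling_property P E" for P E
  have ne: "P\<^sub>0 ~= {}" using assms(2) by auto
  have X: "polytopal_digraph P\<^sub>0 E\<^sub>0" "acyclic E\<^sub>0" "holt_klee P\<^sub>0 E\<^sub>0" "\<not> dshelling_property P\<^sub>0 E\<^sub>0"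
    using assms(4) shelling_property_iff[OF assms(1) ne] by (auto simp: X_type_def)
  have trunc: "\<exists>P E v. good P E \<and> aff_dim P = 4 \<and> card (vertices P) = n\<^sub>0 + k \<and>
      is_sink E P v \<and> card {w. adjacent P v w} = 4" for k
  proof (induction k)
    case 0
    have "aff_dim P\<^sub>0 \<le> DIM('a)" using assms(2,7,8) by simp
    from copy_exists[OF assms(1) ne this X assms(5)] show ?case
      using assms(2,3,6) unfolding good_def by auto
  next
    case (Suc k)
    then obtain P E v where P: "good P E" "aff_dim P = 4" "card (vertices P) = n\<^sub>0 + k"
      "is_sink E P v" "card {w. adjacent P v w} = 4" by blast
    have g: "extension_of P\<^sub>0 P" "polytope P" "polytopal_digraph P E" "acyclic E" "holt_klee P E"
      "\<not> dshelling_property P E" using P(1) by (auto simp: good_def)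
    obtain P' E' v' where P': "truncation_of P P'" "polytope P'" "aff_dim P' = 4"
      "card (vertices P') = card (vertices P) + 1" "polytopal_digraph P' E'" "acyclic E'" "holt_klee P' E'"
      "\<not> dshelling_property P' E'" "is_sink E' P' v'" "card {w. adjacent P' v' w} = 4"
      using cut_exists[OF g(2) P(2) g(3-6) P(4,5)] by blast
    have "good P' E'" unfolding good_def using P' extension_of.truncation[OF g(1) P'(1)] by simp
    then show ?case using P' P(3) by (intro exI[of _ P'] exI[of _ E'] exI[of _ v']) simp
  qed
  \<comment> \<open>The surplus of vertices is spent on truncations in dimension 4, and each of the
    \<open>d - 4\<close> pyramids adds one more vertex.\<close>
  define k where "k = n - (n\<^sub>0 + d - 4)"
  have "\<exists>P E. good P E \<and> aff_dim P = 4 + int j \<and> card (vertices P) = n\<^sub>0 + k + j" if "j \<le> d - 4" for j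
    using that
  proof (induction j)
    case 0
    then show ?case using trunc[of k] by auto
  next
    case (Suc j)
    then obtain P E where P: "good P E" "aff_dim P = 4 + int j" "card (vertices P) = n\<^sub>0 + k + j" by auto
    have g: "extension_of P\<^sub>0 P" "polytope P" "polytopal_digraph P E" "acyclic E" "holt_klee P E"
      "\<not> dshelling_property P E" using P(1) by (auto simp: good_def)
    have dim: "2 \<le> aff_dim P" "aff_dim P < DIM('a)" using P(2) Suc.prems assms(7,8) by auto
    obtain P' E' where P': "pyramid_over P P'" "polytope P'" "aff_dim P' = aff_dim P + 1"
      "card (vertices P') = card (vertices P) + 1" "polytopal_digraph P' E'" "acyclic E'" "holt_klee P' E'"
      "\<not> dshelling_property P' E'"
      using pyramid_exists[OF g(2) dim g(3-6)] by blast
    have "good P' E'" unfolding good_def using P' extension_of.pyramid[OF g(1) P'(1)] by simp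
    then show ?case using P' P(2,3) by (intro exI[of _ P'] exI[of _ E']) simp
  qed
  from this[of "d - 4"] obtain P E where P: "good P E" "aff_dim P = 4 + int (d - 4)"
    "card (vertices P) = n\<^sub>0 + k + (d - 4)" by auto
  have dims: "aff_dim P = int d" "card (vertices P) = n" using P(2,3) assms(7,9) by (simp_all add: k_def)
  have "P ~= {}" using dims(1) assms(7) by auto
  then have "X_type P E"
    using P(1) shelling_property_iff[of P E] by (simp add: good_def X_type_def holt_klee_def)
  then show ?thesis using P(1) dims unfolding good_def by blast
qed

end
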